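(* Let $G$ be a non-compact connected simple Lie group, and let $X_1$ and $X_2$ be infinite-dimensional irreducible $(\mathfrak{g},K)$-modules. Then the tensor product representation $X_1\otimes X_2$ is discretely decomposable as a $(\mathfrak{g},K)$-module if and only if $G$ is of Hermitian type and $X_1$, $X_2$ are either both highest weight $(\mathfrak{g},K)$-modules or both lowest weight $(\mathfrak{g},K)$-modules.
   Context: $\mathfrak{g}=\mathfrak{k}+\mathfrak{p}$ is a Cartan decomposition of the Lie algebra of $G$ and $K$ is the connected subgroup of $G$ with Lie algebra $\mathfrak{k}$; $X_1\otimes X_2$ carries the diagonal action of $(\mathfrak{g},K)$. A $(\mathfrak{g},K)$-module $Y$ is discretely decomposable if there is an increasing filtration $\{Y_i\}_{i\in\mathbb{N}}$ of $Y$ by $(\mathfrak{g},K)$-submodules with $\bigcup_i Y_i=Y$ and each $Y_i$ of finite length. $G$ is of Hermitian type if the center of $\mathfrak{k}$ is one-dimensional, equivalently $G/K$ is a Hermitian symmetric space. In that case $\mathfrak{p}_{\mathbb{C}}=\mathfrak{p}_++\mathfrak{p}_-$ is the decomposition of $\mathfrak{p}_{\mathbb{C}}=\mathfrak{p}\otimes_{\mathbb{R}}\mathbb{C}$ into two irreducible $\mathfrak{k}_{\mathbb{C}}$-modules (with a fixed labeling), and an irreducible $(\mathfrak{g},K)$-module $X$ is called a highest weight (resp. lowest weight) $(\mathfrak{g},K)$-module if $X$ has a non-zero vector annihilated by $\mathfrak{p}_+$ (resp. $\mathfrak{p}_-$). *)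

theory Defs
  imports "HOL-Analysis.Analysis" "HOL-Library.Poly_Mapping"
begin

section \<open>Complex vector spaces\<close>

class complex_vector = ab_group_add +
  fixes scaleC :: "complex \<Rightarrow> 'a \<Rightarrow> 'a" (infixr \<open>*\<^sub>C\<close> 75)
  assumes scaleC_add_right: "a *\<^sub>C (x + y) = a *\<^sub>C x + a *\<^sub>C y"
    and scaleC_add_left: "(a + b) *\<^sub>C x = a *\<^sub>C x + b *\<^sub>C x"
    and scaleC_scaleC: "a *\<^sub>C b *\<^sub>C x = (a * b) *\<^sub>C x"
    and scaleC_one: "1 *\<^sub>C x = x"

global_interpretation complex_vector: vector_space "scaleC :: complex \<Rightarrow> 'a \<Rightarrow> 'a::complex_vector"
  defines csubspace = complex_vector.subspace
    and cspan = complex_vector.span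
  by unfold_locales (simp_all add: scaleC_add_right scaleC_add_left scaleC_scaleC scaleC_one)

abbreviation clinear :: "('a::complex_vector \<Rightarrow> 'b::complex_vector) \<Rightarrow> bool"
  where "clinear \<equiv> Vector_Spaces.linear scaleC scaleC"

definition cfinite_dim :: "'a::complex_vector set \<Rightarrow> bool"
  where "cfinite_dim W \<longleftrightarrow> (\<exists>B. finite B \<and> B \<subseteq> W \<and> W \<subseteq> cspan B)"

instantiation complex :: complex_vector
begin
definition "scaleC_complex = ((*) :: complex \<Rightarrow> complex \<Rightarrow> complex)"
instance by standard (simp_all add: scaleC_complex_def algebra_simps)
end

instantiation poly_mapping :: (type, complex_vector) complex_vector
begin
definition "scaleC_poly_mapping a = (Poly_Mapping.map (scaleC a) :: ('a \<Rightarrow>\<^sub>0 'b) \<Rightarrow> _)"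
lemma lookup_scaleC: "Poly_Mapping.lookup (a *\<^sub>C p) x = a *\<^sub>C Poly_Mapping.lookup p x"
  for p :: "'a \<Rightarrow>\<^sub>0 'b"
  unfolding scaleC_poly_mapping_def by transfer (auto simp: when_def)
instance
proof
  fix p q :: "'a \<Rightarrow>\<^sub>0 'b" and a b :: complex
  show "a *\<^sub>C (p + q) = a *\<^sub>C p + a *\<^sub>C q"
    by (rule poly_mapping_eqI) (simp add: lookup_scaleC lookup_add scaleC_add_right)
  show "(a + b) *\<^sub>C p = a *\<^sub>C p + b *\<^sub>C p"
    by (rule poly_mapping_eqI) (simp add: lookup_scaleC lookup_add scaleC_add_left)
  show "a *\<^sub>C b *\<^sub>C p = (a * b) *\<^sub>C p"
    by (rule poly_mapping_eqI) (simp add: lookup_scaleC scaleC_scaleC)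
  show "1 *\<^sub>C p = p"
    by (rule poly_mapping_eqI) (simp add: lookup_scaleC scaleC_one)
qed

end

section \<open>The tensor product over the complex numbers\<close>

definition tensor_relations :: "('a::complex_vector \<times> 'b::complex_vector \<Rightarrow>\<^sub>0 complex) set"
  where "tensor_relations =
    {Poly_Mapping.single (v + v', w) 1 - Poly_Mapping.single (v, w) 1
       - Poly_Mapping.single (v', w) 1 | v v' w. True}
    \<union> {Poly_Mapping.single (v, w + w') 1 - Poly_Mapping.single (v, w) 1
       - Poly_Mapping.single (v, w') 1 | v w w'. True}
    \<union> {Poly_Mapping.single (a *\<^sub>C v, w) 1 - Poly_Mapping.single (v, w) a | a v w. True}
    \<union> {Poly_Mapping.single (v, a *\<^sub>C w) 1 - Poly_Mapping.single (v, w) a | a v w. True}"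

definition tensor_rel ::
  "('a::complex_vector \<times> 'b::complex_vector \<Rightarrow>\<^sub>0 complex) \<Rightarrow> ('a \<times> 'b \<Rightarrow>\<^sub>0 complex) \<Rightarrow> bool"
  where "tensor_rel p q \<longleftrightarrow> p - q \<in> cspan tensor_relations"

lemma tensor_rel_equivp:
  "equivp (tensor_rel :: ('a::complex_vector \<times> 'b::complex_vector \<Rightarrow>\<^sub>0 complex) \<Rightarrow> _)"
proof (rule equivpI)
  let ?R = "tensor_rel :: ('a \<times> 'b \<Rightarrow>\<^sub>0 complex) \<Rightarrow> _"
  show "reflp ?R"
    by (simp add: reflp_def tensor_rel_def complex_vector.span_zero)
  show "symp ?R"
  proof (rule sympI)
    fix p q :: "'a \<times> 'b \<Rightarrow>\<^sub>0 complex"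
    assume "tensor_rel p q"
    then show "tensor_rel q p"
      using complex_vector.span_neg [of "p - q"] by (simp add: tensor_rel_def)
  qed
  show "transp ?R"
  proof (rule transpI)
    fix p q r :: "'a \<times> 'b \<Rightarrow>\<^sub>0 complex"
    assume "tensor_rel p q" "tensor_rel q r"
    then show "tensor_rel p r"
      using complex_vector.span_add [of "p - q" _ "q - r"] by (simp add: tensor_rel_def)
  qed
qed

quotient_type (overloaded) ('a, 'b) tensor =
  "'a::complex_vector \<times> 'b::complex_vector \<Rightarrow>\<^sub>0 complex" / tensor_rel
  by (rule tensor_rel_equivp)

instantiation tensor :: (complex_vector, complex_vector) complex_vector
begin

lift_definition zero_tensor :: "('a, 'b) tensor" is 0 .

lift_definition plus_tensor :: "('a, 'b) tensor \<Rightarrow> ('a, 'b) tensor \<Rightarrow> ('a, 'b) tensor" is "(+)"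
  unfolding tensor_rel_def by (simp only: add_diff_add complex_vector.span_add)

lift_definition uminus_tensor :: "('a, 'b) tensor \<Rightarrow> ('a, 'b) tensor" is uminus
  unfolding tensor_rel_def by (simp only: minus_diff_minus complex_vector.span_neg)

lift_definition minus_tensor :: "('a, 'b) tensor \<Rightarrow> ('a, 'b) tensor \<Rightarrow> ('a, 'b) tensor" is "(-)"
proof -
  fix p q p' q' :: "'a \<times> 'b \<Rightarrow>\<^sub>0 complex"
  assume "tensor_rel p q" "tensor_rel p' q'"
  moreover have "(p - p') - (q - q') = (p - q) - (p' - q')"
    by (simp add: algebra_simps)
  ultimately show "tensor_rel (p - p') (q - q')"
    by (simp only: tensor_rel_def complex_vector.span_diff)
qed

lift_definition scaleC_tensor :: "complex \<Rightarrow> ('a, 'b) tensor \<Rightarrow> ('a, 'b) tensor" is scaleC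
  unfolding tensor_rel_def
  by (simp only: complex_vector.scale_right_diff_distrib [symmetric] complex_vector.span_scale)

instance
proof
  fix s t u :: "('a, 'b) tensor" and a b :: complex
  have eqI: "tensor_rel p q" if "p = q" for p q :: "'a \<times> 'b \<Rightarrow>\<^sub>0 complex"
    using that by (simp add: tensor_rel_def complex_vector.span_zero)
  show "s + t + u = s + (t + u)" by transfer (rule eqI, simp add: add.assoc)
  show "s + t = t + s" by transfer (rule eqI, simp add: add.commute)
  show "0 + s = s" by transfer (rule eqI, simp)
  show "- s + s = 0" by transfer (rule eqI, simp)
  show "s - t = s + - t" by transfer (rule eqI, simp)
  show "a *\<^sub>C (s + t) = a *\<^sub>C s + a *\<^sub>C t" by transfer (rule eqI, rule scaleC_add_right)
  show "(a + b) *\<^sub>C s = a *\<^sub>C s + b *\<^sub>C s" by transfer (rule eqI, rule scaleC_add_left)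
  show "a *\<^sub>C b *\<^sub>C s = (a * b) *\<^sub>C s" by transfer (rule eqI, rule scaleC_scaleC)
  show "1 *\<^sub>C s = s" by transfer (rule eqI, rule scaleC_one)
qed

end

lift_definition pure_tensor ::
    "'a::complex_vector \<Rightarrow> 'b::complex_vector \<Rightarrow> ('a, 'b) tensor" (infixr \<open>\<otimes>\<close> 70)
  is "\<lambda>v w. Poly_Mapping.single (v, w) 1" .

definition tensor_map ::
    "('a::complex_vector \<Rightarrow> 'c::complex_vector) \<Rightarrow> ('b::complex_vector \<Rightarrow> 'd::complex_vector)
      \<Rightarrow> ('a, 'b) tensor \<Rightarrow> ('c, 'd) tensor"
  where "tensor_map f g = (THE h. clinear h \<and> (\<forall>v w. h (v \<otimes> w) = f v \<otimes> g w))"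


subsection \<open>Existence and uniqueness of \<open>tensor_map\<close>\<close>

lemma scaleC_single: "a *\<^sub>C Poly_Mapping.single x b = Poly_Mapping.single x (a *\<^sub>C b)"
  by (rule poly_mapping_eqI)
    (simp add: lookup_scaleC lookup_single when_def complex_vector.scale_zero_right)

lemma abs_tensor_conv_sum:
  "abs_tensor p = (\<Sum>(v, w)\<in>Poly_Mapping.keys p. Poly_Mapping.lookup p (v, w) *\<^sub>C (v \<otimes> w))"
proof -
  have add: "abs_tensor (q + r) = abs_tensor q + abs_tensor r"
    for q r :: "'a \<times> 'b \<Rightarrow>\<^sub>0 complex"
    by (simp add: plus_tensor.abs_eq)
  have zero: "abs_tensor 0 = (0 :: ('a, 'b) tensor)"
    by (simp add: zero_tensor.abs_eq)
  have sum: "abs_tensor (\<Sum>x\<in>X. f x) = (\<Sum>x\<in>X. abs_tensor (f x))"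
    if "finite X" for X :: "('a \<times> 'b) set" and f :: "_ \<Rightarrow> 'a \<times> 'b \<Rightarrow>\<^sub>0 complex"
    using that by (induction X) (simp_all add: add zero)
  have single: "abs_tensor (Poly_Mapping.single x a) = a *\<^sub>C (fst x \<otimes> snd x)"
    for x :: "'a \<times> 'b" and a
  proof -
    have "Poly_Mapping.single x a = a *\<^sub>C Poly_Mapping.single x 1"
      by (simp add: scaleC_single scaleC_complex_def)
    then show ?thesis
      by (simp add: scaleC_tensor.abs_eq [symmetric] pure_tensor.abs_eq)
  qed
  have "p = (\<Sum>x\<in>Poly_Mapping.keys p. Poly_Mapping.single x (Poly_Mapping.lookup p x))"
    by (rule poly_mapping_eqI)
      (simp add: lookup_sum lookup_single when_def sum.delta' in_keys_iff)
  then have "abs_tensor p = (\<Sum>x\<in>Poly_Mapping.keys p.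
      abs_tensor (Poly_Mapping.single x (Poly_Mapping.lookup p x)))"
    by (metis sum finite_keys)
  then show ?thesis
    by (simp add: single case_prod_unfold)
qed

lemma tensor_universal:
  fixes b :: "'a::complex_vector \<Rightarrow> 'b::complex_vector \<Rightarrow> 'c::complex_vector"
  assumes left: "\<And>w. clinear (\<lambda>v. b v w)" and right: "\<And>v. clinear (b v)"
  shows "\<exists>!h. clinear h \<and> (\<forall>v w. h (v \<otimes> w) = b v w)"
proof -
  define e where "e p = (\<Sum>(v, w)\<in>Poly_Mapping.keys p. Poly_Mapping.lookup p (v, w) *\<^sub>C b v w)" for p
  have e_eq: "e p = (\<Sum>(v, w)\<in>X. Poly_Mapping.lookup p (v, w) *\<^sub>C b v w)"
    if "finite X" "Poly_Mapping.keys p \<subseteq> X" for p X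
    unfolding e_def using that
    by (intro sum.mono_neutral_left) (auto simp: in_keys_iff)
  have e_add: "e (p + q) = e p + e q" for p q
  proof -
    let ?X = "Poly_Mapping.keys p \<union> Poly_Mapping.keys q"
    have "finite ?X" "Poly_Mapping.keys (p + q) \<subseteq> ?X"
      by (simp_all add: Poly_Mapping.keys_add)
    then show ?thesis
      using e_eq [of ?X "p + q"] e_eq [of ?X p] e_eq [of ?X q]
      by (simp add: lookup_add scaleC_add_left sum.distrib case_prod_unfold)
  qed
  have e_scale: "e (a *\<^sub>C p) = a *\<^sub>C e p" for a p
  proof -
    have "Poly_Mapping.keys (a *\<^sub>C p) \<subseteq> Poly_Mapping.keys p"
      by (auto simp: in_keys_iff lookup_scaleC)
    then show ?thesis
      using e_eq [of "Poly_Mapping.keys p" "a *\<^sub>C p"] e_eq [of "Poly_Mapping.keys p" p]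
      by (simp add: lookup_scaleC scaleC_complex_def scaleC_scaleC
          complex_vector.scale_sum_right case_prod_unfold)
  qed
  have e_diff: "e (p - q) = e p - e q" for p q
    by (metis e_add add_diff_cancel_right' diff_add_cancel)
  have e_single: "e (Poly_Mapping.single (v, w) a) = a *\<^sub>C b v w" for v w a
    by (simp add: e_def)
  have b_add_left: "b (v + v') w = b v w + b v' w" and b_scale_left: "b (a *\<^sub>C v) w = a *\<^sub>C b v w"
    and b_add_right: "b v (w + w') = b v w + b v w'" and b_scale_right: "b v (a *\<^sub>C w) = a *\<^sub>C b v w"
    for v v' w w' a
    using left right by (auto simp: Vector_Spaces.linear_iff)
  have e_zero: "e 0 = 0"
    by (simp add: e_def)
  have "csubspace {p. e p = 0}"
    unfolding complex_vector.subspace_def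
    by (auto simp: e_add e_scale complex_vector.scale_zero_right e_zero)
  moreover have "tensor_relations \<subseteq> {p. e p = 0}"
    by (auto simp: tensor_relations_def e_diff e_single b_add_left b_add_right b_scale_left
        b_scale_right scaleC_one)
  ultimately have ker: "e p = 0" if "p \<in> cspan tensor_relations" for p
    using complex_vector.span_minimal that by blast
  define h where "h t = e (rep_tensor t)" for t :: "('a, 'b) tensor"
  have h_abs: "h (abs_tensor p) = e p" for p
  proof -
    have "tensor_rel (rep_tensor (abs_tensor p)) p"
      using Quotient_rep_abs [OF Quotient_tensor] by (simp add: tensor_rel_def complex_vector.span_zero)
    then show ?thesis
      using ker [of "rep_tensor (abs_tensor p) - p"] by (simp add: h_def tensor_rel_def e_diff)
  qed
  have h_add: "h (s + t) = h s + h t" for s t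
    by (induction s; induction t) (simp add: h_abs plus_tensor.abs_eq e_add)
  have h_scale: "h (a *\<^sub>C s) = a *\<^sub>C h s" for a s
    by (induction s) (simp add: h_abs scaleC_tensor.abs_eq e_scale)
  show ?thesis
  proof (rule ex1I [of _ h])
    show "clinear h \<and> (\<forall>v w. h (v \<otimes> w) = b v w)"
      by (simp add: Vector_Spaces.linear_iff complex_vector.vector_space_axioms h_add h_scale
          pure_tensor.abs_eq h_abs e_single scaleC_one)
  next
    fix g assume g: "clinear g \<and> (\<forall>v w. g (v \<otimes> w) = b v w)"
    then have g_add: "g (s + t) = g s + g t" and g_scale: "g (a *\<^sub>C s) = a *\<^sub>C g s" for s t a
      by (auto simp: Vector_Spaces.linear_iff)
    have g0: "g 0 = 0"
      using g_add [of 0 0] by simp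
    have g_sum: "g (\<Sum>x\<in>X. f x) = (\<Sum>x\<in>X. g (f x))"
      if "finite X" for X :: "('a \<times> 'b) set" and f
      using that by (induction X) (simp_all add: g_add g0)
    show "g = h"
    proof
      fix t show "g t = h t"
      proof (induction t)
        case (1 p)
        show ?case
          unfolding h_abs
          by (subst abs_tensor_conv_sum) (use g in \<open>simp add: g_sum g_scale e_def case_prod_unfold\<close>)
      qed
    qed
  qed
qed

lemma tensor_rel_base: "tensor_rel p q" if "p - q \<in> tensor_relations"
  unfolding tensor_rel_def using that by (rule complex_vector.span_base)

lemma pure_tensor_add_left: "(v + v') \<otimes> w = v \<otimes> w + v' \<otimes> w"
  by transfer (rule tensor_rel_base, unfold tensor_relations_def diff_diff_eq [symmetric], blast)

lemma pure_tensor_add_right: "v \<otimes> (w + w') = v \<otimes> w + v \<otimes> w'"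
  by transfer (rule tensor_rel_base, unfold tensor_relations_def diff_diff_eq [symmetric], blast)

lemma pure_tensor_scale_left: "(a *\<^sub>C v) \<otimes> w = a *\<^sub>C (v \<otimes> w)"
  by transfer
    (rule tensor_rel_base, unfold tensor_relations_def scaleC_single scaleC_complex_def mult_1_right, blast)

lemma pure_tensor_scale_right: "v \<otimes> (a *\<^sub>C w) = a *\<^sub>C (v \<otimes> w)"
  by transfer
    (rule tensor_rel_base, unfold tensor_relations_def scaleC_single scaleC_complex_def mult_1_right, blast)

lemma
  assumes "clinear f" "clinear g"
  shows clinear_tensor_map: "clinear (tensor_map f g)"
    and tensor_map_pure: "tensor_map f g (v \<otimes> w) = f v \<otimes> g w"
proof -
  have "\<exists>!h. clinear h \<and> (\<forall>v w. h (v \<otimes> w) = f v \<otimes> g w)"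
    using assms
    by (intro tensor_universal)
      (simp_all add: Vector_Spaces.linear_iff complex_vector.vector_space_axioms
        pure_tensor_add_left pure_tensor_add_right pure_tensor_scale_left pure_tensor_scale_right)
  from theI' [OF this] show "clinear (tensor_map f g)" "tensor_map f g (v \<otimes> w) = f v \<otimes> g w"
    by (simp_all add: tensor_map_def)
qed

section \<open>Smooth functions and Lie groups\<close>

text \<open>Meant for open \<open>S\<close>; \<open>C_on n S f\<close> says that \<open>f\<close> is of class \<open>C\<^sup>n\<close> on \<open>S\<close>.\<close>

primrec C_on :: "nat \<Rightarrow> 'a::real_normed_vector set \<Rightarrow> ('a \<Rightarrow> 'b::real_normed_vector) \<Rightarrow> bool"
  where
    "C_on 0 S f \<longleftrightarrow> continuous_on S f"
  | "C_on (Suc n) S f \<longleftrightarrow> (\<forall>x\<in>S. f differentiable (at x)) \<and>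
       (\<forall>v. C_on n S (\<lambda>x. frechet_derivative f (at x) v))"

definition smooth_on :: "'a::real_normed_vector set \<Rightarrow> ('a \<Rightarrow> 'b::real_normed_vector) \<Rightarrow> bool"
  where "smooth_on S f \<longleftrightarrow> (\<forall>n. C_on n S f)"

type_synonym ('g, 'e) chart = "'g set \<times> ('g \<Rightarrow> 'e)"

definition smooth_atlas ::
    "('g::{t2_space, second_countable_topology}, 'e::euclidean_space) chart set \<Rightarrow> bool"
  where "smooth_atlas A \<longleftrightarrow>
    (\<forall>(U, \<phi>)\<in>A. open U \<and> open (\<phi> ` U) \<and> homeomorphism U (\<phi> ` U) \<phi> (inv_into U \<phi>)) \<and>
    (\<Union>(U, \<phi>)\<in>A. U) = UNIV \<and>
    (\<forall>(U, \<phi>)\<in>A. \<forall>(V, \<psi>)\<in>A. smooth_on (\<phi> ` (U \<inter> V)) (\<psi> \<circ> inv_into U \<phi>))"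

definition smooth_fun :: "('g, 'e::euclidean_space) chart set \<Rightarrow> ('g \<Rightarrow> real) \<Rightarrow> bool"
  where "smooth_fun A f \<longleftrightarrow> (\<forall>(U, \<phi>)\<in>A. smooth_on (\<phi> ` U) (f \<circ> inv_into U \<phi>))"

text \<open>The group is written additively, because \<^class>\<open>topological_group_add\<close> is the library's class of
  topological groups; it does not assume commutativity.\<close>

definition lie_group ::
    "('g::{topological_group_add, t2_space, second_countable_topology}, 'e::euclidean_space) chart set
      \<Rightarrow> bool"
  where "lie_group A \<longleftrightarrow> smooth_atlas A \<and>
    (\<forall>(U, \<phi>)\<in>A. \<forall>(V, \<psi>)\<in>A. \<forall>(W, \<omega>)\<in>A.
       smooth_on {(a, b) \<in> \<phi> ` U \<times> \<psi> ` V. inv_into U \<phi> a + inv_into V \<psi> b \<in> W}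
         (\<lambda>(a, b). \<omega> (inv_into U \<phi> a + inv_into V \<psi> b))) \<and>
    (\<forall>(U, \<phi>)\<in>A. \<forall>(W, \<omega>)\<in>A.
       smooth_on {a \<in> \<phi> ` U. - inv_into U \<phi> a \<in> W} (\<lambda>a. \<omega> (- inv_into U \<phi> a)))"

section \<open>The Lie algebra of a Lie group\<close>

text \<open>Vector fields on the manifold are the derivations of its algebra of smooth functions.  The values
  of \<open>D\<close> at functions that are not smooth are irrelevant.\<close>

definition left_invariant_vector_field ::
    "('g::group_add, 'e::euclidean_space) chart set \<Rightarrow> (('g \<Rightarrow> real) \<Rightarrow> ('g \<Rightarrow> real)) \<Rightarrow> bool"
  where "left_invariant_vector_field A D \<longleftrightarrow>
    (\<forall>f. smooth_fun A f \<longrightarrow> smooth_fun A (D f)) \<and>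
    (\<forall>f g a b. smooth_fun A f \<longrightarrow> smooth_fun A g \<longrightarrow>
       D (\<lambda>x. a * f x + b * g x) = (\<lambda>x. a * D f x + b * D g x)) \<and>
    (\<forall>f g. smooth_fun A f \<longrightarrow> smooth_fun A g \<longrightarrow>
       D (\<lambda>x. f x * g x) = (\<lambda>x. D f x * g x + f x * D g x)) \<and>
    (\<forall>f h. smooth_fun A f \<longrightarrow> D (\<lambda>x. f (h + x)) = (\<lambda>x. D f (h + x)))"

definition lie_algebra :: "('l::real_vector \<Rightarrow> 'l \<Rightarrow> 'l) \<Rightarrow> bool"
  where "lie_algebra br \<longleftrightarrow> bilinear br \<and> (\<forall>x. br x x = 0) \<and>
    (\<forall>x y z. br x (br y z) + br y (br z x) + br z (br x y) = 0)"

text \<open>\<open>vf\<close> identifies the Lie algebra \<open>('l, br)\<close> with the left invariant vector fields on the group.\<close>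

definition lie_algebra_of ::
    "('g::group_add, 'e::euclidean_space) chart set \<Rightarrow> ('l::real_vector \<Rightarrow> 'l \<Rightarrow> 'l)
      \<Rightarrow> ('l \<Rightarrow> ('g \<Rightarrow> real) \<Rightarrow> ('g \<Rightarrow> real)) \<Rightarrow> bool"
  where "lie_algebra_of A br vf \<longleftrightarrow> lie_algebra br \<and>
    (\<forall>x. left_invariant_vector_field A (vf x)) \<and>
    (\<forall>D. left_invariant_vector_field A D \<longrightarrow> (\<exists>!x. \<forall>f. smooth_fun A f \<longrightarrow> vf x f = D f)) \<and>
    (\<forall>x y a b f. smooth_fun A f \<longrightarrow>
       vf (a *\<^sub>R x + b *\<^sub>R y) f = (\<lambda>g. a * vf x f g + b * vf y f g)) \<and>
    (\<forall>x y f. smooth_fun A f \<longrightarrow>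
       vf (br x y) f = (\<lambda>g. vf x (vf y f) g - vf y (vf x f) g))"

definition one_parameter_subgroup ::
    "('g::group_add, 'e::euclidean_space) chart set \<Rightarrow> ('l \<Rightarrow> ('g \<Rightarrow> real) \<Rightarrow> ('g \<Rightarrow> real))
      \<Rightarrow> 'l \<Rightarrow> (real \<Rightarrow> 'g) \<Rightarrow> bool"
  where "one_parameter_subgroup A vf x \<gamma> \<longleftrightarrow> (\<forall>s t. \<gamma> (s + t) = \<gamma> s + \<gamma> t) \<and>
    (\<forall>f t. smooth_fun A f \<longrightarrow> ((\<lambda>s. f (\<gamma> s)) has_real_derivative vf x f (\<gamma> t)) (at t))"

definition lie_exp ::
    "('g::group_add, 'e::euclidean_space) chart set \<Rightarrow> ('l \<Rightarrow> ('g \<Rightarrow> real) \<Rightarrow> ('g \<Rightarrow> real))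
      \<Rightarrow> 'l \<Rightarrow> 'g"
  where "lie_exp A vf x = (THE g. \<exists>\<gamma>. one_parameter_subgroup A vf x \<gamma> \<and> g = \<gamma> 1)"

text \<open>\<open>Ad g\<close> is the push-forward of left invariant vector fields along the conjugation
  \<open>u \<mapsto> g + u - g\<close>.\<close>

definition Ad ::
    "('g::group_add, 'e::euclidean_space) chart set \<Rightarrow> ('l \<Rightarrow> ('g \<Rightarrow> real) \<Rightarrow> ('g \<Rightarrow> real))
      \<Rightarrow> 'g \<Rightarrow> 'l \<Rightarrow> 'l"
  where "Ad A vf g x =
    (THE y. \<forall>f. smooth_fun A f \<longrightarrow> vf y f = (\<lambda>h. vf x (\<lambda>u. f (g + u - g)) (- g + h + g)))"

text \<open>The connected (immersed) Lie subgroup with Lie algebra \<open>s\<close>, that is, the subgroup generated by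
  \<open>exp s\<close>.\<close>

definition connected_lie_subgroup ::
    "('g::group_add, 'e::euclidean_space) chart set \<Rightarrow> ('l::real_vector \<Rightarrow> ('g \<Rightarrow> real) \<Rightarrow> ('g \<Rightarrow> real))
      \<Rightarrow> 'l set \<Rightarrow> 'g set \<Rightarrow> bool"
  where "connected_lie_subgroup A vf s H \<longleftrightarrow>
    0 \<in> H \<and> (\<forall>g\<in>H. \<forall>h\<in>H. g + h \<in> H) \<and> (\<forall>g\<in>H. - g \<in> H) \<and>
    s = {x. \<forall>t. lie_exp A vf (t *\<^sub>R x) \<in> H} \<and>
    (\<forall>g\<in>H. \<exists>xs. set xs \<subseteq> s \<and> g = sum_list (map (lie_exp A vf) xs))"

section \<open>Simple Lie algebras and Cartan decompositions\<close>

definition simple_lie_algebra :: "('l::real_vector \<Rightarrow> 'l \<Rightarrow> 'l) \<Rightarrow> bool"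
  where "simple_lie_algebra br \<longleftrightarrow> lie_algebra br \<and> (\<exists>x y. br x y \<noteq> 0) \<and>
    (\<forall>I. subspace I \<and> (\<forall>x. \<forall>y\<in>I. br x y \<in> I) \<longrightarrow> I = {0} \<or> I = UNIV)"

text \<open>The trace of \<open>ad x \<circ> ad y\<close>, computed in the orthonormal basis \<^const>\<open>Basis\<close>; the inner product of
  \<open>'l\<close> plays no further role.\<close>

definition killing_form :: "('l::euclidean_space \<Rightarrow> 'l \<Rightarrow> 'l) \<Rightarrow> 'l \<Rightarrow> 'l \<Rightarrow> real"
  where "killing_form br x y = (\<Sum>b\<in>Basis. br x (br y b) \<bullet> b)"

definition cartan_involution :: "('l::euclidean_space \<Rightarrow> 'l \<Rightarrow> 'l) \<Rightarrow> ('l \<Rightarrow> 'l) \<Rightarrow> bool"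
  where "cartan_involution br \<theta> \<longleftrightarrow> linear \<theta> \<and> (\<forall>x. \<theta> (\<theta> x) = x) \<and>
    (\<forall>x y. \<theta> (br x y) = br (\<theta> x) (\<theta> y)) \<and> (\<forall>x. x \<noteq> 0 \<longrightarrow> - killing_form br x (\<theta> x) > 0)"

definition cartan_decomposition :: "('l::euclidean_space \<Rightarrow> 'l \<Rightarrow> 'l) \<Rightarrow> 'l set \<Rightarrow> 'l set \<Rightarrow> bool"
  where "cartan_decomposition br k p \<longleftrightarrow>
    (\<exists>\<theta>. cartan_involution br \<theta> \<and> k = {x. \<theta> x = x} \<and> p = {x. \<theta> x = - x})"

definition hermitian_type :: "('l::euclidean_space \<Rightarrow> 'l \<Rightarrow> 'l) \<Rightarrow> 'l set \<Rightarrow> bool"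
  where "hermitian_type br k \<longleftrightarrow> dim {z\<in>k. \<forall>x\<in>k. br z x = 0} = 1"

section \<open>Complexification\<close>

text \<open>\<open>Complexify x y\<close> stands for \<open>x + i y\<close>.\<close>

datatype 'a complexification = Complexify (real_part: 'a) (imag_part: 'a)

instantiation complexification :: (real_vector) complex_vector
begin

definition "0 = Complexify 0 0"
definition "u + v = Complexify (real_part u + real_part v) (imag_part u + imag_part v)"
definition "u - v = Complexify (real_part u - real_part v) (imag_part u - imag_part v)"
definition "- u = Complexify (- real_part u) (- imag_part u)"
definition "c *\<^sub>C u = Complexify (Re c *\<^sub>R real_part u - Im c *\<^sub>R imag_part u)
  (Re c *\<^sub>R imag_part u + Im c *\<^sub>R real_part u)"

instance
  by standard
    (simp_all add: zero_complexification_def plus_complexification_def minus_complexification_def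
      uminus_complexification_def scaleC_complexification_def algebra_simps complexification.expand)

end

definition complexify_set :: "'a set \<Rightarrow> 'a complexification set"
  where "complexify_set S = {u. real_part u \<in> S \<and> imag_part u \<in> S}"

definition complexify_bracket ::
    "('l::real_vector \<Rightarrow> 'l \<Rightarrow> 'l) \<Rightarrow> 'l complexification \<Rightarrow> 'l complexification \<Rightarrow> 'l complexification"
  where "complexify_bracket br u v = Complexify
    (br (real_part u) (real_part v) - br (imag_part u) (imag_part v))
    (br (real_part u) (imag_part v) + br (imag_part u) (real_part v))"

definition complexify_rep ::
    "('l \<Rightarrow> 'v \<Rightarrow> 'v) \<Rightarrow> 'l complexification \<Rightarrow> 'v::complex_vector \<Rightarrow> 'v"
  where "complexify_rep \<pi> u v = \<pi> (real_part u) v + \<i> *\<^sub>C \<pi> (imag_part u) v"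

text \<open>\<open>P\<close> is an irreducible submodule for the adjoint action of the complexification of \<open>k\<close>.\<close>

definition irreducible_kC_submodule ::
    "('l::real_vector \<Rightarrow> 'l \<Rightarrow> 'l) \<Rightarrow> 'l set \<Rightarrow> 'l complexification set \<Rightarrow> bool"
  where "irreducible_kC_submodule br k P \<longleftrightarrow>
    (let sub = (\<lambda>Q. csubspace Q \<and> (\<forall>u\<in>complexify_set k. \<forall>v\<in>Q. complexify_bracket br u v \<in> Q))
     in sub P \<and> P \<noteq> {0} \<and> (\<forall>Q. sub Q \<and> Q \<subseteq> P \<longrightarrow> Q = {0} \<or> Q = P))"

definition hermitian_splitting ::
    "('l::real_vector \<Rightarrow> 'l \<Rightarrow> 'l) \<Rightarrow> 'l set \<Rightarrow> 'l set \<Rightarrow> 'l complexification set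
      \<Rightarrow> 'l complexification set \<Rightarrow> bool"
  where "hermitian_splitting br k p p_plus p_minus \<longleftrightarrow>
    irreducible_kC_submodule br k p_plus \<and> irreducible_kC_submodule br k p_minus \<and>
    complexify_set p = {u + v | u v. u \<in> p_plus \<and> v \<in> p_minus} \<and> p_plus \<inter> p_minus = {0}"

section \<open>\<open>(g, K)\<close>-modules\<close>

definition lie_representation ::
    "('l::real_vector \<Rightarrow> 'l \<Rightarrow> 'l) \<Rightarrow> ('l \<Rightarrow> 'v::complex_vector \<Rightarrow> 'v) \<Rightarrow> bool"
  where "lie_representation br \<pi> \<longleftrightarrow> (\<forall>x. clinear (\<pi> x)) \<and>
    (\<forall>a b x y v. \<pi> (a *\<^sub>R x + b *\<^sub>R y) v
       = complex_of_real a *\<^sub>C \<pi> x v + complex_of_real b *\<^sub>C \<pi> y v) \<and>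
    (\<forall>x y v. \<pi> (br x y) v = \<pi> x (\<pi> y v) - \<pi> y (\<pi> x v))"

text \<open>By local finiteness each \<open>v\<close> lies in a finite dimensional representation of \<open>K\<close>.  The continuity of
  that representation, and the requirement that its differential be the restriction of \<open>\<pi>\<close> to \<open>k\<close>, are
  expressed through the matrix coefficients \<open>l (\<rho> g v)\<close> for linear functionals \<open>l\<close>.\<close>

definition gK_module ::
    "('g::{topological_space, group_add}, 'e::euclidean_space) chart set \<Rightarrow> ('l::real_vector \<Rightarrow> 'l \<Rightarrow> 'l)
      \<Rightarrow> ('l \<Rightarrow> ('g \<Rightarrow> real) \<Rightarrow> ('g \<Rightarrow> real)) \<Rightarrow> 'l set \<Rightarrow> 'g set
      \<Rightarrow> ('l \<Rightarrow> 'v::complex_vector \<Rightarrow> 'v) \<Rightarrow> ('g \<Rightarrow> 'v \<Rightarrow> 'v) \<Rightarrow> bool"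
  where "gK_module A br vf k K \<pi> \<rho> \<longleftrightarrow>
    lie_representation br \<pi> \<and>
    (\<forall>g\<in>K. clinear (\<rho> g)) \<and> (\<forall>v. \<rho> 0 v = v) \<and> (\<forall>g\<in>K. \<forall>h\<in>K. \<forall>v. \<rho> (g + h) v = \<rho> g (\<rho> h v)) \<and>
    (\<forall>g\<in>K. \<forall>x v. \<rho> g (\<pi> x v) = \<pi> (Ad A vf g x) (\<rho> g v)) \<and>
    (\<forall>v. \<exists>W. csubspace W \<and> cfinite_dim W \<and> v \<in> W \<and> (\<forall>g\<in>K. \<rho> g ` W \<subseteq> W)) \<and>
    (\<forall>l v. clinear l \<longrightarrow> continuous_on K (\<lambda>g. l (\<rho> g v) :: complex)) \<and>
    (\<forall>l. \<forall>x\<in>k. \<forall>v. clinear l \<longrightarrow>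
       ((\<lambda>t. l (\<rho> (lie_exp A vf (t *\<^sub>R x)) v) :: complex) has_vector_derivative l (\<pi> x v)) (at 0))"

definition gK_submodule ::
    "'g set \<Rightarrow> ('l \<Rightarrow> 'v::complex_vector \<Rightarrow> 'v) \<Rightarrow> ('g \<Rightarrow> 'v \<Rightarrow> 'v) \<Rightarrow> 'v set \<Rightarrow> bool"
  where "gK_submodule K \<pi> \<rho> W \<longleftrightarrow>
    csubspace W \<and> (\<forall>x. \<pi> x ` W \<subseteq> W) \<and> (\<forall>g\<in>K. \<rho> g ` W \<subseteq> W)"

definition gK_irreducible ::
    "'g set \<Rightarrow> ('l \<Rightarrow> 'v::complex_vector \<Rightarrow> 'v) \<Rightarrow> ('g \<Rightarrow> 'v \<Rightarrow> 'v) \<Rightarrow> bool"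
  where "gK_irreducible K \<pi> \<rho> \<longleftrightarrow> (UNIV :: 'v set) \<noteq> {0} \<and>
    (\<forall>W. gK_submodule K \<pi> \<rho> W \<longrightarrow> W = {0} \<or> W = UNIV)"

text \<open>A submodule has finite length if it has a composition series.  Irreducibility of the quotient
  \<open>Z (Suc i) / Z i\<close> is expressed by the absence of submodules strictly in between.\<close>

definition gK_finite_length ::
    "'g set \<Rightarrow> ('l \<Rightarrow> 'v::complex_vector \<Rightarrow> 'v) \<Rightarrow> ('g \<Rightarrow> 'v \<Rightarrow> 'v) \<Rightarrow> 'v set \<Rightarrow> bool"
  where "gK_finite_length K \<pi> \<rho> Y \<longleftrightarrow>
    (\<exists>n Z. Z 0 = {0} \<and> Z n = Y \<and> (\<forall>i\<le>n. gK_submodule K \<pi> \<rho> (Z i)) \<and>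
       (\<forall>i<n. Z i \<subset> Z (Suc i) \<and>
          (\<nexists>W. gK_submodule K \<pi> \<rho> W \<and> Z i \<subset> W \<and> W \<subset> Z (Suc i))))"

definition discretely_decomposable ::
    "'g set \<Rightarrow> ('l \<Rightarrow> 'v::complex_vector \<Rightarrow> 'v) \<Rightarrow> ('g \<Rightarrow> 'v \<Rightarrow> 'v) \<Rightarrow> bool"
  where "discretely_decomposable K \<pi> \<rho> \<longleftrightarrow>
    (\<exists>Y :: nat \<Rightarrow> 'v set. (\<forall>i. gK_submodule K \<pi> \<rho> (Y i) \<and> gK_finite_length K \<pi> \<rho> (Y i)) \<and>
       (\<forall>i. Y i \<subseteq> Y (Suc i)) \<and> (\<Union>i. Y i) = UNIV)"

definition highest_weight_module ::
    "'l complexification set \<Rightarrow> 'g set \<Rightarrow> ('l \<Rightarrow> 'v::complex_vector \<Rightarrow> 'v) \<Rightarrow> ('g \<Rightarrow> 'v \<Rightarrow> 'v) \<Rightarrow> bool"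
  where "highest_weight_module p_plus K \<pi> \<rho> \<longleftrightarrow> gK_irreducible K \<pi> \<rho> \<and>
    (\<exists>v. v \<noteq> 0 \<and> (\<forall>u\<in>p_plus. complexify_rep \<pi> u v = 0))"

definition lowest_weight_module ::
    "'l complexification set \<Rightarrow> 'g set \<Rightarrow> ('l \<Rightarrow> 'v::complex_vector \<Rightarrow> 'v) \<Rightarrow> ('g \<Rightarrow> 'v \<Rightarrow> 'v) \<Rightarrow> bool"
  where "lowest_weight_module p_minus K \<pi> \<rho> \<longleftrightarrow> gK_irreducible K \<pi> \<rho> \<and>
    (\<exists>v. v \<noteq> 0 \<and> (\<forall>u\<in>p_minus. complexify_rep \<pi> u v = 0))"

definition tensor_lie_action ::
    "('l \<Rightarrow> 'v::complex_vector \<Rightarrow> 'v) \<Rightarrow> ('l \<Rightarrow> 'w::complex_vector \<Rightarrow> 'w)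
      \<Rightarrow> 'l \<Rightarrow> ('v, 'w) tensor \<Rightarrow> ('v, 'w) tensor"
  where "tensor_lie_action \<pi>\<^sub>1 \<pi>\<^sub>2 x t = tensor_map (\<pi>\<^sub>1 x) (\<lambda>w. w) t + tensor_map (\<lambda>v. v) (\<pi>\<^sub>2 x) t"

definition tensor_group_action ::
    "('g \<Rightarrow> 'v::complex_vector \<Rightarrow> 'v) \<Rightarrow> ('g \<Rightarrow> 'w::complex_vector \<Rightarrow> 'w)
      \<Rightarrow> 'g \<Rightarrow> ('v, 'w) tensor \<Rightarrow> ('v, 'w) tensor"
  where "tensor_group_action \<rho>\<^sub>1 \<rho>\<^sub>2 g = tensor_map (\<rho>\<^sub>1 g) (\<rho>\<^sub>2 g)"

end

theory Submission
  imports Defs "HOL-Computational_Algebra.Fundamental_Theorem_Algebra"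
begin

text \<open>Suppose that \<open>X\<^sub>1 \<otimes> X\<^sub>2\<close> is discretely decomposable.  The Casimir operator acts on it as a scalar plus
  twice \<open>\<Omega> = \<Sum> \<plusminus> x \<otimes> x\<close>, where \<open>x\<close> runs through an orthonormal basis for the Killing form, so \<open>\<Omega>\<close> is
  locally finite.  Comparing with the graded modules of \<open>X\<^sub>1\<close> and \<open>X\<^sub>2\<close> shows that the associated varieties of
  \<open>X\<^sub>1\<close> and \<open>X\<^sub>2\<close> are orthogonal to each other.  Their spans are \<open>k\<close>-submodules of the complexification of
  \<open>p\<close>, non-zero since \<open>X\<^sub>1\<close> and \<open>X\<^sub>2\<close> are infinite-dimensional, hence proper.  The existence of a proper
  submodule means that \<open>\<plusminus> \<i>\<close>-eigenspaces \<open>p\<^sub>+\<close> and \<open>p\<^sub>-\<close> of some \<open>ad z\<close>, \<open>z\<close> central in \<open>k\<close>, exist and are the only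
  candidates; they are isotropic and dual to each other, so both spans are the same one.  The symbols in that
  space, say \<open>p\<^sub>+\<close>, are nilpotent on both modules, and counting weights of \<open>z\<close> this produces vectors annihilated
  by \<open>p\<^sub>+\<close>.

  Conversely, if both modules have vectors annihilated by \<open>p\<^sub>+\<close>, then the weights of \<open>z\<close> on \<open>X\<^sub>1 \<otimes> X\<^sub>2\<close> are
  \<open>\<mu> - \<i> n\<close> with finite multiplicities.  On a weight vector which \<open>p\<^sub>+\<close> maps into a submodule \<open>Y\<close>, the Casimir
  operator is, modulo \<open>Y\<close>, minus a sum of squares from \<open>k\<close> plus a scalar of order \<open>n\<^sup>2\<close>, whose spectrum moves to
  infinity with \<open>n\<close>.  On the submodule generated by finitely many weight spaces the Casimir operator has only
  finitely many eigenvalues, so that the submodules of it are determined by finitely many weight spaces and it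
  has finite length.\<close>

section \<open>Subspaces, functionals and dimension counts over the complex numbers\<close>

section \<open>Linear algebra over the complex numbers\<close>

text \<open>The modules carry no invariant inner product, and neither highest weight theory nor
  commutative algebra is developed. Three substitutes shape the proof. Scalars come from Dixmier's
  form of Schur's lemma: an operator without any scalar behaviour on a space of countable dimension
  would have uncountably many independent resolvents. The same argument, run in a quotient of the
  graded module by a maximal graded submodule, replaces the Nullstellensatz and yields points of the
  associated variety as linear functionals. Instead of Casimir eigenvalues on K-types, minus a sum
  of squares from k is bounded below by a numerical range argument: k acts by skew-Hermitian
  matrices on words in generators, up to an error fixed by the finite-dimensional space to which the
  words are applied. The algebraic properties of the adjoint action of K are read off from its
  equivariance and the faithfulness of an irreducible module. That K is generated by exponentials
  enters only to see that K fixes z.\<close>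

lemma clinear_iff: "clinear f \<longleftrightarrow> (\<forall>v w. f (v + w) = f v + f w) \<and> (\<forall>a v. f (a *\<^sub>C v) = a *\<^sub>C f v)"
  by (simp add: Vector_Spaces.linear_iff complex_vector.vector_space_axioms)

lemma clinearI: "(\<And>v w. f (v + w) = f v + f w) \<Longrightarrow> (\<And>a v. f (a *\<^sub>C v) = a *\<^sub>C f v) \<Longrightarrow> clinear f"
  by (simp add: clinear_iff)

lemma
  assumes "clinear f"
  shows clinear_add: "f (v + w) = f v + f w" and clinear_scale: "f (a *\<^sub>C v) = a *\<^sub>C f v"
    and clinear_zero: "f 0 = 0" and clinear_diff: "f (v - w) = f v - f w"
    and clinear_minus: "f (- v) = - f v"
    and clinear_sum: "f (\<Sum>i\<in>I. g i) = (\<Sum>i\<in>I. f (g i))"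
proof -
  interpret f: Vector_Spaces.linear scaleC scaleC f by fact
  show "f (v + w) = f v + f w" "f (a *\<^sub>C v) = a *\<^sub>C f v" "f 0 = 0" "f (v - w) = f v - f w"
    "f (- v) = - f v" "f (\<Sum>i\<in>I. g i) = (\<Sum>i\<in>I. f (g i))"
    by (rule f.add f.scale f.zero f.diff f.neg f.sum)+
qed

lemmas clinear_simps = clinear_add clinear_scale clinear_zero clinear_diff clinear_minus clinear_sum

lemma clinear_compose: "clinear f \<Longrightarrow> clinear g \<Longrightarrow> clinear (\<lambda>v. f (g v))"
  by (rule clinearI) (simp_all add: clinear_simps)

lemma clinear_ident: "clinear (\<lambda>v. v)"
  by (rule clinearI) auto

lemma clinear_plus: "clinear f \<Longrightarrow> clinear g \<Longrightarrow> clinear (\<lambda>v. f v + g v)"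
  by (rule clinearI) (simp_all add: clinear_simps scaleC_add_right)

lemma clinear_minus': "clinear f \<Longrightarrow> clinear g \<Longrightarrow> clinear (\<lambda>v. f v - g v)"
  by (rule clinearI) (simp_all add: clinear_simps complex_vector.scale_right_diff_distrib)

lemma clinear_scaleC: "clinear f \<Longrightarrow> clinear (\<lambda>v. a *\<^sub>C f v)"
  by (rule clinearI)
    (simp_all add: clinear_simps scaleC_add_right complex_vector.scale_left_commute)

lemma clinear_setsum: "(\<And>i. i \<in> I \<Longrightarrow> clinear (f i)) \<Longrightarrow> clinear (\<lambda>v. \<Sum>i\<in>I. f i v)"
  by (rule clinearI) (simp_all add: clinear_simps sum.distrib complex_vector.scale_sum_right)

lemma csubspaceI:
  assumes "0 \<in> W" "\<And>v w. v \<in> W \<Longrightarrow> w \<in> W \<Longrightarrow> v + w \<in> W" "\<And>a v. v \<in> W \<Longrightarrow> a *\<^sub>C v \<in> W"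
  shows "csubspace W"
  using assms by (simp add: complex_vector.subspace_def)

lemmas csub_simps = complex_vector.subspace_0 complex_vector.subspace_add complex_vector.subspace_scale
  complex_vector.subspace_diff complex_vector.subspace_neg complex_vector.subspace_sum

lemma csubspace_cong_diff:
  assumes "csubspace W" "v - w \<in> W" shows "v \<in> W \<longleftrightarrow> w \<in> W"
  using assms csub_simps(2)[OF assms(1), of "v - w" w] csub_simps(4)[OF assms(1), of v "v - w"] by auto

lemma sum_lessThan_const: "(\<Sum>i<n. v) = complex_of_nat n *\<^sub>C v"
  by (induction n) (auto simp: complex_vector.scale_zero_left scaleC_add_left scaleC_one add.commute)

lemma clinear_funpow: "clinear f \<Longrightarrow> clinear (f ^^ n)" for f :: "'a::complex_vector \<Rightarrow> 'a"
  by (induction n) (auto simp: clinear_iff)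

lemma clinear_span_subset:
  assumes "clinear f" "csubspace W" "f ` B \<subseteq> W"
  shows "f ` cspan B \<subseteq> W"
proof -
  have "csubspace {v. f v \<in> W}"
    using assms(1,2) by (intro csubspaceI) (auto simp: clinear_simps csub_simps)
  then have "cspan B \<subseteq> {v. f v \<in> W}"
    using assms(3) by (intro complex_vector.span_minimal) auto
  then show ?thesis by auto
qed

lemma csubspace_image: "clinear f \<Longrightarrow> csubspace V \<Longrightarrow> csubspace (f ` V)"
proof -
  assume "clinear f" and V: "csubspace V"
  then interpret Vector_Spaces.linear scaleC scaleC f by simp
  show ?thesis using subspace_image[of V] V by (simp add: csubspace_def)
qed

lemma separating_functional:
  fixes v :: "'a::complex_vector"
  assumes "csubspace W" "v \<notin> W"
  obtains l :: "'a \<Rightarrow> complex" where "clinear l" "l v = 1" "\<And>w. w \<in> W \<Longrightarrow> l w = 0"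
proof -
  interpret vp: vector_space_pair "scaleC :: _ \<Rightarrow> 'a \<Rightarrow> 'a" "scaleC :: _ \<Rightarrow> complex \<Rightarrow> complex" ..
  obtain B where B: "B \<subseteq> W" "complex_vector.independent B" "W \<subseteq> cspan B"
    using complex_vector.basis_exists by metis
  have "cspan B \<subseteq> W"
    using B(1) assms(1) by (rule complex_vector.span_minimal)
  then have v: "v \<notin> cspan B" using assms(2) by auto
  then have ind: "complex_vector.independent (insert v B)"
    using B(2) complex_vector.independent_insertI by blast
  obtain l :: "'a \<Rightarrow> complex" where l: "clinear l" "\<forall>x\<in>insert v B. l x = (if x = v then 1 else 0)"
    using vp.linear_independent_extend[OF ind, of "\<lambda>x. if x = v then 1 else 0"]
    by metis
  have "v \<notin> B" using v complex_vector.span_base by blast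
  then have "l ` B \<subseteq> {0}" using l(2) by auto
  then have "l ` cspan B \<subseteq> {0}"
    by (intro clinear_span_subset l) auto
  then show ?thesis
    using that[of l] l B(3) by auto
qed

lemma nonzero_functional:
  fixes v :: "'a::complex_vector"
  assumes "v \<noteq> 0"
  obtains l :: "'a \<Rightarrow> complex" where "clinear l" "l v = 1"
  using separating_functional[of "{0}" v] assms complex_vector.subspace_single_0 by (auto simp: csubspace_def)

lemma functional_zero_imp_mem:
  fixes v :: "'a::complex_vector"
  assumes "csubspace W" "\<And>l :: 'a \<Rightarrow> complex. clinear l \<Longrightarrow> (\<And>w. w \<in> W \<Longrightarrow> l w = 0) \<Longrightarrow> l v = 0"
  shows "v \<in> W"
  using separating_functional[OF assms(1)] assms(2) by (metis zero_neq_one)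

subsection \<open>Finite dimension\<close>

lemma cfinite_dimI: "finite B \<Longrightarrow> cfinite_dim (cspan B)"
  unfolding cfinite_dim_def using complex_vector.span_superset by blast

lemma cfinite_dim_span:
  assumes "cfinite_dim W" "csubspace W"
  obtains B where "finite B" "complex_vector.independent B" "B \<subseteq> W" "W = cspan B"
proof -
  obtain B0 where B0: "finite B0" "B0 \<subseteq> W" "W \<subseteq> cspan B0"
    using assms(1) unfolding cfinite_dim_def by blast
  obtain B where B: "B \<subseteq> W" "complex_vector.independent B" "W \<subseteq> cspan B"
    using complex_vector.basis_exists by metis
  have "finite B"
    using B B0 complex_vector.independent_span_bound[of B0 B] by auto
  moreover have "W = cspan B"
    using B(1,3) assms(2) complex_vector.span_minimal by blast
  ultimately show ?thesis using that B by auto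
qed

lemma cfinite_dim_subset:
  assumes "cfinite_dim W" "csubspace V" "V \<subseteq> W"
  shows "cfinite_dim V"
proof -
  obtain B0 where B0: "finite B0" "B0 \<subseteq> W" "W \<subseteq> cspan B0"
    using assms(1) unfolding cfinite_dim_def by blast
  obtain B where B: "B \<subseteq> V" "complex_vector.independent B" "V \<subseteq> cspan B"
    using complex_vector.basis_exists by metis
  have "B \<subseteq> cspan B0" using B(1) assms(3) B0 by blast
  then have "finite B"
    using B B0 complex_vector.independent_span_bound[of B0 B] by auto
  then show ?thesis using B unfolding cfinite_dim_def by auto
qed

lemma cfinite_dim_finite_sum:
  assumes "finite I" "\<And>i. i \<in> I \<Longrightarrow> cfinite_dim (W i)"
  shows "cfinite_dim (cspan (\<Union>i\<in>I. W i))"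
proof -
  obtain B where B: "\<And>i. i \<in> I \<Longrightarrow> finite (B i) \<and> B i \<subseteq> W i \<and> W i \<subseteq> cspan (B i)"
    using assms(2) unfolding cfinite_dim_def by metis
  have "cspan (\<Union>i\<in>I. W i) \<subseteq> cspan (\<Union>i\<in>I. B i)"
  proof (rule complex_vector.span_minimal)
    show "(\<Union>i\<in>I. W i) \<subseteq> cspan (\<Union>i\<in>I. B i)"
      using B complex_vector.span_mono[of "B _" "\<Union>i\<in>I. B i"] by blast
  qed simp
  moreover have "finite (\<Union>i\<in>I. B i)" using B assms(1) by auto
  moreover have "(\<Union>i\<in>I. B i) \<subseteq> cspan (\<Union>i\<in>I. W i)"
    using B complex_vector.span_superset[of "\<Union>i\<in>I. W i"] by blast
  ultimately show ?thesis unfolding cfinite_dim_def by blast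
qed

lemma cfinite_dim_image:
  assumes "cfinite_dim W" "clinear f"
  shows "cfinite_dim (f ` W)"
proof -
  obtain B0 where B0: "finite B0" "B0 \<subseteq> W" "W \<subseteq> cspan B0"
    using assms(1) unfolding cfinite_dim_def by blast
  have "f ` cspan B0 \<subseteq> cspan (f ` B0)"
    using assms(2) by (rule clinear_span_subset) (auto simp: complex_vector.span_superset)
  then show ?thesis
    unfolding cfinite_dim_def using B0 by (intro exI[of _ "f ` B0"]) auto
qed

lemma cfinite_dim_dependent:
  assumes "cfinite_dim E" "infinite L" "f ` L \<subseteq> E"
  obtains S c where "finite S" "S \<subseteq> L" "\<exists>i\<in>S. c i \<noteq> 0" "(\<Sum>i\<in>S. c i *\<^sub>C f i) = 0"
proof -
  have "\<exists>S c. finite S \<and> S \<subseteq> L \<and> (\<exists>i\<in>S. c i \<noteq> 0) \<and> (\<Sum>i\<in>S. c i *\<^sub>C f i) = 0"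
  proof (cases "inj_on f L")
    case False
    then obtain i j where "i \<in> L" "j \<in> L" "i \<noteq> j" "f i = f j" by (auto simp: inj_on_def)
    then show ?thesis
      by (intro exI[of _ "{i,j}"] exI[of _ "\<lambda>k. if k = i then 1 else -1"]) (auto simp: scaleC_one)
  next
    case True
    obtain B0 where B0: "finite B0" "E \<subseteq> cspan B0"
      using assms(1) unfolding cfinite_dim_def by blast
    have "complex_vector.dependent (f ` L)"
      using complex_vector.independent_span_bound[OF B0(1), of "f ` L"] assms True B0(2)
      by (auto simp: finite_image_iff)
    then obtain T u where T: "finite T" "T \<subseteq> f ` L" "\<exists>v\<in>T. u v \<noteq> 0" "(\<Sum>v\<in>T. u v *\<^sub>C v) = 0"
      unfolding complex_vector.dependent_explicit by blast
    obtain S where S: "S \<subseteq> L" "T = f ` S" using T(2) by (metis subset_imageE)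
    have inj: "inj_on f S" using True S(1) inj_on_subset by blast
    have "finite S" using T(1) S(2) inj by (simp add: finite_image_iff)
    moreover have "(\<Sum>i\<in>S. u (f i) *\<^sub>C f i) = 0"
      using T(4) S(2) inj by (simp add: sum.reindex)
    ultimately show ?thesis using S T(3)
      by (intro exI[of _ S] exI[of _ "\<lambda>i. u (f i)"]) auto
  qed
  then show ?thesis using that by blast
qed

lemma cfinite_dim_surj_imp_inj:
  assumes "cfinite_dim V" "csubspace V" "clinear f" "f ` V = V" "v \<in> V" "f v = 0"
  shows "v = 0"
proof (rule ccontr)
  assume "v \<noteq> 0"
  interpret vp: vector_space_pair "scaleC :: _ \<Rightarrow> 'a \<Rightarrow> 'a" "scaleC :: _ \<Rightarrow> 'a \<Rightarrow> 'a" ..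
  interpret f: Vector_Spaces.linear scaleC scaleC f by fact
  obtain B where B: "finite B" "complex_vector.independent B" "B \<subseteq> V" "V = cspan B"
    using cfinite_dim_span assms(1,2) by blast
  have ind: "complex_vector.independent {v}"
    using \<open>v \<noteq> 0\<close> by simp
  obtain C where C: "{v} \<subseteq> C" "C \<subseteq> V" "complex_vector.independent C" "V \<subseteq> cspan C"
    using complex_vector.maximal_independent_subset_extend[of "{v}" V] ind assms(5) by auto
  have finC: "finite C" "card C \<le> card B"
    using complex_vector.independent_span_bound[OF B(1) C(3)] C(2) B(4) by auto
  have "V \<subseteq> cspan (f ` (C - {v}))"
  proof
    fix w assume "w \<in> V"
    then obtain x where x: "x \<in> V" "w = f x" using assms(4) by blast
    have "f ` cspan C \<subseteq> cspan (f ` (C - {v}))"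
    proof (rule clinear_span_subset[OF assms(3)])
      show "f ` C \<subseteq> cspan (f ` (C - {v}))"
        proof
        fix y assume "y \<in> f ` C"
        then obtain c where c: "c \<in> C" "y = f c" by auto
        show "y \<in> cspan (f ` (C - {v}))"
          using c assms(6) complex_vector.span_zero complex_vector.span_base[of y "f ` (C - {v})"]
          by (cases "c = v") auto
      qed
    qed simp
    then show "w \<in> cspan (f ` (C - {v}))" using x C(4) by blast
  qed
  then have "card B \<le> card (f ` (C - {v}))"
    using complex_vector.independent_span_bound[of "f ` (C - {v})" B] B finC by auto
  also have "\<dots> \<le> card (C - {v})" using finC by (intro card_image_le) auto
  also have "\<dots> < card C" using C(1) finC by (intro psubset_card_mono) auto
  finally show False using finC by simp
qed

lemma cfinite_dim_inj_imp_surj: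
  assumes "cfinite_dim V" "csubspace V" "clinear f" "f ` V \<subseteq> V" "\<And>v. v \<in> V \<Longrightarrow> f v = 0 \<Longrightarrow> v = 0"
  shows "f ` V = V"
proof -
  interpret vp: vector_space_pair "scaleC :: _ \<Rightarrow> 'a \<Rightarrow> 'a" "scaleC :: _ \<Rightarrow> 'a \<Rightarrow> 'a" ..
  interpret f: Vector_Spaces.linear scaleC scaleC f by fact
  obtain B where B: "finite B" "complex_vector.independent B" "B \<subseteq> V" "V = cspan B"
    using cfinite_dim_span assms(1,2) by blast
  have inj: "inj_on f (cspan B)"
  proof (rule inj_onI)
    fix x y assume "x \<in> cspan B" "y \<in> cspan B" "f x = f y"
    then have "x - y \<in> V" "f (x - y) = 0"
      using B(4) assms(2) by (auto simp: csub_simps clinear_simps[OF assms(3)])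
    then show "x = y" using assms(5) by fastforce
  qed
  have ind: "complex_vector.independent (f ` B)"
    using f.independent_injective_image[OF B(2) inj[unfolded cspan_def]] .
  have cardB: "card (f ` B) = card B"
    using inj by (intro card_image) (meson complex_vector.span_superset inj_on_subset)
  have "V \<subseteq> cspan (f ` B)"
  proof (rule ccontr)
    assume "\<not> V \<subseteq> cspan (f ` B)"
    then obtain v where v: "v \<in> V" "v \<notin> cspan (f ` B)" by auto
    then have "complex_vector.independent (insert v (f ` B))"
      using ind complex_vector.independent_insertI by blast
    moreover have "insert v (f ` B) \<subseteq> cspan B"
      using v(1) B(3,4) assms(4) by blast
    ultimately have "card (insert v (f ` B)) \<le> card B"
      using complex_vector.independent_span_bound[OF B(1)] by blast
    moreover have "v \<notin> f ` B" using v(2) complex_vector.span_base[of v "f ` B"] by blast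
    ultimately show False using cardB B(1) by simp
  qed
  moreover have "cspan (f ` B) \<subseteq> f ` V"
    using B(4) f.span_image[folded cspan_def, of B] by blast
  ultimately show ?thesis using assms(4) by auto
qed

lemma cfinite_dim_strict_chain_bound:
  assumes "cfinite_dim V"
  obtains d where "\<And>n. \<exists>Z :: nat \<Rightarrow> 'a::complex_vector set.
    (\<forall>i\<le>n. csubspace (Z i) \<and> Z i \<subseteq> V) \<and> (\<forall>i<n. Z i \<subset> Z (Suc i)) \<Longrightarrow> n \<le> d"
proof -
  obtain B0 where B0: "finite B0" "V \<subseteq> cspan B0"
    using assms(1) unfolding cfinite_dim_def by blast
  show ?thesis
  proof (rule that[of "card B0"])
    fix n assume "\<exists>Z :: nat \<Rightarrow> 'a set. (\<forall>i\<le>n. csubspace (Z i) \<and> Z i \<subseteq> V) \<and> (\<forall>i<n. Z i \<subset> Z (Suc i))"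
    then obtain Z :: "nat \<Rightarrow> 'a set" where
      Z: "\<And>i. i \<le> n \<Longrightarrow> csubspace (Z i) \<and> Z i \<subseteq> V" "\<And>i. i < n \<Longrightarrow> Z i \<subset> Z (Suc i)" by blast
    have "\<exists>C. C \<subseteq> Z i \<and> complex_vector.independent C \<and> finite C \<and> card C = i" if "i \<le> n" for i
      using that
    proof (induction i)
      case 0 then show ?case
        by (intro exI[of _ "{}"]) (auto simp: complex_vector.independent_empty)
    next
      case (Suc i)
      then obtain C where C: "C \<subseteq> Z i" "complex_vector.independent C" "finite C" "card C = i" by auto
      obtain v where v: "v \<in> Z (Suc i)" "v \<notin> Z i" using Z(2)[of i] Suc.prems by auto
      have "cspan C \<subseteq> Z i" using C(1) Z(1)[of i] Suc.prems by (intro complex_vector.span_minimal) auto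
      then have "v \<notin> cspan C" using v by auto
      then have "complex_vector.independent (insert v C)" "v \<notin> C"
        using C(2) complex_vector.independent_insertI complex_vector.span_base by blast+
      then show ?case using C v Z(2)[of i] Suc.prems
        by (intro exI[of _ "insert v C"]) auto
    qed
    from this[of n] obtain C where C: "C \<subseteq> Z n" "complex_vector.independent C" "finite C" "card C = n" by auto
    have "C \<subseteq> cspan B0" using C(1) Z(1)[of n] B0(2) by auto
    then show "n \<le> card B0"
      using complex_vector.independent_span_bound[OF B0(1) C(2)] C(4) by simp
  qed
qed

subsection \<open>Dixmier's lemma in filtered form\<close>

text \<open>The quotients \<open>F n / Q n\<close> form a graded module over the polynomial ring in \<open>x\<close> and \<open>u\<close>, and
  \<open>hom_eval q s\<close> acts as the homogeneous form of degree \<open>s\<close> with dehomogenization \<open>q\<close>.\<close>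

locale graded_pair =
  fixes x u :: "'v::complex_vector \<Rightarrow> 'v" and F Q :: "nat \<Rightarrow> 'v set"
  assumes clin: "clinear x" "clinear u"
    and sub: "\<And>n. csubspace (F n)" "\<And>n. csubspace (Q n)"
    and QF: "\<And>n. Q n \<subseteq> F n"
    and xF: "\<And>n v. v \<in> F n \<Longrightarrow> x v \<in> F (Suc n)" and uF: "\<And>n v. v \<in> F n \<Longrightarrow> u v \<in> F (Suc n)"
    and xQ: "\<And>n v. v \<in> Q n \<Longrightarrow> x v \<in> Q (Suc n)" and uQ: "\<And>n v. v \<in> Q n \<Longrightarrow> u v \<in> Q (Suc n)"
    and comm: "\<And>n v. v \<in> F n \<Longrightarrow> x (u v) - u (x v) \<in> Q (Suc (Suc n))"
begin

definition hom_eval :: "complex poly \<Rightarrow> nat \<Rightarrow> 'v \<Rightarrow> 'v"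
  where "hom_eval q s v = (\<Sum>k\<le>s. coeff q k *\<^sub>C (x ^^ k) ((u ^^ (s - k)) v))"

lemmas lin = clinear_simps[OF clin(1)] clinear_simps[OF clin(2)]

lemma clinear_hom_eval: "clinear (hom_eval q s)"
  unfolding hom_eval_def
  by (intro clinear_setsum clinear_scaleC clinear_compose[of "x ^^ _" "u ^^ _"] clinear_funpow clin)

lemma pow_F: "v \<in> F n \<Longrightarrow> (x ^^ k) v \<in> F (n + k)" "v \<in> F n \<Longrightarrow> (u ^^ k) v \<in> F (n + k)"
  by (induction k) (auto intro: xF uF)

lemma pow_Q: "v \<in> Q n \<Longrightarrow> (x ^^ k) v \<in> Q (n + k)" "v \<in> Q n \<Longrightarrow> (u ^^ k) v \<in> Q (n + k)"
  by (induction k) (auto intro: xQ uQ)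

lemma hom_eval_F: "v \<in> F n \<Longrightarrow> hom_eval q s v \<in> F (n + s)"
  unfolding hom_eval_def
proof (intro csub_simps(6,3) sub)
  fix k assume "v \<in> F n" "k \<in> {..s}"
  then show "(x ^^ k) ((u ^^ (s - k)) v) \<in> F (n + s)"
    using pow_F(1)[OF pow_F(2), of v n k "s - k"] by simp
qed

lemma hom_eval_Q: "v \<in> Q n \<Longrightarrow> hom_eval q s v \<in> Q (n + s)"
  unfolding hom_eval_def
proof (intro csub_simps(6,3) sub)
  fix k assume "v \<in> Q n" "k \<in> {..s}"
  then show "(x ^^ k) ((u ^^ (s - k)) v) \<in> Q (n + s)"
    using pow_Q(1)[OF pow_Q(2), of v n k "s - k"] by simp
qed

lemma comm_x_pow: "v \<in> F n \<Longrightarrow> (x ^^ k) (u v) - u ((x ^^ k) v) \<in> Q (n + k + 1)"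
proof (induction k)
  case 0 then show ?case using csub_simps(1)[OF sub(2)] by simp
next
  case (Suc k)
  have "x ((x ^^ k) (u v) - u ((x ^^ k) v)) + (x (u ((x ^^ k) v)) - u (x ((x ^^ k) v))) \<in> Q (n + Suc k + 1)"
    using xQ[OF Suc.IH[OF Suc.prems]] comm[OF pow_F(1)[OF Suc.prems, of k]]
    by (intro csub_simps(2) sub) auto
  then show ?case by (simp add: lin)
qed

lemma comm_u_pow: "v \<in> F n \<Longrightarrow> x ((u ^^ k) v) - (u ^^ k) (x v) \<in> Q (n + k + 1)"
proof (induction k)
  case 0 then show ?case using csub_simps(1)[OF sub(2)] by simp
next
  case (Suc k)
  have "u (x ((u ^^ k) v) - (u ^^ k) (x v)) + (x (u ((u ^^ k) v)) - u (x ((u ^^ k) v))) \<in> Q (n + Suc k + 1)"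
    using uQ[OF Suc.IH[OF Suc.prems]] comm[OF pow_F(2)[OF Suc.prems, of k]]
    by (intro csub_simps(2) sub) auto
  then show ?case by (simp add: lin)
qed

text \<open>Homogenizing in a degree above the actual one produces a factor \<open>u\<close>, which
  here stands rightmost.\<close>

lemma hom_eval_Suc: "degree q \<le> s \<Longrightarrow> hom_eval q (Suc s) v = hom_eval q s (u v)"
  unfolding hom_eval_def
proof -
  assume "degree q \<le> s"
  then have "(\<Sum>k\<le>s. coeff q k *\<^sub>C (x ^^ k) ((u ^^ (Suc s - k)) v))
    = (\<Sum>k\<le>s. coeff q k *\<^sub>C (x ^^ k) ((u ^^ (s - k)) (u v)))"
    by (intro sum.cong) (auto simp: Suc_diff_le funpow_swap1)
  then show "(\<Sum>k\<le>Suc s. coeff q k *\<^sub>C (x ^^ k) ((u ^^ (Suc s - k)) v))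
    = (\<Sum>k\<le>s. coeff q k *\<^sub>C (x ^^ k) ((u ^^ (s - k)) (u v)))"
    using \<open>degree q \<le> s\<close> by (simp add: coeff_eq_0 complex_vector.scale_zero_left)
qed

lemma hom_eval_pCons: "hom_eval (pCons 0 r) (Suc s) v = x (hom_eval r s v)"
  unfolding hom_eval_def
  by (subst sum.atMost_Suc_shift)
    (simp add: complex_vector.scale_zero_left lin)

lemma hom_eval_add: "hom_eval (p + q) s v = hom_eval p s v + hom_eval q s v"
  unfolding hom_eval_def by (simp add: scaleC_add_left sum.distrib)

lemma hom_eval_smult: "hom_eval (smult a q) s v = a *\<^sub>C hom_eval q s v"
  unfolding hom_eval_def by (simp add: complex_vector.scale_sum_right scaleC_scaleC)

lemma hom_eval_sum: "hom_eval (\<Sum>i\<in>I. q i) s v = (\<Sum>i\<in>I. hom_eval (q i) s v)"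
proof -
  have "hom_eval 0 s v = 0" by (simp add: hom_eval_def complex_vector.scale_zero_left)
  then show ?thesis
    by (induction I rule: infinite_finite_induct) (simp_all add: hom_eval_add)
qed

lemma hom_eval_factor:
  "degree r \<le> s \<Longrightarrow> hom_eval ([:- m, 1:] * r) (Suc s) v = x (hom_eval r s v) - m *\<^sub>C hom_eval r s (u v)"
proof -
  assume r: "degree r \<le> s"
  have "[:- m, 1:] * r = smult (- m) r + pCons 0 r" by simp
  then show ?thesis
    using r by (simp only: hom_eval_add hom_eval_smult hom_eval_pCons hom_eval_Suc)
      (simp add: complex_vector.scale_minus_left)
qed

lemma hom_eval_comm_u: "v \<in> F n \<Longrightarrow> hom_eval r s (u v) - u (hom_eval r s v) \<in> Q (n + s + 1)"
proof -
  assume v: "v \<in> F n"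
  have "(\<Sum>k\<le>s. coeff r k *\<^sub>C ((x ^^ k) (u ((u ^^ (s - k)) v)) - u ((x ^^ k) ((u ^^ (s - k)) v)))) \<in> Q (n + s + 1)"
  proof (intro csub_simps(6,3) sub)
    fix k assume "k \<in> {..s}"
    then show "(x ^^ k) (u ((u ^^ (s - k)) v)) - u ((x ^^ k) ((u ^^ (s - k)) v)) \<in> Q (n + s + 1)"
      using comm_x_pow[OF pow_F(2)[OF v, of "s - k"], of k] by simp
  qed
  then show ?thesis
    by (simp add: hom_eval_def lin funpow_swap1 complex_vector.scale_right_diff_distrib sum_subtractf)
qed

lemma hom_eval_comm_x: "v \<in> F n \<Longrightarrow> x (hom_eval r s v) - hom_eval r s (x v) \<in> Q (n + s + 1)"
proof -
  assume v: "v \<in> F n"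
  have "(\<Sum>k\<le>s. coeff r k *\<^sub>C ((x ^^ k) (x ((u ^^ (s - k)) v) - (u ^^ (s - k)) (x v)))) \<in> Q (n + s + 1)"
  proof (intro csub_simps(6,3) sub)
    fix k assume "k \<in> {..s}"
    then show "(x ^^ k) (x ((u ^^ (s - k)) v) - (u ^^ (s - k)) (x v)) \<in> Q (n + s + 1)"
      using pow_Q(1)[OF comm_u_pow[OF v, of "s - k"], of k] by simp
  qed
  then show ?thesis
    by (simp add: hom_eval_def lin clinear_simps[OF clinear_funpow[OF clin(1)]] funpow_swap1
        complex_vector.scale_right_diff_distrib sum_subtractf)
qed

text \<open>A binary form over the complex numbers is a product of linear forms: a drop of the
  degree of \<open>p\<close> below \<open>s\<close> gives a factor \<open>u\<close>, a root
  \<open>m\<close> gives a factor \<open>x - m u\<close>. Each factor is injective on the quotients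
  by assumption, and reordering the factors only produces terms in \<open>Q\<close>.\<close>

lemma hom_eval_inj:
  assumes uinj: "\<And>n v. v \<in> F n \<Longrightarrow> u v \<in> Q (Suc n) \<Longrightarrow> v \<in> Q n"
    and xinj: "\<And>m n v. v \<in> F n \<Longrightarrow> x v - m *\<^sub>C u v \<in> Q (Suc n) \<Longrightarrow> v \<in> Q n"
    and "p \<noteq> 0" "degree p \<le> s" "v \<in> F n" "hom_eval p s v \<in> Q (n + s)"
  shows "v \<in> Q n"
  using assms(3-)
proof (induction s arbitrary: p v n)
  case 0
  then obtain a where a: "p = [:a:]" "a \<noteq> 0" by (metis degree_eq_zeroE le_zero_eq pCons_0_0)
  have "a *\<^sub>C v \<in> Q n"
    using 0 a by (simp add: hom_eval_def)
  then have "inverse a *\<^sub>C (a *\<^sub>C v) \<in> Q n"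
    by (rule csub_simps(3)[OF sub(2)])
  moreover have "inverse a *\<^sub>C (a *\<^sub>C v) = v" using a(2) by (simp only: scaleC_scaleC) (simp add: scaleC_one)
  ultimately show ?case by simp
next
  case (Suc s)
  show ?case
  proof (cases "degree p \<le> s")
    case True
    then have "hom_eval p s (u v) \<in> Q (Suc n + s)" using Suc.prems by (simp add: hom_eval_Suc)
    then have "u v \<in> Q (Suc n)" using Suc.IH[of p "u v" "Suc n"] True Suc.prems uF by auto
    then show ?thesis using uinj Suc.prems by auto
  next
    case False
    then have deg: "degree p = Suc s" using Suc.prems by simp
    then obtain m where "poly p m = 0"
      using alg_closed_imp_poly_has_root[of p] by auto
    then obtain r where r: "p = [:- m, 1:] * r" by (metis dvdE poly_eq_0_iff_dvd)
    have "r \<noteq> 0" using r Suc.prems(1) by auto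
    moreover from this have "degree p = Suc (degree r)"
      unfolding r by (subst degree_mult_eq) auto
    ultimately have r0: "r \<noteq> 0" "degree r = s" using deg by auto
    let ?w = "hom_eval r s v"
    have "x ?w - m *\<^sub>C hom_eval r s (u v) \<in> Q (n + Suc s)"
      using Suc.prems(4) r r0 by (simp add: hom_eval_factor del: mult_pCons_left)
    moreover have "m *\<^sub>C (hom_eval r s (u v) - u ?w) \<in> Q (n + Suc s)"
      using hom_eval_comm_u[OF Suc.prems(3), of r s] by (intro csub_simps(3) sub) simp
    ultimately have "(x ?w - m *\<^sub>C hom_eval r s (u v)) + m *\<^sub>C (hom_eval r s (u v) - u ?w) \<in> Q (Suc (n + s))"
      using csub_simps(2)[OF sub(2)] by simp
    then have "x ?w - m *\<^sub>C u ?w \<in> Q (Suc (n + s))"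
      by (simp add: complex_vector.scale_right_diff_distrib)
    then have "?w \<in> Q (n + s)"
      using xinj hom_eval_F[OF Suc.prems(3)] by blast
    then show ?thesis using Suc.IH[of r v n] r0 Suc.prems(3) by simp
  qed
qed

text \<open>\<open>r m\<close> is a resolvent (x - m u)^-1 w modulo \<open>Q\<close>. Multiplying a
  linear relation by the product of all factors x - l u leaves \<open>q\<close> applied to
  \<open>w\<close>, where \<open>q\<close> is the combination of the products \<open>P m\<close>
  that omit one factor. At \<open>m\<close> only the summand of \<open>m\<close> survives, as in
  Lagrange interpolation, so \<open>q\<close> is non-zero if \<open>c m\<close> is, and this
  contradicts injectivity.\<close>

lemma resolvents_independent:
  assumes uinj: "\<And>n v. v \<in> F n \<Longrightarrow> u v \<in> Q (Suc n) \<Longrightarrow> v \<in> Q n"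
    and xinj: "\<And>m n v. v \<in> F n \<Longrightarrow> x v - m *\<^sub>C u v \<in> Q (Suc n) \<Longrightarrow> v \<in> Q n"
    and S: "finite S" "\<And>m. m \<in> S \<Longrightarrow> r m \<in> F n"
      "\<And>m. m \<in> S \<Longrightarrow> x (r m) - m *\<^sub>C u (r m) - w \<in> Q (Suc n)"
    and w: "w \<in> F (Suc n)" "w \<notin> Q (Suc n)"
    and dep: "(\<Sum>m\<in>S. c m *\<^sub>C r m) = 0"
    and "m \<in> S"
  shows "c m = 0"
proof (rule ccontr)
  assume "c m \<noteq> 0"
  define P where "P m = (\<Prod>l\<in>S - {m}. [:- l, 1:])" for m
  obtain s where s: "card S = Suc s" using \<open>m \<in> S\<close> S(1) by (metis card_gt_0_iff empty_iff gr0_implies_Suc)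
  have degP: "degree (P m) \<le> s" if "m \<in> S" for m
  proof -
    have "degree (P m) \<le> (\<Sum>l\<in>S - {m}. 1)"
      unfolding P_def by (rule order.trans[OF degree_prod_sum_le]) (use S(1) in auto)
    then show ?thesis using s S(1) that by simp
  qed
  define q where "q = (\<Sum>m\<in>S. smult (c m) (P m))"
  have "poly q m = (\<Sum>l\<in>S. c l * poly (P l) m)"
    by (simp add: q_def poly_sum)
  also have "\<dots> = (\<Sum>l\<in>S. if l = m then c m * poly (P m) m else 0)"
    using S(1) \<open>m \<in> S\<close> by (intro sum.cong) (auto simp: P_def poly_prod)
  also have "\<dots> = c m * poly (P m) m" using S(1) \<open>m \<in> S\<close> by simp
  finally have "poly q m \<noteq> 0"
    using \<open>c m \<noteq> 0\<close> S(1) by (auto simp: P_def poly_prod)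
  then have q0: "q \<noteq> 0" by auto
  have degq: "degree q \<le> s"
    unfolding q_def using degP S(1) by (intro degree_sum_le) (auto intro: order.trans[OF degree_smult_le])
  define PS where "PS = (\<Prod>l\<in>S. [:- l, 1:])"
  have main: "hom_eval (P m) s w - hom_eval PS (Suc s) (r m) \<in> Q (Suc n + s)" if m: "m \<in> S" for m
  proof -
    let ?E = "hom_eval (P m) s"
    note E = clinear_simps[OF clinear_hom_eval]
    have PS: "PS = [:- m, 1:] * P m"
      unfolding PS_def P_def using S(1) m by (rule prod.remove)
    have "?E (x (r m) - m *\<^sub>C u (r m) - w) \<in> Q (Suc n + s)"
      using hom_eval_Q[OF S(3)[OF m]] .
    moreover have "x (?E (r m)) - ?E (x (r m)) \<in> Q (Suc n + s)"
      using hom_eval_comm_x[OF S(2)[OF m], of "P m" s] by simp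
    ultimately have "- (?E (x (r m) - m *\<^sub>C u (r m) - w) + (x (?E (r m)) - ?E (x (r m)))) \<in> Q (Suc n + s)"
      by (intro csub_simps(2,5) sub)
    moreover have "- (?E (x (r m) - m *\<^sub>C u (r m) - w) + (x (?E (r m)) - ?E (x (r m)))) = ?E w - hom_eval PS (Suc s) (r m)"
      unfolding PS hom_eval_factor[OF degP[OF m]] by (simp add: E)
    ultimately show ?thesis by simp
  qed
  have "(\<Sum>m\<in>S. c m *\<^sub>C (hom_eval (P m) s w - hom_eval PS (Suc s) (r m))) \<in> Q (Suc n + s)"
    using main by (intro csub_simps(6,3) sub)
  also have "(\<Sum>m\<in>S. c m *\<^sub>C (hom_eval (P m) s w - hom_eval PS (Suc s) (r m)))
     = hom_eval q s w - hom_eval PS (Suc s) (\<Sum>m\<in>S. c m *\<^sub>C r m)"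
    by (simp add: q_def hom_eval_sum hom_eval_smult clinear_simps[OF clinear_hom_eval]
        complex_vector.scale_right_diff_distrib sum_subtractf)
  finally have "hom_eval q s w \<in> Q (Suc n + s)"
    using dep by (simp add: clinear_zero[OF clinear_hom_eval])
  note fin = this
  have "w \<in> Q (Suc n)"
    using uinj xinj q0 degq w(1) fin by (rule hom_eval_inj)
  then show False using w by simp
qed

end

text \<open>The ungraded case: with \<open>u\<close> the identity and constant families, forms in
  \<open>x\<close> and \<open>u\<close> become polynomials in \<open>f\<close> acting on
  Z'/Z.\<close>

lemma graded_pair_const:
  fixes f :: "'v::complex_vector \<Rightarrow> 'v"
  assumes "clinear f" "csubspace Z" "csubspace Z'" "Z \<subset> Z'" "f ` Z \<subseteq> Z" "f ` Z' \<subseteq> Z'"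
  shows "graded_pair f (\<lambda>v. v) (\<lambda>_. Z') (\<lambda>_. Z)"
proof (rule graded_pair.intro)
  show "f v - f v \<in> Z" for v using csub_simps(1)[OF assms(2)] by simp
  show "Z \<subseteq> Z'" using assms(4) by (rule psubset_imp_subset)
  show "f v \<in> Z" if "v \<in> Z" for v using that assms(5) by blast
  show "f v \<in> Z'" if "v \<in> Z'" for v using that assms(6) by blast
  show "clinear f" "clinear (\<lambda>v::'v. v)" "csubspace Z'" "csubspace Z" by (rule assms(1-3) clinear_ident)+
qed auto

text \<open>Used to place infinitely many resolvents in one step of a countable exhaustion by
  finite-dimensional spaces.\<close>

lemma infinite_fibre_complex:
  fixes f :: "complex \<Rightarrow> nat"
  obtains n where "infinite {z. f z = n}"
proof -
  have "\<exists>n. infinite {z. f z = n}"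
  proof (rule ccontr)
    assume "\<not> ?thesis"
    then have "countable (\<Union>n. {z. f z = n})"
      by (intro countable_UN) (auto intro: countable_finite)
    moreover have "(\<Union>n. {z. f z = n}) = UNIV" by auto
    ultimately have "countable (UNIV :: complex set)" by simp
    then have "countable (range complex_of_real)" by (rule countable_subset[rotated]) auto
    then have "countable (UNIV :: real set)"
      by (rule countable_image_inj_on) (auto simp: inj_on_def)
    then show False using uncountable_UNIV_real by simp
  qed
  then show ?thesis using that by blast
qed

text \<open>Schur's lemma in the form of Dixmier: uncountably many resolvents cannot be independent.\<close>

lemma dixmier:
  fixes f :: "'v::complex_vector \<Rightarrow> 'v" and E :: "nat \<Rightarrow> 'v set"
  assumes "clinear f" "csubspace Z" "csubspace Z'" "Z \<subset> Z'"
    and "f ` Z \<subseteq> Z" "f ` Z' \<subseteq> Z'"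
    and E: "\<And>n. cfinite_dim (E n)" "Z' \<subseteq> (\<Union>n. E n)"
    and ker: "\<And>l. {v \<in> Z'. f v - l *\<^sub>C v \<in> Z} = Z \<or> {v \<in> Z'. f v - l *\<^sub>C v \<in> Z} = Z'"
    and im: "\<And>l. {f v - l *\<^sub>C v + z | v z. v \<in> Z' \<and> z \<in> Z} = Z \<or> {f v - l *\<^sub>C v + z | v z. v \<in> Z' \<and> z \<in> Z} = Z'"
  obtains l where "\<And>v. v \<in> Z' \<Longrightarrow> f v - l *\<^sub>C v \<in> Z"
proof (rule ccontr)
  assume "\<not> thesis"
  then have neg: "{v \<in> Z'. f v - l *\<^sub>C v \<in> Z} \<noteq> Z'" for l using that by blast
  then have ker': "{v \<in> Z'. f v - l *\<^sub>C v \<in> Z} = Z" for l using ker by blast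
  have im': "{f v - l *\<^sub>C v + z | v z. v \<in> Z' \<and> z \<in> Z} = Z'" for l
  proof (rule ccontr)
    assume "\<not> ?thesis"
    then have *: "{f v - l *\<^sub>C v + z | v z. v \<in> Z' \<and> z \<in> Z} = Z" using im by blast
    have "f v - l *\<^sub>C v \<in> Z" if "v \<in> Z'" for v
    proof -
      have "f v - l *\<^sub>C v + 0 \<in> {f v - l *\<^sub>C v + z | v z. v \<in> Z' \<and> z \<in> Z}"
        using that csub_simps(1)[OF assms(2)] by blast
      then show ?thesis using * by simp
    qed
    then show False using neg[of l] by blast
  qed
  obtain w where w: "w \<in> Z'" "w \<notin> Z" using \<open>Z \<subset> Z'\<close> by blast
  have "\<exists>v. v \<in> Z' \<and> f v - l *\<^sub>C v - w \<in> Z" for l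
  proof -
    obtain v z where "v \<in> Z'" "z \<in> Z" "w = f v - l *\<^sub>C v + z" using im'[of l] w by blast
    then show ?thesis
      using csub_simps(5)[OF assms(2), of z] by (intro exI[of _ v]) simp
  qed
  then obtain r where r: "\<And>l. r l \<in> Z'" "\<And>l. f (r l) - l *\<^sub>C r l - w \<in> Z" by metis
  have "\<exists>n. r l \<in> E n" for l using r(1)[of l] E(2) by blast
  then obtain g where g: "\<And>l. r l \<in> E (g l)" by metis
  obtain n where n: "infinite {l. g l = n}" using infinite_fibre_complex by blast
  have "r ` {l. g l = n} \<subseteq> E n" using g by auto
  from cfinite_dim_dependent[OF E(1) n this]
  obtain S c where S: "finite S" "S \<subseteq> {l. g l = n}" "\<exists>i\<in>S. c i \<noteq> 0" "(\<Sum>i\<in>S. c i *\<^sub>C r i) = 0" .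
  interpret graded_pair f "\<lambda>v. v" "\<lambda>_. Z'" "\<lambda>_. Z"
    using assms(1-6) by (rule graded_pair_const)
  have "c i = 0" if "i \<in> S" for i
  proof (rule resolvents_independent[of S r w c i])
    show "v \<in> Z" if "v \<in> Z'" "f v - m *\<^sub>C v \<in> Z" for m v using ker'[of m] that by blast
  qed (use r w S(1,4) that in \<open>simp_all\<close>)
  then show False using S(3) by blast
qed

text \<open>Without such a vector every f - l is injective on Z'/Z, hence so is every non-zero
  polynomial in \<open>f\<close>; but the powers of \<open>f\<close> applied to a single vector are
  linearly dependent.\<close>

lemma relative_eigenvector:
  fixes f :: "'v::complex_vector \<Rightarrow> 'v"
  assumes "clinear f" "csubspace Z" "csubspace Z'" "Z \<subset> Z'" "f ` Z \<subseteq> Z" "f ` Z' \<subseteq> Z'" "cfinite_dim Z'"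
  obtains l v where "v \<in> Z'" "v \<notin> Z" "f v - l *\<^sub>C v \<in> Z"
proof (rule ccontr)
  assume "\<not> thesis"
  note found = that this
  have inj: "v \<in> Z" if "v \<in> Z'" "f v - l *\<^sub>C v \<in> Z" for v l
    using found(1)[OF that(1) _ that(2)] found(2) by metis
  interpret graded_pair f "\<lambda>v. v" "\<lambda>_. Z'" "\<lambda>_. Z"
    using assms(1-6) by (rule graded_pair_const)
  obtain w where w: "w \<in> Z'" "w \<notin> Z" using \<open>Z \<subset> Z'\<close> by blast
  have "(f ^^ i) w \<in> Z'" for i using w(1) assms(6) by (induction i) auto
  then have "range (\<lambda>i. (f ^^ i) w) \<subseteq> Z'" by auto
  from cfinite_dim_dependent[OF assms(7) infinite_UNIV_nat this]
  obtain S c where S: "finite S" "S \<subseteq> UNIV" "\<exists>i\<in>S. c i \<noteq> 0" "(\<Sum>i\<in>S. c i *\<^sub>C (f ^^ i) w) = 0" .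
  define q where "q = (\<Sum>i\<in>S. monom (c i) i)"
  have coeff: "coeff q k = (if k \<in> S then c k else 0)" for k
    using S(1) by (simp add: q_def coeff_sum)
  have "q \<noteq> 0" using S(3) coeff by (metis coeff_0)
  define s where "s = Max S"
  have sub: "S \<subseteq> {..s}" using S(1) by (auto simp: s_def)
  have "degree q \<le> s" using sub by (intro degree_le) (auto simp: coeff)
  have "hom_eval q s w = (\<Sum>i\<in>S. c i *\<^sub>C (f ^^ i) w)"
    unfolding hom_eval_def coeff using sub S(1)
    by (intro sum.mono_neutral_cong_right) (auto simp: complex_vector.scale_zero_left id_def[symmetric])
  then have "hom_eval q s w \<in> Z" using S(4) csub_simps(1)[OF assms(2)] by simp
  then have "w \<in> Z"
    by (intro hom_eval_inj[of q s w]) (use inj \<open>q \<noteq> 0\<close> \<open>degree q \<le> s\<close> w in auto)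
  then show False using w by simp
qed

lemma eigenvector_exists:
  fixes f :: "'v::complex_vector \<Rightarrow> 'v"
  assumes "clinear f" "csubspace V" "V \<noteq> {0}" "f ` V \<subseteq> V" "cfinite_dim V"
  obtains l v where "v \<in> V" "v \<noteq> 0" "f v = l *\<^sub>C v"
proof -
  have "csubspace {0 :: 'v}" by (intro csubspaceI) (auto simp: complex_vector.scale_zero_right)
  moreover have "{0} \<subset> V" using assms(2,3) csub_simps(1) by blast
  ultimately show ?thesis
    using relative_eigenvector[of f "{0}" V] assms that by (auto simp: clinear_zero)
qed

primrec op_prod :: "('v::complex_vector \<Rightarrow> 'v) \<Rightarrow> complex list \<Rightarrow> 'v \<Rightarrow> 'v"
  where "op_prod f [] v = v" | "op_prod f (l # ls) v = f (op_prod f ls v) - l *\<^sub>C op_prod f ls v"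

lemma clinear_op_prod: "clinear f \<Longrightarrow> clinear (op_prod f ls)"
  by (induction ls) (auto simp: clinear_iff complex_vector.scale_right_diff_distrib
      scaleC_add_right complex_vector.scale_left_commute)

text \<open>As long as the kernel of a product of factors f - l is not all of \<open>V\<close>, an
  eigenvector of \<open>f\<close> modulo this kernel supplies one more factor and the kernel grows
  strictly. The dimension stops this, which replaces the minimal polynomial.\<close>

lemma op_prod_annihilates:
  fixes f :: "'v::complex_vector \<Rightarrow> 'v"
  assumes "clinear f" "csubspace V" "f ` V \<subseteq> V" "cfinite_dim V"
  obtains ls where "\<And>v. v \<in> V \<Longrightarrow> op_prod f ls v = 0"
proof (rule ccontr)
  assume no: "\<not> thesis"
  define Z where "Z ls = {v \<in> V. op_prod f ls v = 0}" for ls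
  have sub: "csubspace (Z ls)" for ls
    using assms(2) clinear_op_prod[OF assms(1), of ls]
    by (intro csubspaceI) (auto simp: Z_def clinear_simps csub_simps complex_vector.scale_zero_right)
  have comm: "op_prod f ls (f v) = f (op_prod f ls v)" for ls v
    by (induction ls) (auto simp: clinear_simps[OF assms(1)])
  have stab: "f ` Z ls \<subseteq> Z ls" for ls
    using assms(3) by (auto simp: Z_def comm clinear_zero[OF assms(1)])
  have step: "\<exists>l. Z ls \<subset> Z (l # ls)" for ls
  proof -
    have "Z ls \<noteq> V"
    proof
      assume "Z ls = V"
      then have "op_prod f ls v = 0" if "v \<in> V" for v using that by (auto simp: Z_def)
      then show False using no that by metis
    qed
    then have "Z ls \<subset> V" by (auto simp: Z_def)
    from relative_eigenvector[OF assms(1) sub assms(2) this stab assms(3,4)]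
    obtain l v where v: "v \<in> V" "v \<notin> Z ls" "f v - l *\<^sub>C v \<in> Z ls" .
    have "op_prod f ls (f v - l *\<^sub>C v) = 0" using v(3) by (simp add: Z_def)
    then have "v \<in> Z (l # ls)"
      using v(1) by (simp add: Z_def clinear_simps[OF clinear_op_prod[OF assms(1)]] comm)
    moreover have "Z ls \<subseteq> Z (l # ls)"
      by (auto simp: Z_def clinear_zero[OF assms(1)] complex_vector.scale_zero_right)
    ultimately show ?thesis using v(2) by blast
  qed
  then obtain h where h: "\<And>ls. Z ls \<subset> Z (h ls # ls)" by metis
  define L where "L n = ((\<lambda>ls. h ls # ls) ^^ n) []" for n
  obtain d where d: "\<And>n. \<exists>Z :: nat \<Rightarrow> 'v set. (\<forall>i\<le>n. csubspace (Z i) \<and> Z i \<subseteq> V) \<and> (\<forall>i<n. Z i \<subset> Z (Suc i)) \<Longrightarrow> n \<le> d"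
    using cfinite_dim_strict_chain_bound[OF assms(4)] by metis
  have "csubspace (Z (L i)) \<and> Z (L i) \<subseteq> V" "Z (L i) \<subset> Z (L (Suc i))" for i
    using sub h[of "L i"] by (auto simp: Z_def L_def)
  then have "Suc d \<le> d"
    by (intro d exI[of _ "\<lambda>i. Z (L i)"]) simp
  then show False by simp
qed

section \<open>Good filtrations, their graded modules and associated varieties\<close>

section \<open>Filtered modules and their characteristic directions\<close>

text \<open>A module over a complexified Lie algebra with the filtration generated by a
  finite-dimensional \<open>W\<close>; \<open>ks\<close> plays the part of the complexification of
  k, whose symbols act by zero on the graded module.\<close>

locale filtered_module =
  fixes bra :: "'a::complex_vector \<Rightarrow> 'a \<Rightarrow> 'a" and ks :: "'a set"
    and act :: "'a \<Rightarrow> 'v::complex_vector \<Rightarrow> 'v" and W :: "'v set"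
  assumes clin_act: "\<And>y. clinear (act y)" and clin_arg: "\<And>v. clinear (\<lambda>y. act y v)"
    and act_bra: "\<And>x y v. act (bra x y) v = act x (act y v) - act y (act x v)"
    and fd: "cfinite_dim (UNIV :: 'a set)"
    and subW: "csubspace W" and fdW: "cfinite_dim W"
    and ksW: "\<And>y w. y \<in> ks \<Longrightarrow> w \<in> W \<Longrightarrow> act y w \<in> W"
begin

primrec F :: "nat \<Rightarrow> 'v set" where
  "F 0 = W"
| "F (Suc n) = cspan (F n \<union> {act y v | y v. v \<in> F n})"

text \<open>\<open>F\<close> shifted by one, with value \<open>0\<close> in degree \<open>0\<close>: congruence modulo \<open>G n\<close> is equality of symbols
  in degree \<open>n\<close>.\<close>

primrec G :: "nat \<Rightarrow> 'v set" where
  "G 0 = {0}"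
| "G (Suc n) = F n"

primrec word :: "'a list \<Rightarrow> 'v \<Rightarrow> 'v" where
  "word [] v = v"
| "word (u # us) v = act u (word us v)"

lemmas act_simps = clinear_simps[OF clin_act]
lemmas arg_simps = clinear_simps[OF clin_arg]

lemma subF: "csubspace (F n)"
  by (cases n) (auto simp: subW)

lemma subG: "csubspace (G n)"
  by (cases n) (auto simp: subF intro!: csubspaceI simp: complex_vector.scale_zero_right)

lemma F_Suc: "F n \<subseteq> F (Suc n)"
  by (auto intro: complex_vector.span_base)

lemma F_mono: "m \<le> n \<Longrightarrow> F m \<subseteq> F n"
  by (rule lift_Suc_mono_le[of F]) (rule F_Suc)

lemma G_F: "G n \<subseteq> F n"
  using csub_simps(1)[OF subW] F_Suc by (cases n) auto

lemma act_F: "v \<in> F n \<Longrightarrow> act y v \<in> F (Suc n)"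
  by (auto intro: complex_vector.span_base)

lemma act_G: "v \<in> G n \<Longrightarrow> act y v \<in> G (Suc n)"
  using act_F csub_simps(1)[OF subW] by (cases n) (auto simp: act_simps)

text \<open>Moving \<open>y\<close> past a letter \<open>x\<close> leaves the single letter
  \<open>bra y x\<close>, so the degree does not rise.\<close>

lemma act_ks_F: "y \<in> ks \<Longrightarrow> v \<in> F n \<Longrightarrow> act y v \<in> F n"
proof (induction n arbitrary: v)
  case 0 then show ?case using ksW by simp
next
  case (Suc n)
  have "act y ` cspan (F n \<union> {act y v | y v. v \<in> F n}) \<subseteq> F (Suc n)"
  proof (rule clinear_span_subset[OF clin_act subF])
    have "act y (act x v) \<in> F (Suc n)" if v: "v \<in> F n" for x v
    proof -
      have "act x (act y v) + act (bra y x) v \<in> F (Suc n)"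
        using Suc.IH[OF Suc.prems(1) v] v by (intro csub_simps(2) subF act_F)
      then show ?thesis by (simp add: act_bra)
    qed
    then show "act y ` (F n \<union> {act y v | y v. v \<in> F n}) \<subseteq> F (Suc n)"
      using act_F by auto
  qed
  then show ?case using Suc.prems by auto
qed

lemma act_ks_G: "y \<in> ks \<Longrightarrow> v \<in> G n \<Longrightarrow> act y v \<in> G n"
  using act_ks_F by (cases n) (auto simp: act_simps)

lemma F_Suc_subset:
  assumes "csubspace V" "F n \<subseteq> V" "\<And>y v. v \<in> F n \<Longrightarrow> act y v \<in> V"
  shows "F (Suc n) \<subseteq> V"
  unfolding F.simps
proof (rule complex_vector.span_minimal)
  show "F n \<union> {act y v | y v. v \<in> F n} \<subseteq> V" using assms(2,3) by blast
qed (rule assms(1))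

lemma fdF: "cfinite_dim (F n)"
proof (induction n)
  case 0 then show ?case using fdW by simp
next
  case (Suc n)
  obtain B :: "'a set" where B: "finite B" "UNIV \<subseteq> cspan B"
    using fd unfolding cfinite_dim_def by auto
  define U where "U i = (case i of None \<Rightarrow> F n | Some b \<Rightarrow> act b ` F n)" for i
  define V where "V = cspan (\<Union>i\<in>insert None (Some ` B). U i)"
  have "cfinite_dim (U i)" for i
    using Suc.IH cfinite_dim_image[OF Suc.IH clin_act] by (cases i) (simp_all add: U_def)
  then have fdV: "cfinite_dim V"
    unfolding V_def using B(1) by (intro cfinite_dim_finite_sum) auto
  have subV: "csubspace V" by (simp add: V_def)
  have UV: "U i \<subseteq> V" if "i \<in> insert None (Some ` B)" for i
    using that complex_vector.span_superset[of "\<Union>i\<in>insert None (Some ` B). U i"]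
    unfolding V_def by blast
  have "F (Suc n) \<subseteq> V"
  proof (rule F_Suc_subset[OF subV])
    show "F n \<subseteq> V" using UV[of None] by (simp add: U_def)
    fix y v assume v: "v \<in> F n"
    have "(\<lambda>y. act y v) ` B \<subseteq> V"
    proof safe
      fix b assume "b \<in> B"
      then show "act b v \<in> V" using v UV[of "Some b"] by (auto simp: U_def)
    qed
    then have "(\<lambda>y. act y v) ` cspan B \<subseteq> V"
      by (rule clinear_span_subset[OF clin_arg subV])
    then show "act y v \<in> V" using B(2) by blast
  qed
  then show ?case using cfinite_dim_subset[OF fdV subF] by blast
qed

lemma clinear_word: "clinear (word us)"
  by (induction us) (auto simp: clinear_iff act_simps)

lemmas word_simps = clinear_simps[OF clinear_word]

lemma word_append: "word (us @ vs) v = word us (word vs v)"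
  by (induction us) auto

lemma word_F: "v \<in> F n \<Longrightarrow> word us v \<in> F (n + length us)"
  by (induction us) (auto simp del: F.simps simp: act_F)

lemma word_G: "v \<in> G n \<Longrightarrow> word us v \<in> G (n + length us)"
  by (induction us) (auto simp del: G.simps simp: act_G)

lemma word_move:
  "v \<in> F n \<Longrightarrow> word (xs @ y # zs) v - word (y # xs @ zs) v \<in> G (n + length (xs @ y # zs))"
proof (induction xs)
  case Nil then show ?case using csub_simps(1)[OF subG] by (simp del: G.simps)
next
  case (Cons x xs)
  let ?w = "word (xs @ zs) v"
  have "act x (word (xs @ y # zs) v - word (y # xs @ zs) v) + act (bra x y) ?w
     \<in> G (n + length ((x # xs) @ y # zs))"
    using act_G[OF Cons.IH[OF Cons.prems], of x] act_F[OF word_F[OF Cons.prems, of "xs @ zs"], of "bra x y"]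
    by (intro csub_simps(2) subG) (auto simp: add.commute add.left_commute simp del: F.simps)
  then show ?case by (simp add: act_bra act_simps del: G.simps)
qed

text \<open>The graded module is a module over the symmetric algebra: transposing two letters costs
  a shorter word.\<close>

lemma word_perm:
  "mset us = mset vs \<Longrightarrow> v \<in> F n \<Longrightarrow> word us v - word vs v \<in> G (n + length us)"
proof (induction us arbitrary: vs)
  case Nil then show ?case using csub_simps(1)[OF subG] by (simp del: G.simps)
next
  case (Cons u us)
  then have "u \<in> set vs" by (metis list.set_intros(1) mset_eq_setD)
  then obtain xs zs where vs: "vs = xs @ u # zs" by (metis split_list)
  then have ms: "mset us = mset (xs @ zs)" using Cons.prems(1) by simp
  have len: "length vs = Suc (length us)" using Cons.prems(1) by (metis length_Cons mset_eq_length)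
  have "act u (word us v - word (xs @ zs) v) - (word (xs @ u # zs) v - word (u # xs @ zs) v)
      \<in> G (n + length (u # us))"
    using act_G[OF Cons.IH[OF ms Cons.prems(2)], of u] word_move[OF Cons.prems(2), of xs u zs] len vs
    by - (rule csub_simps(4)[OF subG]; simp del: G.simps word.simps)
  then show ?case by (simp add: vs act_simps del: G.simps)
qed

lemma word_perm_mem:
  assumes "mset us = mset vs" "v \<in> F n" "csubspace Q" "G (n + length us) \<subseteq> Q"
  shows "word us v \<in> Q \<longleftrightarrow> word vs v \<in> Q"
  using csubspace_cong_diff[OF assms(3), of "word us v" "word vs v"] word_perm[OF assms(1,2)] assms(4) by auto

text \<open>These families correspond to the graded submodules of the associated graded module,
  \<open>Q n\<close> being the preimage of the part of degree n.\<close>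

definition admissible :: "(nat \<Rightarrow> 'v set) \<Rightarrow> bool"
  where "admissible Q \<longleftrightarrow> (\<forall>n. csubspace (Q n) \<and> G n \<subseteq> Q n \<and> Q n \<subseteq> F n \<and> (\<forall>y. \<forall>v\<in>Q n. act y v \<in> Q (Suc n)))"

lemma admissible_G: "admissible G"
  unfolding admissible_def using subG G_F act_G by blast

lemma admissibleD:
  assumes "admissible Q"
  shows "csubspace (Q n)" "G n \<subseteq> Q n" "Q n \<subseteq> F n" "v \<in> Q n \<Longrightarrow> act y v \<in> Q (Suc n)" "F n \<subseteq> Q (Suc n)"
proof -
  show "csubspace (Q n)" "G n \<subseteq> Q n" "Q n \<subseteq> F n" "v \<in> Q n \<Longrightarrow> act y v \<in> Q (Suc n)"
    using assms unfolding admissible_def by blast+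
  have "G (Suc n) \<subseteq> Q (Suc n)" using assms unfolding admissible_def by blast
  then show "F n \<subseteq> Q (Suc n)" by simp
qed

lemma admissible_word: "admissible Q \<Longrightarrow> v \<in> Q n \<Longrightarrow> word us v \<in> Q (n + length us)"
  by (induction us) (auto intro: admissibleD(4))

text \<open>The graded module is generated in degree 0, so a quotient of it that vanishes in one
  degree vanishes in all higher degrees.\<close>

lemma admissible_full: "admissible Q \<Longrightarrow> F n \<subseteq> Q n \<Longrightarrow> F (n + j) \<subseteq> Q (n + j)"
proof (induction j)
  case (Suc j)
  then have "F (Suc (n + j)) \<subseteq> Q (Suc (n + j))"
    using admissibleD[OF Suc.prems(1)] by (intro F_Suc_subset) auto
  then show ?case by (simp del: F.simps)
qed simp

definition shift_sum :: "'a \<Rightarrow> (nat \<Rightarrow> 'v set) \<Rightarrow> nat \<Rightarrow> 'v set"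
  where "shift_sum y Q n = {a + act y v | a v. a \<in> Q n \<and> v \<in> G n}"

text \<open>Here \<open>v \<in> G n\<close> encodes \<open>v \<in> F (n - 1)\<close>.\<close>

lemma shift_sum_Q: "Q n \<subseteq> shift_sum y Q n"
proof
  fix a assume "a \<in> Q n"
  moreover have "a = a + act y 0" by (simp add: act_simps)
  moreover have "0 \<in> G n" by (rule csub_simps(1)[OF subG])
  ultimately show "a \<in> shift_sum y Q n" unfolding shift_sum_def by blast
qed

lemma admissible_shift_sum:
  assumes "admissible Q" shows "admissible (shift_sum y Q)"
  unfolding admissible_def
proof (intro allI conjI ballI)
  note Q = admissibleD[OF assms]
  fix n
  show "csubspace (shift_sum y Q n)"
  proof (rule csubspaceI)
    show "0 \<in> shift_sum y Q n" using shift_sum_Q csub_simps(1)[OF Q(1)] by blast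
  next
    fix v w assume "v \<in> shift_sum y Q n" "w \<in> shift_sum y Q n"
    then obtain a b c d where *: "v = a + act y b" "w = c + act y d" "a \<in> Q n" "c \<in> Q n" "b \<in> G n" "d \<in> G n"
      unfolding shift_sum_def by blast
    have "v + w = (a + c) + act y (b + d)" using * by (simp add: act_simps)
    moreover have "a + c \<in> Q n" "b + d \<in> G n" using * Q(1) subG csub_simps(2) by blast+
    ultimately show "v + w \<in> shift_sum y Q n" unfolding shift_sum_def by blast
  next
    fix t v assume "v \<in> shift_sum y Q n"
    then obtain a b where *: "v = a + act y b" "a \<in> Q n" "b \<in> G n"
      unfolding shift_sum_def by blast
    have "t *\<^sub>C v = t *\<^sub>C a + act y (t *\<^sub>C b)" using * by (simp add: act_simps scaleC_add_right)
    moreover have "t *\<^sub>C a \<in> Q n" "t *\<^sub>C b \<in> G n" using * Q(1) subG csub_simps(3) by blast+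
    ultimately show "t *\<^sub>C v \<in> shift_sum y Q n" unfolding shift_sum_def by blast
  qed
  show "G n \<subseteq> shift_sum y Q n" using shift_sum_Q Q(2) by blast
  show "shift_sum y Q n \<subseteq> F n"
  proof
    fix v assume "v \<in> shift_sum y Q n"
    then obtain a b where *: "v = a + act y b" "a \<in> Q n" "b \<in> G n"
      unfolding shift_sum_def by blast
    have "act y b \<in> F n"
      using *(3) act_F csub_simps(1)[OF subF] by (cases n) (auto simp: act_simps simp del: F.simps)
    then show "v \<in> F n" using * Q(3) csub_simps(2)[OF subF] by blast
  qed
  fix z v assume "v \<in> shift_sum y Q n"
  then obtain a b where *: "v = a + act y b" "a \<in> Q n" "b \<in> G n"
    unfolding shift_sum_def by blast
  have "act z v = (act z a + act (bra z y) b) + act y (act z b)"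
    using * by (simp add: act_simps act_bra)
  moreover have "act (bra z y) b \<in> Q (Suc n)" using act_G[OF *(3)] Q(2) by blast
  then have "act z a + act (bra z y) b \<in> Q (Suc n)" using Q(4)[OF *(2)] csub_simps(2)[OF Q(1)] by blast
  moreover have "act z b \<in> G (Suc n)" using act_G *(3) by blast
  ultimately show "act z v \<in> shift_sum y Q (Suc n)" unfolding shift_sum_def by blast
qed

text \<open>The part of degree one of the radical of the annihilator of the graded module.\<close>

definition nilpotent_symbols :: "'a set"
  where "nilpotent_symbols = {u. \<exists>m. \<forall>n. \<forall>v\<in>F n. word (replicate m u) v \<in> G (n + m)}"

text \<open>Testing on generators suffices because symbols commute.\<close>

lemma nilpotent_symbolI:
  assumes "\<And>w. w \<in> W \<Longrightarrow> word (replicate m u) w \<in> G m"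
  shows "u \<in> nilpotent_symbols"
proof -
  have "word (replicate m u) v \<in> G (n + m)" if "v \<in> F n" for n v
    using that
  proof (induction n arbitrary: v)
    case 0 then show ?case using assms by simp
  next
    case (Suc n)
    have "csubspace {v. word (replicate m u) v \<in> G (Suc n + m)}"
      using subG by (intro csubspaceI) (auto simp: word_simps csub_simps simp del: G.simps)
    moreover have "F n \<subseteq> {v. word (replicate m u) v \<in> G (Suc n + m)}"
      using Suc.IH G_F[of "n + m"] by auto
    moreover have "act y v \<in> {v. word (replicate m u) v \<in> G (Suc n + m)}" if "v \<in> F n" for y v
    proof -
      have "act y (word (replicate m u) v) \<in> G (Suc n + m)"
        using act_G[OF Suc.IH[OF that]] by (simp del: G.simps)
      then have "word (y # replicate m u) v \<in> G (Suc n + m)" by (simp del: G.simps)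
      then have "word (replicate m u @ [y]) v \<in> G (Suc n + m)"
        using that by (subst word_perm_mem[of _ "y # replicate m u" v n]) (auto simp: subG simp del: G.simps)
      then show ?thesis by (simp add: word_append del: G.simps)
    qed
    ultimately have "F (Suc n) \<subseteq> {v. word (replicate m u) v \<in> G (Suc n + m)}"
      by (rule F_Suc_subset)
    then show ?case using Suc.prems by blast
  qed
  then show ?thesis unfolding nilpotent_symbols_def by blast
qed

lemma ks_nilpotent: "ks \<subseteq> nilpotent_symbols"
  using nilpotent_symbolI[of 1] ksW by auto

subsection \<open>Stability of the nilpotent symbols under derivations\<close>

lemma word_derivation:
  "act x (word us v) - word us (act x v) = (\<Sum>i<length us. word (us[i := bra x (us ! i)]) v)"
proof (induction us)
  case (Cons u us)
  have "act x (word (u # us) v) - word (u # us) (act x v) =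
      act (bra x u) (word us v) + act u (act x (word us v) - word us (act x v))"
    by (simp add: act_bra act_simps)
  also have "\<dots> = act (bra x u) (word us v) + (\<Sum>i<length us. word (u # us[i := bra x (us ! i)]) v)"
    unfolding Cons.IH by (simp add: act_simps)
  also have "\<dots> = (\<Sum>i<length (u # us). word ((u # us)[i := bra x ((u # us) ! i)]) v)"
    unfolding length_Cons by (subst sum.lessThan_Suc_shift) simp
  finally show ?case .
qed simp

text \<open>Apply the derivation ad x to the relation u^(a+1) y^b = 0 on the graded module and
  multiply by y. With y' = [x, y] this gives (a+1) u^a y^(b+2) + b u^(a+1) y^b y' = 0, and the
  second term is zero already. In characteristic zero one may divide by a+1, so one \<open>u\<close>
  is traded for two \<open>y\<close>.\<close>

lemma nilpotent_derivation_step: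
  assumes x: "x \<in> ks" and y: "y = bra x u"
    and P: "\<And>n v. v \<in> F n \<Longrightarrow> word (replicate (Suc a) u @ replicate b y) v \<in> G (n + Suc a + b)"
    and v: "v \<in> F n"
  shows "word (replicate a u @ replicate (Suc (Suc b)) y) v \<in> G (n + a + Suc (Suc b))"
proof -
  let ?us = "replicate (Suc a) u @ replicate b y" and ?N = "n + a + Suc (Suc b)"
  let ?goal = "word (replicate a u @ replicate (Suc (Suc b)) y) v"
  let ?y' = "bra x y"
  have v1: "act y v \<in> F (Suc n)" using act_F v by blast
  have mod: "word (?us[i := bra x (?us ! i)]) (act y v) - (if i < Suc a then ?goal else 0) \<in> G ?N"
    if i: "i < Suc a + b" for i
  proof (cases "i < Suc a")
    case True
    have "mset (?us[i := bra x (?us ! i)]) = mset (replicate a u @ replicate (Suc b) y)"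
    proof (subst mset_update)
      show "i < length ?us" using i by simp
      have "?us ! i = u" using True by (simp add: nth_append del: replicate.simps)
      then show "add_mset (bra x (?us ! i)) (mset ?us - {#?us ! i#}) = mset (replicate a u @ replicate (Suc b) y)"
        by (simp add: y)
    qed
    from word_perm[OF this v1]
    have "word (?us[i := bra x (?us ! i)]) (act y v) - word (replicate a u @ replicate (Suc b) y) (act y v) \<in> G ?N"
      by (simp add: add.assoc del: G.simps replicate.simps)
    moreover have "word (replicate a u @ replicate (Suc b) y) (act y v) = ?goal"
    proof -
      have "word (replicate a u @ replicate (Suc b) y) (act y v)
          = word ((replicate a u @ replicate (Suc b) y) @ [y]) v"
        by (simp only: word_append word.simps)
      also have "(replicate a u @ replicate (Suc b) y) @ [y] = replicate a u @ replicate (Suc (Suc b)) y"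
        by (simp add: replicate_append_same)
      finally show ?thesis .
    qed
    ultimately show ?thesis using True by simp
  next
    case False
    \<comment> \<open>Here the letter hit by the derivation was a \<open>y\<close>; the additional
      \<open>y\<close> at the end restores it, so the word is again u^(a+1) y^b up to order, applied
      after \<open>?y'\<close>.\<close>
    let ?vs = "?us[i := bra x (?us ! i)] @ [y]"
    have us: "?us ! i = y" using False i by (auto simp: nth_append simp del: replicate.simps)
    have "y \<in># mset ?us" using us i nth_mem[of i ?us] by (auto simp del: replicate.simps)
    have "mset ?vs = mset (?us @ [?y'])"
      using i us \<open>y \<in># mset ?us\<close>
      by (simp only: mset_append, subst mset_update) (auto simp del: replicate.simps)
    moreover have "n + length ?vs = ?N" by (simp del: replicate.simps)
    ultimately have "word ?vs v \<in> G ?N \<longleftrightarrow> word (?us @ [?y']) v \<in> G ?N"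
      using word_perm_mem[of ?vs "?us @ [?y']" v n "G ?N"] v subG by (simp only: order_refl)
    moreover have "word (?us @ [?y']) v \<in> G ?N"
      using P[OF act_F[OF v, of ?y']] by (simp add: word_append del: G.simps replicate.simps)
    ultimately show ?thesis using False by (simp add: word_append del: G.simps replicate.simps)
  qed
  have "act x (word ?us (act y v)) - word ?us (act x (act y v)) \<in> G ?N"
  proof (intro csub_simps(4) subG act_ks_G[OF x])
    show "word ?us (act y v) \<in> G ?N" using P[OF v1] by (simp del: G.simps)
    show "word ?us (act x (act y v)) \<in> G ?N"
      using P[OF act_ks_F[OF x v1]] by (simp del: G.simps)
  qed
  moreover have "(\<Sum>i<length ?us. word (?us[i := bra x (?us ! i)]) (act y v) - (if i < Suc a then ?goal else 0)) \<in> G ?N"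
    using mod by (intro csub_simps(6) subG) auto
  ultimately have "(act x (word ?us (act y v)) - word ?us (act x (act y v)))
     - (\<Sum>i<length ?us. word (?us[i := bra x (?us ! i)]) (act y v) - (if i < Suc a then ?goal else 0)) \<in> G ?N"
    by (rule csub_simps(4)[OF subG])
  also have "(act x (word ?us (act y v)) - word ?us (act x (act y v)))
     - (\<Sum>i<length ?us. word (?us[i := bra x (?us ! i)]) (act y v) - (if i < Suc a then ?goal else 0))
     = (\<Sum>i<length ?us. if i < Suc a then ?goal else 0)"
    unfolding word_derivation by (simp only: sum_subtractf) simp
  also have "\<dots> = (\<Sum>i\<in>{..<length ?us} \<inter> {i. i < Suc a}. ?goal)"
    by (subst sum.inter_restrict) simp_all
  also have "{..<length ?us} \<inter> {i. i < Suc a} = {..<Suc a}" by auto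
  also have "(\<Sum>i<Suc a. ?goal) = complex_of_nat (Suc a) *\<^sub>C ?goal"
    by (rule sum_lessThan_const)
  finally have "inverse (complex_of_nat (Suc a)) *\<^sub>C complex_of_nat (Suc a) *\<^sub>C ?goal \<in> G ?N"
    by (rule csub_simps(3)[OF subG])
  then show ?thesis
    by (simp add: scaleC_scaleC scaleC_one del: G.simps of_nat_Suc replicate.simps)
qed

text \<open>An instance of the fact that in characteristic zero the radical of an ideal stable under
  a derivation is stable. Trading all \<open>m\<close> factors turns u^m = 0 into y^(2m) =
  0.\<close>

lemma nilpotent_derivation:
  assumes "x \<in> ks" "u \<in> nilpotent_symbols"
  shows "bra x u \<in> nilpotent_symbols"
proof -
  obtain m where m: "\<And>n v. v \<in> F n \<Longrightarrow> word (replicate m u) v \<in> G (n + m)"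
    using assms(2) unfolding nilpotent_symbols_def by blast
  define y where "y = bra x u"
  have "word (replicate (m - j) u @ replicate (2 * j) y) v \<in> G (n + (m - j) + 2 * j)"
    if "j \<le> m" "v \<in> F n" for j n v
    using that
  proof (induction j arbitrary: n v)
    case 0 then show ?case using m by simp
  next
    case (Suc j)
    then have "m - j = Suc (m - Suc j)" by simp
    with Suc nilpotent_derivation_step[OF assms(1) y_def, of "m - Suc j" "2 * j" v n]
    show ?case by (simp del: G.simps replicate.simps)
  qed
  from this[of m] have "word (replicate (2 * m) y) v \<in> G (n + 2 * m)" if "v \<in> F n" for n v
    using that by simp
  then show ?thesis unfolding nilpotent_symbols_def y_def by blast
qed

subsection \<open>Characteristic functionals\<close>

primrec char_family :: "('a \<Rightarrow> complex) \<Rightarrow> nat \<Rightarrow> 'v set" where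
  "char_family \<xi> 0 = {0}"
| "char_family \<xi> (Suc n) = cspan (F n \<union> {act y v | y v. \<xi> y = 0 \<and> v \<in> F n})"

text \<open>These functionals are the points of the associated variety: \<open>char_family \<xi>\<close> is the submodule
  generated by the kernel of \<open>\<xi>\<close>, and \<open>\<xi>\<close> belongs to the support iff the quotient is non-zero in every
  degree.\<close>

definition char_functionals :: "('a \<Rightarrow> complex) set"
  where "char_functionals = {\<xi>. clinear \<xi> \<and> (\<forall>n. \<not> F n \<subseteq> char_family \<xi> n)}"

lemma admissible_char_family: "admissible (char_family \<xi>)"
proof -
  have sub: "csubspace (char_family \<xi> n)" for n
    using subG[of 0] by (cases n) auto
  have GQ: "G n \<subseteq> char_family \<xi> n" for n
    by (cases n) (auto intro: complex_vector.span_base)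
  have QF: "char_family \<xi> n \<subseteq> F n" for n
    using csub_simps(1)[OF subW] complex_vector.span_mono[of "F m \<union> {act y v |y v. \<xi> y = 0 \<and> v \<in> F m}" "F m \<union> {act y v |y v. v \<in> F m}" for m]
    by (cases n) auto
  have "act z ` char_family \<xi> n \<subseteq> char_family \<xi> (Suc n)" for z n
  proof (cases n)
    case 0 then show ?thesis using csub_simps(1)[OF sub] by (auto simp: act_simps simp del: char_family.simps(2))
  next
    case (Suc m)
    have "act z ` cspan (F m \<union> {act y v |y v. \<xi> y = 0 \<and> v \<in> F m}) \<subseteq> char_family \<xi> (Suc n)"
    proof (rule clinear_span_subset[OF clin_act sub])
      have 1: "act z v \<in> char_family \<xi> (Suc n)" if "v \<in> F m" for z v
        using act_F[OF that] GQ[of "Suc n"] Suc by auto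
      have "act z (act y v) \<in> char_family \<xi> (Suc n)" if "\<xi> y = 0" "v \<in> F m" for y v
      proof -
        have "act y (act z v) \<in> char_family \<xi> (Suc n)"
          using that act_F[OF that(2)] Suc by (auto intro!: complex_vector.span_base simp del: F.simps)
        then have "act y (act z v) + act (bra z y) v \<in> char_family \<xi> (Suc n)"
          using 1[OF that(2)] csub_simps(2)[OF sub] by blast
        then show ?thesis by (simp add: act_bra del: char_family.simps)
      qed
      then show "act z ` (F m \<union> {act y v |y v. \<xi> y = 0 \<and> v \<in> F m}) \<subseteq> char_family \<xi> (Suc n)"
        using 1 by auto
    qed
    then show ?thesis using Suc by simp
  qed
  then show ?thesis unfolding admissible_def using sub GQ QF by blast
qed

text \<open>Modulo \<open>char_family \<xi>\<close> every \<open>y\<close> acts as the multiple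
  \<xi> y / \<xi> u of \<open>u\<close>, so the quotient in degree n is the image of
  \<open>W\<close> under u^n.\<close>

lemma char_family_reduce:
  assumes "clinear \<xi>" "\<xi> u \<noteq> 0" "v \<in> F n"
  shows "\<exists>w\<in>W. v - word (replicate n u) w \<in> char_family \<xi> n"
  using assms(3)
proof (induction n arbitrary: v)
  case 0 then show ?case by auto
next
  case (Suc n)
  note Q = admissibleD[OF admissible_char_family]
  let ?S = "{v. \<exists>w\<in>W. v - word (replicate (Suc n) u) w \<in> char_family \<xi> (Suc n)}"
  have "F (Suc n) \<subseteq> ?S"
  proof (rule F_Suc_subset)
    show "csubspace ?S"
    proof (rule csubspaceI)
      show "0 \<in> ?S" using csub_simps(1)[OF subW] csub_simps(1)[OF Q(1)]
        by (auto simp: word_simps act_simps intro!: bexI[of _ 0] simp del: char_family.simps)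
    next
      fix v1 v2 assume "v1 \<in> ?S" "v2 \<in> ?S"
      then obtain w1 w2 where w: "w1 \<in> W" "v1 - word (replicate (Suc n) u) w1 \<in> char_family \<xi> (Suc n)"
        "w2 \<in> W" "v2 - word (replicate (Suc n) u) w2 \<in> char_family \<xi> (Suc n)" by blast
      have "(v1 - word (replicate (Suc n) u) w1) + (v2 - word (replicate (Suc n) u) w2) \<in> char_family \<xi> (Suc n)"
        using w by (intro csub_simps(2) Q)
      then have "(v1 + v2) - word (replicate (Suc n) u) (w1 + w2) \<in> char_family \<xi> (Suc n)"
        by (simp add: word_simps algebra_simps del: char_family.simps word.simps replicate.simps)
      then show "v1 + v2 \<in> ?S" using w csub_simps(2)[OF subW] by blast
    next
      fix a v1 assume "v1 \<in> ?S"
      then obtain w1 where w: "w1 \<in> W" "v1 - word (replicate (Suc n) u) w1 \<in> char_family \<xi> (Suc n)" by blast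
      have "a *\<^sub>C (v1 - word (replicate (Suc n) u) w1) \<in> char_family \<xi> (Suc n)"
        using w by (intro csub_simps(3) Q)
      then have "a *\<^sub>C v1 - word (replicate (Suc n) u) (a *\<^sub>C w1) \<in> char_family \<xi> (Suc n)"
        by (simp add: word_simps complex_vector.scale_right_diff_distrib del: char_family.simps word.simps replicate.simps)
      then show "a *\<^sub>C v1 \<in> ?S" using w csub_simps(3)[OF subW] by blast
    qed
    show "F n \<subseteq> ?S"
    proof
      fix v assume "v \<in> F n"
      then have "v - word (replicate (Suc n) u) 0 \<in> char_family \<xi> (Suc n)"
        using Q(5) by (auto simp: word_simps simp del: char_family.simps word.simps replicate.simps)
      then show "v \<in> ?S" using csub_simps(1)[OF subW] by blast
    qed
    fix y v assume v: "v \<in> F n"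
    from Suc.IH[OF v] obtain w where w: "w \<in> W" "v - word (replicate n u) w \<in> char_family \<xi> n" by blast
    define c where "c = \<xi> y / \<xi> u"
    have "act (y - c *\<^sub>C u) v \<in> char_family \<xi> (Suc n)"
    proof -
      have "\<xi> (y - c *\<^sub>C u) = 0"
        using assms(2) by (simp add: clinear_simps[OF assms(1)] c_def scaleC_complex_def)
      then show ?thesis using v by (auto intro!: complex_vector.span_base)
    qed
    moreover have "c *\<^sub>C act u (v - word (replicate n u) w) \<in> char_family \<xi> (Suc n)"
      by (rule csub_simps(3)[OF Q(1) Q(4)[OF w(2)]])
    ultimately have "act (y - c *\<^sub>C u) v + c *\<^sub>C act u (v - word (replicate n u) w) \<in> char_family \<xi> (Suc n)"
      by (rule csub_simps(2)[OF Q(1)])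
    also have "act (y - c *\<^sub>C u) v + c *\<^sub>C act u (v - word (replicate n u) w)
      = act y v - word (replicate (Suc n) u) (c *\<^sub>C w)"
      by (simp add: arg_simps act_simps word_simps complex_vector.scale_right_diff_distrib)
    finally show "act y v \<in> ?S" using w(1) csub_simps(3)[OF subW] by blast
  qed
  then show ?case using Suc.prems by blast
qed

lemma char_functional_word:
  assumes "\<xi> \<in> char_functionals" "\<xi> u \<noteq> 0"
  shows "\<exists>w\<in>W. word (replicate n u) w \<notin> char_family \<xi> n"
proof -
  have \<xi>: "clinear \<xi>" "\<not> F n \<subseteq> char_family \<xi> n" using assms(1) by (auto simp: char_functionals_def)
  then obtain v where v: "v \<in> F n" "v \<notin> char_family \<xi> n" by blast
  then obtain w where w: "w \<in> W" "v - word (replicate n u) w \<in> char_family \<xi> n"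
    using char_family_reduce[OF \<xi>(1) assms(2)] by blast
  then have "word (replicate n u) w \<notin> char_family \<xi> n"
    using v csubspace_cong_diff[OF admissibleD(1)[OF admissible_char_family] w(2)] by simp
  then show ?thesis using w(1) by blast
qed

lemma char_functional_nilpotent:
  assumes "\<xi> \<in> char_functionals" "u \<in> nilpotent_symbols"
  shows "\<xi> u = 0"
proof (rule ccontr)
  assume "\<xi> u \<noteq> 0"
  obtain m where m: "\<And>n v. v \<in> F n \<Longrightarrow> word (replicate m u) v \<in> G (n + m)"
    using assms(2) unfolding nilpotent_symbols_def by blast
  have "word (replicate m u) w \<in> G m" if "w \<in> W" for w using m[of w 0] that by simp
  then show False
    using char_functional_word[OF assms(1) \<open>\<xi> u \<noteq> 0\<close>, of m] admissibleD(2)[OF admissible_char_family] by blast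
qed

lemma admissible_graded_pair:
  assumes "admissible Q"
  shows "graded_pair (act y) (act u) F Q"
proof (rule graded_pair.intro)
  note Q = admissibleD[OF assms]
  show "act y (act u v) - act u (act y v) \<in> Q (Suc (Suc n))" if "v \<in> F n" for n v
    using Q(5) act_F[OF that] by (simp add: act_bra[symmetric] subset_iff del: F.simps)
qed (use admissibleD[OF assms] in \<open>simp_all add: subF clin_act act_F del: F.simps\<close>)

text \<open>A graded Nullstellensatz. Take a graded submodule \<open>Q\<close> maximal among those
  that contain u^n W for no n. By maximality \<open>u\<close> is injective on the quotient. If some
  \<open>y\<close> were not a multiple of \<open>u\<close> there, every y - l u would be injective,
  and its image would contain u^n w for some n; these uncountably many resolvents would be
  independent within spaces of finite dimension. Hence every \<open>y\<close> acts as \<xi> y times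
  \<open>u\<close>.\<close>

lemma char_functional_exists:
  assumes "u \<notin> nilpotent_symbols"
  obtains \<xi> where "\<xi> \<in> char_functionals" "\<xi> u \<noteq> 0"
proof -
  let ?u = "\<lambda>n. word (replicate n u)"
  \<comment> \<open>Families are coded as sets of pairs, so that Zorn's lemma for inclusion
    applies.\<close>
  let ?fam = "\<lambda>T n. {v. (n, v) \<in> T}"
  define good where "good Q \<longleftrightarrow> admissible Q \<and> (\<forall>n. \<not> ?u n ` W \<subseteq> Q n)" for Q
  define \<A> where "\<A> = {T :: (nat \<times> 'v) set. good (?fam T)}"
  have goodG: "good G"
    unfolding good_def using admissible_G nilpotent_symbolI assms by blast
  then have "{(n, v). v \<in> G n} \<in> \<A>" by (simp add: \<A>_def)
  then have ne: "\<A> \<noteq> {}" by blast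
  from cfinite_dim_span[OF fdW subW]
  obtain B where Bs: "finite B" "complex_vector.independent B" "B \<subseteq> W" "W = cspan B" .
  note B = Bs(1,3,4)
  have chain: "\<Union>C \<in> \<A>" if C: "C \<noteq> {}" "subset.chain \<A> C" for C
  proof -
    have CA: "good (?fam T)" if "T \<in> C" for T
      using C(2) that by (auto simp: subset.chain_def \<A>_def)
    then have adm: "admissible (?fam T)" if "T \<in> C" for T using that by (simp add: good_def)
    note Q = admissibleD[OF adm]
    have lin: "T \<subseteq> T' \<or> T' \<subseteq> T" if "T \<in> C" "T' \<in> C" for T T'
      using C(2) that by (auto simp: subset.chain_def)
    have memU: "v \<in> ?fam (\<Union>C) n \<longleftrightarrow> (\<exists>T\<in>C. v \<in> ?fam T n)" for v n by auto
    have "admissible (?fam (\<Union>C))"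
      unfolding admissible_def
    proof (intro allI conjI ballI)
      fix n
      obtain T0 where T0: "T0 \<in> C" using C(1) by blast
      show "csubspace (?fam (\<Union>C) n)"
      proof (rule csubspaceI)
        show "0 \<in> ?fam (\<Union>C) n" unfolding memU using csub_simps(1)[OF Q(1)[OF T0, of n]] T0 by blast
      next
        fix v w assume "v \<in> ?fam (\<Union>C) n" "w \<in> ?fam (\<Union>C) n"
        then obtain T T' where T: "T \<in> C" "T' \<in> C" "v \<in> ?fam T n" "w \<in> ?fam T' n"
          unfolding memU by blast
        then obtain T'' where T'': "T'' \<in> C" "v \<in> ?fam T'' n" "w \<in> ?fam T'' n"
          using lin[OF T(1,2)] by blast
        show "v + w \<in> ?fam (\<Union>C) n"
          unfolding memU using T''(1) csub_simps(2)[OF Q(1)[OF T''(1)] T''(2,3)] by blast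
      next
        fix a v assume "v \<in> ?fam (\<Union>C) n"
        then obtain T where T: "T \<in> C" "v \<in> ?fam T n" unfolding memU by blast
        show "a *\<^sub>C v \<in> ?fam (\<Union>C) n"
          unfolding memU using T(1) csub_simps(3)[OF Q(1)[OF T(1)] T(2)] by blast
      qed
      show "G n \<subseteq> ?fam (\<Union>C) n" using Q(2)[OF T0, of n] T0 by blast
      show "?fam (\<Union>C) n \<subseteq> F n" using Q(3)[of _ n] by blast
      show "act y v \<in> ?fam (\<Union>C) (Suc n)" if v: "v \<in> ?fam (\<Union>C) n" for y v
      proof -
        obtain T where T: "T \<in> C" "v \<in> ?fam T n" using v unfolding memU by blast
        show ?thesis unfolding memU using T(1) Q(4)[OF T] by blast
      qed
    qed
    \<comment> \<open>\<open>W\<close> is spanned by the finite set \<open>B\<close>, so a union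
      containing u^n W would have a member of the chain containing it.\<close>
    moreover have "\<not> ?u n ` W \<subseteq> ?fam (\<Union>C) n" for n
    proof
      assume "?u n ` W \<subseteq> ?fam (\<Union>C) n"
      then have "(\<lambda>b. (n, ?u n b)) ` B \<subseteq> \<Union>C" using B(2) by auto
      then obtain T where T: "T \<in> C" "(\<lambda>b. (n, ?u n b)) ` B \<subseteq> T"
        using finite_subset_Union_chain[of "(\<lambda>b. (n, ?u n b)) ` B" C \<A>] C B(1) by blast
      then have "?u n ` B \<subseteq> ?fam T n" by auto
      then have "?u n ` cspan B \<subseteq> ?fam T n"
        by (rule clinear_span_subset[OF clinear_word Q(1)[OF T(1)]])
      then show False using CA[OF T(1)] B(3) by (auto simp: good_def)
    qed
    ultimately show ?thesis by (simp add: \<A>_def good_def)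
  qed
  obtain M where M: "M \<in> \<A>" "\<And>T. T \<in> \<A> \<Longrightarrow> M \<subseteq> T \<Longrightarrow> T = M"
    using subset_Zorn_nonempty[OF ne chain] by blast
  define Q where "Q = ?fam M"
  have goodQ: "good Q" using M(1) by (simp add: \<A>_def Q_def)
  then have admQ: "admissible Q" and uQ: "\<not> ?u n ` W \<subseteq> Q n" for n by (auto simp: good_def)
  note Q = admissibleD[OF admQ]
  have maximal: "(\<exists>n. ?u n ` W \<subseteq> R n) \<or> R = Q" if "admissible R" "\<And>n. Q n \<subseteq> R n" for R
  proof (cases "good R")
    case True
    then have "{(n, v). v \<in> R n} \<in> \<A>" by (simp add: \<A>_def)
    moreover have "M \<subseteq> {(n, v). v \<in> R n}" using that(2) by (auto simp: Q_def)
    ultimately have "{(n, v). v \<in> R n} = M" by (rule M(2))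
    then show ?thesis by (auto simp: Q_def)
  next
    case False then show ?thesis using that(1) by (auto simp: good_def)
  qed
  \<comment> \<open>The kernel of a word on the quotient is a graded submodule because letters
    commute up to \<open>G\<close>.\<close>
  have kernel_adm: "admissible (\<lambda>n. {v \<in> F n. word us v \<in> Q (n + length us)})" for us
    unfolding admissible_def
  proof (intro allI conjI ballI)
    fix n
    show "csubspace {v \<in> F n. word us v \<in> Q (n + length us)}"
      using csub_simps[OF subF] csub_simps[OF Q(1)] by (intro csubspaceI) (auto simp: word_simps)
    show "G n \<subseteq> {v \<in> F n. word us v \<in> Q (n + length us)}"
      using G_F Q(2) word_G by blast
    show "{v \<in> F n. word us v \<in> Q (n + length us)} \<subseteq> F n" by auto
    fix y v assume v: "v \<in> {v \<in> F n. word us v \<in> Q (n + length us)}"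
    have "word (y # us) v \<in> Q (Suc n + length us)" using v Q(4) by simp
    moreover have "mset (us @ [y]) = mset (y # us)" by simp
    ultimately have "word (us @ [y]) v \<in> Q (Suc n + length us)"
      using word_perm_mem[of "us @ [y]" "y # us" v n "Q (Suc n + length us)"] v Q(1,2) by (simp del: G.simps)
    then show "act y v \<in> {v \<in> F (Suc n). word us v \<in> Q (Suc n + length us)}"
      using v act_F by (auto simp: word_append simp del: F.simps)
  qed
  have kernel_Q: "Q n \<subseteq> {v \<in> F n. word us v \<in> Q (n + length us)}" for us n
    using Q(3) admissible_word[OF admQ] by blast
  \<comment> \<open>If the kernel of u^m contained u^n W, then \<open>Q\<close> would contain
    u^(m+n) W. So the kernel still belongs to the competitors of \<open>Q\<close> and equals
    \<open>Q\<close>.\<close>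
  have u_inj: "v \<in> Q n" if v: "v \<in> F n" "?u m v \<in> Q (n + m)" for n m v
  proof -
    let ?R = "\<lambda>n. {v \<in> F n. ?u m v \<in> Q (n + length (replicate m u))}"
    have "\<not> ?u n ` W \<subseteq> ?R n" for n
    proof
      assume "?u n ` W \<subseteq> ?R n"
      then have "?u (m + n) ` W \<subseteq> Q (n + m)" by (auto simp: replicate_add word_append)
      then show False using uQ[of "m + n"] by (simp add: add.commute)
    qed
    then have "?R = Q"
      using maximal[OF kernel_adm[of "replicate m u"] kernel_Q[of _ "replicate m u"]] by blast
    then have "?R n = Q n" by (rule fun_cong)
    then show ?thesis using v by auto
  qed
  \<comment> \<open>One vector serves all degrees: if each basis vector died in some degree, all of
    \<open>W\<close> would die in degree \<open>N\<close>, the sum of these degrees.\<close>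
  obtain w where w: "w \<in> W" "\<And>n. ?u n w \<notin> Q n"
  proof -
    have "\<exists>b\<in>B. \<forall>n. ?u n b \<notin> Q n"
    proof (rule ccontr)
      assume "\<not> ?thesis"
      then obtain f where f: "\<And>b. b \<in> B \<Longrightarrow> ?u (f b) b \<in> Q (f b)" by metis
      define N where "N = (\<Sum>b\<in>B. f b)"
      have "?u N b \<in> Q N" if b: "b \<in> B" for b
      proof -
        have "f b \<le> N" unfolding N_def using B(1) b by (intro member_le_sum) auto
        then obtain k where k: "N = f b + k" by (metis le_add_diff_inverse)
        have "?u k (?u (f b) b) \<in> Q (f b + k)"
          using admissible_word[OF admQ f[OF b], of "replicate k u"] by simp
        then show ?thesis by (simp add: k add.commute[of "f b"] replicate_add word_append)
      qed
      then have "?u N ` cspan B \<subseteq> Q N"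
        by (intro clinear_span_subset[OF clinear_word Q(1)]) auto
      then show False using uQ[of N] B(3) by blast
    qed
    then show ?thesis using B(2) that by blast
  qed
  have scalar: "\<exists>l. \<forall>n. \<forall>v\<in>F n. act (y - l *\<^sub>C u) v \<in> Q (Suc n)" for y
  proof (rule ccontr)
    assume no: "\<not> ?thesis"
    interpret gp: graded_pair "act y" "act u" F Q
      by (rule admissible_graded_pair[OF admQ])
    have act_yl: "act (y - l *\<^sub>C u) v = act y v - l *\<^sub>C act u v" for l v
      by (simp add: arg_simps)
    \<comment> \<open>If the kernel of z = y - l u contained u^m W, then u^m z would kill the
      generators, hence everything, and injectivity of \<open>u\<close> would make \<open>z\<close>
      act by zero, against \<open>no\<close>.\<close>
    have yinj: "v \<in> Q n" if v: "v \<in> F n" "act y v - l *\<^sub>C act u v \<in> Q (Suc n)" for l n v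
    proof -
      let ?z = "y - l *\<^sub>C u"
      let ?R = "\<lambda>n. {v \<in> F n. word [?z] v \<in> Q (n + length [?z])}"
      have "\<not> ?u m ` W \<subseteq> ?R m" for m
      proof
        assume abs: "?u m ` W \<subseteq> ?R m"
        have "act ?z v \<in> Q (Suc n)" if v: "v \<in> F n" for n v
        proof -
          have adm: "admissible (\<lambda>n. {v \<in> F n. word (replicate m u @ [?z]) v \<in> Q (n + length (replicate m u @ [?z]))})"
            by (rule kernel_adm)
          have "W \<subseteq> {v \<in> F 0. word (replicate m u @ [?z]) v \<in> Q (0 + length (replicate m u @ [?z]))}"
          proof safe
            fix v assume vW: "v \<in> W"
            then have v0: "v \<in> F 0" by simp
            then show "v \<in> F 0" .
            have "word (?z # replicate m u) v \<in> Q (Suc m)" using abs vW by auto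
            moreover have "mset (replicate m u @ [?z]) = mset (?z # replicate m u)" by simp
            ultimately show "word (replicate m u @ [?z]) v \<in> Q (0 + length (replicate m u @ [?z]))"
              using word_perm_mem[OF _ v0, of "replicate m u @ [?z]" "?z # replicate m u" "Q (Suc m)"] Q(1,2)
              by (simp del: G.simps word.simps)
          qed
          then have "F (0 + n) \<subseteq> {v \<in> F (0 + n). word (replicate m u @ [?z]) v \<in> Q (0 + n + length (replicate m u @ [?z]))}"
            by (intro admissible_full[OF adm]) simp
          then have "?u m (act ?z v) \<in> Q (Suc n + m)" using v by (auto simp: word_append)
          then show ?thesis using u_inj act_F[OF v] by blast
        qed
        then show False using no by blast
      qed
      then have "?R = Q"
        using maximal[OF kernel_adm[of "[?z]"] kernel_Q[of _ "[?z]"]] by blast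
      then have "?R n = Q n" by (rule fun_cong)
      moreover have "v \<in> ?R n" using v by (simp add: act_yl del: F.simps)
      ultimately show ?thesis by blast
    qed
    \<comment> \<open>The image of \<open>?z\<close> enlarges \<open>Q\<close> strictly, so by
      maximality the sum contains u^n W for some n. This n is not 0, since the image adds nothing in
      degree 0.\<close>
    have "\<exists>m v. v \<in> F m \<and> act y v - l *\<^sub>C act u v - ?u (Suc m) w \<in> Q (Suc m)" for l
    proof -
      let ?z = "y - l *\<^sub>C u"
      have "shift_sum ?z Q \<noteq> Q"
      proof
        assume eq: "shift_sum ?z Q = Q"
        have "act ?z v \<in> Q (Suc n)" if "v \<in> F n" for n v
        proof -
          have "0 + act ?z v \<in> shift_sum ?z Q (Suc n)"
            using that csub_simps(1)[OF Q(1), of "Suc n"] unfolding shift_sum_def G.simps by blast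
          then show ?thesis using eq by simp
        qed
        then show False using no by blast
      qed
      then obtain n where n: "?u n ` W \<subseteq> shift_sum ?z Q n"
        using maximal[OF admissible_shift_sum[OF admQ, of ?z] shift_sum_Q] by blast
      then obtain a v where av: "?u n w = a + act ?z v" "a \<in> Q n" "v \<in> G n"
        using w(1) unfolding shift_sum_def by blast
      show ?thesis
      proof (cases n)
        case 0
        then have "?u 0 w \<in> Q 0" using av by (simp add: act_simps)
        then show ?thesis using w(2)[of 0] by blast
      next
        case (Suc m)
        have "act ?z v - ?u (Suc m) w = - a" using av Suc by simp
        then have "act y v - l *\<^sub>C act u v - ?u (Suc m) w \<in> Q (Suc m)"
          using csub_simps(5)[OF Q(1) av(2)] Suc by (simp only: act_yl)
        then show ?thesis using av(3) Suc by auto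
      qed
    qed
    then obtain d r where r: "\<And>l. r l \<in> F (d l)"
      "\<And>l. act y (r l) - l *\<^sub>C act u (r l) - ?u (Suc (d l)) w \<in> Q (Suc (d l))" by metis
    obtain m where m: "infinite {l. d l = m}" using infinite_fibre_complex by blast
    have "r ` {l. d l = m} \<subseteq> F m" using r(1) by auto
    from cfinite_dim_dependent[OF fdF m this]
    obtain S c where S: "finite S" "S \<subseteq> {l. d l = m}" "\<exists>i\<in>S. c i \<noteq> 0" "(\<Sum>i\<in>S. c i *\<^sub>C r i) = 0" .
    have "c i = 0" if "i \<in> S" for i
    proof (rule gp.resolvents_independent[of S r m "?u (Suc m) w" c i])
      show "v \<in> Q n" if "v \<in> F n" "act u v \<in> Q (Suc n)" for n v
        using u_inj[of v n 1] that by simp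
      show "v \<in> Q n" if "v \<in> F n" "act y v - l *\<^sub>C act u v \<in> Q (Suc n)" for l n v
        using yinj that by blast
      show "?u (Suc m) w \<in> F (Suc m)" using word_F[of w 0 "replicate (Suc m) u"] w(1) by simp
      show "?u (Suc m) w \<notin> Q (Suc m)" by (rule w(2))
      show "finite S" "(\<Sum>m\<in>S. c m *\<^sub>C r m) = 0" "i \<in> S" by fact+
      show "r l \<in> F m" if "l \<in> S" for l using r(1)[of l] S(2) that by auto
      show "act y (r l) - l *\<^sub>C act u (r l) - ?u (Suc m) w \<in> Q (Suc m)" if "l \<in> S" for l
        using r(2)[of l] S(2) that by auto
    qed
    then show False using S(3) by blast
  qed
  then obtain \<xi> where \<xi>: "\<And>y n v. v \<in> F n \<Longrightarrow> act (y - \<xi> y *\<^sub>C u) v \<in> Q (Suc n)" by metis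
  \<comment> \<open>\<open>u w\<close> is non-zero in the quotient, so the scalar of each
    \<open>y\<close> is determined by its effect on \<open>w\<close>; this makes \<xi>
    linear.\<close>
  have unique: "l = 0" if "act (l *\<^sub>C u) w \<in> Q (Suc 0)" for l
  proof (rule ccontr)
    assume "l \<noteq> 0"
    have "inverse l *\<^sub>C act (l *\<^sub>C u) w \<in> Q (Suc 0)"
      by (rule csub_simps(3)[OF Q(1) that])
    then have "act u w \<in> Q (Suc 0)"
      using \<open>l \<noteq> 0\<close> by (simp add: arg_simps scaleC_scaleC scaleC_one)
    then show False using w(2)[of "Suc 0"] by simp
  qed
  have w0: "w \<in> F 0" using w(1) by simp
  note \<xi>w = \<xi>[OF w0]
  have "clinear \<xi>"
  proof (rule clinearI)
    fix y z
    have "act (y - \<xi> y *\<^sub>C u) w + act (z - \<xi> z *\<^sub>C u) w - act (y + z - \<xi> (y + z) *\<^sub>C u) w \<in> Q (Suc 0)"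
      by (intro csub_simps(2)[OF Q(1)] csub_simps(4)[OF Q(1)] \<xi>w)
    then have "act ((\<xi> (y + z) - \<xi> y - \<xi> z) *\<^sub>C u) w \<in> Q (Suc 0)"
      by (simp add: arg_simps complex_vector.scale_left_diff_distrib algebra_simps)
    then have "\<xi> (y + z) - \<xi> y - \<xi> z = 0" by (rule unique)
    then show "\<xi> (y + z) = \<xi> y + \<xi> z" by (simp add: algebra_simps)
  next
    fix a y
    have "a *\<^sub>C act (y - \<xi> y *\<^sub>C u) w - act (a *\<^sub>C y - \<xi> (a *\<^sub>C y) *\<^sub>C u) w \<in> Q (Suc 0)"
      by (intro csub_simps(3)[OF Q(1)] csub_simps(4)[OF Q(1)] \<xi>w)
    then have "act ((\<xi> (a *\<^sub>C y) - a * \<xi> y) *\<^sub>C u) w \<in> Q (Suc 0)"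
      by (simp add: arg_simps complex_vector.scale_left_diff_distrib complex_vector.scale_right_diff_distrib
          scaleC_scaleC)
    then have "\<xi> (a *\<^sub>C y) - a * \<xi> y = 0" by (rule unique)
    then show "\<xi> (a *\<^sub>C y) = a *\<^sub>C \<xi> y" by (simp add: scaleC_complex_def)
  qed
  moreover have "\<not> F n \<subseteq> char_family \<xi> n" for n
  proof -
    have "char_family \<xi> n \<subseteq> Q n"
    proof (cases n)
      case 0 then show ?thesis using csub_simps(1)[OF Q(1)] by simp
    next
      case (Suc m)
      have "F m \<union> {act y v |y v. \<xi> y = 0 \<and> v \<in> F m} \<subseteq> Q (Suc m)"
        using Q(5)[of m] \<xi> by (auto simp: complex_vector.scale_zero_left dest: \<xi>)
          (metis \<xi> complex_vector.scale_zero_left diff_zero)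
      then show ?thesis unfolding Suc char_family.simps
        using complex_vector.span_minimal[OF _ Q(1)] by blast
    qed
    moreover have "?u n w \<in> F n" "?u n w \<notin> Q n"
      using word_F[OF w0, of "replicate n u"] w(2) by auto
    ultimately show ?thesis by blast
  qed
  moreover have "\<xi> u = 1"
  proof -
    have "act ((1 - \<xi> u) *\<^sub>C u) w \<in> Q (Suc 0)"
      using \<xi>w[of u] by (simp add: complex_vector.scale_left_diff_distrib scaleC_one)
    then show ?thesis using unique by fastforce
  qed
  ultimately show ?thesis using that[of \<xi>] by (simp add: char_functionals_def)
qed

lemma nilpotent_symbols_iff: "u \<in> nilpotent_symbols \<longleftrightarrow> (\<forall>\<xi>\<in>char_functionals. \<xi> u = 0)"
  using char_functional_exists char_functional_nilpotent by metis

subsection \<open>A filtration that never stabilizes has a characteristic functional\<close>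

text \<open>Nakayama's lemma for a nilpotent symbol: from M = Q + u M in high degrees, iteration
  gives M = Q + u^m M = Q.\<close>

lemma shift_sum_full:
  assumes Q: "admissible Q" and u: "u \<in> nilpotent_symbols" and full: "F n \<subseteq> shift_sum u Q n"
  shows "\<exists>m. F m \<subseteq> Q m"
proof -
  obtain m where m: "\<And>n v. v \<in> F n \<Longrightarrow> word (replicate m u) v \<in> G (n + m)"
    using u unfolding nilpotent_symbols_def by blast
  have full: "F (n + j) \<subseteq> shift_sum u Q (n + j)" for j
    by (rule admissible_full[OF admissible_shift_sum[OF Q] full])
  have "\<exists>v'\<in>F n. v - word (replicate i u) v' \<in> Q (n + i)" if "v \<in> F (n + i)" for i v
    using that
  proof (induction i arbitrary: v)
    case 0 then show ?case using csub_simps(1)[OF admissibleD(1)[OF Q]] by (auto intro!: bexI[of _ v])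
  next
    case (Suc i)
    then obtain a b where ab: "v = a + act u b" "a \<in> Q (n + Suc i)" "b \<in> F (n + i)"
      using full[of "Suc i"] unfolding shift_sum_def by auto
    obtain v' where v': "v' \<in> F n" "b - word (replicate i u) v' \<in> Q (n + i)"
      using Suc.IH[OF ab(3)] by blast
    have "a + act u (b - word (replicate i u) v') \<in> Q (Suc (n + i))"
      using admissibleD(4)[OF Q v'(2), of u] ab(2) by (intro csub_simps(2) admissibleD(1)[OF Q]) auto
    then have "v - word (replicate (Suc i) u) v' \<in> Q (n + Suc i)"
      by (simp add: ab(1) act_simps algebra_simps)
    then show ?case using v'(1) by blast
  qed
  note red = this
  have "F (n + m) \<subseteq> Q (n + m)"
  proof
    fix v assume "v \<in> F (n + m)"
    then obtain v' where v': "v' \<in> F n" "v - word (replicate m u) v' \<in> Q (n + m)"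
      using red by blast
    have "word (replicate m u) v' \<in> Q (n + m)"
      using m[OF v'(1)] admissibleD(2)[OF Q] by blast
    then show "v \<in> Q (n + m)"
      using csubspace_cong_diff[OF admissibleD(1)[OF Q] v'(2)] by simp
  qed
  then show ?thesis by blast
qed

text \<open>The images of a basis of the Lie algebra together fill degree 1.
  \<open>shift_sum_full\<close> removes them one at a time, until the graded module itself vanishes
  in some degree.\<close>

lemma stable_if_all_nilpotent:
  assumes "nilpotent_symbols = UNIV"
  shows "\<exists>n. \<forall>y. \<forall>v\<in>F n. act y v \<in> F n"
proof -
  obtain B :: "'a set" where B: "finite B" "UNIV \<subseteq> cspan B"
    using fd unfolding cfinite_dim_def by auto
  obtain bs where bs: "set bs = B" using finite_list[OF B(1)] by blast
  define R where "R us = foldr shift_sum us G" for us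
  have adm: "admissible (R us)" for us
    by (induction us) (auto simp: R_def admissible_G admissible_shift_sum)
  have mem: "act b v \<in> R us (Suc n)" if "b \<in> set us" "v \<in> F n" for b us v n
    using that(1)
  proof (induction us)
    case (Cons u us)
    show ?case
    proof (cases "b = u")
      case True
      have "0 + act u v \<in> shift_sum u (R us) (Suc n)"
        using that(2) csub_simps(1)[OF admissibleD(1)[OF adm], of us "Suc n"]
        unfolding shift_sum_def G.simps by blast
      then show ?thesis using True by (simp add: R_def)
    next
      case False
      then have "act b v \<in> R us (Suc n)" using Cons by simp
      then show ?thesis using shift_sum_Q[of "R us" "Suc n" u] by (auto simp: R_def)
    qed
  qed simp
  have descend: "\<exists>m. F m \<subseteq> G m" if "F n \<subseteq> R us n" for us n
    using that
  proof (induction us arbitrary: n)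
    case Nil then show ?case by (auto simp: R_def)
  next
    case (Cons u us)
    then have "F n \<subseteq> shift_sum u (R us) n" by (simp add: R_def)
    then obtain m where "F m \<subseteq> R us m" using shift_sum_full[OF adm] assms by blast
    then show ?case by (rule Cons.IH)
  qed
  have "F (Suc 0) \<subseteq> R bs (Suc 0)"
  proof (rule F_Suc_subset)
    show "csubspace (R bs (Suc 0))" by (rule admissibleD(1)[OF adm])
    show "F 0 \<subseteq> R bs (Suc 0)" by (rule admissibleD(5)[OF adm])
    fix y v assume v: "v \<in> F 0"
    have "(\<lambda>y. act y v) ` cspan B \<subseteq> R bs (Suc 0)"
      using mem[OF _ v, of _ bs] bs by (intro clinear_span_subset clin_arg admissibleD(1)[OF adm]) auto
    then show "act y v \<in> R bs (Suc 0)" using B(2) by blast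
  qed
  then obtain m where m: "F m \<subseteq> G m" using descend by blast
  show ?thesis
  proof (cases m)
    case 0
    then have "F 0 \<subseteq> {0}" using m by simp
    then have "act y v \<in> F 0" if "v \<in> F 0" for y v
      using that by (auto simp: act_simps)
    then show ?thesis by blast
  next
    case (Suc k)
    then show ?thesis using m act_F[of _ k] by (metis G.simps(2) subsetD)
  qed
qed

end

section \<open>Invariant form and irreducible isotropy representation of the real simple Lie
  algebra\<close>

section \<open>Killing form and Cartan involution\<close>

definition op_trace :: "('l::euclidean_space \<Rightarrow> 'l) \<Rightarrow> real"
  where "op_trace f = (\<Sum>b\<in>Basis. f b \<bullet> b)"

lemma op_trace_commute:
  fixes f g :: "'l::euclidean_space \<Rightarrow> 'l"
  assumes "linear f" "linear g"
  shows "op_trace (\<lambda>x. f (g x)) = op_trace (\<lambda>x. g (f x))"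
proof -
  have expand: "h (h' b) = (\<Sum>c\<in>Basis. (h' b \<bullet> c) *\<^sub>R h c)" if "linear h" for h h' :: "'l \<Rightarrow> 'l" and b
  proof -
    have "h (\<Sum>c\<in>Basis. (h' b \<bullet> c) *\<^sub>R c) = (\<Sum>c\<in>Basis. (h' b \<bullet> c) *\<^sub>R h c)"
      by (simp add: linear_sum[OF that] linear_scale[OF that])
    then show ?thesis by (simp add: euclidean_representation)
  qed
  have "op_trace (\<lambda>x. f (g x)) = (\<Sum>b\<in>Basis. \<Sum>c\<in>Basis. (g b \<bullet> c) * (f c \<bullet> b))"
    unfolding op_trace_def by (subst expand[OF assms(1)]) (simp add: inner_sum_left)
  also have "\<dots> = (\<Sum>c\<in>Basis. \<Sum>b\<in>Basis. (f c \<bullet> b) * (g b \<bullet> c))"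
    by (subst sum.swap) (simp add: mult.commute)
  also have "\<dots> = op_trace (\<lambda>x. g (f x))"
    unfolding op_trace_def by (subst expand[OF assms(2)]) (simp add: inner_sum_left)
  finally show ?thesis .
qed

lemma op_trace_diff: "op_trace (\<lambda>x. f x - g x) = op_trace f - op_trace g"
  by (simp add: op_trace_def inner_diff_left sum_subtractf)

lemma op_trace_add: "op_trace (\<lambda>x. f x + g x) = op_trace f + op_trace g"
  by (simp add: op_trace_def inner_add_left sum.distrib)

lemma op_trace_scale: "op_trace (\<lambda>x. a *\<^sub>R f x) = a * op_trace f"
  by (simp add: op_trace_def sum_distrib_left)

locale cartan =
  fixes br :: "'l::euclidean_space \<Rightarrow> 'l \<Rightarrow> 'l" and \<theta> :: "'l \<Rightarrow> 'l"
  assumes simple: "simple_lie_algebra br" and cartan: "cartan_involution br \<theta>"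
begin

abbreviation B where "B \<equiv> killing_form br"

definition k where "k = {x. \<theta> x = x}"
definition p where "p = {x. \<theta> x = - x}"

lemma lie: "lie_algebra br"
  using simple by (simp add: simple_lie_algebra_def)

lemma bil: "bilinear br"
  using lie by (simp add: lie_algebra_def)

lemma lin_br: "linear (br x)"
  using bil by (simp add: bilinear_def)

lemmas br_simps = bilinear_ladd[OF bil] bilinear_radd[OF bil] bilinear_lsub[OF bil] bilinear_rsub[OF bil]
  bilinear_lmul[OF bil] bilinear_rmul[OF bil] bilinear_lneg[OF bil] bilinear_rneg[OF bil]
  bilinear_lzero[OF bil] bilinear_rzero[OF bil]

lemma br_sum_right: "br x (\<Sum>i\<in>I. f i) = (\<Sum>i\<in>I. br x (f i))"
  by (rule linear_sum[OF lin_br])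

lemma br_self: "br x x = 0"
  using lie by (simp add: lie_algebra_def)

lemma br_anti: "br x y = - br y x"
proof -
  have "br x y + br y x = br (x + y) (x + y) - br x x - br y y" by (simp only: br_simps) simp
  then show ?thesis by (simp add: br_self eq_neg_iff_add_eq_0)
qed

lemma jacobi: "br x (br y z) = br (br x y) z + br y (br x z)"
proof -
  have "br x (br y z) + br y (br z x) + br z (br x y) = 0"
    using lie by (simp add: lie_algebra_def)
  then show ?thesis
    using br_anti[of z x] br_anti[of z "br x y"] by (simp add: br_simps eq_neg_iff_add_eq_0 algebra_simps)
qed

lemma B_trace: "B x y = op_trace (\<lambda>b. br x (br y b))"
  by (simp add: killing_form_def op_trace_def)

lemma B_sym: "B x y = B y x"
  unfolding B_trace by (rule op_trace_commute[OF lin_br lin_br])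

lemma B_add: "B (x + y) z = B x z + B y z" "B z (x + y) = B z x + B z y"
  and B_diff: "B (x - y) z = B x z - B y z" "B z (x - y) = B z x - B z y"
  and B_scale: "B (a *\<^sub>R x) z = a * B x z" "B z (a *\<^sub>R x) = a * B z x"
  and B_minus: "B (- x) z = - B x z" "B z (- x) = - B z x"
  and B_zero: "B 0 z = 0" "B z 0 = 0"
  by (simp_all add: killing_form_def br_simps inner_add_left inner_diff_left sum.distrib sum_subtractf
      sum_distrib_left sum_negf)

lemmas B_simps = B_add B_diff B_scale B_minus B_zero

lemma B_sum: "B (\<Sum>i\<in>I. f i) z = (\<Sum>i\<in>I. B (f i) z)" "B z (\<Sum>i\<in>I. f i) = (\<Sum>i\<in>I. B z (f i))"
  by (induction I rule: infinite_finite_induct) (auto simp: B_simps)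

lemma trace_bracket:
  assumes "linear f"
  shows "op_trace (\<lambda>b. f (br (br x y) b)) = op_trace (\<lambda>b. f (br x (br y b))) - op_trace (\<lambda>b. f (br y (br x b)))"
proof -
  have "f (br (br x y) b) = f (br x (br y b)) - f (br y (br x b))" for b
    using jacobi[of x y b] by (simp add: linear_diff[OF assms, symmetric])
  then show ?thesis by (simp add: op_trace_diff)
qed

lemma B_inv: "B (br x y) z = B x (br y z)"
proof -
  have "B (br x y) z = B z (br x y)" by (rule B_sym)
  also have "\<dots> = op_trace (\<lambda>b. br z (br x (br y b))) - op_trace (\<lambda>b. br z (br y (br x b)))"
    unfolding B_trace by (rule trace_bracket[OF lin_br])
  also have "op_trace (\<lambda>b. br z (br x (br y b))) = op_trace (\<lambda>b. br x (br y (br z b)))"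
    using op_trace_commute[OF lin_br linear_compose[OF lin_br lin_br], of z x y] by (simp add: o_def)
  also have "op_trace (\<lambda>b. br z (br y (br x b))) = op_trace (\<lambda>b. br x (br z (br y b)))"
    using op_trace_commute[OF linear_compose[OF lin_br lin_br] lin_br, of z y x] by (simp add: o_def)
  finally show ?thesis unfolding B_trace[of x] by (simp add: trace_bracket[OF lin_br])
qed

lemma B_aut:
  assumes "linear f" "linear g" "\<And>x. f (g x) = x" "\<And>x. g (f x) = x" "\<And>x y. f (br x y) = br (f x) (f y)"
  shows "B (f x) (f y) = B x y"
proof -
  have "br (f x) (br (f y) b) = f (br x (br y (g b)))" for x y b
    by (simp add: assms(3,5))
  then have "B (f x) (f y) = op_trace (\<lambda>b. f (br x (br y (g b))))"
    unfolding B_trace by simp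
  also have "\<dots> = op_trace (\<lambda>b. br x (br y (g (f b))))"
    using op_trace_commute[OF assms(1) linear_compose[OF linear_compose[OF assms(2) lin_br] lin_br], of x y]
    by (simp add: o_def)
  finally show ?thesis by (simp add: assms(4) B_trace)
qed

lemma lin_\<theta>: "linear \<theta>" and \<theta>\<theta>: "\<theta> (\<theta> x) = x" and \<theta>_br: "\<theta> (br x y) = br (\<theta> x) (\<theta> y)"
  and B_\<theta>_pos: "x \<noteq> 0 \<Longrightarrow> - B x (\<theta> x) > 0"
  using cartan by (auto simp: cartan_involution_def)

lemmas \<theta>_simps = linear_add[OF lin_\<theta>] linear_diff[OF lin_\<theta>] linear_scale[OF lin_\<theta>] linear_neg[OF lin_\<theta>]
  linear_0[OF lin_\<theta>]

lemma B_\<theta>: "B (\<theta> x) (\<theta> y) = B x y"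
  using B_aut[OF lin_\<theta> lin_\<theta> \<theta>\<theta> \<theta>\<theta> \<theta>_br] .

lemma sub_k: "subspace k" and sub_p: "subspace p"
  by (auto simp: k_def p_def subspace_def \<theta>_simps)

lemma br_kk: "x \<in> k \<Longrightarrow> y \<in> k \<Longrightarrow> br x y \<in> k"
  and br_kp: "x \<in> k \<Longrightarrow> y \<in> p \<Longrightarrow> br x y \<in> p"
  and br_pk: "x \<in> p \<Longrightarrow> y \<in> k \<Longrightarrow> br x y \<in> p"
  and br_pp: "x \<in> p \<Longrightarrow> y \<in> p \<Longrightarrow> br x y \<in> k"
  by (auto simp: k_def p_def \<theta>_br br_simps)

lemma B_kp: "x \<in> k \<Longrightarrow> y \<in> p \<Longrightarrow> B x y = 0" "x \<in> k \<Longrightarrow> y \<in> p \<Longrightarrow> B y x = 0"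
proof -
  show "B x y = 0" if "x \<in> k" "y \<in> p" for x y
    using B_\<theta>[of x y] that by (simp add: k_def p_def B_simps)
  then show "x \<in> k \<Longrightarrow> y \<in> p \<Longrightarrow> B y x = 0" by (simp add: B_sym)
qed

lemma B_k_neg: "x \<in> k \<Longrightarrow> x \<noteq> 0 \<Longrightarrow> B x x < 0" and B_p_pos: "x \<in> p \<Longrightarrow> x \<noteq> 0 \<Longrightarrow> B x x > 0"
  using B_\<theta>_pos[of x] by (auto simp: k_def p_def B_simps)

lemma kp_zero: "x \<in> k \<Longrightarrow> x \<in> p \<Longrightarrow> x = 0"
  using B_k_neg B_p_pos by force

definition kpart where "kpart x = (1/2) *\<^sub>R (x + \<theta> x)"
definition ppart where "ppart x = (1/2) *\<^sub>R (x - \<theta> x)"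

lemma kp_sum: "kpart x + ppart x = x"
proof -
  have "kpart x + ppart x = (1/2) *\<^sub>R ((x + \<theta> x) + (x - \<theta> x))"
    unfolding kpart_def ppart_def by (rule scaleR_add_right[symmetric])
  then show ?thesis by simp
qed

lemma kpart: "kpart x \<in> k" and ppart: "ppart x \<in> p"
  by (simp_all add: kpart_def ppart_def k_def p_def \<theta>_simps \<theta>\<theta> algebra_simps)

lemma kp_decomp: obtains a b where "a \<in> k" "b \<in> p" "x = a + b"
  using kpart ppart kp_sum by metis

lemma B_nondeg: "(\<And>y. B x y = 0) \<Longrightarrow> x = 0"
  using B_\<theta>_pos[of x] by fastforce

lemma B_nondeg_k: "x \<in> k \<Longrightarrow> (\<And>y. y \<in> k \<Longrightarrow> B x y = 0) \<Longrightarrow> x = 0"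
  using B_k_neg[of x] by fastforce

lemma B_nondeg_p: "x \<in> p \<Longrightarrow> (\<And>y. y \<in> p \<Longrightarrow> B x y = 0) \<Longrightarrow> x = 0"
  using B_p_pos[of x] by fastforce

lemma ideal: "subspace I \<Longrightarrow> (\<And>x y. y \<in> I \<Longrightarrow> br x y \<in> I) \<Longrightarrow> I = {0} \<or> I = UNIV"
  using simple by (auto simp: simple_lie_algebra_def)

lemma center_zero: "(\<And>x. br x c = 0) \<Longrightarrow> c = 0"
proof -
  assume c: "\<And>x. br x c = 0"
  have "subspace {c. \<forall>x. br x c = 0}" by (auto simp: subspace_def br_simps)
  then have "{c. \<forall>x. br x c = 0} = {0} \<or> {c. \<forall>x. br x c = 0} = UNIV"
    by (rule ideal) (auto simp: br_simps)
  moreover have "{c. \<forall>x. br x c = 0} \<noteq> UNIV"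
    using simple unfolding simple_lie_algebra_def by blast
  ultimately show ?thesis using c by blast
qed

lemma center_zero_k: "c \<in> k \<Longrightarrow> (\<And>x. x \<in> k \<Longrightarrow> br c x = 0) \<Longrightarrow> (\<And>x. x \<in> p \<Longrightarrow> br c x = 0) \<Longrightarrow> c = 0"
proof -
  assume c: "c \<in> k" "\<And>x. x \<in> k \<Longrightarrow> br c x = 0" "\<And>x. x \<in> p \<Longrightarrow> br c x = 0"
  have "br c x = 0" for x using c(2,3) kp_decomp[of x] by (metis add_0 br_simps(2))
  then have "br x c = 0" for x using br_anti[of x c] by simp
  then show ?thesis by (rule center_zero)
qed

subsection \<open>Orthonormal bases\<close>

text \<open>Orthonormal up to sign, since \<open>B\<close> is negative on \<open>k\<close> and
  positive on \<open>p\<close>. Completeness is stated as the expansion formula, in which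
  \<open>B e e\<close> is the sign.\<close>

definition onb :: "'l set \<Rightarrow> 'l set \<Rightarrow> bool"
  where "onb V E \<longleftrightarrow> finite E \<and> E \<subseteq> V \<and> (\<forall>e\<in>E. \<bar>B e e\<bar> = 1) \<and> (\<forall>e\<in>E. \<forall>f\<in>E. e \<noteq> f \<longrightarrow> B e f = 0) \<and>
    (\<forall>x\<in>V. x = (\<Sum>e\<in>E. (B e e * B x e) *\<^sub>R e))"

lemma onbD:
  assumes "onb V E"
  shows "finite E" "E \<subseteq> V" "e \<in> E \<Longrightarrow> \<bar>B e e\<bar> = 1" "e \<in> E \<Longrightarrow> f \<in> E \<Longrightarrow> e \<noteq> f \<Longrightarrow> B e f = 0"
    "x \<in> V \<Longrightarrow> x = (\<Sum>e\<in>E. (B e e * B x e) *\<^sub>R e)" "e \<in> E \<Longrightarrow> e \<in> V"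
    "e \<in> E \<Longrightarrow> B e e * B e e = 1"
proof -
  show 1: "finite E" "E \<subseteq> V" "e \<in> E \<Longrightarrow> \<bar>B e e\<bar> = 1" "e \<in> E \<Longrightarrow> f \<in> E \<Longrightarrow> e \<noteq> f \<Longrightarrow> B e f = 0"
    "x \<in> V \<Longrightarrow> x = (\<Sum>e\<in>E. (B e e * B x e) *\<^sub>R e)" "e \<in> E \<Longrightarrow> e \<in> V"
    using assms unfolding onb_def by blast+
  show "e \<in> E \<Longrightarrow> B e e * B e e = 1" using 1(3) by (metis abs_mult_self_eq mult.right_neutral)
qed

text \<open>An orthonormal extension of \<open>S\<close> of largest cardinality is complete, as the
  normalized defect of an expansion would enlarge it. A prescribed \<open>S\<close> makes it
  possible to have the normalized central element as a basis vector.\<close>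

lemma onb_extend:
  assumes V: "subspace V" and def: "\<And>x. x \<in> V \<Longrightarrow> x \<noteq> 0 \<Longrightarrow> B x x \<noteq> 0"
    and S: "finite S" "S \<subseteq> V" "\<And>e. e \<in> S \<Longrightarrow> \<bar>B e e\<bar> = 1" "\<And>e f. e \<in> S \<Longrightarrow> f \<in> S \<Longrightarrow> e \<noteq> f \<Longrightarrow> B e f = 0"
  obtains E where "S \<subseteq> E" "onb V E"
proof -
  define P where "P E \<longleftrightarrow> finite E \<and> S \<subseteq> E \<and> E \<subseteq> V \<and> (\<forall>e\<in>E. \<bar>B e e\<bar> = 1) \<and> (\<forall>e\<in>E. \<forall>f\<in>E. e \<noteq> f \<longrightarrow> B e f = 0)" for E
  have coeff: "B (\<Sum>e\<in>E. u e *\<^sub>R e) f = u f * B f f" if "P E" "f \<in> E" for E u f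
  proof -
    have "B (\<Sum>e\<in>E. u e *\<^sub>R e) f = (\<Sum>e\<in>E. u e * B e f)"
      by (simp add: B_sum B_simps)
    also have "\<dots> = (\<Sum>e\<in>E. if e = f then u f * B f f else 0)"
      using that by (intro sum.cong refl) (auto simp: P_def)
    finally show ?thesis using that by (simp add: P_def)
  qed
  have bound: "card E \<le> DIM('l)" if "P E" for E
  proof -
    have fin: "finite E" using that by (simp add: P_def)
    have "u f = 0" if "(\<Sum>v\<in>E. u v *\<^sub>R v) = 0" "f \<in> E" for u f
    proof -
      have "u f * B f f = 0" using coeff[OF \<open>P E\<close> that(2), of u] that(1) by (simp add: B_simps)
      moreover have "\<bar>B f f\<bar> = 1" using \<open>P E\<close> that(2) by (simp add: P_def)
      ultimately show ?thesis by auto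
    qed
    then have "independent E" by (rule real_vector.independent_if_scalars_zero[OF fin])
    then show ?thesis by (rule independent_card_le[THEN order.trans]) simp
  qed
  have "P S" using S by (auto simp: P_def)
  then obtain E where E: "P E" "\<And>E'. P E' \<Longrightarrow> card E' \<le> card E"
    using ex_has_greatest_nat[of P S card "Suc (DIM('l))"] bound by (metis le_imp_less_Suc)
  have "x = (\<Sum>e\<in>E. (B e e * B x e) *\<^sub>R e)" if x: "x \<in> V" for x
  proof (rule ccontr)
    assume neq: "x \<noteq> (\<Sum>e\<in>E. (B e e * B x e) *\<^sub>R e)"
    define y where "y = x - (\<Sum>e\<in>E. (B e e * B x e) *\<^sub>R e)"
    have y: "y \<in> V" "y \<noteq> 0"
      using neq x E(1) V by (auto simp: y_def P_def intro!: subspace_diff subspace_sum subspace_scale)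
    have yE: "B y e = 0" if "e \<in> E" for e
    proof -
      have "\<bar>B e e\<bar> = 1" using E(1) that by (simp add: P_def)
      then have "B e e * B e e = 1" by (metis abs_mult_self_eq mult.right_neutral)
      then show ?thesis
        using coeff[OF E(1) that, of "\<lambda>e. B e e * B x e"] by (simp add: y_def B_simps mult.assoc mult.commute)
    qed
    define c where "c = 1 / sqrt \<bar>B y y\<bar>"
    have "B y y \<noteq> 0" using def y by blast
    then have c: "\<bar>B (c *\<^sub>R y) (c *\<^sub>R y)\<bar> = 1"
      by (simp add: B_simps c_def abs_mult real_sqrt_mult_self)
    have cE: "B (c *\<^sub>R y) e = 0" "B e (c *\<^sub>R y) = 0" if "e \<in> E" for e
      using yE[OF that] B_sym[of e y] by (auto simp: B_simps)
    have "c *\<^sub>R y \<notin> E" using c cE by force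
    moreover have "P (insert (c *\<^sub>R y) E)"
      using E(1) c cE y(1) V by (auto simp: P_def intro: subspace_scale)
    ultimately show False using E(2)[of "insert (c *\<^sub>R y) E"] E(1) by (simp add: P_def)
  qed
  then show ?thesis using that[of E] E(1) by (auto simp: onb_def P_def)
qed

lemma onb_exists:
  assumes "V = k \<or> V = p"
  obtains E where "onb V E"
proof -
  have "subspace V" "\<And>x. x \<in> V \<Longrightarrow> x \<noteq> 0 \<Longrightarrow> B x x \<noteq> 0"
    using assms sub_k sub_p B_k_neg B_p_pos by force+
  from onb_extend[OF this, of "{}"] that show ?thesis by auto
qed

lemma onb_union:
  assumes E: "onb k E" and E': "onb p E'"
  shows "onb UNIV (E \<union> E')" and "E \<inter> E' = {}"
proof -
  note D = onbD[OF E] and D' = onbD[OF E']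
  have zero: "B e e' = 0" "B e' e = 0" if "e \<in> E" "e' \<in> E'" for e e'
    using that D(6) D'(6) B_kp by auto
  show disj: "E \<inter> E' = {}" using D(3) zero by fastforce
  have expand: "x = (\<Sum>e\<in>E \<union> E'. (B e e * B x e) *\<^sub>R e)" for x
  proof -
    obtain a b where ab: "a \<in> k" "b \<in> p" "x = a + b" by (rule kp_decomp)
    have "a = (\<Sum>e\<in>E. (B e e * B a e) *\<^sub>R e)" by (rule D(5)[OF ab(1)])
    also have "\<dots> = (\<Sum>e\<in>E. (B e e * B x e) *\<^sub>R e)"
      using D(6) ab B_kp(2)[of _ b] by (intro sum.cong) (auto simp: B_simps)
    finally have a: "a = (\<Sum>e\<in>E. (B e e * B x e) *\<^sub>R e)" .
    have "b = (\<Sum>e\<in>E'. (B e e * B b e) *\<^sub>R e)" by (rule D'(5)[OF ab(2)])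
    also have "\<dots> = (\<Sum>e\<in>E'. (B e e * B x e) *\<^sub>R e)"
      using D'(6) ab B_kp(1)[of a] by (intro sum.cong) (auto simp: B_simps)
    finally have b: "b = (\<Sum>e\<in>E'. (B e e * B x e) *\<^sub>R e)" .
    have "(\<Sum>e\<in>E \<union> E'. (B e e * B x e) *\<^sub>R e) = (\<Sum>e\<in>E. (B e e * B x e) *\<^sub>R e) + (\<Sum>e\<in>E'. (B e e * B x e) *\<^sub>R e)"
      by (rule sum.union_disjoint[OF D(1) D'(1) disj])
    then show ?thesis using a b ab(3) by metis
  qed
  show "onb UNIV (E \<union> E')"
  proof (unfold onb_def, intro conjI ballI impI)
    show "B e f = 0" if "e \<in> E \<union> E'" "f \<in> E \<union> E'" "e \<noteq> f" for e f
      using that zero D(4) D'(4) by blast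
    show "x = (\<Sum>e\<in>E \<union> E'. (B e e * B x e) *\<^sub>R e)" for x by (rule expand)
  qed (use D(1,3) D'(1,3) in auto)
qed

definition rbilinear :: "('l \<Rightarrow> 'l \<Rightarrow> 'v::complex_vector) \<Rightarrow> bool"
  where "rbilinear T \<longleftrightarrow>
    (\<forall>x y z. T (x + y) z = T x z + T y z) \<and> (\<forall>x y z. T z (x + y) = T z x + T z y) \<and>
    (\<forall>a x z. T (a *\<^sub>R x) z = complex_of_real a *\<^sub>C T x z) \<and> (\<forall>a x z. T z (a *\<^sub>R x) = complex_of_real a *\<^sub>C T z x)"

lemma
  assumes "rbilinear T"
  shows rbilinear_sum_left: "T (\<Sum>i\<in>I. f i *\<^sub>R g i) z = (\<Sum>i\<in>I. complex_of_real (f i) *\<^sub>C T (g i) z)"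
    and rbilinear_sum_right: "T z (\<Sum>i\<in>I. f i *\<^sub>R g i) = (\<Sum>i\<in>I. complex_of_real (f i) *\<^sub>C T z (g i))"
proof -
  have add: "T (x + y) z = T x z + T y z" "T z (x + y) = T z x + T z y"
    "T (a *\<^sub>R x) z = complex_of_real a *\<^sub>C T x z" "T z (a *\<^sub>R x) = complex_of_real a *\<^sub>C T z x" for a x y z
    using assms by (auto simp: rbilinear_def)
  have zero: "T 0 z = 0" "T z 0 = 0" for z
    using add(3)[of 0 0 z] add(4)[of z 0 0] by (simp_all add: complex_vector.scale_zero_left)
  show "T (\<Sum>i\<in>I. f i *\<^sub>R g i) z = (\<Sum>i\<in>I. complex_of_real (f i) *\<^sub>C T (g i) z)"
    "T z (\<Sum>i\<in>I. f i *\<^sub>R g i) = (\<Sum>i\<in>I. complex_of_real (f i) *\<^sub>C T z (g i))"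
    by (induction I rule: infinite_finite_induct) (auto simp: add zero)
qed

text \<open>The contraction of \<open>T\<close> with the tensor inverse to \<open>B\<close>; up to
  the sign \<open>B e e\<close>, each \<open>e\<close> is its own dual basis vector.\<close>

definition cas :: "'l set \<Rightarrow> ('l \<Rightarrow> 'l \<Rightarrow> 'v::complex_vector) \<Rightarrow> 'v"
  where "cas E T = (\<Sum>e\<in>E. complex_of_real (B e e) *\<^sub>C T e e)"

text \<open>Infinitesimal invariance of the inverse tensor: after expanding \<open>D e\<close>, the
  coefficients of \<open>T e f\<close> are antisymmetric in the matrix of \<open>D\<close> and
  cancel.\<close>

lemma cas_skew:
  assumes E: "onb V E" and T: "rbilinear T" and D: "\<And>x. x \<in> V \<Longrightarrow> D x \<in> V"
    and skew: "\<And>x y. x \<in> V \<Longrightarrow> y \<in> V \<Longrightarrow> B (D x) y = - B x (D y)"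
  shows "cas E (\<lambda>x y. T (D x) y + T x (D y)) = 0"
proof -
  have EV: "e \<in> V" if "e \<in> E" for e by (rule onbD(6)[OF E that])
  have expand: "D e = (\<Sum>f\<in>E. (B f f * B (D e) f) *\<^sub>R f)" if "e \<in> E" for e
    by (rule onbD(5)[OF E D[OF EV[OF that]]])
  let ?c = "\<lambda>e f. complex_of_real (B e e) * complex_of_real (B f f * B (D e) f)"
  have "(\<Sum>e\<in>E. complex_of_real (B e e) *\<^sub>C T (D e) e) = (\<Sum>e\<in>E. \<Sum>f\<in>E. ?c e f *\<^sub>C T f e)"
    using expand rbilinear_sum_left[OF T, of "\<lambda>f. B f f * B (D e) f" "\<lambda>f. f" E e for e]
    by (intro sum.cong refl) (metis (no_types, lifting) complex_vector.scale_sum_right scaleC_scaleC sum.cong)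
  also have "\<dots> = (\<Sum>e\<in>E. \<Sum>f\<in>E. ?c f e *\<^sub>C T e f)" by (rule sum.swap)
  finally have left: "(\<Sum>e\<in>E. complex_of_real (B e e) *\<^sub>C T (D e) e) = (\<Sum>e\<in>E. \<Sum>f\<in>E. ?c f e *\<^sub>C T e f)" .
  have right: "(\<Sum>e\<in>E. complex_of_real (B e e) *\<^sub>C T e (D e)) = (\<Sum>e\<in>E. \<Sum>f\<in>E. ?c e f *\<^sub>C T e f)"
    using expand rbilinear_sum_right[OF T, of e "\<lambda>f. B f f * B (D e) f" "\<lambda>f. f" E for e]
    by (intro sum.cong refl) (metis (no_types, lifting) complex_vector.scale_sum_right scaleC_scaleC sum.cong)
  have "cas E (\<lambda>x y. T (D x) y + T x (D y)) = (\<Sum>e\<in>E. \<Sum>f\<in>E. (?c f e + ?c e f) *\<^sub>C T e f)"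
    by (simp add: cas_def scaleC_add_right sum.distrib left right scaleC_add_left)
  also have "\<dots> = 0"
  proof (intro sum.neutral ballI)
    fix e f assume "e \<in> E" "f \<in> E"
    then have "B (D f) e = - B (D e) f" using skew[OF EV EV, of f e] B_sym[of f "D e"] by simp
    then have "?c f e + ?c e f = 0" by simp
    then show "(?c f e + ?c e f) *\<^sub>C T e f = 0" by (simp only: complex_vector.scale_zero_left)
  qed
  finally show ?thesis .
qed

text \<open>Independence of the contraction of the orthonormal basis, needed for the action of
  K.\<close>

lemma cas_isometry:
  assumes E: "onb UNIV E" and T: "rbilinear T"
    and f: "\<And>x. f (g x) = x" "\<And>x y. B (f x) (f y) = B x y"
  shows "cas E (\<lambda>x y. T (f x) (f y)) = cas E T"
proof -
  note ss = onbD(7)[OF E]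
  have expand: "x = (\<Sum>e\<in>E. (B e e * B x e) *\<^sub>R e)" for x by (rule onbD(5)[OF E UNIV_I])
  have Bfg: "B (f x) y = B x (g y)" for x y using f(2)[of x "g y"] by (simp add: f(1))
  have "T (f e) (f e) = (\<Sum>a\<in>E. \<Sum>b\<in>E. complex_of_real (B a a * B b b * (B (f e) a * B (f e) b)) *\<^sub>C T a b)" for e
  proof -
    have "T (f e) (f e) = T (\<Sum>a\<in>E. (B a a * B (f e) a) *\<^sub>R a) (\<Sum>b\<in>E. (B b b * B (f e) b) *\<^sub>R b)"
      using expand[of "f e"] by simp
    also have "\<dots> = (\<Sum>a\<in>E. \<Sum>b\<in>E. complex_of_real (B a a * B b b * (B (f e) a * B (f e) b)) *\<^sub>C T a b)"
      by (subst rbilinear_sum_left[OF T], subst rbilinear_sum_right[OF T])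
        (simp add: complex_vector.scale_sum_right scaleC_scaleC algebra_simps)
    finally show ?thesis .
  qed
  then have "cas E (\<lambda>x y. T (f x) (f y)) = (\<Sum>e\<in>E. \<Sum>a\<in>E. \<Sum>b\<in>E.
      complex_of_real (B a a * B b b * (B e e * B (f e) a * B (f e) b)) *\<^sub>C T a b)"
    by (simp add: cas_def complex_vector.scale_sum_right scaleC_scaleC algebra_simps)
  also have "\<dots> = (\<Sum>a\<in>E. \<Sum>b\<in>E. \<Sum>e\<in>E.
      complex_of_real (B a a * B b b * (B e e * B (f e) a * B (f e) b)) *\<^sub>C T a b)"
    by (subst sum.swap) (intro sum.cong refl sum.swap)
  also have "\<dots> = (\<Sum>a\<in>E. \<Sum>b\<in>E. complex_of_real (B a a * B b b * B a b) *\<^sub>C T a b)"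
  proof (intro sum.cong refl)
    fix a b assume "a \<in> E" "b \<in> E"
    have "(\<Sum>e\<in>E. B e e * B (f e) a * B (f e) b) = B (\<Sum>e\<in>E. (B e e * B (g a) e) *\<^sub>R e) (g b)"
      by (simp add: B_sum B_simps Bfg B_sym[of _ "g a"] mult.assoc)
    also have "\<dots> = B a b" using expand[of "g a"] f(2)[of "g a" "g b"] by (simp add: f(1))
    finally have sum: "(\<Sum>e\<in>E. B e e * B (f e) a * B (f e) b) = B a b" .
    have "(\<Sum>e\<in>E. complex_of_real (B a a * B b b * (B e e * B (f e) a * B (f e) b)) *\<^sub>C T a b)
      = complex_of_real (B a a * B b b * (\<Sum>e\<in>E. B e e * B (f e) a * B (f e) b)) *\<^sub>C T a b"
      by (simp add: complex_vector.scale_sum_left sum_distrib_left)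
    then show "(\<Sum>e\<in>E. complex_of_real (B a a * B b b * (B e e * B (f e) a * B (f e) b)) *\<^sub>C T a b)
      = complex_of_real (B a a * B b b * B a b) *\<^sub>C T a b" by (simp only: sum)
  qed
  also have "\<dots> = (\<Sum>a\<in>E. \<Sum>b\<in>E. if b = a then complex_of_real (B a a) *\<^sub>C T a a else 0)"
  proof (intro sum.cong refl)
    fix a b assume "a \<in> E" "b \<in> E"
    then show "complex_of_real (B a a * B b b * B a b) *\<^sub>C T a b = (if b = a then complex_of_real (B a a) *\<^sub>C T a a else 0)"
      using ss[of a] onbD(4)[OF E, of a b] by (cases "a = b") (auto simp: complex_vector.scale_zero_left mult.assoc)
  qed
  also have "\<dots> = cas E T" using onbD(1)[OF E] by (simp add: cas_def)
  finally show ?thesis .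
qed

subsection \<open>Irreducibility of \<open>p\<close>\<close>

text \<open>Let q' be the orthogonal complement of \<open>q\<close> in \<open>p\<close>. The
  brackets of \<open>q\<close> with q' lie in \<open>k\<close> and are orthogonal to
  \<open>k\<close>, so they vanish; therefore q + [q, q] is an ideal of the simple algebra, and its
  intersection with \<open>p\<close> is \<open>q\<close>.\<close>

lemma p_irreducible:
  assumes q: "subspace q" "q \<subseteq> p" "\<And>w x. w \<in> k \<Longrightarrow> x \<in> q \<Longrightarrow> br w x \<in> q"
  shows "q = {0} \<or> q = p"
proof -
  define q' where "q' = {x\<in>p. \<forall>y\<in>q. B x y = 0}"
  have q'k: "br w x \<in> q'" if "w \<in> k" "x \<in> q'" for w x
  proof -
    have "B (br w x) y = - B x (br w y)" for y
      using br_anti[of w x] by (simp add: B_simps B_inv)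
    then show ?thesis using that q(3) br_kp by (auto simp: q'_def)
  qed
  have comm: "br x y = 0" if "x \<in> q" "y \<in> q'" for x y
  proof (rule B_nondeg_k)
    show "br x y \<in> k" using that q(2) br_pp by (auto simp: q'_def)
    fix w assume w: "w \<in> k"
    have "B (br x y) w = - B (br w y) x"
      unfolding B_inv[of x] B_sym[of "br w y"] br_anti[of y w] by (simp add: B_simps)
    then show "B (br x y) w = 0" using q'k[OF w that(2)] that(1) by (auto simp: q'_def)
  qed
  have decomp: "\<exists>a\<in>q. \<exists>b\<in>q'. x = a + b" if x: "x \<in> p" for x
  proof -
    have "\<And>x. x \<in> q \<Longrightarrow> x \<noteq> 0 \<Longrightarrow> B x x \<noteq> 0" using q(2) B_p_pos by force
    then obtain E where E: "onb q E" using onb_extend[OF q(1), of "{}"] by auto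
    define a where "a = (\<Sum>e\<in>E. (B e e * B x e) *\<^sub>R e)"
    have a: "a \<in> q" unfolding a_def using onbD(6)[OF E]
      by (intro subspace_sum[OF q(1)] subspace_scale[OF q(1)])
    have "B (x - a) e = 0" if "e \<in> E" for e
    proof -
      have "B a e = (\<Sum>f\<in>E. B f f * B x f * B f e)"
        unfolding a_def B_sum by (simp add: B_simps)
      also have "\<dots> = (\<Sum>f\<in>E. if f = e then B x e else 0)"
        using onbD(4)[OF E _ that] onbD(7)[OF E that] by (intro sum.cong refl) (auto simp: mult.assoc mult.left_commute)
      finally show ?thesis using onbD(1)[OF E] that by (simp add: B_simps)
    qed
    then have "B (x - a) (\<Sum>e\<in>E. (B e e * B y e) *\<^sub>R e) = 0" for y
      by (simp add: B_sum B_simps)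
    then have "B (x - a) y = 0" if "y \<in> q" for y
      using onbD(5)[OF E that] by metis
    then have "x - a \<in> q'" using x a q(2) sub_p by (auto simp: q'_def subspace_diff)
    then show ?thesis using a by (intro bexI[of _ a] bexI[of _ "x - a"]) auto
  qed
  define Q where "Q = span {br x y | x y. x \<in> q \<and> y \<in> q}"
  have Qk: "Q \<subseteq> k" unfolding Q_def using q(2) br_pp by (intro span_minimal sub_k) auto
  define I where "I = {a + b | a b. a \<in> q \<and> b \<in> Q}"
  have subI: "subspace I"
    unfolding I_def using q(1) by (intro subspace_sums) (auto simp: Q_def)
  have qI: "q \<subseteq> I" unfolding I_def
    using span_0[of "{br x y | x y. x \<in> q \<and> y \<in> q}"] by (force simp: Q_def)
  have QI: "Q \<subseteq> I" unfolding I_def using subspace_0[OF q(1)] by force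
  have br_Q: "br x ` Q \<subseteq> I" if "\<And>y y'. y \<in> q \<Longrightarrow> y' \<in> q \<Longrightarrow> br x (br y y') \<in> I" for x
  proof -
    have "subspace {y. br x y \<in> I}"
      using subI by (auto simp: subspace_def br_simps)
    then have "Q \<subseteq> {y. br x y \<in> I}"
      unfolding Q_def using that by (intro span_minimal) auto
    then show ?thesis by auto
  qed
  have brq: "br y y' \<in> Q" if "y \<in> q" "y' \<in> q" for y y'
    unfolding Q_def using that by (intro span_base) auto
  have kQ: "br w ` Q \<subseteq> I" if w: "w \<in> k" for w
  proof (rule br_Q)
    fix y y' assume "y \<in> q" "y' \<in> q"
    then have "br (br w y) y' + br y (br w y') \<in> Q"
      using brq q(3)[OF w] unfolding Q_def by (intro span_add) auto
    then show "br w (br y y') \<in> I" using QI by (auto simp: jacobi[of w])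
  qed
  have qQ: "br x y \<in> I" if "x \<in> q" "y \<in> Q" for x y
    using q(3)[of y x] that Qk qI br_anti[of x y] subspace_neg[OF subI, of "br y x"] by (auto simp: subset_iff)
  have q'Q: "br x ` Q \<subseteq> I" if "x \<in> q'" for x
  proof (rule br_Q)
    fix y y' assume *: "y \<in> q" "y' \<in> q"
    have "br x (br y y') = 0"
      using comm[OF *(1) that] comm[OF *(2) that] br_anti[of x y] br_anti[of x y']
      by (simp add: jacobi[of x] br_simps)
    then show "br x (br y y') \<in> I" using subspace_0[OF subI] by simp
  qed
  have "I = {0} \<or> I = UNIV"
  proof (rule ideal[OF subI])
    fix x v assume "v \<in> I"
    then obtain a b where ab: "v = a + b" "a \<in> q" "b \<in> Q" unfolding I_def by blast
    obtain w m where wm: "w \<in> k" "m \<in> p" "x = w + m" by (rule kp_decomp)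
    obtain c d where cd: "c \<in> q" "d \<in> q'" "m = c + d" using decomp[OF wm(2)] by blast
    have "br x v = br w a + br w b + (br c a + br c b) + (br d a + br d b)"
      by (simp add: ab(1) wm(3) cd(3) br_simps)
    moreover have "br w a \<in> I" using q(3)[OF wm(1) ab(2)] qI by blast
    moreover have "br w b \<in> I" using kQ[OF wm(1)] ab(3) by blast
    moreover have "br c a \<in> I" using brq[OF cd(1) ab(2)] QI by blast
    moreover have "br c b \<in> I" using qQ[OF cd(1) ab(3)] .
    moreover have "br d a = 0" using comm[OF ab(2) cd(2)] br_anti[of d a] by simp
    moreover have "br d b \<in> I" using q'Q[OF cd(2)] ab(3) by blast
    ultimately show "br x v \<in> I" using subspace_add[OF subI] by simp
  qed
  then show ?thesis
  proof
    assume "I = {0}" then show ?thesis using qI subspace_0[OF q(1)] by auto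
  next
    assume "I = UNIV"
    have "p \<subseteq> q"
    proof
      fix x assume x: "x \<in> p"
      then obtain a b where ab: "x = a + b" "a \<in> q" "b \<in> Q"
        using \<open>I = UNIV\<close> unfolding I_def by blast
      have "b = x - a" using ab by simp
      moreover have "a \<in> p" using ab(2) q(2) by blast
      ultimately have "b \<in> p" using subspace_diff[OF sub_p x] by simp
      then have "b = 0" using ab(3) Qk kp_zero by blast
      then show "x \<in> q" using ab by simp
    qed
    then show ?thesis using q(2) by auto
  qed
qed

text \<open>A subspace containing \<open>k\<close> is \<open>k\<close> plus its intersection with
  \<open>p\<close>. The lemma identifies \<open>k\<close> inside an abstractly defined stabilizer in
  \<open>Adj_k\<close>.\<close>

lemma k_maximal:
  assumes h: "subspace h" "k \<subseteq> h" "\<And>w x. w \<in> k \<Longrightarrow> x \<in> h \<Longrightarrow> br w x \<in> h"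
  shows "h = k \<or> h = UNIV"
proof -
  have "h \<inter> p = {0} \<or> h \<inter> p = p"
    using h sub_p br_kp by (intro p_irreducible) (auto intro: subspace_inter)
  moreover have "x \<in> k" if "x \<in> h" "h \<inter> p = {0}" for x
  proof -
    obtain a b where ab: "a \<in> k" "b \<in> p" "x = a + b" by (rule kp_decomp)
    then have "b \<in> h" using that(1) h(1,2) subspace_diff[of h x a] by auto
    then have "b = 0" using ab(2) that(2) by blast
    then show ?thesis using ab by simp
  qed
  moreover have "x \<in> h" if "h \<inter> p = p" for x
  proof -
    obtain a b where ab: "a \<in> k" "b \<in> p" "x = a + b" by (rule kp_decomp)
    then show ?thesis using that h(1,2) subspace_add[of h a b] by auto
  qed
  ultimately show ?thesis using h(2) by blast
qed

end

section \<open>Submodules of the complexified isotropy representation and invariant complex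
  structures\<close>

section \<open>Complexification and Hermitian type\<close>

lemmas complexification_simps = zero_complexification_def plus_complexification_def
  minus_complexification_def uminus_complexification_def scaleC_complexification_def

lemma real_part_sum: "real_part (\<Sum>i\<in>I. f i) = (\<Sum>i\<in>I. real_part (f i))"
  and imag_part_sum: "imag_part (\<Sum>i\<in>I. f i) = (\<Sum>i\<in>I. imag_part (f i))"
  by (induction I rule: infinite_finite_induct) (auto simp: complexification_simps)

lemma cfinite_dim_complexification:
  "cfinite_dim (UNIV :: 'l::euclidean_space complexification set)"
proof -
  let ?B = "(\<lambda>b. Complexify b 0) ` (Basis :: 'l set)"
  have sub: "csubspace (cspan ?B)" by simp
  have re: "Complexify x 0 \<in> cspan ?B" for x :: 'l
  proof -
    have sum: "Complexify (\<Sum>b\<in>I. f b *\<^sub>R b) 0 = (\<Sum>b\<in>I. complex_of_real (f b) *\<^sub>C Complexify b 0)" for f and I :: "'l set"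
      by (rule complexification.expand)
        (simp add: real_part_sum imag_part_sum, simp add: complexification_simps)
    have "Complexify x 0 = (\<Sum>b\<in>Basis. complex_of_real (x \<bullet> b) *\<^sub>C Complexify b 0)"
      unfolding sum[symmetric] by (simp add: euclidean_representation)
    also have "\<dots> \<in> cspan ?B"
      by (intro csub_simps(6)[OF sub] csub_simps(3)[OF sub]) (auto intro: complex_vector.span_base)
    finally show ?thesis .
  qed
  have "u \<in> cspan ?B" for u
  proof -
    have "u = Complexify (real_part u) 0 + \<i> *\<^sub>C Complexify (imag_part u) 0"
      by (simp add: complexification_simps)
    also have "\<dots> \<in> cspan ?B"
      by (intro csub_simps(2)[OF sub] csub_simps(3)[OF sub] re)
    finally show ?thesis .
  qed
  then have "(UNIV :: 'l complexification set) = cspan ?B" by auto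
  then show ?thesis using cfinite_dimI[of ?B] by simp
qed

context cartan
begin

text \<open>The complex bilinear, not Hermitian, extension of \<open>B\<close>.\<close>

definition BC :: "'l complexification \<Rightarrow> 'l complexification \<Rightarrow> complex"
  where "BC u v = Complex (B (real_part u) (real_part v) - B (imag_part u) (imag_part v))
    (B (real_part u) (imag_part v) + B (imag_part u) (real_part v))"

lemma BC_sym: "BC u v = BC v u"
  unfolding BC_def using B_sym by (metis add.commute)

lemma clinear_BC: "clinear (BC u)"
  by (rule clinearI)
    (simp_all add: BC_def complexification_simps complex_eq_iff B_simps scaleC_complex_def algebra_simps)

lemma clinear_BC': "clinear (\<lambda>u. BC u v)"
  using clinear_BC[of v] by (subst BC_sym)

lemma BC_inv: "BC (complexify_bracket br u v) w = BC u (complexify_bracket br v w)"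
  by (simp add: BC_def complexify_bracket_def complex_eq_iff B_simps B_inv)

lemma complexify_bracket_anti: "complexify_bracket br u v = - complexify_bracket br v u"
  using br_anti[of "real_part u" "real_part v"] br_anti[of "real_part u" "imag_part v"]
    br_anti[of "imag_part u" "real_part v"] br_anti[of "imag_part u" "imag_part v"]
  by (simp add: complexify_bracket_def complexification_simps)

definition kC where "kC = complexify_set k"
definition pC where "pC = complexify_set p"

lemma csub_pC: "csubspace pC"
  using sub_p
  by (auto intro!: csubspaceI simp: kC_def pC_def complexify_set_def complexification_simps
      subspace_def subspace_diff)

lemma pC_trivial:
  assumes "p = {0}" shows "pC = {0}"
proof -
  have "u = 0" if "u \<in> pC" for u
    using that assms by (cases u) (simp add: pC_def complexify_set_def zero_complexification_def)
  then show ?thesis using csub_simps(1)[OF csub_pC] by blast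
qed

lemma BC_perp_kC: "(\<And>u. u \<in> kC \<Longrightarrow> BC v u = 0) \<Longrightarrow> v \<in> pC"
proof -
  assume v: "\<And>u. u \<in> kC \<Longrightarrow> BC v u = 0"
  have "x \<in> p" if x: "\<And>y. y \<in> k \<Longrightarrow> B x y = 0" for x
  proof -
    obtain a b where ab: "a \<in> k" "b \<in> p" "x = a + b" by (rule kp_decomp)
    have "B a y = 0" if "y \<in> k" for y
      using x[OF that] B_kp(2)[OF that ab(2)] by (simp add: ab(3) B_simps)
    then have "a = 0" using B_nondeg_k ab(1) by blast
    then show ?thesis using ab by simp
  qed
  moreover have "B (real_part v) y = 0" "B (imag_part v) y = 0" if "y \<in> k" for y
    using v[of "Complexify y 0"] that subspace_0[OF sub_k]
    by (auto simp: BC_def kC_def complexify_set_def B_simps complex_eq_iff)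
  ultimately show ?thesis by (simp add: pC_def complexify_set_def)
qed

lemma BC_represent:
  assumes "clinear (f :: 'l complexification \<Rightarrow> complex)"
  obtains u where "f = BC u"
proof -
  obtain Ek Ep where E: "onb k Ek" "onb p Ep" by (metis onb_exists)
  define E where "E = Ek \<union> Ep"
  have E: "onb UNIV E" unfolding E_def by (rule onb_union(1)[OF E])
  have repr: "\<exists>x. \<forall>y. B x y = g y" if g: "linear g" for g :: "'l \<Rightarrow> real"
  proof (intro exI allI)
    fix y
    have "B (\<Sum>e\<in>E. (B e e * g e) *\<^sub>R e) y = (\<Sum>e\<in>E. (B e e * B y e) * g e)"
      unfolding B_sum by (simp add: B_simps B_sym[of _ y] algebra_simps)
    also have "\<dots> = g (\<Sum>e\<in>E. (B e e * B y e) *\<^sub>R e)"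
      by (simp add: linear_sum[OF g] linear_scale[OF g])
    also have "\<dots> = g y" using onbD(5)[OF E UNIV_I, of y] by simp
    finally show "B (\<Sum>e\<in>E. (B e e * g e) *\<^sub>R e) y = g y" .
  qed
  have lin: "linear (\<lambda>y. Re (f (Complexify y 0)))" "linear (\<lambda>y. Im (f (Complexify y 0)))"
  proof -
    have 1: "f (Complexify (a + b) 0) = f (Complexify a 0) + f (Complexify b 0)" for a b
      using clinear_add[OF assms, of "Complexify a 0" "Complexify b 0"] by (simp add: complexification_simps)
    have 2: "f (Complexify (c *\<^sub>R a) 0) = complex_of_real c * f (Complexify a 0)" for a c
      using clinear_scale[OF assms, of "complex_of_real c" "Complexify a 0"]
      by (simp add: complexification_simps scaleC_complex_def)
    show "linear (\<lambda>y. Re (f (Complexify y 0)))" "linear (\<lambda>y. Im (f (Complexify y 0)))"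
      by (rule linearI; simp add: 1 2)+
  qed
  obtain x y where xy: "\<And>z. B x z = Re (f (Complexify z 0))" "\<And>z. B y z = Im (f (Complexify z 0))"
    using repr[OF lin(1)] repr[OF lin(2)] by blast
  have "f u = BC (Complexify x y) u" for u
  proof -
    have "u = Complexify (real_part u) 0 + \<i> *\<^sub>C Complexify (imag_part u) 0"
      by (simp add: complexification_simps)
    then have "f u = f (Complexify (real_part u) 0) + \<i> * f (Complexify (imag_part u) 0)"
      using clinear_simps(1,2)[OF assms] by (metis scaleC_complex_def)
    then show ?thesis by (simp add: BC_def xy complex_eq_iff)
  qed
  then show ?thesis using that by blast
qed

lemma BC_double_perp:
  assumes M: "csubspace M" and u: "\<And>v. (\<And>m. m \<in> M \<Longrightarrow> BC m v = 0) \<Longrightarrow> BC u v = 0"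
  shows "u \<in> M"
proof (rule functional_zero_imp_mem[OF M])
  fix l :: "'l complexification \<Rightarrow> complex" assume l: "clinear l" "\<And>w. w \<in> M \<Longrightarrow> l w = 0"
  obtain v where v: "l = BC v" using BC_represent[OF l(1)] by blast
  have "BC u v = 0" using l(2) by (intro u) (simp add: v BC_sym)
  then show "l u = 0" by (simp add: v BC_sym)
qed

lemma B_p_nonneg: "x \<in> p \<Longrightarrow> B x x \<ge> 0"
  using B_p_pos[of x] by (cases "x = 0") (auto simp: B_simps)

text \<open>\<open>x\<close> and \<open>y\<close> are the real and imaginary parts of an eigenvector in \<open>pC\<close>.\<close>

lemma p_eigenvector:
  assumes f: "linear f" "\<And>x. x \<in> p \<Longrightarrow> f x \<in> p" and "p \<noteq> {0}"
  obtains a b x y where "x \<in> p" "y \<in> p" "B x x + B y y > 0"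
    "f x = a *\<^sub>R x - b *\<^sub>R y" "f y = a *\<^sub>R y + b *\<^sub>R x"
proof -
  note fs = linear_add[OF f(1)] linear_diff[OF f(1)] linear_scale[OF f(1)]
  let ?F = "\<lambda>u. Complexify (f (real_part u)) (f (imag_part u))"
  obtain x0 where x0: "x0 \<in> p" "x0 \<noteq> 0" using assms(3) subspace_0[OF sub_p] by auto
  then have "Complexify x0 0 \<in> pC" "Complexify x0 0 \<noteq> 0"
    using subspace_0[OF sub_p] by (auto simp: pC_def complexify_set_def complexification_simps)
  then have nz: "pC \<noteq> {0}" by blast
  have lin: "clinear ?F"
    by (rule clinearI) (simp_all add: complexification_simps fs)
  have st: "?F ` pC \<subseteq> pC" using f(2) by (auto simp: pC_def complexify_set_def)
  from eigenvector_exists[OF lin csub_pC nz st cfinite_dim_subset[OF cfinite_dim_complexification csub_pC subset_UNIV]]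
  obtain l u where u: "u \<in> pC" "u \<noteq> 0" "?F u = l *\<^sub>C u" .
  have xy: "real_part u \<in> p" "imag_part u \<in> p" "real_part u \<noteq> 0 \<or> imag_part u \<noteq> 0"
    using u(1,2) by (auto simp: pC_def complexify_set_def zero_complexification_def complexification.expand)
  have "B (real_part u) (real_part u) \<ge> 0" "B (imag_part u) (imag_part u) \<ge> 0"
    using B_p_nonneg xy by auto
  then have "B (real_part u) (real_part u) + B (imag_part u) (imag_part u) > 0"
    using B_p_pos[OF xy(1)] B_p_pos[OF xy(2)] xy(3) by fastforce
  moreover have "f (real_part u) = Re l *\<^sub>R real_part u - Im l *\<^sub>R imag_part u"
    "f (imag_part u) = Re l *\<^sub>R imag_part u + Im l *\<^sub>R real_part u"
    using u(3) by (simp_all add: scaleC_complexification_def)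
  ultimately show ?thesis using that xy(1,2) by blast
qed

text \<open>Symmetry makes the eigenvalue of \<open>p_eigenvector\<close> real, so real and
  imaginary part of the eigenvector are eigenvectors themselves, and the real eigenspace is stable
  under \<open>k\<close>.\<close>

lemma p_schur_symmetric:
  assumes f: "linear f" "\<And>x. x \<in> p \<Longrightarrow> f x \<in> p" "\<And>w x. w \<in> k \<Longrightarrow> x \<in> p \<Longrightarrow> f (br w x) = br w (f x)"
    and sym: "\<And>x y. x \<in> p \<Longrightarrow> y \<in> p \<Longrightarrow> B (f x) y = B x (f y)" and nz: "p \<noteq> {0}"
  obtains a where "\<And>x. x \<in> p \<Longrightarrow> f x = a *\<^sub>R x"
proof -
  obtain a b x y where xy: "x \<in> p" "y \<in> p" "B x x + B y y > 0"
    "f x = a *\<^sub>R x - b *\<^sub>R y" "f y = a *\<^sub>R y + b *\<^sub>R x" by (rule p_eigenvector[OF f(1,2) nz])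
  have "b * (B x x + B y y) = 0"
    using sym[OF xy(1,2)] by (simp add: xy(4,5) B_simps B_sym[of y x] algebra_simps)
  then have b: "b = 0" using xy(3) by simp
  define q where "q = {x\<in>p. f x = a *\<^sub>R x}"
  have "subspace q"
    using sub_p by (auto simp: q_def subspace_def linear_add[OF f(1)] linear_scale[OF f(1)] linear_0[OF f(1)] scaleR_add_right)
  moreover have "br w x \<in> q" if "w \<in> k" "x \<in> q" for w x
    using that br_kp f(3) by (auto simp: q_def br_simps)
  ultimately have "q = {0} \<or> q = p" by (intro p_irreducible) (auto simp: q_def)
  moreover have "x \<in> q" "y \<in> q" using xy b by (auto simp: q_def)
  moreover have "x \<noteq> 0 \<or> y \<noteq> 0" using xy(3) by (auto simp: B_simps)
  ultimately have "q = p" by blast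
  then show ?thesis using that[of a] by (auto simp: q_def)
qed

definition center_k where "center_k = {z\<in>k. \<forall>x\<in>k. br z x = 0}"

lemma center_kD: "z \<in> center_k \<Longrightarrow> z \<in> k" "z \<in> center_k \<Longrightarrow> w \<in> k \<Longrightarrow> br z w = 0"
  "w \<in> k \<Longrightarrow> z \<in> center_k \<Longrightarrow> br z (br w x) = br w (br z x)"
proof -
  show 1: "z \<in> center_k \<Longrightarrow> z \<in> k" "z \<in> center_k \<Longrightarrow> w \<in> k \<Longrightarrow> br z w = 0"
    by (auto simp: center_k_def)
  show "w \<in> k \<Longrightarrow> z \<in> center_k \<Longrightarrow> br z (br w x) = br w (br z x)"
    using 1(2) jacobi[of z w x] by (simp add: br_simps)
qed

lemma B_skew: "B (br z x) y = - B x (br z y)"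
  using B_inv[of x z y] br_anti[of z x] by (simp add: B_simps)

text \<open>The square of ad c is symmetric and commutes with \<open>k\<close>, hence is a scalar on
  \<open>p\<close>; the scalar is negative because ad c is skew and non-zero on
  \<open>p\<close>.\<close>

lemma center_scaled:
  assumes nz: "p \<noteq> {0}" and c: "c \<in> center_k" "c \<noteq> 0"
  obtains r where "r > 0" "\<And>x. x \<in> p \<Longrightarrow> br c (br c x) = - (r *\<^sub>R x)"
proof -
  have ck: "c \<in> k" using c(1) by (simp add: center_k_def)
  have cp: "br c x \<in> p" if "x \<in> p" for x using br_kp[OF ck that] .
  obtain a where a: "\<And>x. x \<in> p \<Longrightarrow> br c (br c x) = a *\<^sub>R x"
  proof (rule p_schur_symmetric[of "\<lambda>x. br c (br c x)"])
    show "linear (\<lambda>x. br c (br c x))" using linear_compose[OF lin_br lin_br, of c c] by (simp add: o_def)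
    show "br c (br c x) \<in> p" if "x \<in> p" for x using cp that by blast
    show "br c (br c (br w x)) = br w (br c (br c x))" if "w \<in> k" for w x
      using center_kD(3)[OF that c(1)] by metis
    show "B (br c (br c x)) y = B x (br c (br c y))" for x y by (simp add: B_skew)
  qed (use nz in auto)
  have "\<exists>x\<in>p. br c x \<noteq> 0"
    using center_zero_k[OF ck] c by (auto simp: center_k_def)
  then obtain x where x: "x \<in> p" "br c x \<noteq> 0" by blast
  then have "x \<noteq> 0" by (auto simp: br_simps)
  have "B (br c x) (br c x) > 0" using B_p_pos cp x by blast
  then have "a * B x x < 0" using a[OF x(1)] by (simp add: B_skew B_simps)
  then have "a < 0" using B_p_pos[OF x(1) \<open>x \<noteq> 0\<close>] by (simp add: mult_less_0_iff)
  then show ?thesis using a that[of "- a"] by auto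
qed

text \<open>These \<open>z\<close> give the K-invariant complex structures of the symmetric space;
  \<open>hermitian_iff\<close> relates their existence to the dimension of the centre of
  \<open>k\<close>.\<close>

definition complex_structure :: "'l \<Rightarrow> bool"
  where "complex_structure z \<longleftrightarrow> z \<in> center_k \<and> (\<forall>x\<in>p. br z (br z x) = - x)"

lemma sub_center: "subspace center_k"
  using sub_k by (auto simp: center_k_def subspace_def br_simps)

lemma complex_structure_exists:
  assumes "p \<noteq> {0}" "c \<in> center_k" "c \<noteq> 0"
  obtains z t where "complex_structure z" "c = t *\<^sub>R z"
proof -
  obtain r where r: "r > 0" "\<And>x. x \<in> p \<Longrightarrow> br c (br c x) = - (r *\<^sub>R x)" using center_scaled[OF assms] by metis
  let ?z = "(1 / sqrt r) *\<^sub>R c"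
  have "?z \<in> center_k" using assms(2) sub_center subspace_scale by blast
  moreover have "br ?z (br ?z x) = - x" if "x \<in> p" for x
    using r that by (simp add: br_simps real_sqrt_mult_self)
  ultimately have "complex_structure ?z" by (simp add: complex_structure_def)
  moreover have "c = sqrt r *\<^sub>R ?z" using r(1) by simp
  ultimately show ?thesis using that by blast
qed

text \<open>The product of ad z and ad z' is symmetric on \<open>p\<close>, hence a scalar
  \<open>a\<close>. Then z' + a z acts trivially on \<open>k\<close> and on \<open>p\<close>, so it
  is zero, and comparing squares gives a^2 = 1.\<close>

lemma complex_structure_unique:
  assumes "p \<noteq> {0}" "complex_structure z" "complex_structure z'"
  shows "z' = z \<or> z' = - z"
proof -
  have z: "z \<in> center_k" "z' \<in> center_k" "z \<in> k" "z' \<in> k"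
    using assms(2,3) by (auto simp: complex_structure_def center_k_def)
  have zz: "br z (br z x) = - x" "br z' (br z' x) = - x" if "x \<in> p" for x
    using assms(2,3) that by (auto simp: complex_structure_def)
  have inp: "br z x \<in> p" "br z' x \<in> p" if "x \<in> p" for x using br_kp z that by auto
  have comm: "br z (br z' x) = br z' (br z x)" for x using center_kD(3)[OF z(4) z(1)] .
  obtain a where a: "\<And>x. x \<in> p \<Longrightarrow> br z (br z' x) = a *\<^sub>R x"
  proof (rule p_schur_symmetric[of "\<lambda>x. br z (br z' x)"])
    show "linear (\<lambda>x. br z (br z' x))" using linear_compose[OF lin_br lin_br, of z z'] by (simp add: o_def)
    show "br z (br z' (br w x)) = br w (br z (br z' x))" if "w \<in> k" for w x
      using center_kD(3)[OF that z(1)] center_kD(3)[OF that z(2)] by metis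
    show "B (br z (br z' x)) y = B x (br z (br z' y))" for x y by (simp add: B_skew comm)
  qed (use assms(1) inp in auto)
  have z'a: "br z' x = - (a *\<^sub>R br z x)" if "x \<in> p" for x
    using a[OF inp(1)[OF that]] zz(1)[OF that] comm[of "br z x"]
    by (metis a br_simps(6) inp(2) that zz(1) minus_equation_iff)
  have diff: "z' + a *\<^sub>R z = 0"
  proof (rule center_zero_k)
    show "z' + a *\<^sub>R z \<in> k" using z sub_k by (intro subspace_add subspace_scale) auto
    show "br (z' + a *\<^sub>R z) x = 0" if "x \<in> k" for x
      using z(1,2) that by (simp add: br_simps center_k_def)
    show "br (z' + a *\<^sub>R z) x = 0" if "x \<in> p" for x
      using z'a[OF that] by (simp add: br_simps)
  qed
  obtain x where x: "x \<in> p" "x \<noteq> 0" using assms(1) subspace_0[OF sub_p] by auto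
  have "z' = (- a) *\<^sub>R z" using diff by (simp add: eq_neg_iff_add_eq_0)
  then have "(a * a) *\<^sub>R br z (br z x) = - x"
    using zz(2)[OF x(1)] by (simp add: br_simps)
  then have "(1 - a * a) *\<^sub>R x = 0" using zz(1)[OF x(1)] by (simp add: algebra_simps)
  then have "a * a = 1" using x(2) by simp
  then have "(a - 1) * (a + 1) = 0" by (simp add: algebra_simps)
  then have "a = 1 \<or> a = -1" by auto
  then show ?thesis using \<open>z' = (- a) *\<^sub>R z\<close> by auto
qed

text \<open>Every non-zero central element of \<open>k\<close> is a multiple of a complex structure,
  and there are only two of these.\<close>

lemma center_span:
  assumes "p \<noteq> {0}" "complex_structure z"
  shows "center_k = span {z}"
proof
  show "span {z} \<subseteq> center_k"
    using assms(2) sub_center by (intro span_minimal) (auto simp: complex_structure_def)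
  show "center_k \<subseteq> span {z}"
  proof
    fix c assume c: "c \<in> center_k"
    show "c \<in> span {z}"
    proof (cases "c = 0")
      case False
      obtain z' t where z': "complex_structure z'" "c = t *\<^sub>R z'"
        by (rule complex_structure_exists[OF assms(1) c False])
      then have "z' = z \<or> z' = - z" using complex_structure_unique[OF assms] by blast
      then show ?thesis using z'(2) span_base[of z "{z}"] span_scale span_neg by (metis insertI1)
    qed (simp add: span_zero)
  qed
qed

lemma complex_structure_nonzero:
  assumes "p \<noteq> {0}" "complex_structure z"
  shows "z \<noteq> 0"
proof
  assume "z = 0"
  obtain x where x: "x \<in> p" "x \<noteq> 0" using assms(1) subspace_0[OF sub_p] by auto
  then have "br z (br z x) = - x" using assms(2) by (auto simp: complex_structure_def)
  then show False using x \<open>z = 0\<close> by (simp add: br_simps)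
qed

lemma hermitian_iff:
  assumes "p \<noteq> {0}"
  shows "hermitian_type br k \<longleftrightarrow> (\<exists>z. complex_structure z)"
proof
  assume "hermitian_type br k"
  then have "dim center_k = 1" by (simp add: hermitian_type_def center_k_def)
  then have "\<not> center_k \<subseteq> {0}" using dim_eq_0[of center_k] by simp
  then obtain c where "c \<in> center_k" "c \<noteq> 0" by blast
  then show "\<exists>z. complex_structure z" using complex_structure_exists[OF assms] by metis
next
  assume "\<exists>z. complex_structure z"
  then obtain z where z: "complex_structure z" by blast
  have "dim (span {z}) = 1"
    using complex_structure_nonzero[OF assms z] by (subst dim_span) (simp add: dim_eq_card_independent)
  then show "hermitian_type br k"
    using center_span[OF assms z] by (simp add: hermitian_type_def center_k_def)
qed

text \<open>The functional x |-> tr (D ad x) is represented by some \<open>z\<close>. For D' = D -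
  ad z it vanishes, and B (D' x) y is tr (D' ad [x, y]), so D' = 0.\<close>

lemma inner_derivation:
  assumes D: "linear D" and der: "\<And>x y. D (br x y) = br (D x) y + br x (D y)"
  obtains z where "\<And>x. D x = br z x"
proof -
  have lin: "linear (\<lambda>x. op_trace (\<lambda>b. D (br x b)))"
    by (rule linearI) (simp_all add: br_simps linear_add[OF D] linear_scale[OF D] op_trace_add op_trace_scale)
  obtain Ek Ep where E: "onb k Ek" "onb p Ep" by (metis onb_exists)
  define E where "E = Ek \<union> Ep"
  have E: "onb UNIV E" unfolding E_def by (rule onb_union(1)[OF E])
  define z where "z = (\<Sum>e\<in>E. (B e e * op_trace (\<lambda>b. D (br e b))) *\<^sub>R e)"
  have z: "B z x = op_trace (\<lambda>b. D (br x b))" for x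
  proof -
    have "B z x = (\<Sum>e\<in>E. (B e e * B x e) * op_trace (\<lambda>b. D (br e b)))"
      unfolding z_def B_sum by (simp add: B_simps B_sym[of _ x] algebra_simps)
    also have "\<dots> = op_trace (\<lambda>b. D (br (\<Sum>e\<in>E. (B e e * B x e) *\<^sub>R e) b))"
      by (simp add: linear_sum[OF lin] linear_scale[OF lin])
    also have "(\<Sum>e\<in>E. (B e e * B x e) *\<^sub>R e) = x" using onbD(5)[OF E UNIV_I, of x] by simp
    finally show ?thesis .
  qed
  define D' where "D' x = D x - br z x" for x
  have D': "linear D'" unfolding D'_def by (rule linear_compose_sub[OF D lin_br])
  have der': "D' (br x y) = br (D' x) y + br x (D' y)" for x y
    by (simp add: D'_def der jacobi[of z] br_simps)
  have tr: "op_trace (\<lambda>b. D' (br x b)) = 0" for x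
    using z[of x] B_trace[of z x] by (simp add: D'_def op_trace_diff)
  have "D' x = 0" for x
  proof (rule B_nondeg)
    fix y
    have "br (D' x) (br y b) = D' (br x (br y b)) - br x (D' (br y b))" for b
      by (simp add: der'[of x])
    then have "B (D' x) y = op_trace (\<lambda>b. D' (br x (br y b))) - op_trace (\<lambda>b. br x (D' (br y b)))"
      by (simp add: B_trace op_trace_diff)
    also have "op_trace (\<lambda>b. br x (D' (br y b))) = op_trace (\<lambda>b. D' (br y (br x b)))"
      using op_trace_commute[OF lin_br linear_compose[OF lin_br D'], of x y] by (simp add: o_def)
    also have "op_trace (\<lambda>b. D' (br x (br y b))) - op_trace (\<lambda>b. D' (br y (br x b))) = 0"
      using trace_bracket[OF D', of x y] tr[of "br x y"] by simp
    finally show "B (D' x) y = 0" .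
  qed
  then show ?thesis using that[of z] by (simp add: D'_def)
qed

text \<open>The \<open>\<i>\<close>-eigenspace of \<open>ad z\<close> in \<open>pC\<close>.\<close>

definition pz :: "'l \<Rightarrow> 'l complexification set"
  where "pz z = {Complexify x (- br z x) | x. x \<in> p}"

lemma ppart_kp: "x \<in> p \<Longrightarrow> ppart x = x" "x \<in> k \<Longrightarrow> ppart x = 0"
proof -
  show "x \<in> k \<Longrightarrow> ppart x = 0" by (simp add: ppart_def k_def)
  show "x \<in> p \<Longrightarrow> ppart x = x"
    using scaleR_half_double[of x] by (simp add: ppart_def p_def)
qed

lemma linear_ppart: "linear ppart"
  by (rule linearI) (simp_all add: ppart_def \<theta>_simps scaleR_add_right scaleR_diff_right algebra_simps)

text \<open>Let \<open>T\<close> be the adjoint of \<open>D\<close>. The symmetric operator D + T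
  commutes with \<open>k\<close> and is a scalar \<open>a\<close>. If \<open>a\<close> were
  non-zero, \<open>D\<close> itself would be the scalar a/2, whose square is not -1.\<close>

lemma commutant_structure_skew:
  assumes D: "linear D" "\<And>x. x \<in> p \<Longrightarrow> D x \<in> p" "\<And>w x. w \<in> k \<Longrightarrow> x \<in> p \<Longrightarrow> D (br w x) = br w (D x)"
    and sq: "\<And>x. x \<in> p \<Longrightarrow> D (D x) = - x" and nz: "p \<noteq> {0}"
    and xy: "x \<in> p" "y \<in> p"
  shows "B (D x) y = - B x (D y)"
proof -
  obtain E where E: "onb p E" by (metis onb_exists)
  have pos: "B e e = 1" if "e \<in> E" for e
    using onbD(3)[OF E that] B_p_nonneg[OF onbD(6)[OF E that]] by simp
  define T where "T x = (\<Sum>e\<in>E. B x (D e) *\<^sub>R e)" for x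
  have linT: "linear T"
    by (rule linearI) (simp_all add: T_def B_simps scaleR_add_left sum.distrib scaleR_sum_right)
  have Tp: "T x \<in> p" for x
    unfolding T_def using onbD(6)[OF E] by (intro subspace_sum subspace_scale sub_p)
  have adj: "B (T x) y = B x (D y)" if y: "y \<in> p" for x y
  proof -
    have "B (T x) y = (\<Sum>e\<in>E. (B e e * B y e) * B x (D e))"
      unfolding T_def B_sum using pos by (simp add: B_simps B_sym[of _ y] mult.commute cong: sum.cong)
    also have "\<dots> = B x (D (\<Sum>e\<in>E. (B e e * B y e) *\<^sub>R e))"
      by (simp add: linear_sum[OF D(1)] linear_scale[OF D(1)] B_sum B_simps)
    finally show ?thesis using onbD(5)[OF E y] by simp
  qed
  have commT: "T (br w x) = br w (T x)" if w: "w \<in> k" and x: "x \<in> p" for w x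
  proof -
    have "T (br w x) - br w (T x) = 0"
    proof (rule B_nondeg_p)
      show "T (br w x) - br w (T x) \<in> p" using Tp br_kp[OF w Tp] sub_p subspace_diff by blast
      fix y assume y: "y \<in> p"
      have "B (T (br w x)) y = B (br w (T x)) y"
        using adj[OF y] adj[OF br_kp[OF w y]] D(3)[OF w y] by (simp add: B_skew)
      then show "B (T (br w x) - br w (T x)) y = 0" by (simp add: B_simps)
    qed
    then show ?thesis by simp
  qed
  obtain a where a: "\<And>x. x \<in> p \<Longrightarrow> D x + T x = a *\<^sub>R x"
  proof (rule p_schur_symmetric[of "\<lambda>x. D x + T x"])
    show "linear (\<lambda>x. D x + T x)" by (rule linear_compose_add[OF D(1) linT])
    show "D x + T x \<in> p" if "x \<in> p" for x using D(2)[OF that] Tp sub_p subspace_add by blast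
    show "D (br w x) + T (br w x) = br w (D x + T x)" if "w \<in> k" "x \<in> p" for w x
      using D(3)[OF that] commT[OF that] by (simp add: br_simps)
    show "B (D x + T x) y = B x (D y + T y)" if "x \<in> p" "y \<in> p" for x y
      using adj[OF that(1), of y] adj[OF that(2), of x] B_sym[of "T y" x] B_sym[of y "D x"] by (simp add: B_simps)
    show "p \<noteq> {0}" by (rule nz)
  qed metis
  have rel: "B x (D y) = a * B x y - B (D x) y" if "x \<in> p" "y \<in> p" for x y
  proof -
    have "T x = a *\<^sub>R x - D x" using a[OF that(1)] by (simp add: algebra_simps)
    then show ?thesis using adj[OF that(2), of x] by (simp add: B_simps)
  qed
  have "a = 0"
  proof (rule ccontr)
    assume "a \<noteq> 0"
    \<comment> \<open>Applying \<open>rel\<close> to (x, D y) and to (D x, y) and using D^2 = -1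
      shows that \<open>D\<close> is symmetric, since \<open>a\<close> is non-zero.\<close>
    have half: "D y = (a / 2) *\<^sub>R y" if y: "y \<in> p" for y
    proof -
      have "D y - (a / 2) *\<^sub>R y = 0"
      proof (rule B_nondeg_p)
        show "D y - (a / 2) *\<^sub>R y \<in> p" using D(2)[OF y] y sub_p subspace_diff subspace_scale by blast
        fix x assume x: "x \<in> p"
        have 1: "- B x y = a * B x (D y) - B (D x) (D y)" using rel[OF x D(2)[OF y]] sq[OF y] by (simp add: B_simps)
        have 2: "B (D x) (D y) = a * B (D x) y + B x y" using rel[OF D(2)[OF x] y] sq[OF x] by (simp add: B_simps)
        have "a * (B x (D y) - B (D x) y) = 0" using 1 2 unfolding right_diff_distrib by linarith
        then have "B (D x) y = B x (D y)" using \<open>a \<noteq> 0\<close> by auto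
        then have "2 * B x (D y) = a * B x y" using rel[OF x y] by simp
        then show "B (D y - (a / 2) *\<^sub>R y) x = 0" by (simp add: B_simps B_sym[of _ x])
      qed
      then show ?thesis by simp
    qed
    obtain x where x: "x \<in> p" "x \<noteq> 0" using nz subspace_0[OF sub_p] by auto
    have "D (D x) = (a / 2 * (a / 2)) *\<^sub>R x" using half[OF x(1)] by (simp add: linear_scale[OF D(1)])
    then have "(a / 2 * (a / 2)) *\<^sub>R x = - x" using sq[OF x(1)] by metis
    then have "(1 + a / 2 * (a / 2)) *\<^sub>R x = 0" unfolding scaleR_add_left by simp
    moreover have "1 + a / 2 * (a / 2) > 0" by (simp add: add_pos_nonneg)
    ultimately show False using x(2) by simp
  qed
  then show ?thesis using rel[OF xy] by simp
qed

text \<open>By irreducibility of \<open>p\<close>, a proper \<open>M\<close> contains no non-zero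
  real vector and its real parts fill \<open>p\<close>. So it is the graph of a map -J, where J
  commutes with \<open>k\<close> and J^2 = -1. Extended by zero to \<open>k\<close>, J is a
  derivation, hence ad z for some \<open>z\<close>, and this \<open>z\<close> turns out to be
  central in \<open>k\<close>.\<close>

lemma kC_submodule_structure:
  assumes M: "csubspace M" "M \<subseteq> pC" "\<And>u v. u \<in> kC \<Longrightarrow> v \<in> M \<Longrightarrow> complexify_bracket br u v \<in> M"
    and proper: "M \<noteq> {0}" "M \<noteq> pC"
  obtains z where "complex_structure z" "M = pz z"
proof -
  note Ms = csub_simps[OF M(1)]
  have Mp: "x \<in> p" "y \<in> p" if "Complexify x y \<in> M" for x y
    using that M(2) by (auto simp: pC_def complexify_set_def)
  have Madd: "Complexify (x + x') (y + y') \<in> M" if "Complexify x y \<in> M" "Complexify x' y' \<in> M" for x y x' y'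
    using Ms(2)[OF that] by (simp add: complexification_simps)
  have Mscale: "Complexify (a *\<^sub>R x) (a *\<^sub>R y) \<in> M" if "Complexify x y \<in> M" for x y a
    using Ms(3)[OF that, of "complex_of_real a"] by (simp add: complexification_simps)
  have Mi: "Complexify (- y) x \<in> M" if "Complexify x y \<in> M" for x y
    using Ms(3)[OF that, of \<i>] by (simp add: complexification_simps)
  have Mbr: "Complexify (br w x) (br w y) \<in> M" if "w \<in> k" "Complexify x y \<in> M" for w x y
    using M(3)[of "Complexify w 0" "Complexify x y"] that subspace_0[OF sub_k]
    by (simp add: kC_def complexify_set_def complexify_bracket_def br_simps)
  have M0: "Complexify 0 0 \<in> M" using Ms(1) by (simp add: complexification_simps)
  have nz: "p \<noteq> {0}"
  proof
    assume "p = {0}"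
    then have "pC = {0}" by (rule pC_trivial)
    then show False using M(2) proper csub_simps(1)[OF M(1)] by blast
  qed
  define q where "q = {x. Complexify x 0 \<in> M}"
  have "q = {0} \<or> q = p"
  proof (rule p_irreducible)
    show "subspace q"
      using M0 Madd[of _ 0 _ 0] Mscale[of _ 0] by (auto simp: q_def subspace_def)
    show "q \<subseteq> p" using Mp by (auto simp: q_def)
    show "br w x \<in> q" if "w \<in> k" "x \<in> q" for w x
      using Mbr[of w x 0] that by (simp add: q_def br_simps)
  qed
  moreover have "q \<noteq> p"
  proof
    assume "q = p"
    have "u \<in> M" if "u \<in> pC" for u
    proof -
      have "Complexify (real_part u) 0 \<in> M" "Complexify (imag_part u) 0 \<in> M"
        using that \<open>q = p\<close> by (auto simp: pC_def complexify_set_def q_def)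
      moreover have "Complexify (- 0) (imag_part u) \<in> M" by (rule Mi) fact
      ultimately show ?thesis using Madd[of "real_part u" 0 "- 0" "imag_part u"] by simp
    qed
    then show False using proper(2) M(2) by blast
  qed
  ultimately have q0: "x = 0" if "Complexify x 0 \<in> M" for x using that by (auto simp: q_def)
  have uniq: "y = y'" if "Complexify x y \<in> M" "Complexify x y' \<in> M" for x y y'
  proof -
    have "Complexify 0 (y - y') \<in> M"
      using Ms(4)[OF that] by (simp add: complexification_simps)
    then show ?thesis using q0 Mi[of 0 "y - y'"] by fastforce
  qed
  define q' where "q' = {x. \<exists>y. Complexify x y \<in> M}"
  have "q' = {0} \<or> q' = p"
  proof (rule p_irreducible)
    show "subspace q'"
      unfolding subspace_def q'_def using M0 Madd Mscale by (intro conjI ballI allI; simp; blast)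
    show "q' \<subseteq> p" using Mp by (auto simp: q'_def)
    show "br w x \<in> q'" if "w \<in> k" "x \<in> q'" for w x
      using Mbr[of w x] that by (auto simp: q'_def)
  qed
  moreover have "q' \<noteq> {0}"
  proof
    assume "q' = {0}"
    have "u = 0" if "u \<in> M" for u
    proof -
      obtain x y where u: "u = Complexify x y" by (cases u)
      have "x = 0" using that u \<open>q' = {0}\<close> by (auto simp: q'_def)
      moreover have "- y = 0" using Mi[of x y] that u \<open>q' = {0}\<close> unfolding q'_def by blast
      ultimately show ?thesis using u by (simp add: complexification_simps)
    qed
    then show False using proper(1) Ms(1) by blast
  qed
  ultimately have q': "q' = p" by blast
  have "\<exists>y. Complexify x (- y) \<in> M" if "x \<in> p" for x
  proof -
    obtain y where "Complexify x y \<in> M" using \<open>x \<in> p\<close> unfolding q'[symmetric] q'_def by blast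
    then show ?thesis by (intro exI[of _ "- y"]) simp
  qed
  then obtain J where J: "\<And>x. x \<in> p \<Longrightarrow> Complexify x (- J x) \<in> M" by metis
  have Jeq: "J x = y" if "Complexify x (- y) \<in> M" for x y
    using uniq[OF that J[OF Mp(1)[OF that]]] by simp
  have Jp: "J x \<in> p" if "x \<in> p" for x
    using Mp(2)[OF J[OF that]] subspace_neg[OF sub_p] by fastforce
  have J2: "J (J x) = - x" if "x \<in> p" for x
    using Mi[OF J[OF that]] by (intro Jeq) simp
  have Jbr: "J (br w x) = br w (J x)" if "w \<in> k" "x \<in> p" for w x
    using Mbr[OF that(1) J[OF that(2)]] by (intro Jeq) (simp add: br_simps)
  have Jadd: "J (x + y) = J x + J y" if "x \<in> p" "y \<in> p" for x y
    using Madd[OF J[OF that(1)] J[OF that(2)]] by (intro Jeq) (simp add: algebra_simps)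
  have Jscale: "J (a *\<^sub>R x) = a *\<^sub>R J x" if "x \<in> p" for a x
    using Mscale[OF J[OF that], of a] by (intro Jeq) simp
  define D where "D x = J (ppart x)" for x
  have DJ: "D x = J x" if "x \<in> p" for x using that by (simp add: D_def ppart_kp)
  have Dk: "D x = 0" if "x \<in> k" for x
    using that Jscale[of 0 0] subspace_0[OF sub_p] by (simp add: D_def ppart_kp)
  have linD: "linear D"
    by (rule linearI)
      (simp_all add: D_def linear_add[OF linear_ppart] linear_scale[OF linear_ppart] Jadd Jscale ppart)
  have skew: "B (D x) y = - B x (D y)" if "x \<in> p" "y \<in> p" for x y
  proof (rule commutant_structure_skew[OF linD _ _ _ nz that])
    show "D x \<in> p" if "x \<in> p" for x using DJ[OF that] Jp[OF that] by simp
    show "D (br w x) = br w (D x)" if "w \<in> k" "x \<in> p" for w x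
      using DJ that Jbr br_kp by simp
    show "D (D x) = - x" if "x \<in> p" for x using DJ J2 Jp that by simp
  qed
  \<comment> \<open>\<open>D\<close> vanishes on \<open>k\<close>, which contains the bracket, so
    the two terms have to cancel; tested against \<open>k\<close> this is the skewness of
    \<open>D\<close>.\<close>
  have der_pp: "br (D x) y + br x (D y) = 0" if xy: "x \<in> p" "y \<in> p" for x y
  proof (rule B_nondeg_k)
    have Dp: "D x \<in> p" "D y \<in> p" using DJ Jp xy by auto
    then show "br (D x) y + br x (D y) \<in> k"
      using br_pp xy sub_k subspace_add by blast
    fix w assume w: "w \<in> k"
    have yw: "br y w \<in> p" using br_pk xy w by blast
    have "br (D y) w = D (br y w)"
      using Jbr[OF w xy(2)] DJ[OF xy(2)] DJ[OF br_kp[OF w xy(2)]] br_anti[of y w] br_anti[of "D y" w]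
      by (simp add: linear_neg[OF linD])
    then show "B (br (D x) y + br x (D y)) w = 0"
      using skew[OF xy(1) yw] by (simp add: B_simps B_inv)
  qed
  have der: "D (br x y) = br (D x) y + br x (D y)" for x y
  proof -
    obtain a b where ab: "a \<in> k" "b \<in> p" "x = a + b" by (rule kp_decomp)
    obtain c d where cd: "c \<in> k" "d \<in> p" "y = c + d" by (rule kp_decomp)
    have "D (br a d) = br a (D d)" using Jbr ab cd DJ br_kp by simp
    moreover have "D (br b c) = br (D b) c"
      using Jbr[OF cd(1) ab(2)] DJ[OF ab(2)] DJ[OF br_kp[OF cd(1) ab(2)]] br_anti[of b c] br_anti[of "D b" c]
      by (simp add: linear_neg[OF linD])
    moreover have "D (br a c) = 0" "D (br b d) = 0" "D a = 0" "D c = 0"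
      using Dk br_kk br_pp ab cd by auto
    ultimately show ?thesis
      using der_pp[OF ab(2) cd(2)]
      by (simp add: ab(3) cd(3) br_simps linear_add[OF linD] algebra_simps)
  qed
  obtain z where z: "\<And>x. D x = br z x" using inner_derivation[OF linD der] by metis
  \<comment> \<open>\<open>D\<close> commutes with \<theta>, so \<theta> z and \<open>z\<close>
    induce the same derivation, and \<open>z\<close> lies in \<open>k\<close>.\<close>
  have D\<theta>: "\<theta> (D (\<theta> x)) = D x" for x
  proof -
    obtain a b where ab: "a \<in> k" "b \<in> p" "x = a + b" by (rule kp_decomp)
    have "D b \<in> p" using DJ Jp ab by simp
    then show ?thesis using ab Dk[OF ab(1)]
      by (simp add: k_def p_def \<theta>_simps linear_diff[OF linD] linear_add[OF linD] linear_neg[OF linD])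
  qed
  have "br x (\<theta> z - z) = 0" for x
    using D\<theta>[of x] br_anti[of x "\<theta> z"] br_anti[of x z] by (simp add: z \<theta>_br \<theta>\<theta> br_simps)
  then have "\<theta> z - z = 0" by (rule center_zero)
  then have "z \<in> k" by (simp add: k_def)
  then have cs: "complex_structure z"
    using Dk DJ J2 Jp by (auto simp: complex_structure_def center_k_def z[symmetric])
  have "M = pz z"
  proof
    show "M \<subseteq> pz z"
    proof
      fix u assume u: "u \<in> M"
      obtain x y where xy: "u = Complexify x y" by (cases u)
      then have x: "x \<in> p" using u Mp by blast
      have "J x = - y" using u xy by (intro Jeq) simp
      then have "y = - br z x" using z[of x] DJ[OF x] by (metis minus_minus)
      then show "u \<in> pz z" using xy x by (auto simp: pz_def)
    qed
    show "pz z \<subseteq> M" using J DJ by (auto simp: pz_def z[symmetric])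
  qed
  then show ?thesis using that cs by blast
qed

lemma BC_pz:
  assumes "complex_structure z" "u \<in> pz z" "v \<in> pz z"
  shows "BC u v = 0"
  using assms by (auto simp: pz_def BC_def B_simps B_skew complex_structure_def complex_eq_iff)

lemma pz_opposite:
  assumes "p \<noteq> {0}" "complex_structure z"
  obtains u v where "u \<in> pz z" "v \<in> pz (- z)" "BC u v \<noteq> 0"
proof -
  obtain x where x: "x \<in> p" "x \<noteq> 0" using assms(1) subspace_0[OF sub_p] by auto
  have "BC (Complexify x (- br z x)) (Complexify x (- br (- z) x)) \<noteq> 0"
    using assms(2) x B_p_pos[OF x] by (simp add: BC_def B_simps B_skew br_simps complex_structure_def complex_eq_iff)
  then show ?thesis using that x by (auto simp: pz_def)
qed

lemma complex_structure_minus: "complex_structure z \<Longrightarrow> complex_structure (- z)"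
  using sub_center by (auto simp: complex_structure_def br_simps intro: subspace_neg)

lemma BC_pC_nondeg: "u \<in> pC \<Longrightarrow> (\<And>v. v \<in> pC \<Longrightarrow> BC u v = 0) \<Longrightarrow> u = 0"
proof -
  assume u: "u \<in> pC" "\<And>v. v \<in> pC \<Longrightarrow> BC u v = 0"
  have xy: "real_part u \<in> p" "imag_part u \<in> p" using u(1) by (auto simp: pC_def complexify_set_def)
  then have "Complexify (real_part u) (- imag_part u) \<in> pC"
    using subspace_neg[OF sub_p] by (auto simp: pC_def complexify_set_def)
  then have "B (real_part u) (real_part u) + B (imag_part u) (imag_part u) = 0"
    using u(2) by (fastforce simp: BC_def B_simps complex_eq_iff)
  then have "B (real_part u) (real_part u) = 0" "B (imag_part u) (imag_part u) = 0"
    using B_p_nonneg[OF xy(1)] B_p_nonneg[OF xy(2)] by linarith+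
  then have "real_part u = 0" "imag_part u = 0"
    using B_p_pos[OF xy(1)] B_p_pos[OF xy(2)] by fastforce+
  then show ?thesis by (simp add: zero_complexification_def complexification.expand)
qed

text \<open>Nondegeneracy excludes all of \<open>pC\<close>. Among the two remaining candidates,
  \<open>pz z\<close> and \<open>pz (- z)\<close> pair non-trivially, so orthogonal submodules
  coincide.\<close>

lemma orthogonal_submodules:
  assumes M: "csubspace M" "M \<subseteq> pC" "\<And>u v. u \<in> kC \<Longrightarrow> v \<in> M \<Longrightarrow> complexify_bracket br u v \<in> M" "M \<noteq> {0}"
    and M': "csubspace M'" "M' \<subseteq> pC" "\<And>u v. u \<in> kC \<Longrightarrow> v \<in> M' \<Longrightarrow> complexify_bracket br u v \<in> M'" "M' \<noteq> {0}"
    and orth: "\<And>u v. u \<in> M \<Longrightarrow> v \<in> M' \<Longrightarrow> BC u v = 0"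
  obtains z where "complex_structure z" "M = pz z" "M' = pz z"
proof -
  have "M \<noteq> pC"
  proof
    assume "M = pC"
    then have "u = 0" if "u \<in> M'" for u
      using BC_pC_nondeg[of u] M'(2) orth that BC_sym by (metis subsetD)
    then show False using M'(4) csub_simps(1)[OF M'(1)] by blast
  qed
  then obtain z where z: "complex_structure z" "M = pz z" using kC_submodule_structure[OF M] by metis
  have "M' \<noteq> pC"
  proof
    assume "M' = pC"
    then have "u = 0" if "u \<in> M" for u
      using BC_pC_nondeg[of u] M(2) orth that by (metis subsetD)
    then show False using M(4) csub_simps(1)[OF M(1)] by blast
  qed
  then obtain z' where z': "complex_structure z'" "M' = pz z'" using kC_submodule_structure[OF M'] by metis
  have nz: "p \<noteq> {0}" using M(2,4) pC_trivial csub_simps(1)[OF M(1)] by blast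
  have "z' \<noteq> - z" using pz_opposite[OF nz z(1)] orth z(2) z'(2) by metis
  then have "z' = z" using complex_structure_unique[OF nz z(1) z'(1)] by blast
  then show ?thesis using that z z' by blast
qed

lemma hermitian_splitting_structure:
  assumes "hermitian_splitting br k p P P'"
  obtains z where "complex_structure z" "P = pz z" "P' = pz (- z)"
proof -
  have irr: "irreducible_kC_submodule br k P" "irreducible_kC_submodule br k P'"
    and dec: "pC = {u + v | u v. u \<in> P \<and> v \<in> P'}" and int: "P \<inter> P' = {0}"
    using assms by (auto simp: hermitian_splitting_def pC_def)
  have sub: "csubspace P" "\<And>u v. u \<in> kC \<Longrightarrow> v \<in> P \<Longrightarrow> complexify_bracket br u v \<in> P" "P \<noteq> {0}"
    using irr(1) by (auto simp: irreducible_kC_submodule_def kC_def Let_def)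
  have sub': "csubspace P'" "\<And>u v. u \<in> kC \<Longrightarrow> v \<in> P' \<Longrightarrow> complexify_bracket br u v \<in> P'" "P' \<noteq> {0}"
    using irr(2) by (auto simp: irreducible_kC_submodule_def kC_def Let_def)
  have PpC: "P \<subseteq> pC"
  proof
    fix u assume "u \<in> P"
    then have "u + 0 \<in> pC" using csub_simps(1)[OF sub'(1)] unfolding dec by blast
    then show "u \<in> pC" by simp
  qed
  have P'pC: "P' \<subseteq> pC"
  proof
    fix u assume "u \<in> P'"
    then have "0 + u \<in> pC" using csub_simps(1)[OF sub(1)] unfolding dec by blast
    then show "u \<in> pC" by simp
  qed
  have "P \<noteq> pC" using int P'pC sub' csub_simps(1)[OF sub'(1)] by blast
  then obtain z where z: "complex_structure z" "P = pz z"
    using kC_submodule_structure[OF sub(1) PpC sub(2,3)] by metis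
  have "P' \<noteq> pC" using int PpC sub csub_simps(1)[OF sub(1)] by blast
  then obtain z' where z': "complex_structure z'" "P' = pz z'"
    using kC_submodule_structure[OF sub'(1) P'pC sub'(2,3)] by metis
  have nz: "p \<noteq> {0}" using PpC sub(3) pC_trivial csub_simps(1)[OF sub(1)] by blast
  have "z' \<noteq> z" using int sub(3) z z' by auto
  then have "z' = - z" using complex_structure_unique[OF nz z(1) z'(1)] by blast
  then show ?thesis using that z z' by blast
qed

end

section \<open>Enough calculus for bump functions\<close>

section \<open>Smooth functions\<close>

lemma C_on_subset: "C_on n S f \<Longrightarrow> T \<subseteq> S \<Longrightarrow> C_on n T f"
  by (induction n arbitrary: f) (auto intro: continuous_on_subset)

lemma C_on_cong:
  assumes "open S" "\<And>x. x \<in> S \<Longrightarrow> f x = g x"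
  shows "C_on n S f \<longleftrightarrow> C_on n S g"
  using assms(2)
proof (induction n arbitrary: f g)
  case 0 then show ?case by (auto cong: continuous_on_cong)
next
  case (Suc n)
  have tr: "(f has_derivative D) (at x) \<longleftrightarrow> (g has_derivative D) (at x)" if "x \<in> S" for x D
    using has_derivative_transform_within_open[OF _ assms(1) that] Suc.prems by metis
  have diff: "f differentiable (at x) \<longleftrightarrow> g differentiable (at x)" if "x \<in> S" for x
    using tr[OF that] by (simp add: differentiable_def)
  have fd: "frechet_derivative f (at x) = frechet_derivative g (at x)" if "x \<in> S" for x
    using tr[OF that] by (simp add: frechet_derivative_def)
  show ?case
    using diff Suc.IH[of "\<lambda>x. frechet_derivative f (at x) v" "\<lambda>x. frechet_derivative g (at x) v" for v] fd
    by simp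
qed

lemma C_on_Suc_imp: "C_on (Suc n) S f \<Longrightarrow> C_on n S f"
proof (induction n arbitrary: f)
  case 0
  then show ?case
    by (auto intro!: continuous_at_imp_continuous_on differentiable_imp_continuous_within)
next
  case (Suc n) then show ?case by auto
qed

lemma C_on_SucI:
  assumes "open S" "\<And>x. x \<in> S \<Longrightarrow> (f has_derivative D x) (at x)" "\<And>v. C_on n S (\<lambda>x. D x v)"
  shows "C_on (Suc n) S f"
proof -
  have "C_on n S (\<lambda>x. frechet_derivative f (at x) v)" for v
    using assms(3)[of v] frechet_derivative_at[OF assms(2)]
    by (subst C_on_cong[OF assms(1), of _ "\<lambda>x. D x v"]) auto
  then show ?thesis using assms(2) by (auto simp: differentiable_def)
qed

lemma C_on_SucD:
  assumes "C_on (Suc n) S f"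
  shows "x \<in> S \<Longrightarrow> (f has_derivative frechet_derivative f (at x)) (at x)"
    "C_on n S (\<lambda>x. frechet_derivative f (at x) v)"
  using assms by (auto simp: frechet_derivative_works)

lemma C_on_const: "open S \<Longrightarrow> C_on n S (\<lambda>x. c)"
proof (induction n arbitrary: c)
  case (Suc n) then show ?case by (intro C_on_SucI[where D = "\<lambda>x v. 0"]) auto
qed simp

lemma C_on_bounded_linear: "open S \<Longrightarrow> bounded_linear f \<Longrightarrow> C_on n S f"
proof (cases n)
  case (Suc m)
  assume "open S" "bounded_linear f"
  then show ?thesis unfolding Suc
    by (intro C_on_SucI[where D = "\<lambda>x. f"] bounded_linear_imp_has_derivative C_on_const)
qed (simp add: linear_continuous_on)

lemma C_on_add: "open S \<Longrightarrow> C_on n S f \<Longrightarrow> C_on n S g \<Longrightarrow> C_on n S (\<lambda>x. f x + g x)"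
proof (induction n arbitrary: f g)
  case 0 then show ?case by (auto intro: continuous_intros)
next
  case (Suc n)
  show ?case
    by (rule C_on_SucI[OF Suc.prems(1), where D = "\<lambda>x v. frechet_derivative f (at x) v + frechet_derivative g (at x) v"])
      (auto intro!: has_derivative_add C_on_SucD(1)[OF Suc.prems(2)] C_on_SucD(1)[OF Suc.prems(3)]
        Suc.IH[OF Suc.prems(1)] C_on_SucD(2)[OF Suc.prems(2)] C_on_SucD(2)[OF Suc.prems(3)])
qed

lemma C_on_bilinear:
  assumes "bounded_bilinear b" "open S" "C_on n S f" "C_on n S g"
  shows "C_on n S (\<lambda>x. b (f x) (g x))"
  using assms(3,4)
proof (induction n arbitrary: f g)
  case 0 then show ?case using bounded_bilinear.continuous_on[OF assms(1)] by auto
next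
  case (Suc n)
  show ?case
  proof (rule C_on_SucI[OF assms(2), where D = "\<lambda>x v. b (f x) (frechet_derivative g (at x) v) + b (frechet_derivative f (at x) v) (g x)"])
    show "((\<lambda>x. b (f x) (g x)) has_derivative (\<lambda>v. b (f x) (frechet_derivative g (at x) v) + b (frechet_derivative f (at x) v) (g x))) (at x)"
      if "x \<in> S" for x
      by (intro bounded_bilinear.FDERIV[OF assms(1)] C_on_SucD(1)[OF Suc.prems(1)] C_on_SucD(1)[OF Suc.prems(2)] that)
    show "C_on n S (\<lambda>x. b (f x) (frechet_derivative g (at x) v) + b (frechet_derivative f (at x) v) (g x))" for v
      by (intro C_on_add assms(2) Suc.IH C_on_SucD(2)[OF Suc.prems(1)] C_on_SucD(2)[OF Suc.prems(2)]
          C_on_Suc_imp[OF Suc.prems(1)] C_on_Suc_imp[OF Suc.prems(2)])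
  qed
qed

lemma C_on_sum: "open S \<Longrightarrow> (\<And>i. i \<in> I \<Longrightarrow> C_on n S (f i)) \<Longrightarrow> C_on n S (\<lambda>x. \<Sum>i\<in>I. f i x)"
  by (induction I rule: infinite_finite_induct) (auto intro: C_on_add C_on_const)

lemma C_on_linear_compose:
  assumes "bounded_linear h" "open S" "C_on n S f"
  shows "C_on n S (\<lambda>x. h (f x))"
  using assms(3)
proof (induction n arbitrary: f)
  case 0 then show ?case using bounded_linear.continuous_on[OF assms(1)] by auto
next
  case (Suc n)
  show ?case
    by (rule C_on_SucI[OF assms(2), where D = "\<lambda>x v. h (frechet_derivative f (at x) v)"])
      (auto intro: bounded_linear.has_derivative[OF assms(1)] C_on_SucD(1)[OF Suc.prems] Suc.IH C_on_SucD(2)[OF Suc.prems])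
qed

text \<open>In the chain rule the direction of the outer derivative varies with the point, whereas
  \<open>C_on\<close> speaks of constant directions. Expansion in \<open>Basis\<close> turns the
  derivative into a sum of products to which the induction hypothesis applies.\<close>

lemma C_on_compose:
  fixes f :: "'a::euclidean_space \<Rightarrow> 'b::euclidean_space" and g :: "'b \<Rightarrow> 'c::real_normed_vector"
  assumes "open S" "C_on n S f" "C_on n T g" "f ` S \<subseteq> T"
  shows "C_on n S (\<lambda>x. g (f x))"
  using assms(2,3)
proof (induction n arbitrary: g)
  case 0 then show ?case using assms(4) by (auto intro: continuous_on_compose2)
next
  case (Suc n)
  let ?Df = "\<lambda>x. frechet_derivative f (at x)" and ?Dg = "\<lambda>y. frechet_derivative g (at y)"
  show ?case
  proof (rule C_on_SucI[OF assms(1), where D = "\<lambda>x v. \<Sum>b\<in>Basis. (?Df x v \<bullet> b) *\<^sub>R ?Dg (f x) b"])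
    fix x assume x: "x \<in> S"
    then have dg: "(g has_derivative ?Dg (f x)) (at (f x))"
      using assms(4) by (intro C_on_SucD(1)[OF Suc.prems(2)]) auto
    have "((\<lambda>x. g (f x)) has_derivative (\<lambda>v. ?Dg (f x) (?Df x v))) (at x)"
      using has_derivative_compose[OF C_on_SucD(1)[OF Suc.prems(1) x] dg] .
    moreover have "(\<lambda>v. ?Dg (f x) (?Df x v)) = (\<lambda>v. \<Sum>b\<in>Basis. (?Df x v \<bullet> b) *\<^sub>R ?Dg (f x) b)"
    proof
      fix v
      let ?w = "?Df x v"
      have lin: "linear (?Dg (f x))" using dg has_derivative_linear by blast
      have "?Dg (f x) (\<Sum>b\<in>Basis. (?w \<bullet> b) *\<^sub>R b) = (\<Sum>b\<in>Basis. (?w \<bullet> b) *\<^sub>R ?Dg (f x) b)"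
        by (simp add: linear_sum[OF lin] linear_scale[OF lin])
      then show "?Dg (f x) ?w = (\<Sum>b\<in>Basis. (?w \<bullet> b) *\<^sub>R ?Dg (f x) b)"
        by (simp add: euclidean_representation)
    qed
    ultimately show "((\<lambda>x. g (f x)) has_derivative (\<lambda>v. \<Sum>b\<in>Basis. (?Df x v \<bullet> b) *\<^sub>R ?Dg (f x) b)) (at x)"
      by (simp only:)
  next
    fix v
    show "C_on n S (\<lambda>x. \<Sum>b\<in>Basis. (?Df x v \<bullet> b) *\<^sub>R ?Dg (f x) b)"
    proof (intro C_on_sum assms(1) C_on_bilinear[OF bounded_bilinear_scaleR])
      show "C_on n S (\<lambda>x. ?Df x v \<bullet> b)" for b
        by (rule C_on_linear_compose[OF bounded_linear_inner_left assms(1) C_on_SucD(2)[OF Suc.prems(1)]])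
      show "C_on n S (\<lambda>x. ?Dg (f x) b)" for b
        by (rule Suc.IH[OF C_on_Suc_imp[OF Suc.prems(1)] C_on_SucD(2)[OF Suc.prems(2)]])
    qed
  qed
qed

lemma C_on_local:
  assumes "\<And>x. x \<in> S \<Longrightarrow> \<exists>U. open U \<and> x \<in> U \<and> C_on n U f"
  shows "C_on n S f"
  using assms
proof (induction n arbitrary: f)
  case 0
  have "continuous (at x) f" if "x \<in> S" for x
    using 0[OF that] by (auto simp: continuous_on_eq_continuous_at)
  then show ?case by (auto intro: continuous_at_imp_continuous_on)
next
  case (Suc n)
  have "f differentiable (at x)" if "x \<in> S" for x
    using Suc.prems[OF that] by auto
  moreover have "C_on n S (\<lambda>x. frechet_derivative f (at x) v)" for v
  proof (rule Suc.IH)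
    fix x assume "x \<in> S"
    from Suc.prems[OF this] obtain U where "open U" "x \<in> U" "C_on (Suc n) U f" by blast
    then show "\<exists>U. open U \<and> x \<in> U \<and> C_on n U (\<lambda>x. frechet_derivative f (at x) v)" by auto
  qed
  ultimately show ?case by simp
qed

lemma smooth_on_compose:
  fixes f :: "'a::euclidean_space \<Rightarrow> 'b::euclidean_space" and g :: "'b \<Rightarrow> 'c::real_normed_vector"
  shows "open S \<Longrightarrow> smooth_on S f \<Longrightarrow> smooth_on T g \<Longrightarrow> f ` S \<subseteq> T \<Longrightarrow> smooth_on S (\<lambda>x. g (f x))"
  using C_on_compose[of S _ f T g] by (auto simp: smooth_on_def)

lemma smooth_on_local:
  assumes "\<And>x. x \<in> S \<Longrightarrow> \<exists>U. open U \<and> x \<in> U \<and> smooth_on U f"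
  shows "smooth_on S f"
  unfolding smooth_on_def
proof
  show "C_on n S f" for n using assms by (intro C_on_local) (auto simp: smooth_on_def)
qed

lemma smooth_on_cong: "open S \<Longrightarrow> (\<And>x. x \<in> S \<Longrightarrow> f x = g x) \<Longrightarrow> smooth_on S f \<longleftrightarrow> smooth_on S g"
  unfolding smooth_on_def using C_on_cong[of S f g] by auto

lemma smooth_on_subset: "smooth_on S f \<Longrightarrow> T \<subseteq> S \<Longrightarrow> smooth_on T f"
  unfolding smooth_on_def using C_on_subset by blast

subsection \<open>Bump functions\<close>

text \<open>The denominators t^m make the span of these functions closed under differentiation, so
  that smoothness follows by induction on the order.\<close>

definition flat_exp :: "nat \<Rightarrow> real \<Rightarrow> real"
  where "flat_exp m t = (if t > 0 then exp (- 1 / t) / t ^ m else 0)"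

lemma flat_exp_limit: "((\<lambda>t. flat_exp m t) \<longlongrightarrow> 0) (at 0)"
proof -
  have "((\<lambda>t. t ^ m / exp t) \<longlongrightarrow> (0::real)) at_top"
    by (rule tendsto_power_div_exp_0)
  then have "((\<lambda>t. inverse t ^ m / exp (inverse t)) \<longlongrightarrow> (0::real)) (at_right 0)"
    by (rule filterlim_compose[OF _ filterlim_inverse_at_top_right])
  then have "((\<lambda>t. flat_exp m t) \<longlongrightarrow> 0) (at_right 0)"
    by (rule Lim_transform_eventually)
      (auto simp: eventually_at_filter flat_exp_def field_simps exp_minus power_inverse[symmetric])
  moreover have "((\<lambda>t. flat_exp m t) \<longlongrightarrow> 0) (at_left 0)"
    by (rule tendsto_eventually) (auto simp: eventually_at_filter flat_exp_def)
  ultimately show ?thesis by (simp add: filterlim_split_at)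
qed

lemma flat_exp_derivative:
  "(flat_exp m has_real_derivative flat_exp (m + 2) t - real m * flat_exp (m + 1) t) (at t)"
proof (cases t "0 :: real" rule: linorder_cases)
  case less
  have "((\<lambda>t. 0) has_real_derivative 0) (at t)" by simp
  then have "(flat_exp m has_real_derivative 0) (at t)"
    by (rule has_field_derivative_transform_within_open[of _ _ _ "{..<0}"]) (use less in \<open>auto simp: flat_exp_def\<close>)
  then show ?thesis using less by (simp add: flat_exp_def)
next
  case equal
  have "((\<lambda>y. (flat_exp m y - flat_exp m 0) / (y - 0)) \<longlongrightarrow> 0) (at 0)"
    by (rule Lim_transform_eventually[OF flat_exp_limit[of "Suc m"]])
      (auto simp: eventually_at_filter flat_exp_def field_simps)
  then show ?thesis using equal by (simp add: has_field_derivative_iff flat_exp_def)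
next
  case greater
  have "((\<lambda>t. exp (- 1 / t) / t ^ m) has_real_derivative
      exp (- 1 / t) * (1 / t\<^sup>2) / t ^ m - exp (- 1 / t) * real m / t ^ (m + 1)) (at t)"
    using greater
    by (cases m) (auto intro!: derivative_eq_intros simp: field_simps power2_eq_square,
      metis One_nat_def power_eq_if)
  then have "(flat_exp m has_real_derivative
      exp (- 1 / t) * (1 / t\<^sup>2) / t ^ m - exp (- 1 / t) * real m / t ^ (m + 1)) (at t)"
    by (rule has_field_derivative_transform_within_open[of _ _ _ "{0<..}"]) (use greater in \<open>auto simp: flat_exp_def\<close>)
  moreover have "exp (- 1 / t) * (1 / t\<^sup>2) / t ^ m - exp (- 1 / t) * real m / t ^ (m + 1)
     = flat_exp (m + 2) t - real m * flat_exp (m + 1) t"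
    using greater by (simp add: flat_exp_def power2_eq_square field_simps)
  ultimately show ?thesis by simp
qed

lemma flat_exp_smooth: "smooth_on UNIV (flat_exp m)"
proof -
  have "C_on n UNIV (flat_exp m)" for n
  proof (induction n arbitrary: m)
    case 0
    then show ?case
      using DERIV_isCont[OF flat_exp_derivative] by (auto intro: continuous_at_imp_continuous_on)
  next
    case (Suc n)
    show ?case
    proof (rule C_on_SucI[where D = "\<lambda>t v. v *\<^sub>R (flat_exp (m + 2) t + (- real m) *\<^sub>R flat_exp (m + 1) t)"])
      show "(flat_exp m has_derivative (\<lambda>v. v *\<^sub>R (flat_exp (m + 2) t + (- real m) *\<^sub>R flat_exp (m + 1) t))) (at t)" for t
        using flat_exp_derivative[of m t] by (simp add: has_field_derivative_def mult_commute_abs)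
      show "C_on n UNIV (\<lambda>t. v *\<^sub>R (flat_exp (m + 2) t + (- real m) *\<^sub>R flat_exp (m + 1) t))" for v
        by (intro C_on_linear_compose[OF bounded_linear_scaleR_right] C_on_add open_UNIV Suc.IH)
    qed simp
  qed
  then show ?thesis by (simp add: smooth_on_def)
qed

lemma smooth_bump:
  fixes c :: "'a::euclidean_space"
  shows "smooth_on UNIV (\<lambda>y. flat_exp 0 (r\<^sup>2 - (y - c) \<bullet> (y - c)))"
proof (rule smooth_on_compose[OF open_UNIV _ flat_exp_smooth])
  have "C_on n UNIV (\<lambda>y. r\<^sup>2 + (- 1) *\<^sub>R ((y + (- c)) \<bullet> (y + (- c))))" for n
    by (intro C_on_add C_on_const C_on_linear_compose[OF bounded_linear_scaleR_right]
        C_on_bilinear[OF bounded_bilinear_inner] C_on_bounded_linear bounded_linear_ident open_UNIV)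
  then show "smooth_on UNIV (\<lambda>y. r\<^sup>2 - (y - c) \<bullet> (y - c))" by (simp add: smooth_on_def)
qed simp

section \<open>Uniqueness of integral curves through bump functions\<close>

section \<open>One-parameter subgroups\<close>

locale lie_grp =
  fixes A :: "('g::{topological_group_add, t2_space, second_countable_topology}, 'e::euclidean_space) chart set"
  assumes grp: "lie_group A"
begin

lemma chart:
  assumes "(U, \<phi>) \<in> A"
  shows "open U" "open (\<phi> ` U)" "continuous_on U \<phi>" "continuous_on (\<phi> ` U) (inv_into U \<phi>)"
    "u \<in> U \<Longrightarrow> inv_into U \<phi> (\<phi> u) = u" "a \<in> \<phi> ` U \<Longrightarrow> inv_into U \<phi> a \<in> U"
    "a \<in> \<phi> ` U \<Longrightarrow> \<phi> (inv_into U \<phi> a) = a"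
proof -
  have "open U" "open (\<phi> ` U)" "homeomorphism U (\<phi> ` U) \<phi> (inv_into U \<phi>)"
    using grp assms by (auto simp: lie_group_def smooth_atlas_def)
  then show "open U" "open (\<phi> ` U)" "continuous_on U \<phi>" "continuous_on (\<phi> ` U) (inv_into U \<phi>)"
    "u \<in> U \<Longrightarrow> inv_into U \<phi> (\<phi> u) = u" "a \<in> \<phi> ` U \<Longrightarrow> inv_into U \<phi> a \<in> U"
    "a \<in> \<phi> ` U \<Longrightarrow> \<phi> (inv_into U \<phi> a) = a"
    by (auto simp: homeomorphism_def inv_into_into f_inv_into_f)
qed

lemma chart_exists: obtains U \<phi> where "(U, \<phi>) \<in> A" "u \<in> U"
proof -
  have "u \<in> (\<Union>(U, \<phi>)\<in>A. U)"
    using grp by (simp add: lie_group_def smooth_atlas_def)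
  then show ?thesis using that by auto
qed

lemma chart_preimage_open:
  assumes "(U, \<phi>) \<in> A" "open V"
  shows "open {a \<in> \<phi> ` U. inv_into U \<phi> a \<in> V}"
  using continuous_on_open_vimage[OF chart(2)[OF assms(1)], of "inv_into U \<phi>"] chart(4)[OF assms(1)] assms(2)
  by (simp add: vimage_def Collect_conj_eq Int_commute)

lemma smooth_fun_continuous:
  assumes "smooth_fun A f"
  shows "continuous_on UNIV f"
proof (rule continuous_at_imp_continuous_on, rule ballI)
  fix u
  obtain U \<phi> where U: "(U, \<phi>) \<in> A" "u \<in> U" by (rule chart_exists)
  have "smooth_on (\<phi> ` U) (f \<circ> inv_into U \<phi>)" using assms U(1) by (auto simp: smooth_fun_def)
  then have "C_on 0 (\<phi> ` U) (f \<circ> inv_into U \<phi>)" unfolding smooth_on_def by blast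
  then have "continuous_on (\<phi> ` U) (f \<circ> inv_into U \<phi>)" by simp
  then have "continuous_on U (\<lambda>u. (f \<circ> inv_into U \<phi>) (\<phi> u))"
    using chart(3)[OF U(1)] by (rule continuous_on_compose2) auto
  then have "continuous_on U f"
    by (rule continuous_on_eq) (simp add: chart(5)[OF U(1)])
  then show "isCont f u" using U(2) chart(1)[OF U(1)] by (simp add: continuous_on_eq_continuous_at)
qed

lemma smooth_fun_localI:
  assumes "\<And>U \<phi> a. (U, \<phi>) \<in> A \<Longrightarrow> a \<in> \<phi> ` U \<Longrightarrow>
    \<exists>N. open N \<and> a \<in> N \<and> smooth_on N (\<lambda>a. f (inv_into U \<phi> a))"
  shows "smooth_fun A f"
  unfolding smooth_fun_def using assms by (auto simp: o_def intro!: smooth_on_local)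

text \<open>A bump in a chart, extended by zero. The closed ball has compact image, which is closed
  because the group is Hausdorff, so the extension vanishes on a neighbourhood of every point
  outside the chart.\<close>

lemma bump_exists:
  assumes "open V" "g \<in> V"
  obtains f where "smooth_fun A f" "f g > 0" "\<And>u. u \<notin> V \<Longrightarrow> f u = 0"
proof -
  obtain U \<phi> where U: "(U, \<phi>) \<in> A" "g \<in> U" by (rule chart_exists)
  note ch = chart[OF U(1)]
  have "open {a \<in> \<phi> ` U. inv_into U \<phi> a \<in> V}" by (rule chart_preimage_open[OF U(1) assms(1)])
  moreover have "\<phi> g \<in> {a \<in> \<phi> ` U. inv_into U \<phi> a \<in> V}" using U(2) ch(5) assms(2) by auto
  ultimately obtain r where r: "r > 0" "cball (\<phi> g) r \<subseteq> {a \<in> \<phi> ` U. inv_into U \<phi> a \<in> V}"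
    using open_contains_cball by metis
  define b where "b y = flat_exp 0 (r\<^sup>2 - (y - \<phi> g) \<bullet> (y - \<phi> g))" for y
  have b: "smooth_on UNIV b" unfolding b_def by (rule smooth_bump)
  have b0: "b y = 0" if "y \<notin> cball (\<phi> g) r" for y
  proof -
    have "r < norm (y - \<phi> g)" using that by (simp add: dist_norm norm_minus_commute)
    then have "r\<^sup>2 \<le> (norm (y - \<phi> g))\<^sup>2" using r(1) by (intro power_mono) auto
    then show ?thesis by (simp add: b_def flat_exp_def power2_norm_eq_inner)
  qed
  define C where "C = inv_into U \<phi> ` cball (\<phi> g) r"
  have "compact C" unfolding C_def
    using r(2) by (intro compact_continuous_image continuous_on_subset[OF ch(4)]) auto
  then have C: "closed C" by (rule compact_imp_closed)
  define f where "f u = (if u \<in> U then b (\<phi> u) else 0)" for u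
  have fC: "f u = 0" if "u \<notin> C" for u
    using that b0[of "\<phi> u"] ch(5)[of u] by (force simp: f_def C_def)
  have "smooth_fun A f"
  proof (rule smooth_fun_localI)
    fix U' \<psi> a assume U': "(U', \<psi>) \<in> A" "a \<in> \<psi> ` U'"
    note ch' = chart[OF U'(1)]
    show "\<exists>N. open N \<and> a \<in> N \<and> smooth_on N (\<lambda>a. f (inv_into U' \<psi> a))"
    proof (cases "inv_into U' \<psi> a \<in> U")
      case True
      let ?N = "{a \<in> \<psi> ` U'. inv_into U' \<psi> a \<in> U}"
      have N: "open ?N" by (rule chart_preimage_open[OF U'(1) ch(1)])
      have "?N \<subseteq> \<psi> ` (U' \<inter> U)"
      proof
        fix c assume "c \<in> ?N"
        then have "c = \<psi> (inv_into U' \<psi> c)" "inv_into U' \<psi> c \<in> U' \<inter> U" using ch'(6,7) by simp_all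
        then show "c \<in> \<psi> ` (U' \<inter> U)" by (rule image_eqI)
      qed
      moreover have "smooth_on (\<psi> ` (U' \<inter> U)) (\<phi> \<circ> inv_into U' \<psi>)"
      proof -
        have "\<forall>(U, \<phi>)\<in>A. \<forall>(V, \<psi>)\<in>A. smooth_on (\<phi> ` (U \<inter> V)) (\<psi> \<circ> inv_into U \<phi>)"
          using grp by (simp add: lie_group_def smooth_atlas_def)
        from bspec[OF this U'(1)]
        have "\<forall>(V, \<psi>')\<in>A. smooth_on (\<psi> ` (U' \<inter> V)) (\<psi>' \<circ> inv_into U' \<psi>)"
          by (simp only: case_prod_conv)
        from bspec[OF this U(1)] show ?thesis by (simp only: case_prod_conv)
      qed
      ultimately have "smooth_on ?N (\<lambda>a. \<phi> (inv_into U' \<psi> a))"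
        using smooth_on_subset by (auto simp: o_def)
      then have "smooth_on ?N (\<lambda>a. b (\<phi> (inv_into U' \<psi> a)))"
        using b by (rule smooth_on_compose[OF N]) auto
      then have "smooth_on ?N (\<lambda>a. f (inv_into U' \<psi> a))"
        by (subst smooth_on_cong[OF N, of _ "\<lambda>a. b (\<phi> (inv_into U' \<psi> a))"]) (auto simp: f_def)
      then show ?thesis using N True U'(2) by blast
    next
      case False
      let ?N = "{a \<in> \<psi> ` U'. inv_into U' \<psi> a \<in> - C}"
      have N: "open ?N" using C by (intro chart_preimage_open[OF U'(1)]) auto
      have "smooth_on ?N (\<lambda>a. f (inv_into U' \<psi> a))"
        using N by (subst smooth_on_cong[OF N, of _ "\<lambda>a. 0"]) (auto simp: fC smooth_on_def C_on_const)
      moreover have "C \<subseteq> U" unfolding C_def using r(2) ch(6) by blast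
      ultimately show ?thesis using N False U'(2) by blast
    qed
  qed
  moreover have "f g > 0" using U(2) r(1) by (simp add: f_def b_def flat_exp_def)
  moreover have "f u = 0" if "u \<notin> V" for u
  proof (rule fC)
    show "u \<notin> C" using that r(2) by (auto simp: C_def)
  qed
  ultimately show ?thesis using that by blast
qed

lemma smooth_translate_left:
  assumes f: "smooth_fun A f" shows "smooth_fun A (\<lambda>u. f (g + u))"
proof (rule smooth_fun_localI)
  fix U \<phi> a assume U: "(U, \<phi>) \<in> A" "a \<in> \<phi> ` U"
  obtain V \<psi> where V: "(V, \<psi>) \<in> A" "g \<in> V" by (rule chart_exists)
  obtain W \<omega> where W: "(W, \<omega>) \<in> A" "g + inv_into U \<phi> a \<in> W" by (rule chart_exists)
  let ?D = "{(b, a). (b, a) \<in> \<psi> ` V \<times> \<phi> ` U \<and> inv_into V \<psi> b + inv_into U \<phi> a \<in> W}"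
  have M: "smooth_on ?D (\<lambda>(b, a). \<omega> (inv_into V \<psi> b + inv_into U \<phi> a))"
    using grp U(1) V(1) W(1) unfolding lie_group_def by fast
  let ?N = "{a \<in> \<phi> ` U. inv_into U \<phi> a \<in> (\<lambda>u. g + u) -` W}"
  have N: "open ?N"
    using chart(1)[OF W(1)] by (intro chart_preimage_open[OF U(1)] open_vimage continuous_intros)
  have fw: "smooth_on (\<omega> ` W) (\<lambda>c. f (inv_into W \<omega> c))"
    using f W(1) by (auto simp: smooth_fun_def o_def)
  have "C_on n ?N (\<lambda>a. (\<psi> g, 0) + (0, a))" for n
    by (intro C_on_add C_on_const N C_on_bounded_linear bounded_linear_Pair bounded_linear_zero bounded_linear_ident)
  then have pair: "smooth_on ?N (\<lambda>a. (\<psi> g, a))" by (simp add: smooth_on_def)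
  have "smooth_on ?N (\<lambda>a. (\<lambda>(b, a). \<omega> (inv_into V \<psi> b + inv_into U \<phi> a)) (\<psi> g, a))"
    using N pair M by (rule smooth_on_compose) (use V(2) chart(5)[OF V(1)] in auto)
  then have "smooth_on ?N (\<lambda>a. \<omega> (g + inv_into U \<phi> a))"
    using chart(5)[OF V(1,2)] by simp
  then have "smooth_on ?N (\<lambda>a. f (inv_into W \<omega> (\<omega> (g + inv_into U \<phi> a))))"
    using fw by (rule smooth_on_compose[OF N]) auto
  then have "smooth_on ?N (\<lambda>a. f (g + inv_into U \<phi> a))"
    using chart(5)[OF W(1)] by (subst (asm) smooth_on_cong[OF N, of _ "\<lambda>a. f (g + inv_into U \<phi> a)"]) auto
  then show "\<exists>N. open N \<and> a \<in> N \<and> smooth_on N (\<lambda>a. f (g + inv_into U \<phi> a))"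
    using N U(2) W(2) by blast
qed

lemma smooth_translate_right:
  assumes f: "smooth_fun A f" shows "smooth_fun A (\<lambda>u. f (u + g))"
proof (rule smooth_fun_localI)
  fix U \<phi> a assume U: "(U, \<phi>) \<in> A" "a \<in> \<phi> ` U"
  obtain V \<psi> where V: "(V, \<psi>) \<in> A" "g \<in> V" by (rule chart_exists)
  obtain W \<omega> where W: "(W, \<omega>) \<in> A" "inv_into U \<phi> a + g \<in> W" by (rule chart_exists)
  let ?D = "{(a, b). (a, b) \<in> \<phi> ` U \<times> \<psi> ` V \<and> inv_into U \<phi> a + inv_into V \<psi> b \<in> W}"
  have M: "smooth_on ?D (\<lambda>(a, b). \<omega> (inv_into U \<phi> a + inv_into V \<psi> b))"
    using grp U(1) V(1) W(1) unfolding lie_group_def by fast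
  let ?N = "{a \<in> \<phi> ` U. inv_into U \<phi> a \<in> (\<lambda>u. u + g) -` W}"
  have N: "open ?N"
    using chart(1)[OF W(1)] by (intro chart_preimage_open[OF U(1)] open_vimage continuous_intros)
  have fw: "smooth_on (\<omega> ` W) (\<lambda>c. f (inv_into W \<omega> c))"
    using f W(1) by (auto simp: smooth_fun_def o_def)
  have "C_on n ?N (\<lambda>a. (0, \<psi> g) + (a, 0))" for n
    by (intro C_on_add C_on_const N C_on_bounded_linear bounded_linear_Pair bounded_linear_zero bounded_linear_ident)
  then have pair: "smooth_on ?N (\<lambda>a. (a, \<psi> g))" by (simp add: smooth_on_def)
  have "smooth_on ?N (\<lambda>a. (\<lambda>(a, b). \<omega> (inv_into U \<phi> a + inv_into V \<psi> b)) (a, \<psi> g))"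
    using N pair M by (rule smooth_on_compose) (use V(2) chart(5)[OF V(1)] in auto)
  then have "smooth_on ?N (\<lambda>a. \<omega> (inv_into U \<phi> a + g))"
    using chart(5)[OF V(1,2)] by simp
  then have "smooth_on ?N (\<lambda>a. f (inv_into W \<omega> (\<omega> (inv_into U \<phi> a + g))))"
    using fw by (rule smooth_on_compose[OF N]) auto
  then have "smooth_on ?N (\<lambda>a. f (inv_into U \<phi> a + g))"
    using chart(5)[OF W(1)] by (subst (asm) smooth_on_cong[OF N, of _ "\<lambda>a. f (inv_into U \<phi> a + g)"]) auto
  then show "\<exists>N. open N \<and> a \<in> N \<and> smooth_on N (\<lambda>a. f (inv_into U \<phi> a + g))"
    using N U(2) W(2) by blast
qed

text \<open>The curve is only known through its compositions with smooth functions; bump functions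
  recover the topology from these.\<close>

lemma one_parameter_subgroup_continuous:
  assumes "one_parameter_subgroup A vf x \<gamma>"
  shows "isCont \<gamma> t"
proof (unfold isCont_def, rule topological_tendstoI)
  fix V assume V: "open V" "\<gamma> t \<in> V"
  then obtain f where f: "smooth_fun A f" "f (\<gamma> t) > 0" "\<And>u. u \<notin> V \<Longrightarrow> f u = 0"
    using bump_exists by metis
  have "isCont (\<lambda>s. f (\<gamma> s)) t"
    using assms f(1) unfolding one_parameter_subgroup_def by (blast intro: DERIV_isCont)
  then have "\<forall>\<^sub>F s in at t. f (\<gamma> s) > 0"
    using f(2) unfolding isCont_def by (rule order_tendstoD(1))
  then show "\<forall>\<^sub>F s in at t. \<gamma> s \<in> V"
    by (rule eventually_mono) (use f(3) in force)
qed

text \<open>The curve \<open>\<gamma> t - \<gamma>' t\<close> has zero derivative: both factors move with velocity \<open>x\<close>, and smooth functions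
  separate points.\<close>

lemma one_parameter_subgroup_unique:
  assumes vf: "left_invariant_vector_field A (vf x)"
    and \<gamma>: "one_parameter_subgroup A vf x \<gamma>" and \<gamma>': "one_parameter_subgroup A vf x \<gamma>'"
  shows "\<gamma> = \<gamma>'"
proof
  fix t
  have hom: "\<gamma> (s + t) = \<gamma> s + \<gamma> t" "\<gamma>' (s + t) = \<gamma>' s + \<gamma>' t" for s t
    using \<gamma> \<gamma>' by (auto simp: one_parameter_subgroup_def)
  have der: "((\<lambda>s. f (\<gamma> s)) has_real_derivative vf x f (\<gamma> t)) (at t)"
    "((\<lambda>s. f (\<gamma>' s)) has_real_derivative vf x f (\<gamma>' t)) (at t)" if "smooth_fun A f" for f t
    using \<gamma> \<gamma>' that by (auto simp: one_parameter_subgroup_def)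
  have zero: "\<gamma> 0 = 0" "\<gamma>' 0 = 0"
    using add_left_imp_eq[of "\<gamma> 0" "\<gamma> 0" 0] add_left_imp_eq[of "\<gamma>' 0" "\<gamma>' 0" 0] hom[of 0 0]
    by (simp_all only: add_0_right)
  have minus: "\<gamma>' (- s) = - \<gamma>' s" for s
    using hom(2)[of "- s" s] zero by (simp add: eq_neg_iff_add_eq_0)
  define H where "H F e = F (\<gamma> e - \<gamma>' e)" for F :: "'g \<Rightarrow> real" and e
  have H0: "(H F has_real_derivative 0) (at 0)" if F: "smooth_fun A F" for F
  proof -
    define c where "c = vf x F 0"
    have smooth_vf: "smooth_fun A (vf x F)"
      using vf F by (simp add: left_invariant_vector_field_def)
    have "isCont (\<lambda>q. \<gamma> (fst q) - \<gamma>' (snd q)) (0, 0)"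
      by (intro continuous_intros isCont_o2[OF _ one_parameter_subgroup_continuous[OF \<gamma>]]
          isCont_o2[OF _ one_parameter_subgroup_continuous[OF \<gamma>']])
    moreover have "isCont (vf x F) (\<gamma> (fst (0, 0)) - \<gamma>' (snd (0, 0)))"
      using smooth_fun_continuous[OF smooth_vf] by (simp add: continuous_on_eq_continuous_at)
    ultimately have cont: "isCont (\<lambda>q. vf x F (\<gamma> (fst q) - \<gamma>' (snd q))) (0, 0)"
      by (rule isCont_o2)
    have "((\<lambda>e. (H F e - H F 0) / (e - 0)) \<longlongrightarrow> 0) (at 0)"
    proof (rule LIM_I)
      fix r :: real assume "r > 0"
      have "\<exists>s>0. \<forall>q. norm (q - (0, 0)) < s \<longrightarrow> norm (vf x F (\<gamma> (fst q) - \<gamma>' (snd q)) - vf x F (\<gamma> 0 - \<gamma>' 0)) < r / 3"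
        using cont \<open>r > 0\<close> unfolding isCont_def LIM_eq
        by (metis (no_types, lifting) diff_self divide_pos_pos fst_conv norm_zero snd_conv zero_less_numeral)
      then obtain s1 where s1: "s1 > 0" "\<And>a b. norm (a, b) < s1 \<Longrightarrow> \<bar>vf x F (\<gamma> a - \<gamma>' b) - c\<bar> < r / 3"
        by (auto simp: zero c_def)
      have "((\<lambda>e. (F (\<gamma> e) - F (\<gamma> 0)) / (e - 0)) \<longlongrightarrow> c) (at 0)"
        using der(1)[OF F, of 0] by (simp add: has_field_derivative_iff zero c_def)
      then obtain s2 where s2: "s2 > 0" "\<And>e. e \<noteq> 0 \<Longrightarrow> \<bar>e\<bar> < s2 \<Longrightarrow> \<bar>(F (\<gamma> e) - F 0) / e - c\<bar> < r / 3"
        using LIM_D[of "\<lambda>e. (F (\<gamma> e) - F (\<gamma> 0)) / (e - 0)" c 0 "r / 3"] \<open>r > 0\<close> zero by auto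
      have "norm ((H F e - H F 0) / (e - 0) - 0) < r" if e: "e \<noteq> 0" "\<bar>e\<bar> < min (s1 / 2) s2" for e
      proof -
        \<comment> \<open>For fixed \<open>e\<close> the mean value inequality in \<open>s\<close>
          compares F (\<gamma> e - \<gamma>' s) with a linear function of slope -c. Left invariance
          turns the derivative into the value of \<open>vf x F\<close> at \<gamma> e - \<gamma>' s,
          and this is close to \<open>c\<close> by continuity in both arguments jointly.\<close>
        define P where "P s = F (\<gamma> e - \<gamma>' s) + s * c" for s
        have dP: "(P has_real_derivative - vf x F (\<gamma> e - \<gamma>' s) + c) (at s within {- \<bar>e\<bar>..\<bar>e\<bar>})" for s
        proof -
          have "smooth_fun A (\<lambda>u. F (\<gamma> e + u))" by (rule smooth_translate_left[OF F])
          from der(2)[OF this, of "- s"]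
          have "((\<lambda>s. F (\<gamma> e + \<gamma>' s)) has_real_derivative vf x (\<lambda>u. F (\<gamma> e + u)) (\<gamma>' (- s))) (at (- s))" .
          moreover have "vf x (\<lambda>u. F (\<gamma> e + u)) = (\<lambda>u. vf x F (\<gamma> e + u))"
            using vf F unfolding left_invariant_vector_field_def by blast
          ultimately have "((\<lambda>s. F (\<gamma> e + \<gamma>' s)) has_real_derivative vf x F (\<gamma> e - \<gamma>' s)) (at (- s))"
            by (simp add: minus)
          then have "((\<lambda>s. F (\<gamma> e + \<gamma>' (- s))) has_real_derivative vf x F (\<gamma> e - \<gamma>' s) * (- 1)) (at s)"
            by (rule DERIV_chain2) (auto intro!: derivative_eq_intros)
          then have "(P has_real_derivative vf x F (\<gamma> e - \<gamma>' s) * (- 1) + c) (at s)"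
            unfolding P_def minus by (auto intro!: derivative_eq_intros)
          then show ?thesis by (simp add: has_field_derivative_at_within)
        qed
        have bound: "norm (- vf x F (\<gamma> e - \<gamma>' s) + c) \<le> r / 3" if "s \<in> {- \<bar>e\<bar>..\<bar>e\<bar>}" for s
        proof -
          have "norm (e, s) \<le> \<bar>e\<bar> + \<bar>s\<bar>" using norm_Pair_le[of e s] by simp
          then have "norm (e, s) < s1" using e that by auto
          then show ?thesis using s1(2)[of e s] abs_minus_commute[of c] by simp
        qed
        have "norm (P e - P 0) \<le> r / 3 * norm (e - 0)"
          by (rule field_differentiable_bound[OF _ dP bound]) auto
        then have 1: "\<bar>F (\<gamma> e - \<gamma>' e) - F (\<gamma> e) + e * c\<bar> \<le> r / 3 * \<bar>e\<bar>"
          by (simp add: P_def zero algebra_simps)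
        have "\<bar>(F (\<gamma> e) - F 0) / e - c\<bar> * \<bar>e\<bar> \<le> r / 3 * \<bar>e\<bar>"
          using s2(2)[OF e(1)] e(2) by (intro mult_right_mono) auto
        moreover have "((F (\<gamma> e) - F 0) / e - c) * e = F (\<gamma> e) - F 0 - e * c"
          using e(1) by (simp add: field_simps)
        ultimately have 2: "\<bar>F (\<gamma> e) - F 0 - e * c\<bar> \<le> r / 3 * \<bar>e\<bar>"
          by (metis abs_mult)
        have "\<bar>H F e - H F 0\<bar> \<le> 2 * (r / 3 * \<bar>e\<bar>)"
          using 1 2 unfolding H_def zero diff_0_right by linarith
        also have "\<dots> < r * \<bar>e\<bar>" using \<open>r > 0\<close> e(1) by simp
        finally show ?thesis using e(1) by (simp add: abs_divide field_simps)
      qed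
      then show "\<exists>s>0. \<forall>e. e \<noteq> 0 \<and> norm (e - 0) < s \<longrightarrow> norm ((H F e - H F 0) / (e - 0) - 0) < r"
        using s1(1) s2(1) by (intro exI[of _ "min (s1 / 2) s2"]) auto
    qed
    then show ?thesis by (simp add: has_field_derivative_iff)
  qed
  \<comment> \<open>The identity \<gamma> (t + e) - \<gamma>' (t + e) = \<gamma> t + (\<gamma> e -
    \<gamma>' e) - \<gamma>' t reduces the derivative at t to the one at 0, for a translated
    function.\<close>
  have der_zero: "(H f has_real_derivative 0) (at t)" if f: "smooth_fun A f" for f t
  proof -
    define F where "F u = f (\<gamma> t + u - \<gamma>' t)" for u
    have "smooth_fun A (\<lambda>u. f (\<gamma> t + u + - \<gamma>' t))"
      using smooth_translate_left[OF smooth_translate_right[OF f, of "- \<gamma>' t"], of "\<gamma> t"] .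
    then have F: "smooth_fun A F" unfolding F_def by simp
    have "H f (t + e) = H F e" for e
    proof -
      have "\<gamma> (t + e) - \<gamma>' (t + e) = \<gamma> t + (\<gamma> e - \<gamma>' e) - \<gamma>' t"
        by (simp add: hom diff_conv_add_uminus minus_add add.assoc del: add_uminus_conv_diff)
      then show ?thesis by (simp add: H_def F_def)
    qed
    then have "(\<lambda>e. H f (t + e)) = H F" by (rule ext)
    then have "((\<lambda>e. H f (t + e)) has_real_derivative 0) (at 0)" using H0[OF F] by (simp only:)
    then show ?thesis using DERIV_shift[of "H f" 0 0 t] by (simp add: add.commute)
  qed
  show "\<gamma> t = \<gamma>' t"
  proof (rule ccontr)
    assume neq: "\<gamma> t \<noteq> \<gamma>' t"
    have "open (- {\<gamma> t - \<gamma>' t})" "0 \<in> - {\<gamma> t - \<gamma>' t}" using neq by auto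
    then obtain f where f: "smooth_fun A f" "f 0 > 0" "\<And>u. u \<notin> - {\<gamma> t - \<gamma>' t} \<Longrightarrow> f u = 0"
      using bump_exists by metis
    have "H f t = H f 0" using der_zero[OF f(1)] DERIV_isconst_all by blast
    then show False using f(2) f(3)[of "\<gamma> t - \<gamma>' t"] by (simp add: H_def zero)
  qed
qed

lemma lie_exp_one_parameter:
  assumes "left_invariant_vector_field A (vf x)" "one_parameter_subgroup A vf x \<gamma>"
  shows "lie_exp A vf x = \<gamma> 1"
  unfolding lie_exp_def using one_parameter_subgroup_unique[where vf = vf] assms by (intro the_equality) blast+

lemma one_parameter_subgroup_scale:
  assumes alg: "lie_algebra_of A br vf" and \<gamma>: "one_parameter_subgroup A vf x \<gamma>"
  shows "one_parameter_subgroup A vf (a *\<^sub>R x) (\<lambda>s. \<gamma> (a * s))"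
  unfolding one_parameter_subgroup_def
proof (intro conjI allI impI)
  show "\<gamma> (a * (s + t)) = \<gamma> (a * s) + \<gamma> (a * t)" for s t
    using \<gamma> by (simp add: one_parameter_subgroup_def distrib_left)
  fix f t assume f: "smooth_fun A f"
  have "vf (a *\<^sub>R x + 0 *\<^sub>R x) f = (\<lambda>g. a * vf x f g + 0 * vf x f g)"
    using alg f unfolding lie_algebra_of_def by blast
  moreover have "((\<lambda>s. f (\<gamma> s)) has_real_derivative vf x f (\<gamma> (a * t))) (at (a * t))"
    using \<gamma> f by (simp add: one_parameter_subgroup_def)
  then have "((\<lambda>s. f (\<gamma> (a * s))) has_real_derivative vf x f (\<gamma> (a * t)) * a) (at t)"
    by (rule DERIV_chain2) (auto intro!: derivative_eq_intros)
  ultimately show "((\<lambda>s. f (\<gamma> (a * s))) has_real_derivative vf (a *\<^sub>R x) f (\<gamma> (a * t))) (at t)"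
    by (simp add: mult.commute)
qed

lemma lie_exp_scale:
  assumes "lie_algebra_of A br vf" "one_parameter_subgroup A vf x \<gamma>"
  shows "lie_exp A vf (a *\<^sub>R x) = \<gamma> a"
  using lie_exp_one_parameter[where vf = vf, OF _ one_parameter_subgroup_scale[OF assms, of a]] assms(1)
  by (simp add: lie_algebra_of_def)

end

section \<open>Casimir operators and filtrations of equivariant representations\<close>

section \<open>Representations with an equivariant group action\<close>

text \<open>Only these properties of the adjoint action \<open>\<alpha>\<close> of \<open>K\<close> are needed; for an irreducible
  \<open>(g, K)\<close>-module they follow from the equivariance of \<open>\<pi>\<close>.\<close>

locale equivariant_rep = cartan br \<theta>
  for br :: "'l::euclidean_space \<Rightarrow> 'l \<Rightarrow> 'l" and \<theta> +
  fixes K :: "'g set" and \<alpha> :: "'g \<Rightarrow> 'l \<Rightarrow> 'l"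
    and \<pi> :: "'l \<Rightarrow> 'v::complex_vector \<Rightarrow> 'v" and \<rho> :: "'g \<Rightarrow> 'v \<Rightarrow> 'v"
  assumes rep: "lie_representation br \<pi>"
    and clin_\<rho>: "\<And>g. g \<in> K \<Longrightarrow> clinear (\<rho> g)"
    and equiv: "\<And>g x v. g \<in> K \<Longrightarrow> \<rho> g (\<pi> x v) = \<pi> (\<alpha> g x) (\<rho> g v)"
    and lin_\<alpha>: "\<And>g. g \<in> K \<Longrightarrow> linear (\<alpha> g)"
    and surj_\<alpha>: "\<And>g. g \<in> K \<Longrightarrow> \<exists>h. \<forall>x. \<alpha> g (h x) = x"
    and B_\<alpha>: "\<And>g x y. g \<in> K \<Longrightarrow> killing_form br (\<alpha> g x) (\<alpha> g y) = killing_form br x y"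
begin

lemma clin_\<pi>: "clinear (\<pi> x)"
  using rep by (simp add: lie_representation_def)

lemmas \<pi>_simps = clinear_simps[OF clin_\<pi>]

lemma \<pi>_lin: "\<pi> (a *\<^sub>R x + b *\<^sub>R y) v = complex_of_real a *\<^sub>C \<pi> x v + complex_of_real b *\<^sub>C \<pi> y v"
  using rep unfolding lie_representation_def by blast

lemma \<pi>_add: "\<pi> (x + y) v = \<pi> x v + \<pi> y v"
  using \<pi>_lin[of 1 x 1 y v] by (simp add: scaleC_one)

lemma \<pi>_scale: "\<pi> (a *\<^sub>R x) v = complex_of_real a *\<^sub>C \<pi> x v"
  using \<pi>_lin[of a x 0 x v] by (simp add: complex_vector.scale_zero_left)

lemma \<pi>_zero: "\<pi> 0 v = 0"
  using \<pi>_scale[of 0 0 v] by (simp add: complex_vector.scale_zero_left)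

lemma \<pi>_minus: "\<pi> (- x) v = - \<pi> x v"
  using \<pi>_scale[of "-1" x v] by (simp add: complex_vector.scale_minus_left scaleC_one)

lemma \<pi>_diff: "\<pi> (x - y) v = \<pi> x v - \<pi> y v"
  using \<pi>_add[of x "- y"] by (simp add: \<pi>_minus)

lemma \<pi>_br: "\<pi> (br x y) v = \<pi> x (\<pi> y v) - \<pi> y (\<pi> x v)"
  using rep unfolding lie_representation_def by blast

lemma \<pi>_sum: "\<pi> (\<Sum>i\<in>I. f i) v = (\<Sum>i\<in>I. \<pi> (f i) v)"
  by (induction I rule: infinite_finite_induct) (auto simp: \<pi>_zero \<pi>_add)

definition casimir :: "'l set \<Rightarrow> 'v \<Rightarrow> 'v"
  where "casimir E v = cas E (\<lambda>x y. \<pi> x (\<pi> y v))"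

lemma rbilinear_\<pi>: "rbilinear (\<lambda>x y. \<pi> x (\<pi> y v))"
  by (simp add: rbilinear_def \<pi>_add \<pi>_scale \<pi>_simps)

lemma clinear_casimir: "clinear (casimir E)"
  unfolding casimir_def cas_def
  by (intro clinear_setsum clinear_scaleC clinear_compose[OF clin_\<pi>] clin_\<pi>)

lemma casimir_\<pi>:
  assumes "onb UNIV E"
  shows "casimir E (\<pi> x v) = \<pi> x (casimir E v)"
proof -
  have "cas E (\<lambda>a b. \<pi> (br x a) (\<pi> b v) + \<pi> a (\<pi> (br x b) v)) = 0"
    by (rule cas_skew[OF assms rbilinear_\<pi>]) (auto simp: B_skew)
  moreover have "\<pi> (br x a) (\<pi> b v) + \<pi> a (\<pi> (br x b) v) = \<pi> x (\<pi> a (\<pi> b v)) - \<pi> a (\<pi> b (\<pi> x v))" for a b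
    by (simp add: \<pi>_br \<pi>_simps)
  ultimately have "\<pi> x (casimir E v) - casimir E (\<pi> x v) = 0"
    by (simp add: casimir_def cas_def \<pi>_simps complex_vector.scale_right_diff_distrib sum_subtractf)
  then show ?thesis by simp
qed

lemma casimir_\<rho>:
  assumes "onb UNIV E" "g \<in> K"
  shows "casimir E (\<rho> g v) = \<rho> g (casimir E v)"
proof -
  obtain h where h: "\<And>x. \<alpha> g (h x) = x" using surj_\<alpha>[OF assms(2)] by blast
  have "\<rho> g (casimir E v) = cas E (\<lambda>a b. \<pi> (\<alpha> g a) (\<pi> (\<alpha> g b) (\<rho> g v)))"
    unfolding casimir_def cas_def
    by (simp add: clinear_simps[OF clin_\<rho>[OF assms(2)]] equiv[OF assms(2)])
  also have "\<dots> = casimir E (\<rho> g v)"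
    unfolding casimir_def by (rule cas_isometry[OF assms(1) rbilinear_\<pi>]) (use h B_\<alpha>[OF assms(2)] in auto)
  finally show ?thesis by simp
qed

abbreviation submodule where "submodule \<equiv> gK_submodule K \<pi> \<rho>"

lemma submoduleI:
  assumes "csubspace W" "\<And>x v. v \<in> W \<Longrightarrow> \<pi> x v \<in> W" "\<And>g v. g \<in> K \<Longrightarrow> v \<in> W \<Longrightarrow> \<rho> g v \<in> W"
  shows "submodule W"
  using assms by (auto simp: gK_submodule_def)

lemma submoduleD:
  assumes "submodule W"
  shows "csubspace W" "v \<in> W \<Longrightarrow> \<pi> x v \<in> W" "g \<in> K \<Longrightarrow> v \<in> W \<Longrightarrow> \<rho> g v \<in> W"
  using assms by (auto simp: gK_submodule_def image_subset_iff)

lemma submodule_zero: "submodule {0}"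
proof (rule submoduleI)
  show "csubspace {0::'v}" by (auto intro!: csubspaceI simp: complex_vector.scale_zero_right)
qed (auto simp: \<pi>_simps clinear_zero[OF clin_\<rho>])

lemma casimir_submodule:
  assumes "onb UNIV E" "submodule W" "v \<in> W"
  shows "casimir E v \<in> W"
  unfolding casimir_def cas_def
  using submoduleD[OF assms(2)] assms(3) by (intro csub_simps(6,3)) auto

text \<open>Kernel and image of the Casimir operator minus a scalar are submodules, so
  \<open>dixmier\<close> applies to the irreducible factor; the family \<open>X\<close> expresses
  that its dimension is countable.\<close>

lemma casimir_scalar_on_factor:
  fixes X :: "nat \<Rightarrow> 'v set"
  assumes E: "onb UNIV E" and Z: "submodule Z" "submodule Z'" "Z \<subset> Z'"
    and irr: "\<nexists>W. submodule W \<and> Z \<subset> W \<and> W \<subset> Z'"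
    and exh: "\<And>n. cfinite_dim (X n)" "Z' \<subseteq> (\<Union>n. X n)"
  obtains l where "\<And>v. v \<in> Z' \<Longrightarrow> casimir E v - l *\<^sub>C v \<in> Z"
proof (rule dixmier[of "casimir E" Z Z' X])
  note D = submoduleD[OF Z(1)] and D' = submoduleD[OF Z(2)]
  note C = clinear_simps[OF clinear_casimir[of E]]
  show "clinear (casimir E)" by (rule clinear_casimir)
  show "csubspace Z" "csubspace Z'" by fact+
  show "casimir E ` Z \<subseteq> Z" "casimir E ` Z' \<subseteq> Z'" using casimir_submodule[OF E] Z by auto
  have sub: "W = Z \<or> W = Z'" if "submodule W" "Z \<subseteq> W" "W \<subseteq> Z'" for W
    using irr that by blast
  show "{v \<in> Z'. casimir E v - l *\<^sub>C v \<in> Z} = Z \<or> {v \<in> Z'. casimir E v - l *\<^sub>C v \<in> Z} = Z'" for l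
  proof (rule sub)
    show "submodule {v \<in> Z'. casimir E v - l *\<^sub>C v \<in> Z}"
    proof (rule submoduleI)
      have lin: "clinear (\<lambda>v. casimir E v - l *\<^sub>C v)"
        by (intro clinear_minus' clinear_casimir clinear_scaleC clinear_ident)
      show "csubspace {v \<in> Z'. casimir E v - l *\<^sub>C v \<in> Z}"
        using D(1) D'(1) clinear_simps(1,2,3)[OF lin] by (intro csubspaceI) (auto simp: csub_simps)
      fix x v assume v: "v \<in> {v \<in> Z'. casimir E v - l *\<^sub>C v \<in> Z}"
      have "casimir E (\<pi> x v) - l *\<^sub>C \<pi> x v = \<pi> x (casimir E v - l *\<^sub>C v)"
        by (simp add: casimir_\<pi>[OF E] \<pi>_simps)
      then show "\<pi> x v \<in> {v \<in> Z'. casimir E v - l *\<^sub>C v \<in> Z}"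
        using v D(2) D'(2) by auto
    next
      fix g v assume g: "g \<in> K" and v: "v \<in> {v \<in> Z'. casimir E v - l *\<^sub>C v \<in> Z}"
      have "casimir E (\<rho> g v) - l *\<^sub>C \<rho> g v = \<rho> g (casimir E v - l *\<^sub>C v)"
        by (simp add: casimir_\<rho>[OF E g] clinear_simps[OF clin_\<rho>[OF g]])
      then show "\<rho> g v \<in> {v \<in> Z'. casimir E v - l *\<^sub>C v \<in> Z}"
        using v D(3)[OF g] D'(3)[OF g] by auto
    qed
    show "Z \<subseteq> {v \<in> Z'. casimir E v - l *\<^sub>C v \<in> Z}"
      using Z(3) casimir_submodule[OF E Z(1)] csub_simps(3,4)[OF D(1)] by auto
  qed auto
  show "{casimir E v - l *\<^sub>C v + z | v z. v \<in> Z' \<and> z \<in> Z} = Z \<or> {casimir E v - l *\<^sub>C v + z | v z. v \<in> Z' \<and> z \<in> Z} = Z'" for l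
  proof (rule sub)
    let ?I = "{casimir E v - l *\<^sub>C v + z | v z. v \<in> Z' \<and> z \<in> Z}"
    show "submodule ?I"
    proof (rule submoduleI)
      have "casimir E 0 - l *\<^sub>C 0 + 0 = 0" by (simp add: C complex_vector.scale_zero_right)
      then have z: "0 \<in> ?I" using csub_simps(1)[OF D(1)] csub_simps(1)[OF D'(1)]
        by (metis (mono_tags, lifting) mem_Collect_eq)
      show "csubspace ?I"
      proof (rule csubspaceI[OF z])
        fix a b assume "a \<in> ?I" "b \<in> ?I"
        then obtain v z v' z' where *: "a = casimir E v - l *\<^sub>C v + z" "b = casimir E v' - l *\<^sub>C v' + z'"
          "v \<in> Z'" "v' \<in> Z'" "z \<in> Z" "z' \<in> Z" by blast
        have "a + b = casimir E (v + v') - l *\<^sub>C (v + v') + (z + z')"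
          by (simp add: * C scaleC_add_right)
        then show "a + b \<in> ?I" using * csub_simps(2)[OF D(1)] csub_simps(2)[OF D'(1)] by blast
      next
        fix c a assume "a \<in> ?I"
        then obtain v z where *: "a = casimir E v - l *\<^sub>C v + z" "v \<in> Z'" "z \<in> Z" by blast
        have "c *\<^sub>C a = casimir E (c *\<^sub>C v) - l *\<^sub>C (c *\<^sub>C v) + c *\<^sub>C z"
          by (simp add: * C scaleC_add_right complex_vector.scale_right_diff_distrib
              complex_vector.scale_left_commute)
        then show "c *\<^sub>C a \<in> ?I" using * csub_simps(3)[OF D(1)] csub_simps(3)[OF D'(1)] by blast
      qed
      fix x a assume "a \<in> ?I"
      then obtain v z where *: "a = casimir E v - l *\<^sub>C v + z" "v \<in> Z'" "z \<in> Z" by blast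
      have "\<pi> x a = casimir E (\<pi> x v) - l *\<^sub>C (\<pi> x v) + \<pi> x z"
        by (simp add: * \<pi>_simps casimir_\<pi>[OF E])
      then show "\<pi> x a \<in> ?I" using * D(2) D'(2) by blast
    next
      fix g a assume g: "g \<in> K" and "a \<in> ?I"
      then obtain v z where *: "a = casimir E v - l *\<^sub>C v + z" "v \<in> Z'" "z \<in> Z" by blast
      have "\<rho> g a = casimir E (\<rho> g v) - l *\<^sub>C (\<rho> g v) + \<rho> g z"
        by (simp add: * clinear_simps[OF clin_\<rho>[OF g]] casimir_\<rho>[OF E g])
      then show "\<rho> g a \<in> ?I" using * D(3)[OF g] D'(3)[OF g] by blast
    qed
    show "Z \<subseteq> ?I"
    proof
      fix z assume "z \<in> Z"
      moreover have "z = casimir E 0 - l *\<^sub>C 0 + z" by (simp add: C complex_vector.scale_zero_right)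
      ultimately show "z \<in> ?I" using csub_simps(1)[OF D'(1)] by blast
    qed
    show "?I \<subseteq> Z'"
    proof safe
      fix v z assume "v \<in> Z'" "z \<in> Z"
      then show "casimir E v - l *\<^sub>C v + z \<in> Z'"
        using Z(3) casimir_submodule[OF E Z(2)]
        by (intro csub_simps(2)[OF D'(1)] csub_simps(4)[OF D'(1)] csub_simps(3)[OF D'(1)]) auto
    qed
  qed
  show "Z \<subset> Z'" by (rule Z(3))
  show "cfinite_dim (X n)" for n by (rule exh(1))
  show "Z' \<subseteq> (\<Union>n. X n)" by (rule exh(2))
  show thesis if "\<And>v. v \<in> Z' \<Longrightarrow> casimir E v - l *\<^sub>C v \<in> Z" for l
    using that \<open>\<And>l. (\<And>v. v \<in> Z' \<Longrightarrow> casimir E v - l *\<^sub>C v \<in> Z) \<Longrightarrow> thesis\<close> by metis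
qed

text \<open>One linear factor for each step of a composition series.\<close>

lemma casimir_polynomial:
  fixes X :: "nat \<Rightarrow> 'v set"
  assumes E: "onb UNIV E" and Y: "gK_finite_length K \<pi> \<rho> Y"
    and exh: "\<And>n. cfinite_dim (X n)" "(\<Union>n. X n) = UNIV"
  obtains ls where "\<And>v. v \<in> Y \<Longrightarrow> op_prod (casimir E) ls v = 0"
proof -
  obtain n Z where Z: "Z 0 = {0}" "Z n = Y" "\<And>i. i \<le> n \<Longrightarrow> submodule (Z i)"
    "\<And>i. i < n \<Longrightarrow> Z i \<subset> Z (Suc i) \<and> (\<nexists>W. submodule W \<and> Z i \<subset> W \<and> W \<subset> Z (Suc i))"
    using Y unfolding gK_finite_length_def by blast
  have app: "op_prod (casimir E) (ls @ [l]) v = op_prod (casimir E) ls (casimir E v - l *\<^sub>C v)" for ls l v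
    by (induction ls) (auto simp: clinear_simps[OF clinear_casimir])
  have "\<exists>ls. \<forall>v\<in>Z i. op_prod (casimir E) ls v = 0" if "i \<le> n" for i
    using that
  proof (induction i)
    case 0
    have "op_prod (casimir E) [] v = 0" if "v \<in> Z 0" for v using that Z(1) by simp
    then show ?case by blast
  next
    case (Suc i)
    then obtain ls where ls: "\<And>v. v \<in> Z i \<Longrightarrow> op_prod (casimir E) ls v = 0" by auto
    have "submodule (Z i)" "submodule (Z (Suc i))" "Z i \<subset> Z (Suc i)"
      "\<nexists>W. submodule W \<and> Z i \<subset> W \<and> W \<subset> Z (Suc i)" "Z (Suc i) \<subseteq> (\<Union>n. X n)"
      using Z(3)[of i] Z(3)[of "Suc i"] Z(4)[of i] Suc.prems exh(2) by auto
    from casimir_scalar_on_factor[OF E this(1-4) exh(1) this(5)]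
    obtain l where l: "\<And>v. v \<in> Z (Suc i) \<Longrightarrow> casimir E v - l *\<^sub>C v \<in> Z i" by metis
    then have "op_prod (casimir E) (ls @ [l]) v = 0" if "v \<in> Z (Suc i)" for v
      using ls[OF l[OF that]] by (simp add: app)
    then show ?case by blast
  qed
  from this[of n] show ?thesis using Z(2) that by auto
qed

subsection \<open>The action of the complexified Lie algebra\<close>

abbreviation act where "act \<equiv> complexify_rep \<pi>"
abbreviation brC where "brC \<equiv> complexify_bracket br"

lemma clinear_act: "clinear (act y)"
  unfolding complexify_rep_def by (intro clinear_plus clinear_scaleC clin_\<pi>)

lemma act_linear: "clinear (\<lambda>y. act y v)"
proof (rule clinearI)
  show "act (y + z) v = act y v + act z v" for y z
    by (simp add: complexify_rep_def complexification_simps \<pi>_add scaleC_add_right)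
  fix a y
  let ?r = "\<pi> (real_part y) v" and ?i = "\<pi> (imag_part y) v"
  let ?R = "complex_of_real (Re a)" and ?I = "complex_of_real (Im a)"
  have "a *\<^sub>C act y v = (?R + \<i> * ?I) *\<^sub>C (?r + \<i> *\<^sub>C ?i)"
    using complex_eq[of a] by (simp add: complexify_rep_def)
  also have "\<dots> = (?R *\<^sub>C ?r + (?I * (\<i> * \<i>)) *\<^sub>C ?i) + \<i> *\<^sub>C (?R *\<^sub>C ?i + ?I *\<^sub>C ?r)"
    by (simp add: scaleC_add_left scaleC_add_right scaleC_scaleC algebra_simps)
  also have "\<dots> = act (a *\<^sub>C y) v"
    by (simp add: complexify_rep_def complexification_simps \<pi>_add \<pi>_diff \<pi>_scale complex_vector.scale_minus_left)
  finally show "act (a *\<^sub>C y) v = a *\<^sub>C act y v" by simp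
qed

lemma act_brC: "act (brC x y) v = act x (act y v) - act y (act x v)"
  by (simp add: complexify_rep_def complexify_bracket_def \<pi>_br \<pi>_add \<pi>_diff \<pi>_simps scaleC_add_right
      scaleC_scaleC complex_vector.scale_right_diff_distrib complex_vector.scale_minus_left scaleC_one)

lemma act_real: "act (Complexify x 0) v = \<pi> x v"
  by (simp add: complexify_rep_def \<pi>_zero complex_vector.scale_zero_right)

lemma filtered_moduleI:
  assumes "csubspace W" "cfinite_dim W" "\<And>x w. x \<in> k \<Longrightarrow> w \<in> W \<Longrightarrow> \<pi> x w \<in> W"
  shows "filtered_module brC kC act W"
proof (rule filtered_module.intro)
  fix y w assume "y \<in> kC" "w \<in> W"
  then show "act y w \<in> W"
    using assms(3) csub_simps(2,3)[OF assms(1)]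
    by (auto simp: complexify_rep_def kC_def complexify_set_def)
qed (rule clinear_act act_linear act_brC cfinite_dim_complexification assms)+

lemma filtration_\<rho>:
  assumes W: "csubspace W" "cfinite_dim W" "\<And>x w. x \<in> k \<Longrightarrow> w \<in> W \<Longrightarrow> \<pi> x w \<in> W"
    "\<And>g w. g \<in> K \<Longrightarrow> w \<in> W \<Longrightarrow> \<rho> g w \<in> W"
    and g: "g \<in> K" and v: "v \<in> filtered_module.F act W n"
  shows "\<rho> g v \<in> filtered_module.F act W n"
proof -
  interpret fm: filtered_module brC kC act W by (rule filtered_moduleI[OF W(1-3)])
  note \<rho> = clinear_simps[OF clin_\<rho>[OF g]]
  show ?thesis using v
  proof (induction n arbitrary: v)
    case 0 then show ?case using W(4)[OF g] by simp
  next
    case (Suc n)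
    have "csubspace {v. \<rho> g v \<in> fm.F (Suc n)}"
      using fm.subF[of "Suc n"] by (intro csubspaceI) (simp_all add: \<rho> csub_simps del: fm.F.simps)
    then have "fm.F (Suc n) \<subseteq> {v. \<rho> g v \<in> fm.F (Suc n)}"
    proof (rule fm.F_Suc_subset)
      show "fm.F n \<subseteq> {v. \<rho> g v \<in> fm.F (Suc n)}" using Suc.IH fm.F_Suc by blast
      fix y v assume "v \<in> fm.F n"
      then have "act (Complexify (\<alpha> g (real_part y)) (\<alpha> g (imag_part y))) (\<rho> g v) \<in> fm.F (Suc n)"
        using Suc.IH fm.act_F by blast
      then show "act y v \<in> {v. \<rho> g v \<in> fm.F (Suc n)}"
        by (simp add: complexify_rep_def \<rho> equiv[OF g] del: fm.F.simps)
    qed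
    then show ?case using Suc.prems by blast
  qed
qed

lemma filtration_union_submodule:
  assumes W: "csubspace W" "cfinite_dim W" "\<And>x w. x \<in> k \<Longrightarrow> w \<in> W \<Longrightarrow> \<pi> x w \<in> W"
    "\<And>g w. g \<in> K \<Longrightarrow> w \<in> W \<Longrightarrow> \<rho> g w \<in> W"
  shows "submodule (\<Union>n. filtered_module.F act W n)"
proof -
  interpret fm: filtered_module brC kC act W by (rule filtered_moduleI[OF W(1-3)])
  show ?thesis
  proof (rule submoduleI)
    show "csubspace (\<Union>n. fm.F n)"
    proof (rule csubspaceI)
      show "0 \<in> (\<Union>n. fm.F n)" using csub_simps(1)[OF fm.subF] by blast
    next
      fix v w assume "v \<in> (\<Union>n. fm.F n)" "w \<in> (\<Union>n. fm.F n)"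
      then obtain m n where "v \<in> fm.F m" "w \<in> fm.F n" by blast
      then have "v \<in> fm.F (max m n)" "w \<in> fm.F (max m n)" using fm.F_mono by (meson max.cobounded1 max.cobounded2 subsetD)+
      then show "v + w \<in> (\<Union>n. fm.F n)" using csub_simps(2)[OF fm.subF] by blast
    next
      fix a v assume "v \<in> (\<Union>n. fm.F n)"
      then show "a *\<^sub>C v \<in> (\<Union>n. fm.F n)" using csub_simps(3)[OF fm.subF] by blast
    qed
    show "\<pi> x v \<in> (\<Union>n. fm.F n)" if v: "v \<in> (\<Union>n. fm.F n)" for x v
    proof -
      obtain n where "v \<in> fm.F n" using v by blast
      then have "act (Complexify x 0) v \<in> fm.F (Suc n)" by (rule fm.act_F)
      then show ?thesis unfolding act_real by blast
    qed
    show "\<rho> g v \<in> (\<Union>n. fm.F n)" if "g \<in> K" "v \<in> (\<Union>n. fm.F n)" for g v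
      using filtration_\<rho>[OF W that(1)] that(2) by blast
  qed
qed

end

section \<open>The adjoint action of K, recovered from an irreducible module\<close>

section \<open>Irreducible \<open>(g, K)\<close>-modules\<close>

locale gK_irr = cartan br \<theta> + lie_grp A
  for br :: "'l::euclidean_space \<Rightarrow> 'l \<Rightarrow> 'l" and \<theta>
    and A :: "('g::{topological_group_add, t2_space, second_countable_topology}, 'e::euclidean_space) chart set" +
  fixes vf :: "'l \<Rightarrow> ('g \<Rightarrow> real) \<Rightarrow> ('g \<Rightarrow> real)" and K :: "'g set"
    and \<pi> :: "'l \<Rightarrow> 'v::complex_vector \<Rightarrow> 'v" and \<rho> :: "'g \<Rightarrow> 'v \<Rightarrow> 'v"
  assumes alg: "lie_algebra_of A br vf" and sub: "connected_lie_subgroup A vf k K"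
    and module: "gK_module A br vf k K \<pi> \<rho>" and irr: "gK_irreducible K \<pi> \<rho>"
    and infdim: "\<not> cfinite_dim (UNIV :: 'v set)"
begin

abbreviation Adj where "Adj \<equiv> Ad A vf"

lemma K_zero: "0 \<in> K" and K_add: "g \<in> K \<Longrightarrow> h \<in> K \<Longrightarrow> g + h \<in> K" and K_minus: "g \<in> K \<Longrightarrow> - g \<in> K"
  using sub by (auto simp: connected_lie_subgroup_def)

lemma lie_exp_K: "x \<in> k \<Longrightarrow> lie_exp A vf (t *\<^sub>R x) \<in> K"
  using sub unfolding connected_lie_subgroup_def by blast

lemma module_facts:
  shows rep: "lie_representation br \<pi>"
    and clin_\<rho>: "g \<in> K \<Longrightarrow> clinear (\<rho> g)"
    and \<rho>_zero: "\<rho> 0 v = v"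
    and \<rho>_add: "g \<in> K \<Longrightarrow> h \<in> K \<Longrightarrow> \<rho> (g + h) v = \<rho> g (\<rho> h v)"
    and equiv: "g \<in> K \<Longrightarrow> \<rho> g (\<pi> x v) = \<pi> (Adj g x) (\<rho> g v)"
    and locally_finite: "\<exists>W. csubspace W \<and> cfinite_dim W \<and> v \<in> W \<and> (\<forall>g\<in>K. \<rho> g ` W \<subseteq> W)"
    and derivative: "x \<in> k \<Longrightarrow> clinear l \<Longrightarrow>
      ((\<lambda>t. l (\<rho> (lie_exp A vf (t *\<^sub>R x)) v) :: complex) has_vector_derivative l (\<pi> x v)) (at 0)"
  using module unfolding gK_module_def by blast+

lemma \<rho>_inverse: "g \<in> K \<Longrightarrow> \<rho> g (\<rho> (- g) v) = v" "g \<in> K \<Longrightarrow> \<rho> (- g) (\<rho> g v) = v"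
  using \<rho>_add[of g "- g" v] \<rho>_add[of "- g" g v] K_minus \<rho>_zero by auto

text \<open>The action of \<open>k\<close> is the derivative of the action of \<open>K\<close>,
  tested against the functionals that vanish on \<open>W\<close>.\<close>

lemma k_stable:
  assumes W: "csubspace W" "\<And>g w. g \<in> K \<Longrightarrow> w \<in> W \<Longrightarrow> \<rho> g w \<in> W" and "x \<in> k" "w \<in> W"
  shows "\<pi> x w \<in> W"
proof (rule functional_zero_imp_mem[OF W(1)])
  fix l :: "'v \<Rightarrow> complex" assume l: "clinear l" "\<And>w. w \<in> W \<Longrightarrow> l w = 0"
  have "(\<lambda>t. l (\<rho> (lie_exp A vf (t *\<^sub>R x)) w)) = (\<lambda>t. 0)"
    using l(2) W(2) lie_exp_K[OF assms(3)] assms(4) by auto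
  then have "((\<lambda>t. 0 :: complex) has_vector_derivative l (\<pi> x w)) (at (0 :: real))"
    using derivative[OF assms(3) l(1), of w] by simp
  moreover have "((\<lambda>t. 0 :: complex) has_vector_derivative 0) (at (0 :: real))" by (rule has_vector_derivative_const)
  ultimately show "l (\<pi> x w) = 0" by (rule vector_derivative_unique_at)
qed

lemma irr_submodule: "gK_submodule K \<pi> \<rho> W \<Longrightarrow> W \<noteq> {0} \<Longrightarrow> W = UNIV"
  using irr by (auto simp: gK_irreducible_def)

lemma fd_K_stable:
  obtains W where "csubspace W" "cfinite_dim W" "W \<noteq> {0}" "\<And>g w. g \<in> K \<Longrightarrow> w \<in> W \<Longrightarrow> \<rho> g w \<in> W"
proof -
  have "(UNIV :: 'v set) \<noteq> {0}" using irr by (simp add: gK_irreducible_def)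
  then obtain v :: 'v where "v \<noteq> 0" by blast
  then show ?thesis using locally_finite[of v] that by blast
qed

lemma fd_not_submodule:
  assumes "csubspace W" "cfinite_dim W" "W \<noteq> {0}" "\<And>g w. g \<in> K \<Longrightarrow> w \<in> W \<Longrightarrow> \<rho> g w \<in> W"
  obtains x w where "w \<in> W" "\<pi> x w \<notin> W"
proof (rule ccontr)
  assume "\<not> thesis"
  then have "gK_submodule K \<pi> \<rho> W" using assms that by (auto simp: gK_submodule_def)
  then have "W = UNIV" using irr_submodule assms by blast
  then show False using assms infdim by blast
qed

lemma \<pi>_basic:
  shows clin_\<pi>0: "clinear (\<pi> x)"
    and \<pi>_lin0: "\<pi> (a *\<^sub>R x + b *\<^sub>R y) v = complex_of_real a *\<^sub>C \<pi> x v + complex_of_real b *\<^sub>C \<pi> y v"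
    and \<pi>_br0: "\<pi> (br x y) v = \<pi> x (\<pi> y v) - \<pi> y (\<pi> x v)"
  using rep unfolding lie_representation_def by blast+

text \<open>The kernel of \<pi> is an ideal of a simple algebra. If it were everything, a
  finite-dimensional K-stable subspace would be a submodule, against irreducibility and infinite
  dimension.\<close>

lemma faithful:
  assumes "\<And>v. \<pi> x v = \<pi> y v" shows "x = y"
proof -
  let ?I = "{x. \<forall>v. \<pi> x v = 0}"
  have lin: "\<pi> (x + y) v = \<pi> x v + \<pi> y v" "\<pi> (x - y) v = \<pi> x v - \<pi> y v" "\<pi> (a *\<^sub>R x) v = complex_of_real a *\<^sub>C \<pi> x v" for x y v a
    using \<pi>_lin0[of 1 x 1 y v] \<pi>_lin0[of 1 x "-1" y v] \<pi>_lin0[of a x 0 x v]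
    by (simp_all add: scaleC_one complex_vector.scale_zero_left complex_vector.scale_minus_left)
  have "\<pi> 0 v = 0" for v using lin(3)[of 0 0 v] by (simp add: complex_vector.scale_zero_left)
  then have "subspace ?I" by (auto simp: subspace_def lin complex_vector.scale_zero_right)
  then have "?I = {0} \<or> ?I = UNIV"
    by (rule ideal) (auto simp: \<pi>_br0 clinear_zero[OF clin_\<pi>0])
  moreover have "?I \<noteq> UNIV"
  proof
    assume "?I = UNIV"
    obtain W where W: "csubspace W" "cfinite_dim W" "W \<noteq> {0}" "\<And>g w. g \<in> K \<Longrightarrow> w \<in> W \<Longrightarrow> \<rho> g w \<in> W"
      using fd_K_stable by metis
    from fd_not_submodule[OF this] obtain x w where "w \<in> W" "\<pi> x w \<notin> W" by blast
    moreover have "\<pi> x w = 0" using \<open>?I = UNIV\<close> by blast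
    ultimately show False using csub_simps(1)[OF W(1)] by simp
  qed
  moreover have "x - y \<in> ?I" using assms by (simp add: lin)
  ultimately show ?thesis by auto
qed

text \<open>\<open>Ad\<close> is a definite description over vector fields. Rather than unfolding
  it, equivariance and faithfulness identify its values; the homomorphism properties of
  \<open>Adj\<close> below rest on this.\<close>

lemma Adj_eq:
  assumes "g \<in> K" "\<And>v. \<rho> g (\<pi> x v) = \<pi> y (\<rho> g v)" shows "Adj g x = y"
proof (rule faithful)
  fix v
  have "\<pi> (Adj g x) (\<rho> g (\<rho> (- g) v)) = \<pi> y (\<rho> g (\<rho> (- g) v))"
    using equiv[OF assms(1), of x "\<rho> (- g) v"] assms(2) by simp
  then show "\<pi> (Adj g x) v = \<pi> y v" by (simp add: \<rho>_inverse[OF assms(1)])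
qed

lemma Adj_add: "g \<in> K \<Longrightarrow> h \<in> K \<Longrightarrow> Adj (g + h) x = Adj g (Adj h x)"
  by (rule Adj_eq) (simp_all add: K_add \<rho>_add equiv[of g] equiv[of h])

lemma Adj_zero: "Adj 0 x = x"
  by (rule Adj_eq) (simp_all add: K_zero \<rho>_zero)

lemma Adj_inverse: "g \<in> K \<Longrightarrow> Adj g (Adj (- g) x) = x" "g \<in> K \<Longrightarrow> Adj (- g) (Adj g x) = x"
  using Adj_add[of g "- g" x] Adj_add[of "- g" g x] K_minus Adj_zero by auto

lemma linear_Adj: "g \<in> K \<Longrightarrow> linear (Adj g)"
proof (rule linearI)
  assume g: "g \<in> K"
  note \<rho> = clinear_simps[OF clin_\<rho>[OF g]]
  show "Adj g (x + y) = Adj g x + Adj g y" for x y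
    using \<pi>_lin0[of 1 x 1 y] \<pi>_lin0[of 1 "Adj g x" 1 "Adj g y"] g
    by (intro Adj_eq) (simp_all add: \<rho> scaleC_one equiv[OF g])
  show "Adj g (a *\<^sub>R x) = a *\<^sub>R Adj g x" for a x
    using \<pi>_lin0[of a x 0 x] \<pi>_lin0[of a "Adj g x" 0 x] g
    by (intro Adj_eq) (simp_all add: \<rho> complex_vector.scale_zero_left equiv[OF g])
qed

lemma Adj_br: "g \<in> K \<Longrightarrow> Adj g (br x y) = br (Adj g x) (Adj g y)"
  by (rule Adj_eq) (simp_all add: \<pi>_br0 clinear_simps[OF clin_\<rho>] equiv)

lemma B_Adj: "g \<in> K \<Longrightarrow> B (Adj g x) (Adj g y) = B x y"
  by (rule B_aut[of _ "Adj (- g)"]) (auto simp: linear_Adj K_minus Adj_inverse Adj_br)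

lemma equivariant: "equivariant_rep br \<theta> K Adj \<pi> \<rho>"
proof (rule equivariant_rep.intro[OF _ equivariant_rep_axioms.intro])
  show "cartan br \<theta>" by unfold_locales
  show "lie_representation br \<pi>" by (rule rep)
  fix g assume g: "g \<in> K"
  show "clinear (\<rho> g)" "\<rho> g (\<pi> x v) = \<pi> (Adj g x) (\<rho> g v)" "linear (Adj g)" "B (Adj g x) (Adj g y) = B x y" for x y v
    by (rule clin_\<rho>[OF g] equiv[OF g] linear_Adj[OF g] B_Adj[OF g])+
  show "\<exists>h. \<forall>x. Adj g (h x) = x" using Adj_inverse(1)[OF g] by blast
qed

sublocale equivariant_rep br \<theta> K Adj \<pi> \<rho>
  by (rule equivariant)

text \<open>Otherwise the whole algebra is \<open>k\<close>, and finite-dimensional K-stable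
  subspaces are submodules.\<close>

lemma p_nonzero: "p \<noteq> {0}"
proof
  assume p: "p = {0}"
  obtain W where W: "csubspace W" "cfinite_dim W" "W \<noteq> {0}" "\<And>g w. g \<in> K \<Longrightarrow> w \<in> W \<Longrightarrow> \<rho> g w \<in> W"
    using fd_K_stable by metis
  from fd_not_submodule[OF this] obtain x w where x: "w \<in> W" "\<pi> x w \<notin> W" by blast
  obtain a b where "a \<in> k" "b \<in> p" "x = a + b" by (rule kp_decomp)
  then have "x \<in> k" using p by simp
  then show False using k_stable[OF W(1,4)] x by blast
qed

text \<open>Let \<open>h\<close> consist of the elements preserving every K-stable subspace. It
  contains \<open>k\<close>, is stable under ad k and is not everything, so it is \<open>k\<close>
  by maximality. Conjugating by \<rho> g shows that \<open>Adj g\<close> maps \<open>k\<close> into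
  \<open>h\<close>.\<close>

lemma Adj_k: "g \<in> K \<Longrightarrow> x \<in> k \<Longrightarrow> Adj g x \<in> k"
proof -
  assume g: "g \<in> K" and x: "x \<in> k"
  define h where "h = {y. \<forall>W. csubspace W \<and> (\<forall>g\<in>K. \<forall>w\<in>W. \<rho> g w \<in> W) \<longrightarrow> (\<forall>w\<in>W. \<pi> y w \<in> W)}"
  have kh: "k \<subseteq> h" using k_stable by (auto simp: h_def)
  have "h = k \<or> h = UNIV"
  proof (rule k_maximal[OF _ kh])
    show "subspace h"
      by (auto simp: subspace_def h_def \<pi>_zero \<pi>_add \<pi>_scale csub_simps)
    show "br w x \<in> h" if "w \<in> k" "x \<in> h" for w x
    proof -
      have "w \<in> h" using kh that(1) by blast
      then show ?thesis using that(2) by (auto simp: h_def \<pi>_br intro: csub_simps(4))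
    qed
  qed
  moreover have "h \<noteq> UNIV"
  proof
    assume "h = UNIV"
    obtain W where W: "csubspace W" "cfinite_dim W" "W \<noteq> {0}" "\<And>g w. g \<in> K \<Longrightarrow> w \<in> W \<Longrightarrow> \<rho> g w \<in> W"
      using fd_K_stable by metis
    from fd_not_submodule[OF this] obtain x w where x: "w \<in> W" "\<pi> x w \<notin> W" by blast
    have "x \<in> h" using \<open>h = UNIV\<close> by blast
    then show False using x W unfolding h_def by blast
  qed
  moreover have "Adj g x \<in> h"
  proof -
    have "\<pi> (Adj g x) w \<in> W" if W: "csubspace W" "\<forall>g\<in>K. \<forall>w\<in>W. \<rho> g w \<in> W" "w \<in> W" for W w
    proof -
      have "\<rho> (- g) w \<in> W" using W K_minus[OF g] by blast
      then have "\<pi> x (\<rho> (- g) w) \<in> W" using k_stable[OF W(1)] W(2) x by blast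
      then have "\<rho> g (\<pi> x (\<rho> (- g) w)) \<in> W" using W(2) g by blast
      then show ?thesis by (simp add: equiv[OF g] \<rho>_inverse[OF g])
    qed
    then show ?thesis by (auto simp: h_def)
  qed
  ultimately show ?thesis by simp
qed

text \<open>If there were no one-parameter subgroup for \<open>x\<close>, then \<open>lie_exp (t x)\<close> would be the same junk value
  for all \<open>t \<noteq> 0\<close>, contradicting the differentiability of the action of \<open>K\<close>.\<close>

lemma one_parameter_subgroup_exists:
  assumes x: "x \<in> k"
  obtains \<gamma> where "one_parameter_subgroup A vf x \<gamma>"
proof (rule ccontr)
  assume "\<not> thesis"
  then have no: "\<not> one_parameter_subgroup A vf x \<gamma>" for \<gamma> using that by blast
  define c where "c = (THE g :: 'g. False)"
  have exp: "lie_exp A vf (t *\<^sub>R x) = c" if "t \<noteq> 0" for t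
  proof -
    have "\<not> one_parameter_subgroup A vf (t *\<^sub>R x) \<gamma>" for \<gamma>
    proof
      assume "one_parameter_subgroup A vf (t *\<^sub>R x) \<gamma>"
      from one_parameter_subgroup_scale[OF alg this, of "1 / t"] no show False using that by simp
    qed
    then show ?thesis by (simp add: lie_exp_def c_def)
  qed
  have "\<pi> x v = 0" for v
  proof (rule ccontr)
    assume "\<pi> x v \<noteq> 0"
    then obtain l :: "'v \<Rightarrow> complex" where l: "clinear l" "l (\<pi> x v) = 1" by (rule nonzero_functional)
    let ?f = "\<lambda>t. l (\<rho> (lie_exp A vf (t *\<^sub>R x)) v)"
    note der = derivative[OF x l(1), of v]
    have "isCont ?f 0" using der has_vector_derivative_continuous by blast
    then have "?f \<midarrow>0\<rightarrow> ?f 0" by (simp add: isCont_def)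
    moreover have "?f \<midarrow>0\<rightarrow> l (\<rho> c v)"
      by (rule tendsto_eventually) (auto simp: eventually_at_filter exp)
    ultimately have "?f 0 = l (\<rho> c v)" by (rule LIM_unique)
    then have "?f = (\<lambda>t. l (\<rho> c v))" using exp by (metis (no_types, lifting))
    then have "((\<lambda>t. l (\<rho> c v)) has_vector_derivative 1) (at (0::real))" using der l(2) by simp
    moreover have "((\<lambda>t. l (\<rho> c v)) has_vector_derivative 0) (at (0::real))" by (rule has_vector_derivative_const)
    ultimately show False using vector_derivative_unique_at by fastforce
  qed
  then have "x = 0" using faithful[of x 0] by (simp add: \<pi>_zero)
  have "vf (0 *\<^sub>R 0 + 0 *\<^sub>R 0) f = (\<lambda>g. 0 * vf 0 f g + 0 * vf 0 f g)" if "smooth_fun A f" for f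
    using alg that unfolding lie_algebra_of_def by blast
  then have "one_parameter_subgroup A vf 0 (\<lambda>t. 0)"
    by (simp add: one_parameter_subgroup_def)
  then show False using no \<open>x = 0\<close> by simp
qed

text \<open>\<open>Adj g z\<close> is central in \<open>k\<close>, hence a multiple of
  \<open>z\<close>, and invariance of \<open>B\<close> leaves only the factors 1 and -1. An
  exponential is the double of the exponential of half the argument, so its factor is a square,
  namely 1; such elements generate \<open>K\<close>.\<close>

lemma Adj_center:
  assumes z: "complex_structure z" and g: "g \<in> K"
  shows "Adj g z = z"
proof -
  have zc: "z \<in> center_k" "z \<in> k" using z by (auto simp: complex_structure_def center_k_def)
  have nz: "z \<noteq> 0" by (rule complex_structure_nonzero[OF p_nonzero z])
  have sign: "\<exists>c. c * c = 1 \<and> Adj g z = c *\<^sub>R z" if g: "g \<in> K" for g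
  proof -
    have "br (Adj g z) w = 0" if "w \<in> k" for w
    proof -
      have "br (Adj g z) w = Adj g (br z (Adj (- g) w))"
        using Adj_br[OF g, of z "Adj (- g) w"] by (simp add: Adj_inverse[OF g])
      also have "br z (Adj (- g) w) = 0"
        using zc(1) Adj_k[OF K_minus[OF g] that] by (simp add: center_k_def)
      finally show ?thesis by (simp add: linear_0[OF linear_Adj[OF g]])
    qed
    then have "Adj g z \<in> center_k" using Adj_k[OF g zc(2)] by (simp add: center_k_def)
    then obtain c where c: "Adj g z = c *\<^sub>R z"
      unfolding center_span[OF p_nonzero z] by (auto simp: span_singleton)
    have "c * c * B z z = B z z" using B_Adj[OF g, of z z] by (simp add: c B_simps)
    then have "c * c = 1" using B_k_neg[OF zc(2) nz] by simp
    then show ?thesis using c by blast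
  qed
  have exp: "Adj (lie_exp A vf x) z = z" if x: "x \<in> k" for x
  proof -
    obtain \<gamma> where \<gamma>: "one_parameter_subgroup A vf x \<gamma>" using one_parameter_subgroup_exists[OF x] by metis
    define h where "h = lie_exp A vf ((1/2) *\<^sub>R x)"
    have "lie_exp A vf (1 *\<^sub>R x) = \<gamma> 1" "h = \<gamma> (1/2)"
      unfolding h_def by (rule lie_exp_scale[OF alg \<gamma>])+
    moreover have "\<gamma> (1/2 + 1/2) = \<gamma> (1/2) + \<gamma> (1/2)"
      using \<gamma> unfolding one_parameter_subgroup_def by blast
    ultimately have "lie_exp A vf x = h + h" by simp
    moreover have h: "h \<in> K" unfolding h_def by (rule lie_exp_K[OF x])
    obtain c where c: "c * c = 1" "Adj h z = c *\<^sub>R z" using sign[OF h] by blast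
    ultimately show ?thesis
      by (simp add: Adj_add[OF h h] linear_scale[OF linear_Adj[OF h]])
  qed
  obtain xs where xs: "set xs \<subseteq> k" "g = sum_list (map (lie_exp A vf) xs)"
    using sub g unfolding connected_lie_subgroup_def by blast
  have "Adj (sum_list (map (lie_exp A vf) xs)) z = z \<and> sum_list (map (lie_exp A vf) xs) \<in> K"
    using xs(1)
  proof (induction xs)
    case Nil then show ?case by (simp add: Adj_zero K_zero)
  next
    case (Cons x xs)
    then have "lie_exp A vf x \<in> K" using lie_exp_K[of x 1] by simp
    then show ?case using Cons exp[of x] by (simp add: Adj_add K_add)
  qed
  then show ?thesis using xs(2) by simp
qed

lemma filtration_exhausts:
  assumes W: "csubspace W" "cfinite_dim W" "W \<noteq> {0}" "\<And>g w. g \<in> K \<Longrightarrow> w \<in> W \<Longrightarrow> \<rho> g w \<in> W"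
  shows "(\<Union>n. filtered_module.F act W n) = UNIV"
proof (rule irr_submodule)
  have ks: "\<pi> x w \<in> W" if "x \<in> k" "w \<in> W" for x w using k_stable[OF W(1,4) that] .
  show "submodule (\<Union>n. filtered_module.F act W n)"
    by (rule filtration_union_submodule[OF W(1,2) ks W(4)])
  interpret fm: filtered_module brC kC act W by (rule filtered_moduleI[OF W(1,2) ks])
  have "W \<subseteq> (\<Union>n. fm.F n)" using UN_upper[of 0 UNIV fm.F] by simp
  then show "(\<Union>n. fm.F n) \<noteq> {0}" using W(1,3) csub_simps(1) by blast
qed

lemma casimir_scalar:
  assumes "onb UNIV E"
  obtains c where "\<And>v. casimir E v = c *\<^sub>C v"
proof -
  obtain W where W: "csubspace W" "cfinite_dim W" "W \<noteq> {0}" "\<And>g w. g \<in> K \<Longrightarrow> w \<in> W \<Longrightarrow> \<rho> g w \<in> W"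
    using fd_K_stable by metis
  have ks: "\<pi> x w \<in> W" if "x \<in> k" "w \<in> W" for x w using k_stable[OF W(1,4) that] .
  interpret fm: filtered_module brC kC act W by (rule filtered_moduleI[OF W(1,2) ks])
  have U: "submodule UNIV" by (rule submoduleI) auto
  have ne: "{0} \<subset> (UNIV :: 'v set)" using irr by (auto simp: gK_irreducible_def)
  have ir: "\<nexists>W. submodule W \<and> {0} \<subset> W \<and> W \<subset> UNIV" using irr_submodule by blast
  have ex: "UNIV \<subseteq> (\<Union>n. fm.F n)" using filtration_exhausts[OF W] by simp
  from casimir_scalar_on_factor[OF assms submodule_zero U ne ir fm.fdF ex]
  obtain l where "\<And>v. v \<in> UNIV \<Longrightarrow> casimir E v - l *\<^sub>C v \<in> {0}" by metis
  then show ?thesis using that[of l] by simp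
qed

end

section \<open>Tensor products\<close>

definition tens :: "'a::complex_vector set \<Rightarrow> 'b::complex_vector set \<Rightarrow> ('a, 'b) tensor set"
  where "tens V W = cspan {v \<otimes> w | v w. v \<in> V \<and> w \<in> W}"

lemma csub_tens: "csubspace (tens V W)"
  by (simp add: tens_def)

lemma pure_tens: "v \<in> V \<Longrightarrow> w \<in> W \<Longrightarrow> v \<otimes> w \<in> tens V W"
  unfolding tens_def by (rule complex_vector.span_base) blast

lemma tens_subset:
  assumes "csubspace S" "\<And>v w. v \<in> V \<Longrightarrow> w \<in> W \<Longrightarrow> v \<otimes> w \<in> S"
  shows "tens V W \<subseteq> S"
  unfolding tens_def by (rule complex_vector.span_minimal) (use assms in auto)

lemma tens_image:
  assumes "clinear f" "csubspace S" "\<And>v w. v \<in> V \<Longrightarrow> w \<in> W \<Longrightarrow> f (v \<otimes> w) \<in> S" "t \<in> tens V W"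
  shows "f t \<in> S"
proof -
  have "f ` tens V W \<subseteq> S"
    unfolding tens_def by (rule clinear_span_subset[OF assms(1,2)]) (use assms(3) in auto)
  then show ?thesis using assms(4) by blast
qed

lemma tens_mono: "V \<subseteq> V' \<Longrightarrow> W \<subseteq> W' \<Longrightarrow> tens V W \<subseteq> tens V' W'"
  by (intro tens_subset csub_tens pure_tens) auto

lemma tens_UNIV: "tens UNIV UNIV = UNIV"
proof -
  have "t \<in> tens UNIV UNIV" for t :: "('a, 'b) tensor"
  proof (induction t)
    case (1 p)
    show ?case
      unfolding abs_tensor_conv_sum case_prod_unfold
      by (intro csub_simps(6)[OF csub_tens] csub_simps(3)[OF csub_tens] pure_tens UNIV_I)
  qed
  then show ?thesis by blast
qed

lemma tensor_ext:
  assumes "clinear f" "clinear g" "\<And>v w. f (v \<otimes> w) = g (v \<otimes> w)"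
  shows "f t = g t"
proof -
  have "csubspace {0 :: 'c}" by (auto intro!: csubspaceI simp: complex_vector.scale_zero_right)
  then have "f t - g t \<in> {0}"
    by (rule tens_image[OF clinear_minus'[OF assms(1,2)], of "{0}" UNIV UNIV]) (auto simp: assms(3) tens_UNIV)
  then show ?thesis by simp
qed

lemma clinear_pure_left: "clinear (\<lambda>v. v \<otimes> w)" and clinear_pure_right: "clinear (\<lambda>w. v \<otimes> w)"
  by (auto intro!: clinearI simp: pure_tensor_add_left pure_tensor_add_right pure_tensor_scale_left
      pure_tensor_scale_right)

lemmas pure_simps = clinear_simps[OF clinear_pure_left] clinear_simps[OF clinear_pure_right]

lemma cfinite_dim_tens:
  assumes "cfinite_dim V" "cfinite_dim W"
  shows "cfinite_dim (tens V W)"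
proof -
  obtain A where A: "finite A" "A \<subseteq> V" "V \<subseteq> cspan A" using assms(1) unfolding cfinite_dim_def by blast
  obtain B where B: "finite B" "B \<subseteq> W" "W \<subseteq> cspan B" using assms(2) unfolding cfinite_dim_def by blast
  let ?P = "(\<lambda>(a, b). a \<otimes> b) ` (A \<times> B)"
  have sub: "csubspace (cspan ?P)" by simp
  have "tens V W \<subseteq> cspan ?P"
  proof (rule tens_subset[OF sub])
    fix v w assume "v \<in> V" "w \<in> W"
    have ab: "a \<otimes> b \<in> cspan ?P" if "a \<in> A" "b \<in> B" for a b
      using that by (intro complex_vector.span_base) auto
    have "(\<lambda>b. a \<otimes> b) ` cspan B \<subseteq> cspan ?P" if "a \<in> A" for a
      using that ab by (intro clinear_span_subset[OF clinear_pure_right sub]) auto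
    then have aw: "a \<otimes> w \<in> cspan ?P" if "a \<in> A" for a using that \<open>w \<in> W\<close> B(3) by blast
    have "(\<lambda>a. a \<otimes> w) ` cspan A \<subseteq> cspan ?P"
      using aw by (intro clinear_span_subset[OF clinear_pure_left sub]) auto
    then show "v \<otimes> w \<in> cspan ?P" using \<open>v \<in> V\<close> A(3) by blast
  qed
  moreover have "finite ?P" using A(1) B(1) by simp
  ultimately show ?thesis
    by (intro cfinite_dim_subset[OF cfinite_dimI csub_tens])
qed

lemma tensor_functional:
  fixes l1 :: "'a::complex_vector \<Rightarrow> complex" and l2 :: "'b::complex_vector \<Rightarrow> complex"
  assumes "clinear l1" "clinear l2"
  obtains l :: "('a, 'b) tensor \<Rightarrow> complex" where "clinear l" "\<And>v w. l (v \<otimes> w) = l1 v * l2 w"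
proof -
  have "\<exists>!h. clinear h \<and> (\<forall>v w. h (v \<otimes> w) = l1 v * l2 w)"
    by (rule tensor_universal; rule clinearI)
      (simp_all add: clinear_simps[OF assms(1)] clinear_simps[OF assms(2)] scaleC_complex_def algebra_simps)
  then obtain h :: "('a, 'b) tensor \<Rightarrow> complex" where "clinear h \<and> (\<forall>v w. h (v \<otimes> w) = l1 v * l2 w)"
    by (rule ex1E)
  then show ?thesis by (intro that[of h]) simp_all
qed

section \<open>Necessity: orthogonality of the associated varieties\<close>

section \<open>The tensor product of two irreducible modules\<close>

locale gK_pair = cartan br \<theta> + lie_grp A + X1: gK_irr br \<theta> A vf K \<pi>\<^sub>1 \<rho>\<^sub>1 + X2: gK_irr br \<theta> A vf K \<pi>\<^sub>2 \<rho>\<^sub>2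
  for br :: "'l::euclidean_space \<Rightarrow> 'l \<Rightarrow> 'l" and \<theta>
    and A :: "('g::{topological_group_add, t2_space, second_countable_topology}, 'e::euclidean_space) chart set"
    and vf K and \<pi>\<^sub>1 :: "'l \<Rightarrow> 'v::complex_vector \<Rightarrow> 'v" and \<rho>\<^sub>1 :: "'g \<Rightarrow> 'v \<Rightarrow> 'v"
    and \<pi>\<^sub>2 :: "'l \<Rightarrow> 'w::complex_vector \<Rightarrow> 'w" and \<rho>\<^sub>2 :: "'g \<Rightarrow> 'w \<Rightarrow> 'w"
begin

abbreviation \<pi>T where "\<pi>T \<equiv> tensor_lie_action \<pi>\<^sub>1 \<pi>\<^sub>2"
abbreviation \<rho>T where "\<rho>T \<equiv> tensor_group_action \<rho>\<^sub>1 \<rho>\<^sub>2"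

lemma clin_\<pi>T: "clinear (\<pi>T x)"
  unfolding tensor_lie_action_def
  by (intro clinear_plus clinear_tensor_map X1.clin_\<pi> X2.clin_\<pi> clinear_ident)

lemma \<pi>T_pure: "\<pi>T x (v \<otimes> w) = \<pi>\<^sub>1 x v \<otimes> w + v \<otimes> \<pi>\<^sub>2 x w"
  by (simp add: tensor_lie_action_def tensor_map_pure X1.clin_\<pi> X2.clin_\<pi> clinear_ident)

lemma clin_\<rho>T: "g \<in> K \<Longrightarrow> clinear (\<rho>T g)"
  unfolding tensor_group_action_def by (intro clinear_tensor_map X1.clin_\<rho> X2.clin_\<rho>)

lemma \<rho>T_pure: "g \<in> K \<Longrightarrow> \<rho>T g (v \<otimes> w) = \<rho>\<^sub>1 g v \<otimes> \<rho>\<^sub>2 g w"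
  by (simp add: tensor_group_action_def tensor_map_pure X1.clin_\<rho> X2.clin_\<rho>)

lemma tensor_equivariant: "equivariant_rep br \<theta> K (Ad A vf) \<pi>T \<rho>T"
proof (rule equivariant_rep.intro[OF _ equivariant_rep_axioms.intro])
  show "cartan br \<theta>" by unfold_locales
  show "lie_representation br \<pi>T"
    unfolding lie_representation_def
  proof (intro conjI allI)
    show "clinear (\<pi>T x)" for x by (rule clin_\<pi>T)
    show "\<pi>T (a *\<^sub>R x + b *\<^sub>R y) t = complex_of_real a *\<^sub>C \<pi>T x t + complex_of_real b *\<^sub>C \<pi>T y t" for a b x y t
      by (rule tensor_ext[of "\<pi>T (a *\<^sub>R x + b *\<^sub>R y)"];
          (intro clin_\<pi>T clinear_plus clinear_scaleC |
          simp add: \<pi>T_pure X1.\<pi>_lin X2.\<pi>_lin pure_simps scaleC_add_right))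
    show "\<pi>T (br x y) t = \<pi>T x (\<pi>T y t) - \<pi>T y (\<pi>T x t)" for x y t
      by (rule tensor_ext[of "\<pi>T (br x y)"];
          (intro clin_\<pi>T clinear_minus' clinear_compose[OF clin_\<pi>T clin_\<pi>T] |
          simp add: \<pi>T_pure X1.\<pi>_br X2.\<pi>_br pure_simps clinear_simps[OF clin_\<pi>T]))
  qed
  fix g assume g: "g \<in> K"
  show "clinear (\<rho>T g)" by (rule clin_\<rho>T[OF g])
  show "\<rho>T g (\<pi>T x t) = \<pi>T (Ad A vf g x) (\<rho>T g t)" for x t
    by (rule tensor_ext[of "\<lambda>t. \<rho>T g (\<pi>T x t)"];
      (intro clinear_compose[OF clin_\<rho>T[OF g] clin_\<pi>T] clinear_compose[OF clin_\<pi>T clin_\<rho>T[OF g]] |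
        simp add: \<pi>T_pure \<rho>T_pure[OF g] X1.equiv[OF g] X2.equiv[OF g] clinear_simps[OF clin_\<rho>T[OF g]]))
  show "linear (Ad A vf g)" "\<exists>h. \<forall>x. Ad A vf g (h x) = x" "B (Ad A vf g x) (Ad A vf g y) = B x y" for x y
    using X1.lin_\<alpha>[OF g] X1.surj_\<alpha>[OF g] X1.B_\<alpha>[OF g] by auto
qed

sublocale T: equivariant_rep br \<theta> K "Ad A vf" \<pi>T \<rho>T
  by (rule tensor_equivariant)

definition omega :: "'l set \<Rightarrow> ('v, 'w) tensor \<Rightarrow> ('v, 'w) tensor"
  where "omega E t = cas E (\<lambda>x y. tensor_map (\<pi>\<^sub>1 x) (\<pi>\<^sub>2 y) t)"

lemma clinear_omega: "clinear (omega E)"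
  unfolding omega_def cas_def
  by (intro clinear_setsum clinear_scaleC clinear_tensor_map X1.clin_\<pi> X2.clin_\<pi>)

lemma omega_pure: "omega E (v \<otimes> w) = cas E (\<lambda>x y. \<pi>\<^sub>1 x v \<otimes> \<pi>\<^sub>2 y w)"
  by (simp add: omega_def tensor_map_pure[OF X1.clin_\<pi> X2.clin_\<pi>])

lemma casimir_tensor:
  assumes "\<And>v. X1.casimir E v = c1 *\<^sub>C v" "\<And>v. X2.casimir E v = c2 *\<^sub>C v"
  shows "T.casimir E t = (c1 + c2) *\<^sub>C t + 2 *\<^sub>C omega E t"
proof (rule tensor_ext[of "T.casimir E"])
  show "clinear (T.casimir E)" by (rule T.clinear_casimir)
  show "clinear (\<lambda>t. (c1 + c2) *\<^sub>C t + 2 *\<^sub>C omega E t)"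
    by (intro clinear_plus clinear_scaleC clinear_ident clinear_omega)
  fix v w
  have "T.casimir E (v \<otimes> w) = X1.casimir E v \<otimes> w + v \<otimes> X2.casimir E w + (omega E (v \<otimes> w) + omega E (v \<otimes> w))"
    unfolding omega_pure
    by (simp add: T.casimir_def X1.casimir_def X2.casimir_def cas_def \<pi>T_pure clinear_simps[OF clin_\<pi>T]
        pure_simps scaleC_add_right sum.distrib algebra_simps)
  also have "omega E (v \<otimes> w) + omega E (v \<otimes> w) = 2 *\<^sub>C omega E (v \<otimes> w)"
    using scaleC_add_left[of 1 1 "omega E (v \<otimes> w)"] by (simp add: scaleC_one)
  finally show "T.casimir E (v \<otimes> w) = (c1 + c2) *\<^sub>C (v \<otimes> w) + 2 *\<^sub>C omega E (v \<otimes> w)"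
    by (simp add: assms pure_simps scaleC_add_left)
qed

lemma op_prod_casimir:
  assumes "\<And>v. X1.casimir E v = c1 *\<^sub>C v" "\<And>v. X2.casimir E v = c2 *\<^sub>C v"
  shows "op_prod (T.casimir E) ls t = (2 ^ length ls) *\<^sub>C op_prod (omega E) (map (\<lambda>l. (l - c1 - c2) / 2) ls) t"
proof (induction ls)
  case Nil then show ?case by (simp add: scaleC_one)
next
  case (Cons l ls)
  let ?s = "op_prod (omega E) (map (\<lambda>l. (l - c1 - c2) / 2) ls) t" and ?n = "length ls"
  have "op_prod (T.casimir E) (l # ls) t = (2 ^ ?n) *\<^sub>C (T.casimir E ?s - l *\<^sub>C ?s)"
    unfolding op_prod.simps Cons.IH
    by (simp add: clinear_simps[OF T.clinear_casimir] complex_vector.scale_right_diff_distrib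
        complex_vector.scale_left_commute)
  also have "T.casimir E ?s - l *\<^sub>C ?s = 2 *\<^sub>C (omega E ?s - ((l - c1 - c2) / 2) *\<^sub>C ?s)"
  proof -
    have "2 * ((l - c1 - c2) / 2) = l - c1 - c2" by simp
    then have "2 *\<^sub>C (omega E ?s - ((l - c1 - c2) / 2) *\<^sub>C ?s) = 2 *\<^sub>C omega E ?s - (l - c1 - c2) *\<^sub>C ?s"
      by (simp only: complex_vector.scale_right_diff_distrib scaleC_scaleC)
    then show ?thesis
      unfolding casimir_tensor[OF assms]
      by (simp add: scaleC_add_left complex_vector.scale_left_diff_distrib)
  qed
  finally show ?case by (simp add: scaleC_scaleC mult.commute)
qed

text \<open>The symbol of \<open>omega\<close> acts on the quotients by the characteristic families as the scalar obtained by
  evaluating the invariant form at the two functionals, so local finiteness forces this scalar to vanish.\<close>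

lemma char_functionals_orthogonal:
  assumes W1: "csubspace W1" "cfinite_dim W1" "\<And>x w. x \<in> k \<Longrightarrow> w \<in> W1 \<Longrightarrow> \<pi>\<^sub>1 x w \<in> W1"
    and W2: "csubspace W2" "cfinite_dim W2" "\<And>x w. x \<in> k \<Longrightarrow> w \<in> W2 \<Longrightarrow> \<pi>\<^sub>2 x w \<in> W2"
    and E: "onb UNIV E"
    and loc: "\<And>t. t \<in> tens W1 W2 \<Longrightarrow> op_prod (omega E) ls t = 0"
    and \<xi>1: "\<xi>1 \<in> filtered_module.char_functionals X1.act W1"
    and \<xi>2: "\<xi>2 \<in> filtered_module.char_functionals X2.act W2"
  shows "cas E (\<lambda>x y. \<xi>1 (Complexify x 0) * \<xi>2 (Complexify y 0)) = 0"
proof (rule ccontr)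
  assume nz: "cas E (\<lambda>x y. \<xi>1 (Complexify x 0) * \<xi>2 (Complexify y 0)) \<noteq> 0"
  interpret f1: filtered_module X1.brC kC X1.act W1 by (rule X1.filtered_moduleI[OF W1])
  interpret f2: filtered_module X2.brC kC X2.act W2 by (rule X2.filtered_moduleI[OF W2])
  obtain e where e: "\<xi>1 (Complexify e 0) \<noteq> 0" "\<xi>2 (Complexify e 0) \<noteq> 0"
  proof (rule ccontr)
    assume "\<not> thesis"
    then have "\<xi>1 (Complexify e 0) * \<xi>2 (Complexify e 0) = 0" for e using that by auto
    then show False
      using nz by (simp only: cas_def complex_vector.scale_zero_right sum.neutral_const)
  qed
  define u where "u = Complexify e 0"
  have u: "\<xi>1 u \<noteq> 0" "\<xi>2 u \<noteq> 0" using e by (simp_all add: u_def)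
  have lin: "clinear \<xi>1" "clinear \<xi>2"
    using \<xi>1 \<xi>2 by (auto simp: f1.char_functionals_def f2.char_functionals_def)
  let ?Q1 = "f1.char_family \<xi>1" and ?Q2 = "f2.char_family \<xi>2"
  note Q1 = f1.admissibleD[OF f1.admissible_char_family[of \<xi>1]]
    and Q2 = f2.admissibleD[OF f2.admissible_char_family[of \<xi>2]]
  let ?c1 = "\<lambda>x. \<xi>1 (Complexify x 0) / \<xi>1 u" and ?c2 = "\<lambda>x. \<xi>2 (Complexify x 0) / \<xi>2 u"
  define \<gamma> where "\<gamma> = cas E (\<lambda>x y. ?c1 x * ?c2 y)"
  have "\<gamma> = cas E (\<lambda>x y. \<xi>1 (Complexify x 0) * \<xi>2 (Complexify y 0)) / (\<xi>1 u * \<xi>2 u)"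
    by (simp add: \<gamma>_def cas_def scaleC_complex_def sum_divide_distrib)
  then have \<gamma>: "\<gamma> \<noteq> 0" using nz u by simp
  have red1: "\<pi>\<^sub>1 x v - ?c1 x *\<^sub>C \<pi>\<^sub>1 e v \<in> ?Q1 (Suc n)" if "v \<in> f1.F n" for x v n
  proof -
    have "\<xi>1 (Complexify x 0 - ?c1 x *\<^sub>C u) = 0"
      using u by (simp add: clinear_simps[OF lin(1)] scaleC_complex_def)
    then have "X1.act (Complexify x 0 - ?c1 x *\<^sub>C u) v \<in> ?Q1 (Suc n)"
      unfolding f1.char_family.simps using that by (intro complex_vector.span_base) blast
    then show ?thesis by (simp add: f1.arg_simps u_def X1.act_real)
  qed
  have red2: "\<pi>\<^sub>2 x v - ?c2 x *\<^sub>C \<pi>\<^sub>2 e v \<in> ?Q2 (Suc n)" if "v \<in> f2.F n" for x v n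
  proof -
    have "\<xi>2 (Complexify x 0 - ?c2 x *\<^sub>C u) = 0"
      using u by (simp add: clinear_simps[OF lin(2)] scaleC_complex_def)
    then have "X2.act (Complexify x 0 - ?c2 x *\<^sub>C u) v \<in> ?Q2 (Suc n)"
      unfolding f2.char_family.simps using that by (intro complex_vector.span_base) blast
    then show ?thesis by (simp add: f2.arg_simps u_def X2.act_real)
  qed
  have F1: "\<pi>\<^sub>1 x v \<in> f1.F (Suc n)" if "v \<in> f1.F n" for x v n
    using f1.act_F[OF that, of "Complexify x 0"] by (simp only: X1.act_real)
  have F2: "\<pi>\<^sub>2 x v \<in> f2.F (Suc n)" if "v \<in> f2.F n" for x v n
    using f2.act_F[OF that, of "Complexify x 0"] by (simp only: X2.act_real)
  have Q1s: "\<pi>\<^sub>1 x v \<in> ?Q1 (Suc n)" if "v \<in> ?Q1 n" for x v n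
    using Q1(4)[OF that, of "Complexify x 0"] by (simp only: X1.act_real)
  have Q2s: "\<pi>\<^sub>2 x v \<in> ?Q2 (Suc n)" if "v \<in> ?Q2 n" for x v n
    using Q2(4)[OF that, of "Complexify x 0"] by (simp only: X2.act_real)
  \<comment> \<open>\<open>S n\<close> is the kernel, in bidegree (n, n), of the map onto the tensor
    product of the quotients by the two characteristic families.\<close>
  define S where "S n = cspan ({v \<otimes> w | v w. v \<in> ?Q1 n \<and> w \<in> f2.F n} \<union> {v \<otimes> w | v w. v \<in> f1.F n \<and> w \<in> ?Q2 n})" for n
  have subS: "csubspace (S n)" for n by (simp add: S_def)
  have S1: "v \<otimes> w \<in> S n" if "v \<in> ?Q1 n" "w \<in> f2.F n" for v w n
    unfolding S_def using that by (intro complex_vector.span_base) blast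
  have S2: "v \<otimes> w \<in> S n" if "v \<in> f1.F n" "w \<in> ?Q2 n" for v w n
    unfolding S_def using that by (intro complex_vector.span_base) blast
  have omS: "omega E s \<in> S (Suc n)" if "s \<in> S n" for s n
  proof -
    have "omega E ` S n \<subseteq> S (Suc n)"
      unfolding S_def[of n]
    proof (rule clinear_span_subset[OF clinear_omega subS])
      have "omega E (v \<otimes> w) \<in> S (Suc n)" if "v \<in> ?Q1 n" "w \<in> f2.F n" for v w
        unfolding omega_pure cas_def
        using that by (intro csub_simps(6)[OF subS] csub_simps(3)[OF subS] S1 Q1s F2)
      moreover have "omega E (v \<otimes> w) \<in> S (Suc n)" if "v \<in> f1.F n" "w \<in> ?Q2 n" for v w
        unfolding omega_pure cas_def
        using that by (intro csub_simps(6)[OF subS] csub_simps(3)[OF subS] S2 Q2s F1)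
      ultimately show "omega E ` ({v \<otimes> w |v w. v \<in> ?Q1 n \<and> w \<in> f2.F n} \<union> {v \<otimes> w |v w. v \<in> f1.F n \<and> w \<in> ?Q2 n}) \<subseteq> S (Suc n)"
        by auto
    qed
    then show ?thesis using that by blast
  qed
  have FS: "t \<in> S (Suc n)" if "t \<in> tens (f1.F n) (f2.F n)" for t n
  proof -
    have "tens (f1.F n) (f2.F n) \<subseteq> S (Suc n)"
      using Q1(5)[of n] f2.F_Suc[of n] by (intro tens_subset subS S1) auto
    then show ?thesis using that by blast
  qed
  have S_F: "t \<in> tens (f1.F n) (f2.F n)" if "t \<in> S n" for t n
  proof -
    have "S n \<subseteq> tens (f1.F n) (f2.F n)"
      unfolding S_def using Q1(3) Q2(3)
      by (intro complex_vector.span_minimal csub_tens) (auto intro!: pure_tens)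
    then show ?thesis using that by blast
  qed
  have om_pure: "omega E (v \<otimes> w) - \<gamma> *\<^sub>C (\<pi>\<^sub>1 e v \<otimes> \<pi>\<^sub>2 e w) \<in> S (Suc n)"
    if vw: "v \<in> f1.F n" "w \<in> f2.F n" for v w n
  proof -
    have "omega E (v \<otimes> w) - \<gamma> *\<^sub>C (\<pi>\<^sub>1 e v \<otimes> \<pi>\<^sub>2 e w) =
        (\<Sum>x\<in>E. complex_of_real (B x x) *\<^sub>C (\<pi>\<^sub>1 x v \<otimes> \<pi>\<^sub>2 x w - (?c1 x *\<^sub>C \<pi>\<^sub>1 e v) \<otimes> (?c2 x *\<^sub>C \<pi>\<^sub>2 e w)))"
      by (simp add: omega_pure cas_def \<gamma>_def pure_simps scaleC_scaleC scaleC_complex_def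
          complex_vector.scale_sum_left complex_vector.scale_right_diff_distrib sum_subtractf mult.commute)
    also have "\<dots> \<in> S (Suc n)"
    proof (intro csub_simps(6)[OF subS] csub_simps(3)[OF subS])
      fix x
      let ?v = "?c1 x *\<^sub>C \<pi>\<^sub>1 e v" and ?w = "?c2 x *\<^sub>C \<pi>\<^sub>2 e w"
      have "(\<pi>\<^sub>1 x v - ?v) \<otimes> \<pi>\<^sub>2 x w + ?v \<otimes> (\<pi>\<^sub>2 x w - ?w) \<in> S (Suc n)"
        by (intro csub_simps(2)[OF subS] S1 S2 red1 red2 F2 vw csub_simps(3)[OF f1.subF] F1)
      then show "\<pi>\<^sub>1 x v \<otimes> \<pi>\<^sub>2 x w - ?v \<otimes> ?w \<in> S (Suc n)" by (simp add: pure_simps(4,10))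
    qed
    finally show ?thesis .
  qed
  let ?n = "length ls"
  obtain w1 where w1: "w1 \<in> W1" "f1.word (replicate ?n u) w1 \<notin> ?Q1 ?n"
    using f1.char_functional_word[OF \<xi>1 u(1)] by blast
  obtain w2 where w2: "w2 \<in> W2" "f2.word (replicate ?n u) w2 \<notin> ?Q2 ?n"
    using f2.char_functional_word[OF \<xi>2 u(2)] by blast
  define v1 where "v1 n = f1.word (replicate n u) w1" for n
  define v2 where "v2 n = f2.word (replicate n u) w2" for n
  have v1: "v1 n \<in> f1.F n" and v2: "v2 n \<in> f2.F n" for n
    using f1.word_F[of w1 0 "replicate n u"] f2.word_F[of w2 0 "replicate n u"] w1 w2
    by (auto simp: v1_def v2_def)
  \<comment> \<open>Modulo \<open>S\<close>, \<open>omega\<close> multiplies by \<gamma> and raises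
    both degrees by one, while subtracting a multiple of the identity has no effect because F n
    tensor F n lies in \<open>S (Suc n)\<close>. So only the leading power of \<gamma>
    remains.\<close>
  have step: "op_prod (omega E) ms (w1 \<otimes> w2) - (\<gamma> ^ length ms) *\<^sub>C (v1 (length ms) \<otimes> v2 (length ms)) \<in> S (length ms)" for ms
  proof (induction ms)
    case Nil then show ?case using csub_simps(1)[OF subS] by (simp add: v1_def v2_def scaleC_one)
  next
    case (Cons m ms)
    let ?m = "length ms" and ?t = "op_prod (omega E) ms (w1 \<otimes> w2)"
    let ?p = "v1 ?m \<otimes> v2 ?m"
    have "?t \<in> tens (f1.F ?m) (f2.F ?m)"
    proof -
      have "?t - (\<gamma> ^ ?m) *\<^sub>C ?p + (\<gamma> ^ ?m) *\<^sub>C ?p \<in> tens (f1.F ?m) (f2.F ?m)"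
        by (intro csub_simps(2)[OF csub_tens] csub_simps(3)[OF csub_tens] S_F Cons.IH pure_tens v1 v2)
      then show ?thesis by simp
    qed
    then have "m *\<^sub>C ?t \<in> S (Suc ?m)" by (intro csub_simps(3)[OF subS] FS)
    moreover have "omega E (?t - (\<gamma> ^ ?m) *\<^sub>C ?p) \<in> S (Suc ?m)" by (rule omS[OF Cons.IH])
    moreover have "(\<gamma> ^ ?m) *\<^sub>C (omega E ?p - \<gamma> *\<^sub>C (\<pi>\<^sub>1 e (v1 ?m) \<otimes> \<pi>\<^sub>2 e (v2 ?m))) \<in> S (Suc ?m)"
      by (intro csub_simps(3)[OF subS] om_pure v1 v2)
    ultimately have "omega E (?t - (\<gamma> ^ ?m) *\<^sub>C ?p) + (\<gamma> ^ ?m) *\<^sub>C (omega E ?p - \<gamma> *\<^sub>C (\<pi>\<^sub>1 e (v1 ?m) \<otimes> \<pi>\<^sub>2 e (v2 ?m)))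
        - m *\<^sub>C ?t \<in> S (Suc ?m)"
      by (intro csub_simps(2)[OF subS] csub_simps(4)[OF subS])
    moreover have "\<pi>\<^sub>1 e (v1 ?m) = v1 (Suc ?m)" "\<pi>\<^sub>2 e (v2 ?m) = v2 (Suc ?m)"
      by (simp_all add: v1_def v2_def u_def X1.act_real X2.act_real)
    ultimately show ?case
      by (simp add: clinear_simps[OF clinear_omega] complex_vector.scale_right_diff_distrib scaleC_scaleC
          algebra_simps)
  qed
  have "op_prod (omega E) ls (w1 \<otimes> w2) = 0" using loc pure_tens[OF w1(1) w2(1)] by blast
  then have "- ((\<gamma> ^ ?n) *\<^sub>C (v1 ?n \<otimes> v2 ?n)) \<in> S ?n" using step[of ls] by simp
  then have mem: "(\<gamma> ^ ?n) *\<^sub>C (v1 ?n \<otimes> v2 ?n) \<in> S ?n"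
    using csub_simps(5)[OF subS] by (metis minus_minus)
  obtain l1 :: "'v \<Rightarrow> complex" where l1: "clinear l1" "l1 (v1 ?n) = 1" "\<And>w. w \<in> ?Q1 ?n \<Longrightarrow> l1 w = 0"
    using separating_functional[OF Q1(1) w1(2)] unfolding v1_def by metis
  obtain l2 :: "'w \<Rightarrow> complex" where l2: "clinear l2" "l2 (v2 ?n) = 1" "\<And>w. w \<in> ?Q2 ?n \<Longrightarrow> l2 w = 0"
    using separating_functional[OF Q2(1) w2(2)] unfolding v2_def by metis
  obtain l :: "('v, 'w) tensor \<Rightarrow> complex" where l: "clinear l" "\<And>v w. l (v \<otimes> w) = l1 v * l2 w"
    using tensor_functional[OF l1(1) l2(1)] by metis
  have "csubspace {0 :: complex}" by (auto intro!: csubspaceI simp: complex_vector.scale_zero_right)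
  then have "l ` S ?n \<subseteq> {0}"
    unfolding S_def by (rule clinear_span_subset[OF l(1)]) (auto simp: l(2) l1(3) l2(3))
  then have "l ((\<gamma> ^ ?n) *\<^sub>C (v1 ?n \<otimes> v2 ?n)) = 0" using mem by blast
  then show False using \<gamma> by (simp add: clinear_simps[OF l(1)] l(2) l1(2) l2(2) scaleC_complex_def)
qed

text \<open>Under \<open>BC\<close>, the space \<open>M\<close> perpendicular to the nilpotent
  symbols is the span of the associated variety. The description as a perpendicular space gives
  stability under the complexified \<open>k\<close>, the one as a span reduces orthogonality to
  generators.\<close>

lemma nilpotent_perp:
  fixes act' :: "'l complexification \<Rightarrow> 'x::complex_vector \<Rightarrow> 'x"
  assumes "filtered_module X1.brC kC act' W" "filtered_module.nilpotent_symbols act' W \<noteq> UNIV"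
  defines "M \<equiv> {y. \<forall>u\<in>filtered_module.nilpotent_symbols act' W. BC y u = 0}"
  shows "csubspace M" "M \<subseteq> pC" "\<And>u v. u \<in> kC \<Longrightarrow> v \<in> M \<Longrightarrow> complexify_bracket br u v \<in> M" "M \<noteq> {0}"
    "M \<subseteq> cspan {y. BC y \<in> filtered_module.char_functionals act' W}"
    "\<And>u. (\<And>y. y \<in> M \<Longrightarrow> BC y u = 0) \<Longrightarrow> u \<in> filtered_module.nilpotent_symbols act' W"
proof -
  interpret f: filtered_module X1.brC kC act' W by fact
  note lin' = clinear_simps[OF clinear_BC'] and lin = clinear_simps[OF clinear_BC]
  show "csubspace M" by (rule csubspaceI) (auto simp: M_def lin' complex_vector.scale_zero_right)
  show "M \<subseteq> pC"
  proof
    fix y assume "y \<in> M"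
    then have "BC y u = 0" if "u \<in> kC" for u
      using that f.ks_nilpotent by (auto simp: M_def)
    then show "y \<in> pC" by (rule BC_perp_kC)
  qed
  show "complexify_bracket br u v \<in> M" if "u \<in> kC" "v \<in> M" for u v
  proof -
    have "BC (complexify_bracket br u v) w = - BC v (complexify_bracket br u w)" for w
      unfolding complexify_bracket_anti[of u v] by (simp add: lin' BC_inv)
    then show ?thesis using that f.nilpotent_derivation[OF that(1)] by (auto simp: M_def)
  qed
  have mem: "y \<in> M" if "BC y \<in> f.char_functionals" for y
    using f.char_functional_nilpotent[OF that] by (auto simp: M_def)
  have detect: "u \<in> f.nilpotent_symbols" if "\<And>y. y \<in> M \<Longrightarrow> BC y u = 0" for u
  proof (subst f.nilpotent_symbols_iff, rule ballI)
    fix \<xi> assume \<xi>: "\<xi> \<in> f.char_functionals"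
    then have "clinear \<xi>" by (simp add: f.char_functionals_def)
    then obtain y where "\<xi> = BC y" by (rule BC_represent)
    then show "\<xi> u = 0" using mem that \<xi> by simp
  qed
  then show "\<And>u. (\<And>y. y \<in> M \<Longrightarrow> BC y u = 0) \<Longrightarrow> u \<in> f.nilpotent_symbols" by blast
  show "M \<noteq> {0}" using detect assms(2) lin'(3) by auto
  show "M \<subseteq> cspan {y. BC y \<in> f.char_functionals}"
  proof
    fix y assume y: "y \<in> M"
    show "y \<in> cspan {y. BC y \<in> f.char_functionals}"
    proof (rule BC_double_perp)
      fix v assume v: "\<And>m. m \<in> cspan {y. BC y \<in> f.char_functionals} \<Longrightarrow> BC m v = 0"
      have "v \<in> f.nilpotent_symbols"
      proof (subst f.nilpotent_symbols_iff, rule ballI)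
        fix \<xi> assume \<xi>: "\<xi> \<in> f.char_functionals"
        then have "clinear \<xi>" by (simp add: f.char_functionals_def)
        then obtain y where "\<xi> = BC y" by (rule BC_represent)
        then show "\<xi> v = 0" using v[of y] \<xi> by (simp add: complex_vector.span_base)
      qed
      then show "BC y v = 0" using y by (auto simp: M_def)
    qed simp
  qed
qed

text \<open>Identifies the scalar of \<open>char_functionals_orthogonal\<close> with a value of the
  invariant form.\<close>

lemma cas_BC:
  assumes E: "onb UNIV E"
  shows "cas E (\<lambda>x y. BC u (Complexify x 0) * BC v (Complexify y 0)) = BC u v"
proof -
  have sum: "(\<Sum>e\<in>E. B e e * B a e * B b e) = B a b" for a b
  proof -
    have "B a b = B (\<Sum>e\<in>E. (B e e * B a e) *\<^sub>R e) b" using onbD(5)[OF E UNIV_I, of a] by simp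
    also have "\<dots> = (\<Sum>e\<in>E. B e e * B a e * B b e)" by (simp add: B_sum B_simps B_sym[of _ b])
    finally show ?thesis by simp
  qed
  let ?a = "real_part u" and ?b = "imag_part u" and ?c = "real_part v" and ?d = "imag_part v"
  have "cas E (\<lambda>x y. BC u (Complexify x 0) * BC v (Complexify y 0)) =
    (\<Sum>e\<in>E. Complex (B e e * B ?a e * B ?c e - B e e * B ?b e * B ?d e) (B e e * B ?a e * B ?d e + B e e * B ?b e * B ?c e))"
    by (simp add: cas_def scaleC_complex_def BC_def B_simps complex_eq_iff algebra_simps)
  also have "\<dots> = Complex (B ?a ?c - B ?b ?d) (B ?a ?d + B ?b ?c)"
    by (simp add: complex_eq_iff sum_subtractf sum.distrib sum)
  finally show ?thesis by (simp add: BC_def)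
qed

end

section \<open>Weights of a central complex structure\<close>

context cartan
begin

lemma weight_decomposition:
  assumes z: "complex_structure z"
  obtains w u u' where "w \<in> kC" "u \<in> pz z" "u' \<in> pz (- z)" "y = w + u + u'"
proof -
  let ?a = "ppart (real_part y)" and ?b = "ppart (imag_part y)"
  let ?J = "br z"
  have zk: "z \<in> k" using z by (simp add: complex_structure_def center_k_def)
  have JJ: "?J (?J x) = - x" if "x \<in> p" for x using z that by (simp add: complex_structure_def)
  let ?w = "Complexify (kpart (real_part y)) (kpart (imag_part y))"
  \<comment> \<open>The real parts of the projections (1 - \<i> ad z)/2 and (1 + \<i> ad z)/2 of the
    component of \<open>y\<close> in \<open>pC\<close>.\<close>
  let ?x = "(1/2) *\<^sub>R (?a + ?J ?b)" and ?x' = "(1/2) *\<^sub>R (?a - ?J ?b)"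
  have in_p: "?x \<in> p" "?x' \<in> p"
    using ppart br_kp[OF zk ppart] sub_p by (auto intro!: subspace_scale subspace_add subspace_diff)
  have "?w \<in> kC" by (simp add: kC_def complexify_set_def kpart)
  moreover have "Complexify ?x (- ?J ?x) \<in> pz z" using in_p by (auto simp: pz_def)
  moreover have "Complexify ?x' (- br (- z) ?x') \<in> pz (- z)" using in_p by (auto simp: pz_def)
  moreover have "y = ?w + Complexify ?x (- ?J ?x) + Complexify ?x' (- br (- z) ?x')"
  proof -
    have "kpart (real_part y) + ?x + ?x' = real_part y"
      using kp_sum[of "real_part y"] scaleR_half_double[of ?a] by (simp add: algebra_simps)
    moreover have "kpart (imag_part y) + - ?J ?x + - br (- z) ?x' = imag_part y"
      using kp_sum[of "imag_part y"] scaleR_half_double[of ?b] JJ[OF ppart]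
      by (simp add: br_simps algebra_simps)
    ultimately show ?thesis by (simp add: complexification_simps complexification.expand)
  qed
  ultimately show ?thesis using that by blast
qed

lemma pz_bracket:
  assumes z: "complex_structure z" and u: "u \<in> pz z"
  shows "complexify_bracket br (Complexify z 0) u = \<i> *\<^sub>C u"
  using assms by (auto simp: pz_def complexify_bracket_def complexification_simps br_simps complex_structure_def)

lemma kC_bracket:
  assumes z: "complex_structure z" and u: "u \<in> kC"
  shows "complexify_bracket br (Complexify z 0) u = 0"
  using assms by (auto simp: kC_def complexify_set_def complexify_bracket_def complexification_simps br_simps
      complex_structure_def center_k_def)

text \<open>The derivation ad z kills brackets of elements of \<open>p\<close>, because these lie in
  \<open>k\<close>. On brackets of two \<i>-eigenvectors it should also act by 2\<i>; in real terms,
  this is the cancellation carried out here.\<close>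

lemma pz_commute:
  assumes z: "complex_structure z" and u: "u \<in> pz z" "v \<in> pz z"
  shows "complexify_bracket br u v = 0"
proof -
  obtain x y where xy: "x \<in> p" "y \<in> p" "u = Complexify x (- br z x)" "v = Complexify y (- br z y)"
    using u by (auto simp: pz_def)
  have zk: "z \<in> k" using z by (simp add: complex_structure_def center_k_def)
  have JJ: "br z (br z x) = - x" if "x \<in> p" for x using z that by (simp add: complex_structure_def)
  have der: "br (br z a) b + br a (br z b) = 0" if "a \<in> p" "b \<in> p" for a b
  proof -
    have "br z (br a b) = 0" using z br_pp[OF that] by (simp add: complex_structure_def center_k_def)
    then show ?thesis using jacobi[of z a b] by simp
  qed
  have 1: "br x y = br (br z x) (br z y)"
    using der[OF br_kp[OF zk xy(1)] xy(2)] JJ[OF xy(1)] by (simp add: br_simps)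
  have 2: "br x (br z y) + br (br z x) y = 0" using der[OF xy(1,2)] by (simp add: add.commute)
  have "br x (- br z y) + br (- br z x) y = - (br x (br z y) + br (br z x) y)"
    by (simp add: br_simps)
  then have 3: "br x (- br z y) + br (- br z x) y = 0" by (simp only: 2 minus_zero)
  have 4: "br x y - br (- br z x) (- br z y) = 0" by (simp add: 1 br_simps)
  show ?thesis unfolding xy(3,4) complexify_bracket_def zero_complexification_def
    by (simp only: complexification.sel 3 4)
qed

end

context equivariant_rep
begin

definition weight :: "'l \<Rightarrow> complex \<Rightarrow> 'v set"
  where "weight z b = {v. \<pi> z v = b *\<^sub>C v}"

lemma csub_weight: "csubspace (weight z b)"
  by (rule csubspaceI) (auto simp: weight_def \<pi>_simps scaleC_add_right complex_vector.scale_left_commute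
      complex_vector.scale_zero_right)

lemma weight_act: "brC (Complexify z 0) u = c *\<^sub>C u \<Longrightarrow> v \<in> weight z b \<Longrightarrow> act u v \<in> weight z (b + c)"
  using act_brC[of "Complexify z 0" u v]
  by (simp add: weight_def act_real clinear_simps[OF clinear_act] clinear_simps[OF act_linear] scaleC_add_left
      eq_diff_eq add.commute)

text \<open>The product of the factors \<pi> z - c over \<open>S\<close> kills the span and
  multiplies \<open>v\<close> by a non-zero number.\<close>

lemma weight_independent:
  assumes v: "v \<in> weight z b" "v \<in> cspan (\<Union>c\<in>S. weight z c)" and S: "finite S" "b \<notin> S"
  shows "v = 0"
proof -
  obtain ls where ls: "set ls = S" using finite_list[OF S(1)] by blast
  have wt: "op_prod (\<pi> z) ms w = prod_list (map (\<lambda>m. c - m) ms) *\<^sub>C w" if "w \<in> weight z c" for ms c w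
  proof (induction ms)
    case Nil then show ?case by (simp add: scaleC_one)
  next
    case (Cons m ms)
    let ?P = "prod_list (map (\<lambda>m. c - m) ms)"
    have "\<pi> z w = c *\<^sub>C w" using that by (simp add: weight_def)
    then have "op_prod (\<pi> z) (m # ms) w = (?P * c) *\<^sub>C w - (m * ?P) *\<^sub>C w"
      by (simp only: op_prod.simps Cons.IH \<pi>_simps scaleC_scaleC)
    also have "\<dots> = ((c - m) * ?P) *\<^sub>C w"
      by (simp add: complex_vector.scale_left_diff_distrib left_diff_distrib mult.commute)
    finally show ?case by simp
  qed
  have z: "csubspace {0 :: 'v}" by (auto intro!: csubspaceI simp: complex_vector.scale_zero_right)
  have "op_prod (\<pi> z) ls ` cspan (\<Union>c\<in>S. weight z c) \<subseteq> {0}"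
  proof (rule clinear_span_subset[OF clinear_op_prod[OF clin_\<pi>] z], safe)
    fix c w assume "c \<in> S" "w \<in> weight z c"
    moreover have "prod_list (map (\<lambda>m. c - m) ls) = 0"
      using \<open>c \<in> S\<close> ls by (auto simp: prod_list_zero_iff)
    ultimately show "op_prod (\<pi> z) ls w = 0" by (simp add: wt complex_vector.scale_zero_left)
  qed
  then have "prod_list (map (\<lambda>m. b - m) ls) *\<^sub>C v = 0" using v(2) wt[OF v(1), of ls] by auto
  moreover have "prod_list (map (\<lambda>m. b - m) ls) \<noteq> 0" using S(2) ls by (auto simp: prod_list_zero_iff)
  ultimately show ?thesis by (simp add: complex_vector.scale_eq_0_iff)
qed

end

section \<open>From nilpotent symbols to vectors annihilated by one half of the complexified
  p\<close>

context gK_irr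
begin

text \<open>Otherwise the filtration would stop at a finite-dimensional submodule.\<close>

lemma nilpotent_symbols_proper:
  assumes W: "csubspace W" "cfinite_dim W" "W \<noteq> {0}" "\<And>g w. g \<in> K \<Longrightarrow> w \<in> W \<Longrightarrow> \<rho> g w \<in> W"
  shows "filtered_module.nilpotent_symbols act W \<noteq> UNIV"
proof
  assume all: "filtered_module.nilpotent_symbols act W = UNIV"
  have ks: "\<pi> x w \<in> W" if "x \<in> k" "w \<in> W" for x w using k_stable[OF W(1,4) that] .
  interpret fm: filtered_module brC kC act W by (rule filtered_moduleI[OF W(1,2) ks])
  obtain n where n: "\<And>y v. v \<in> fm.F n \<Longrightarrow> act y v \<in> fm.F n"
    using fm.stable_if_all_nilpotent[OF all] by blast
  have ne: "fm.F n \<noteq> {0}"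
    using fm.F_mono[of 0 n] W(1,3) csub_simps(1)[OF W(1)] by auto
  have K': "\<rho> g v \<in> fm.F n" if "g \<in> K" "v \<in> fm.F n" for g v
    using filtration_\<rho>[OF W(1,2) ks W(4) that] .
  from fd_not_submodule[OF fm.subF fm.fdF ne K'] obtain x w where "w \<in> fm.F n" "\<pi> x w \<notin> fm.F n" by blast
  then show False using n[of w "Complexify x 0"] by (simp add: act_real)
qed

lemma weight_\<rho>: "complex_structure z \<Longrightarrow> g \<in> K \<Longrightarrow> v \<in> weight z b \<Longrightarrow> \<rho> g v \<in> weight z b"
  using equiv[of g z v] Adj_center[of z g] by (simp add: weight_def clinear_simps[OF clin_\<rho>])

text \<open>\<open>K\<close> fixes \<open>z\<close>, so the eigenspaces of \<open>z\<close> in a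
  K-stable space are K-stable.\<close>

lemma eigen_K_stable:
  assumes z: "complex_structure z"
  obtains W a where "csubspace W" "cfinite_dim W" "W \<noteq> {0}" "\<And>g w. g \<in> K \<Longrightarrow> w \<in> W \<Longrightarrow> \<rho> g w \<in> W"
    "W \<subseteq> weight z a"
proof -
  have zk: "z \<in> k" using z by (simp add: complex_structure_def center_k_def)
  obtain W where W: "csubspace W" "cfinite_dim W" "W \<noteq> {0}" "\<And>g w. g \<in> K \<Longrightarrow> w \<in> W \<Longrightarrow> \<rho> g w \<in> W"
    using fd_K_stable by metis
  have "\<pi> z ` W \<subseteq> W" using k_stable[OF W(1,4) zk] by blast
  from eigenvector_exists[OF clin_\<pi> W(1,3) this W(2)]
  obtain a v where v: "v \<in> W" "v \<noteq> 0" "\<pi> z v = a *\<^sub>C v" .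
  have sub: "csubspace (W \<inter> weight z a)" using W(1) csub_weight by (rule complex_vector.subspace_inter)
  show ?thesis
  proof (rule that[of "W \<inter> weight z a" a])
    show "cfinite_dim (W \<inter> weight z a)" using cfinite_dim_subset[OF W(2) sub] by blast
    show "W \<inter> weight z a \<noteq> {0}" using v by (auto simp: weight_def)
    show "\<rho> g w \<in> W \<inter> weight z a" if "g \<in> K" "w \<in> W \<inter> weight z a" for g w
      using that W(4) weight_\<rho>[OF z] by blast
  qed (use sub in auto)
qed

text \<open>If the symbol of \<open>u\<close> is nilpotent, then \<open>u ^ m\<close> maps a weight space to a weight too high for the
  filtration degree, hence to \<open>0\<close>.\<close>

lemma null_vector_exists:
  assumes z: "complex_structure z"
    and W: "csubspace W" "cfinite_dim W" "W \<noteq> {0}" "\<And>g w. g \<in> K \<Longrightarrow> w \<in> W \<Longrightarrow> \<rho> g w \<in> W" "W \<subseteq> weight z a"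
    and nil: "pz z \<subseteq> filtered_module.nilpotent_symbols act W"
  obtains v where "v \<noteq> 0" "\<And>u. u \<in> pz z \<Longrightarrow> act u v = 0"
proof -
  have ks: "\<pi> x w \<in> W" if "x \<in> k" "w \<in> W" for x w using k_stable[OF W(1,4) that] .
  interpret fm: filtered_module brC kC act W by (rule filtered_moduleI[OF W(1,2) ks])
  \<comment> \<open>An element of the Lie algebra splits into parts that shift the weight by 0, \<i>
    or -\<i>. Hence \<open>F n\<close> only involves weights a + \<i> s with \<bar>s\<bar> \<le>
    n.\<close>
  define S where "S n = (\<lambda>s :: int. a + \<i> * of_int s) ` {- int n..int n}" for n
  define X where "X n = cspan (\<Union>c\<in>S n. weight z c)" for n
  have subX: "csubspace (X n)" for n by (simp add: X_def)
  have XI: "v \<in> X n" if "v \<in> weight z (a + \<i> * of_int s)" "\<bar>s\<bar> \<le> int n" for v n s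
    unfolding X_def
  proof (rule complex_vector.span_base)
    have "a + \<i> * of_int s \<in> S n" unfolding S_def using that(2) by (intro imageI) auto
    then show "v \<in> (\<Union>c\<in>S n. weight z c)" using that(1) by blast
  qed
  have Xact: "act y v \<in> X (Suc n)" if v: "v \<in> X n" for y v n
  proof -
    have "act y ` X n \<subseteq> X (Suc n)"
      unfolding X_def[of n]
    proof (rule clinear_span_subset[OF clinear_act subX], safe)
      fix c v assume "c \<in> S n" and v: "v \<in> weight z c"
      then obtain s where s: "c = a + \<i> * of_int s" "\<bar>s\<bar> \<le> int n" by (auto simp: S_def)
      obtain w u u' where d: "w \<in> kC" "u \<in> pz z" "u' \<in> pz (- z)" "y = w + u + u'"
        by (rule weight_decomposition[OF z])
      have "brC (Complexify z 0) w = 0 *\<^sub>C w"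
        using kC_bracket[OF z d(1)] by (simp add: complex_vector.scale_zero_left)
      from weight_act[OF this v] have 1: "act w v \<in> weight z (a + \<i> * of_int s)" by (simp add: s)
      from weight_act[OF pz_bracket[OF z d(2)] v] have 2: "act u v \<in> weight z (a + \<i> * of_int (s + 1))"
        by (simp add: s algebra_simps)
      have "brC (Complexify (- z) 0) u' = \<i> *\<^sub>C u'"
        by (rule pz_bracket[OF complex_structure_minus[OF z] d(3)])
      then have "brC (Complexify z 0) u' = (- \<i>) *\<^sub>C u'"
        by (simp add: complexify_bracket_def complexification_simps br_simps minus_equation_iff)
      from weight_act[OF this v] have 3: "act u' v \<in> weight z (a + \<i> * of_int (s - 1))"
        by (simp add: s algebra_simps)
      have "act w v + act u v + act u' v \<in> X (Suc n)"
        using s(2) by (intro csub_simps(2)[OF subX] XI[OF 1] XI[OF 2] XI[OF 3]) auto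
      then show "act y v \<in> X (Suc n)" by (simp add: d(4) clinear_simps[OF act_linear])
    qed
    then show ?thesis using v by blast
  qed
  have X_mono: "X n \<subseteq> X (Suc n)" for n
    unfolding X_def
  proof (rule complex_vector.span_mono)
    have "S n \<subseteq> S (Suc n)" unfolding S_def by (rule image_mono) auto
    then show "(\<Union>c\<in>S n. weight z c) \<subseteq> (\<Union>c\<in>S (Suc n). weight z c)" by blast
  qed
  have FX: "fm.F n \<subseteq> X n" for n
  proof (induction n)
    case 0 then show ?case using W(5) XI[of _ 0 0] by auto
  next
    case (Suc n)
    show ?case by (rule fm.F_Suc_subset[OF subX]) (use Suc X_mono Xact in blast)+
  qed
  have word_wt: "fm.word (replicate m u) w \<in> weight z (a + \<i> * of_nat m)" if "u \<in> pz z" "w \<in> W" for m u w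
  proof (induction m)
    case 0 then show ?case using that W(5) by auto
  next
    case (Suc m)
    from weight_act[OF pz_bracket[OF z that(1)] Suc] show ?case by (simp add: algebra_simps)
  qed
  have kill: "\<exists>m. fm.word (replicate m u) w = 0" if u: "u \<in> pz z" and w: "w \<in> W" for u w
  proof -
    obtain m where m: "\<And>n v. v \<in> fm.F n \<Longrightarrow> fm.word (replicate m u) v \<in> fm.G (n + m)"
      using nil u unfolding fm.nilpotent_symbols_def by blast
    have G: "fm.word (replicate m u) w \<in> fm.G m" using m[of w 0] w by simp
    show ?thesis
    proof (cases m)
      case 0 then show ?thesis using G by (intro exI[of _ 0]) simp
    next
      case (Suc j)
      then have "fm.word (replicate m u) w \<in> X j" using G FX by auto
      moreover have "a + \<i> * of_nat m \<notin> S j"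
      proof
        assume "a + \<i> * of_nat m \<in> S j"
        then obtain s where s: "a + \<i> * of_nat m = a + \<i> * of_int s" "s \<in> {- int j..int j}"
          unfolding S_def by (rule imageE)
        then have "(of_int (int m) :: complex) = of_int s" by simp
        then have "int m = s" by (simp only: of_int_eq_iff)
        then show False using s(2) Suc by simp
      qed
      moreover have "finite (S j)" by (simp add: S_def)
      ultimately have "fm.word (replicate m u) w = 0"
        unfolding X_def using weight_independent[OF word_wt[OF u w]] by blast
      then show ?thesis by blast
    qed
  qed
  have sub_pz: "csubspace (pz z)"
  proof -
    have "pz z = {u \<in> pC. imag_part u = - br z (real_part u)}"
      using br_kp[of z] subspace_neg[OF sub_p] z
      by (auto simp: pz_def pC_def complexify_set_def complex_structure_def center_k_def complexification.expand
          intro!: exI[of _ "real_part _"])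
    also have "csubspace \<dots>"
    proof (rule csubspaceI)
      show "0 \<in> {u \<in> pC. imag_part u = - br z (real_part u)}"
        using csub_simps(1)[OF csub_pC] by (simp add: zero_complexification_def br_simps)
    next
      fix v w assume vw: "v \<in> {u \<in> pC. imag_part u = - br z (real_part u)}" "w \<in> {u \<in> pC. imag_part u = - br z (real_part u)}"
      then have "v + w \<in> pC" using csub_simps(2)[OF csub_pC] by blast
      moreover have "imag_part (v + w) = - br z (real_part (v + w))"
        using vw by (simp add: complexification_simps br_simps)
      ultimately show "v + w \<in> {u \<in> pC. imag_part u = - br z (real_part u)}" by blast
    next
      fix c u assume u: "u \<in> {u \<in> pC. imag_part u = - br z (real_part u)}"
      then have "c *\<^sub>C u \<in> pC" using csub_simps(3)[OF csub_pC] by blast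
      moreover have "imag_part (c *\<^sub>C u) = - br z (real_part (c *\<^sub>C u))"
        using u z by (simp add: complexification_simps br_simps complex_structure_def pC_def complexify_set_def)
      ultimately show "c *\<^sub>C u \<in> {u \<in> pC. imag_part u = - br z (real_part u)}" by blast
    qed
    finally show ?thesis .
  qed
  obtain D where D: "finite D" "D \<subseteq> pz z" "pz z = cspan D"
    using cfinite_dim_span[OF cfinite_dim_subset[OF cfinite_dim_complexification sub_pz subset_UNIV] sub_pz] by metis
  define P where "P v \<longleftrightarrow> v \<noteq> 0 \<and> (\<forall>u\<in>pz z. \<exists>m. fm.word (replicate m u) v = 0)" for v
  have comm: "act u (act u' v) = act u' (act u v)" if "u \<in> pz z" "u' \<in> pz z" for u u' v
    using act_brC[of u u' v] pz_commute[OF z that] by (simp add: clinear_simps[OF act_linear])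
  have comm_word: "act u (fm.word (replicate m u') v) = fm.word (replicate m u') (act u v)" if "u \<in> pz z" "u' \<in> pz z" for u u' v m
    using comm[OF that] by (induction m) auto
  \<comment> \<open>The spanning elements of \<open>pz z\<close> are treated one after the other:
    \<open>v\<close> is replaced by its last non-zero image under powers of the new element. Since
    \<open>pz z\<close> is commutative, this preserves nilpotency and the annihilations obtained
    before.\<close>
  have "\<exists>v. P v \<and> (\<forall>u\<in>D'. act u v = 0)" if "finite D'" "D' \<subseteq> pz z" for D'
    using that
  proof (induction D')
    case empty
    obtain w where "w \<in> W" "w \<noteq> 0" using W(1,3) csub_simps(1) by blast
    then have "P w" using kill by (simp add: P_def)
    then show ?case by blast
  next
    case (insert u D')
    then obtain v where v: "P v" "\<And>u. u \<in> D' \<Longrightarrow> act u v = 0" and u: "u \<in> pz z" by blast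
    define m where "m = (LEAST m. fm.word (replicate m u) v = 0)"
    have "\<exists>m. fm.word (replicate m u) v = 0" using v(1) u by (simp add: P_def)
    then have m: "fm.word (replicate m u) v = 0" unfolding m_def by (rule LeastI_ex)
    moreover have "v \<noteq> 0" using v(1) by (simp add: P_def)
    ultimately obtain j where j: "m = Suc j" by (cases m) auto
    define v' where "v' = fm.word (replicate j u) v"
    have "v' \<noteq> 0"
    proof
      assume "v' = 0"
      then have "m \<le> j" unfolding m_def v'_def by (rule Least_le)
      then show False using j by simp
    qed
    moreover have "\<exists>m. fm.word (replicate m u') v' = 0" if u': "u' \<in> pz z" for u'
    proof -
      obtain n where n: "fm.word (replicate n u') v = 0" using v(1) u' by (auto simp: P_def)
      have "fm.word (replicate n u') (fm.word (replicate i u) v) = fm.word (replicate i u) (fm.word (replicate n u') v)" for i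
        by (induction i) (simp_all add: comm_word[OF u u', symmetric])
      then have "fm.word (replicate n u') v' = 0" by (simp add: v'_def n fm.word_simps)
      then show ?thesis by blast
    qed
    moreover have "act u v' = 0" using m by (simp add: v'_def j)
    moreover have "act u' v' = 0" if "u' \<in> D'" for u'
    proof -
      have "u' \<in> pz z" using that insert.prems by blast
      then show ?thesis using v(2)[OF that] by (simp add: v'_def comm_word[OF _ u] fm.word_simps)
    qed
    ultimately show ?case by (intro exI[of _ v']) (auto simp: P_def)
  qed
  from this[OF D(1,2)] obtain v where v: "P v" "\<And>u. u \<in> D \<Longrightarrow> act u v = 0" by blast
  have z0: "csubspace {0 :: 'v}" by (auto intro!: csubspaceI simp: complex_vector.scale_zero_right)
  have "(\<lambda>u. act u v) ` cspan D \<subseteq> {0}"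
    by (rule clinear_span_subset[OF act_linear z0]) (use v(2) in auto)
  then have "act u v = 0" if "u \<in> pz z" for u using that D(3) by blast
  moreover have "v \<noteq> 0" using v(1) by (simp add: P_def)
  ultimately show ?thesis using that by blast
qed

end

section \<open>Necessity: null vectors of both modules for the same complex structure\<close>

context gK_pair
begin

text \<open>The finite-dimensional space \<open>tens W1 W2\<close> lies in one step of the
  filtration, on which a polynomial in the Casimir operator vanishes. The spaces \<open>X n\<close>
  supply the countable dimension required for this.\<close>

lemma decomposable_local_finite:
  assumes dd: "discretely_decomposable K \<pi>T \<rho>T" and E: "onb UNIV E"
    and W: "cfinite_dim W1" "cfinite_dim W2" "csubspace W1" "csubspace W2"
  obtains ls where "\<And>t. t \<in> tens W1 W2 \<Longrightarrow> op_prod (omega E) ls t = 0"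
proof -
  obtain Y :: "nat \<Rightarrow> ('v, 'w) tensor set" where
    Y: "\<And>i. T.submodule (Y i)" "\<And>i. gK_finite_length K \<pi>T \<rho>T (Y i)" "\<And>i. Y i \<subseteq> Y (Suc i)" "(\<Union>i. Y i) = UNIV"
    using dd unfolding discretely_decomposable_def by blast
  have mono: "i \<le> j \<Longrightarrow> Y i \<subseteq> Y j" for i j by (rule lift_Suc_mono_le[of Y, OF Y(3)])
  obtain C where C: "finite C" "C \<subseteq> tens W1 W2" "tens W1 W2 \<subseteq> cspan C"
    using cfinite_dim_tens[OF W(1,2)] unfolding cfinite_dim_def by blast
  have "\<exists>i. t \<in> Y i" for t using Y(4) by blast
  then obtain f where f: "\<And>t. t \<in> Y (f t)" by metis
  define N where "N = (\<Sum>t\<in>C. f t)"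
  have "C \<subseteq> Y N"
  proof
    fix t assume "t \<in> C"
    then have "f t \<le> N" unfolding N_def using C(1) by (intro member_le_sum) auto
    then show "t \<in> Y N" using f mono by blast
  qed
  then have sub: "tens W1 W2 \<subseteq> Y N"
    using C(3) complex_vector.span_minimal[OF _ T.submoduleD(1)[OF Y(1)]] by blast
  obtain V1 where V1: "csubspace V1" "cfinite_dim V1" "V1 \<noteq> {0}" "\<And>g w. g \<in> K \<Longrightarrow> w \<in> V1 \<Longrightarrow> \<rho>\<^sub>1 g w \<in> V1"
    using X1.fd_K_stable by metis
  have ks1: "\<pi>\<^sub>1 x w \<in> V1" if "x \<in> k" "w \<in> V1" for x w using X1.k_stable[OF V1(1,4) that] .
  interpret f1: filtered_module X1.brC kC X1.act V1 by (rule X1.filtered_moduleI[OF V1(1,2) ks1])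
  obtain V2 where V2: "csubspace V2" "cfinite_dim V2" "V2 \<noteq> {0}" "\<And>g w. g \<in> K \<Longrightarrow> w \<in> V2 \<Longrightarrow> \<rho>\<^sub>2 g w \<in> V2"
    using X2.fd_K_stable by metis
  have ks2: "\<pi>\<^sub>2 x w \<in> V2" if "x \<in> k" "w \<in> V2" for x w using X2.k_stable[OF V2(1,4) that] .
  interpret f2: filtered_module X2.brC kC X2.act V2 by (rule X2.filtered_moduleI[OF V2(1,2) ks2])
  define X where "X n = tens (f1.F n) (f2.F n)" for n
  have fdX: "cfinite_dim (X n)" for n unfolding X_def by (rule cfinite_dim_tens[OF f1.fdF f2.fdF])
  have subU: "csubspace (\<Union>n. X n)"
  proof (rule csubspaceI)
    show "0 \<in> (\<Union>n. X n)" using csub_simps(1)[OF csub_tens] by (auto simp: X_def)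
  next
    fix s t assume "s \<in> (\<Union>n. X n)" "t \<in> (\<Union>n. X n)"
    then obtain m n where "s \<in> X m" "t \<in> X n" by blast
    moreover have "X i \<subseteq> X j" if "i \<le> j" for i j
      unfolding X_def by (rule tens_mono[OF f1.F_mono[OF that] f2.F_mono[OF that]])
    ultimately have "s \<in> X (max m n)" "t \<in> X (max m n)"
      by (meson max.cobounded1 max.cobounded2 subsetD)+
    then show "s + t \<in> (\<Union>n. X n)" unfolding X_def using csub_simps(2)[OF csub_tens] by blast
  next
    fix a t assume "t \<in> (\<Union>n. X n)"
    then show "a *\<^sub>C t \<in> (\<Union>n. X n)" unfolding X_def using csub_simps(3)[OF csub_tens] by blast
  qed
  have "v \<otimes> w \<in> (\<Union>n. X n)" for v w
  proof -
    have "v \<in> (\<Union>n. f1.F n)" "w \<in> (\<Union>n. f2.F n)"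
      using X1.filtration_exhausts[OF V1] X2.filtration_exhausts[OF V2] by simp_all
    then obtain m n where "v \<in> f1.F m" "w \<in> f2.F n" by blast
    then have "v \<in> f1.F (max m n)" "w \<in> f2.F (max m n)"
      using f1.F_mono f2.F_mono by (meson max.cobounded1 max.cobounded2 subsetD)+
    then show ?thesis unfolding X_def using pure_tens by blast
  qed
  then have "tens UNIV UNIV \<subseteq> (\<Union>n. X n)" by (intro tens_subset subU)
  then have exh: "(\<Union>n. X n) = UNIV" by (auto simp: tens_UNIV)
  obtain ls where ls: "\<And>v. v \<in> Y N \<Longrightarrow> op_prod (T.casimir E) ls v = 0"
    using T.casimir_polynomial[OF E Y(2) fdX exh] by metis
  obtain c1 where c1: "\<And>v. X1.casimir E v = c1 *\<^sub>C v" using X1.casimir_scalar[OF E] by metis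
  obtain c2 where c2: "\<And>v. X2.casimir E v = c2 *\<^sub>C v" using X2.casimir_scalar[OF E] by metis
  have "op_prod (omega E) (map (\<lambda>l. (l - c1 - c2) / 2) ls) t = 0" if t: "t \<in> tens W1 W2" for t
  proof -
    have "(2 ^ length ls) *\<^sub>C op_prod (omega E) (map (\<lambda>l. (l - c1 - c2) / 2) ls) t = 0"
      using ls[of t] t sub op_prod_casimir[OF c1 c2, of ls t] by auto
    then show ?thesis by (simp add: complex_vector.scale_eq_0_iff)
  qed
  then show ?thesis using that by blast
qed

lemma common_structure:
  assumes dd: "discretely_decomposable K \<pi>T \<rho>T"
    and W1: "csubspace W1" "cfinite_dim W1" "W1 \<noteq> {0}" "\<And>g w. g \<in> K \<Longrightarrow> w \<in> W1 \<Longrightarrow> \<rho>\<^sub>1 g w \<in> W1"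
    and W2: "csubspace W2" "cfinite_dim W2" "W2 \<noteq> {0}" "\<And>g w. g \<in> K \<Longrightarrow> w \<in> W2 \<Longrightarrow> \<rho>\<^sub>2 g w \<in> W2"
  obtains z where "complex_structure z" "pz z \<subseteq> filtered_module.nilpotent_symbols X1.act W1"
    "pz z \<subseteq> filtered_module.nilpotent_symbols X2.act W2"
proof -
  have ks1: "\<pi>\<^sub>1 x w \<in> W1" if "x \<in> k" "w \<in> W1" for x w using X1.k_stable[OF W1(1,4) that] .
  have ks2: "\<pi>\<^sub>2 x w \<in> W2" if "x \<in> k" "w \<in> W2" for x w using X2.k_stable[OF W2(1,4) that] .
  obtain Ek Ep where E: "onb k Ek" "onb p Ep" by (metis onb_exists)
  define E where "E = Ek \<union> Ep"
  have E: "onb UNIV E" unfolding E_def by (rule onb_union(1)[OF E])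
  obtain ls where ls: "\<And>t. t \<in> tens W1 W2 \<Longrightarrow> op_prod (omega E) ls t = 0"
    using decomposable_local_finite[OF dd E W1(2) W2(2) W1(1) W2(1)] by metis
  let ?N1 = "filtered_module.nilpotent_symbols X1.act W1" and ?N2 = "filtered_module.nilpotent_symbols X2.act W2"
  let ?C1 = "filtered_module.char_functionals X1.act W1" and ?C2 = "filtered_module.char_functionals X2.act W2"
  let ?M1 = "{y. \<forall>u\<in>?N1. BC y u = 0}" and ?M2 = "{y. \<forall>u\<in>?N2. BC y u = 0}"
  note M1 = nilpotent_perp[OF X1.filtered_moduleI[OF W1(1,2) ks1] X1.nilpotent_symbols_proper[OF W1]]
  note M2 = nilpotent_perp[OF X2.filtered_moduleI[OF W2(1,2) ks2] X2.nilpotent_symbols_proper[OF W2]]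
  have gen: "BC y1 y2 = 0" if "BC y1 \<in> ?C1" "BC y2 \<in> ?C2" for y1 y2
    using char_functionals_orthogonal[OF W1(1,2) ks1 W2(1,2) ks2 E ls that] cas_BC[OF E] by simp
  have z0: "csubspace {0 :: complex}" by (auto intro!: csubspaceI simp: complex_vector.scale_zero_right)
  have orth: "BC y1 y2 = 0" if y: "y1 \<in> ?M1" "y2 \<in> ?M2" for y1 y2
  proof -
    have 1: "BC y1 y2 = 0" if "y1 \<in> ?M1" "BC y2 \<in> ?C2" for y1 y2
    proof -
      have "(\<lambda>y1. BC y1 y2) ` cspan {y. BC y \<in> ?C1} \<subseteq> {0}"
        by (rule clinear_span_subset[OF clinear_BC' z0]) (use gen that(2) in auto)
      then show ?thesis using M1(5) that(1) by blast
    qed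
    have "BC y1 ` cspan {y. BC y \<in> ?C2} \<subseteq> {0}"
      by (rule clinear_span_subset[OF clinear_BC z0]) (use 1[OF y(1)] in auto)
    then show ?thesis using M2(5) y(2) by blast
  qed
  from orthogonal_submodules[OF M1(1-4) M2(1-4) orth]
  obtain z where z: "complex_structure z" "?M1 = pz z" "?M2 = pz z" by blast
  show ?thesis
  proof (rule that[OF z(1)])
    show "pz z \<subseteq> ?N1" using M1(6) BC_pz[OF z(1)] unfolding z(2) by blast
    show "pz z \<subseteq> ?N2" using M2(6) BC_pz[OF z(1)] unfolding z(3) by blast
  qed
qed

text \<open>\<open>common_structure\<close> is used twice. The first time, with arbitrary K-stable
  spaces, it shows that a complex structure exists; only then can generating spaces consisting of
  weight vectors be chosen, as \<open>null_vector_exists\<close> demands, and the second use refers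
  to these.\<close>

lemma decomposable_imp_null_vectors:
  assumes dd: "discretely_decomposable K \<pi>T \<rho>T"
  obtains z v1 v2 where "complex_structure z" "v1 \<noteq> 0" "\<And>u. u \<in> pz z \<Longrightarrow> X1.act u v1 = 0"
    "v2 \<noteq> 0" "\<And>u. u \<in> pz z \<Longrightarrow> X2.act u v2 = 0"
proof -
  obtain V1 where V1: "csubspace V1" "cfinite_dim V1" "V1 \<noteq> {0}" "\<And>g w. g \<in> K \<Longrightarrow> w \<in> V1 \<Longrightarrow> \<rho>\<^sub>1 g w \<in> V1"
    using X1.fd_K_stable by metis
  obtain V2 where V2: "csubspace V2" "cfinite_dim V2" "V2 \<noteq> {0}" "\<And>g w. g \<in> K \<Longrightarrow> w \<in> V2 \<Longrightarrow> \<rho>\<^sub>2 g w \<in> V2"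
    using X2.fd_K_stable by metis
  obtain z0 where z0: "complex_structure z0" using common_structure[OF dd V1 V2] by metis
  obtain W1 a1 where W1: "csubspace W1" "cfinite_dim W1" "W1 \<noteq> {0}" "\<And>g w. g \<in> K \<Longrightarrow> w \<in> W1 \<Longrightarrow> \<rho>\<^sub>1 g w \<in> W1"
    "W1 \<subseteq> X1.weight z0 a1" using X1.eigen_K_stable[OF z0] by metis
  obtain W2 a2 where W2: "csubspace W2" "cfinite_dim W2" "W2 \<noteq> {0}" "\<And>g w. g \<in> K \<Longrightarrow> w \<in> W2 \<Longrightarrow> \<rho>\<^sub>2 g w \<in> W2"
    "W2 \<subseteq> X2.weight z0 a2" using X2.eigen_K_stable[OF z0] by metis
  obtain z where z: "complex_structure z" "pz z \<subseteq> filtered_module.nilpotent_symbols X1.act W1"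
    "pz z \<subseteq> filtered_module.nilpotent_symbols X2.act W2"
    using common_structure[OF dd W1(1-4) W2(1-4)] by metis
  have "z = z0 \<or> z = - z0" using complex_structure_unique[OF X1.p_nonzero z0 z(1)] .
  then have "W1 \<subseteq> X1.weight z a1 \<or> W1 \<subseteq> X1.weight z (- a1)" "W2 \<subseteq> X2.weight z a2 \<or> W2 \<subseteq> X2.weight z (- a2)"
    using W1(5) W2(5)
    by (auto simp: X1.weight_def X2.weight_def X1.\<pi>_minus X2.\<pi>_minus complex_vector.scale_minus_left)
  then obtain b1 b2 where b: "W1 \<subseteq> X1.weight z b1" "W2 \<subseteq> X2.weight z b2" by blast
  obtain v1 where v1: "v1 \<noteq> 0" "\<And>u. u \<in> pz z \<Longrightarrow> X1.act u v1 = 0"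
    using X1.null_vector_exists[OF z(1) W1(1-4) b(1) z(2)] by metis
  obtain v2 where v2: "v2 \<noteq> 0" "\<And>u. u \<in> pz z \<Longrightarrow> X2.act u v2 = 0"
    using X2.null_vector_exists[OF z(1) W2(1-4) b(2) z(3)] by metis
  show ?thesis by (rule that[OF z(1) v1 v2])
qed

end

section \<open>A numerical range bound for sums of squares\<close>

section \<open>A spectral bound on words\<close>

text \<open>\<open>form n l l'\<close> is the standard Hermitian product of the values of \<open>l\<close> and \<open>l'\<close> on the words of length \<open>n\<close>
  in the operators \<open>ops\<close> applied to \<open>B0\<close>.  It lives on the dual of \<open>V n\<close> because these words may be linearly
  dependent.  Operators whose commutators with the \<open>ops\<close> form a skew-symmetric matrix act on the words by
  a skew-Hermitian matrix up to an error coming from \<open>B0\<close> only, hence independent of \<open>n\<close>.\<close>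

locale words =
  fixes B0 :: "'v::complex_vector set" and J :: "'i set" and ops :: "'i \<Rightarrow> 'v \<Rightarrow> 'v"
  assumes finB: "finite B0" and finJ: "finite J" and clin_ops: "\<And>j. clinear (ops j)"
begin

primrec V :: "nat \<Rightarrow> 'v set" where
  "V 0 = cspan B0"
| "V (Suc n) = cspan (\<Union>j\<in>J. ops j ` V n)"

primrec form :: "nat \<Rightarrow> ('v \<Rightarrow> complex) \<Rightarrow> ('v \<Rightarrow> complex) \<Rightarrow> complex" where
  "form 0 l l' = (\<Sum>b\<in>B0. l b * cnj (l' b))"
| "form (Suc n) l l' = (\<Sum>j\<in>J. form n (\<lambda>v. l (ops j v)) (\<lambda>v. l' (ops j v)))"

definition nrm :: "nat \<Rightarrow> ('v \<Rightarrow> complex) \<Rightarrow> real"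
  where "nrm n l = Re (form n l l)"

lemma subV: "csubspace (V n)"
  by (cases n) auto

lemma fdV: "cfinite_dim (V n)"
proof (induction n)
  case 0 then show ?case by (simp add: cfinite_dimI finB)
next
  case (Suc n)
  have "cfinite_dim (cspan (\<Union>j\<in>J. ops j ` V n))"
    by (intro cfinite_dim_finite_sum finJ cfinite_dim_image Suc clin_ops)
  then show ?case by simp
qed

lemma form_add: "form n (\<lambda>v. l v + m v) l' = form n l l' + form n m l'"
  "form n l (\<lambda>v. l' v + m' v) = form n l l' + form n l m'"
  by (induction n arbitrary: l m l' m') (auto simp: sum.distrib algebra_simps)

lemma form_scale: "form n (\<lambda>v. a * l v) l' = a * form n l l'"
  "form n l (\<lambda>v. a * l' v) = cnj a * form n l l'"
  by (induction n arbitrary: l l') (auto simp: sum_distrib_left algebra_simps)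

lemma form_zero: "form n (\<lambda>v. 0) l' = 0" "form n l (\<lambda>v. 0) = 0"
  using form_scale(1)[of n 0 "\<lambda>v. 0"] form_scale(2)[of n l 0 "\<lambda>v. 0"] by simp_all

lemma form_sum: "form n (\<lambda>v. \<Sum>i\<in>I. g i v) l' = (\<Sum>i\<in>I. form n (g i) l')"
  "form n l (\<lambda>v. \<Sum>i\<in>I. m i v) = (\<Sum>i\<in>I. form n l (m i))"
  by (induction I rule: infinite_finite_induct) (auto simp: form_zero form_add)

lemma form_cong:
  "(\<And>v. v \<in> V n \<Longrightarrow> l v = m v) \<Longrightarrow> form n l l' = form n m l'"
proof (induction n arbitrary: l m l')
  case 0
  then show ?case by (auto intro!: sum.cong simp: complex_vector.span_base)
next
  case (Suc n)
  have "ops j v \<in> V (Suc n)" if "j \<in> J" "v \<in> V n" for j v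
    using that by (auto intro!: complex_vector.span_base)
  then show ?case
    unfolding form.simps using Suc.prems by (intro sum.cong Suc.IH refl) auto
qed

lemma form_real: "form n l l = complex_of_real (nrm n l)"
proof -
  have "Im (form n l l) = 0" by (induction n arbitrary: l) (auto simp: algebra_simps)
  then show ?thesis by (simp add: nrm_def complex_eq_iff)
qed

lemma nrm_nonneg: "nrm n l \<ge> 0"
  unfolding nrm_def by (induction n arbitrary: l) (auto intro!: sum_nonneg)

lemma nrm_Suc: "nrm (Suc n) l = (\<Sum>j\<in>J. nrm n (\<lambda>v. l (ops j v)))"
  by (simp add: nrm_def)

lemma nrm_zero:
  assumes "clinear l" "nrm n l = 0" "v \<in> V n"
  shows "l v = 0"
proof -
  have z: "csubspace {0 :: complex}" by (auto intro!: csubspaceI simp: complex_vector.scale_zero_right)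
  show ?thesis using assms
  proof (induction n arbitrary: l v)
    case 0
    have nonneg: "Re (l b * cnj (l b)) \<ge> 0" for b by simp
    have "(\<Sum>b\<in>B0. Re (l b * cnj (l b))) = 0" using 0(2) by (simp add: nrm_def)
    then have "\<forall>b\<in>B0. Re (l b * cnj (l b)) = 0"
      using sum_nonneg_eq_0_iff[OF finB, of "\<lambda>b. Re (l b * cnj (l b))"] nonneg by blast
    then have "l b = 0" if "b \<in> B0" for b
      using that by (auto simp: complex_eq_iff sum_squares_eq_zero_iff)
    then have "l ` cspan B0 \<subseteq> {0}" by (intro clinear_span_subset[OF 0(1) z]) auto
    then show ?case using 0(3) by auto
  next
    case (Suc n)
    have "\<forall>j\<in>J. nrm n (\<lambda>v. l (ops j v)) = 0"
      using Suc.prems(2) sum_nonneg_eq_0_iff[OF finJ, of "\<lambda>j. nrm n (\<lambda>v. l (ops j v))"] nrm_nonneg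
      unfolding nrm_Suc by blast
    then have "l (ops j v) = 0" if "j \<in> J" "v \<in> V n" for j v
      using Suc.IH[OF clinear_compose[OF Suc.prems(1) clin_ops]] that by blast
    then have "l ` cspan (\<Union>j\<in>J. ops j ` V n) \<subseteq> {0}"
      by (intro clinear_span_subset[OF Suc.prems(1) z]) auto
    then show ?case using Suc.prems(3) by auto
  qed
qed

text \<open>Pushing \<open>X\<close> through the outermost letter leaves commutator terms, which
  cancel between the two summands because \<open>m\<close> is real and skew. By induction only words
  of length 0 contribute; there \<open>c\<close> is twice the sum of the absolute values of matrix
  coefficients of \<open>X\<close> on \<open>B0\<close>. The Cauchy-Schwarz inequality keeps the
  constant the same for all n.\<close>

lemma hermitian_part_bounded:
  assumes X: "clinear X" "\<And>b. b \<in> B0 \<Longrightarrow> X b \<in> cspan B0"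
    and comm: "\<And>j v. j \<in> J \<Longrightarrow> X (ops j v) = ops j (X v) + (\<Sum>i\<in>J. complex_of_real (m j i) *\<^sub>C ops i v)"
    and skew: "\<And>i j. i \<in> J \<Longrightarrow> j \<in> J \<Longrightarrow> m i j = - m j i"
  obtains c where "c \<ge> 0" "\<And>n l l'. clinear l \<Longrightarrow> clinear l' \<Longrightarrow>
    norm (form n (\<lambda>v. l (X v)) l' + form n l (\<lambda>v. l' (X v))) \<le> c * (sqrt (nrm n l) * sqrt (nrm n l'))"
proof -
  have "\<exists>t. X b = (\<Sum>a\<in>B0. t a *\<^sub>C a)" if "b \<in> B0" for b
    using X(2)[OF that] unfolding complex_vector.span_finite[OF finB] by auto
  then obtain t where t: "\<And>b. b \<in> B0 \<Longrightarrow> X b = (\<Sum>a\<in>B0. t b a *\<^sub>C a)" by metis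
  define c where "c = 2 * (\<Sum>b\<in>B0. \<Sum>a\<in>B0. norm (t b a))"
  have c0: "c \<ge> 0" unfolding c_def by (auto intro!: sum_nonneg)
  have val: "norm (l b) \<le> sqrt (nrm 0 l)" if "b \<in> B0" for l :: "'v \<Rightarrow> complex" and b
  proof (rule real_le_rsqrt)
    have "nrm 0 l = (\<Sum>b\<in>B0. (norm (l b))\<^sup>2)"
      unfolding nrm_def form.simps Re_sum by (intro sum.cong refl) (simp add: cmod_power2 flip: power2_eq_square)
    then show "(norm (l b))\<^sup>2 \<le> nrm 0 l"
      using member_le_sum[OF that, of "\<lambda>b. (norm (l b))\<^sup>2"] finB by simp
  qed
  have half: "norm (form 0 (\<lambda>v. l (X v)) l') \<le> c / 2 * (sqrt (nrm 0 l) * sqrt (nrm 0 l'))"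
    if l: "clinear l" for l l' :: "'v \<Rightarrow> complex"
  proof -
    have "form 0 (\<lambda>v. l (X v)) l' = (\<Sum>b\<in>B0. \<Sum>a\<in>B0. t b a * (l a * cnj (l' b)))"
      unfolding form.simps
      by (intro sum.cong refl) (simp add: t clinear_simps[OF l] scaleC_complex_def sum_distrib_right mult.assoc)
    also have "norm \<dots> \<le> (\<Sum>b\<in>B0. \<Sum>a\<in>B0. norm (t b a) * (sqrt (nrm 0 l) * sqrt (nrm 0 l')))"
    proof (intro order.trans[OF norm_sum sum_mono] order.trans[OF norm_sum sum_mono])
      fix b a assume "b \<in> B0" "a \<in> B0"
      then show "norm (t b a * (l a * cnj (l' b))) \<le> norm (t b a) * (sqrt (nrm 0 l) * sqrt (nrm 0 l'))"
        unfolding norm_mult complex_mod_cnj using nrm_nonneg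
        by (intro mult_left_mono mult_mono val) auto
    qed
    also have "\<dots> = c / 2 * (sqrt (nrm 0 l) * sqrt (nrm 0 l'))"
      by (simp add: c_def sum_distrib_right)
    finally show ?thesis .
  qed
  have cnj_form: "form n l l' = cnj (form n l' l)" for n and l l' :: "'v \<Rightarrow> complex"
  proof (induction n arbitrary: l l')
    case 0 then show ?case by (simp add: mult.commute)
  next
    case (Suc n) show ?case unfolding form.simps cnj_sum by (intro sum.cong refl Suc.IH)
  qed
  have "norm (form n (\<lambda>v. l (X v)) l' + form n l (\<lambda>v. l' (X v))) \<le> c * (sqrt (nrm n l) * sqrt (nrm n l'))"
    if "clinear l" "clinear l'" for n l l'
    using that
  proof (induction n arbitrary: l l')
    case 0
    have "norm (form 0 l (\<lambda>v. l' (X v))) \<le> c / 2 * (sqrt (nrm 0 l') * sqrt (nrm 0 l))"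
      using half[OF 0(2), of l] cnj_form[of 0 l] by (metis complex_mod_cnj)
    then show ?case
      using half[OF 0(1), of l'] norm_triangle_ineq[of "form 0 (\<lambda>v. l (X v)) l'" "form 0 l (\<lambda>v. l' (X v))"]
      by (simp add: mult.commute del: form.simps)
  next
    case (Suc n)
    note l = clinear_simps[OF Suc.prems(1)] and l' = clinear_simps[OF Suc.prems(2)]
    let ?l = "\<lambda>j v. l (ops j v)" and ?l' = "\<lambda>j v. l' (ops j v)"
    have eq1: "form n (\<lambda>v. l (X (ops j v))) (?l' j) =
        form n (\<lambda>v. ?l j (X v)) (?l' j) + (\<Sum>i\<in>J. complex_of_real (m j i) * form n (?l i) (?l' j))" if "j \<in> J" for j
    proof -
      have "(\<lambda>v. l (X (ops j v))) = (\<lambda>v. ?l j (X v) + (\<Sum>i\<in>J. complex_of_real (m j i) * ?l i v))"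
        by (rule ext) (simp add: comm[OF that] l scaleC_complex_def)
      then show ?thesis by (simp only: form_add form_sum form_scale)
    qed
    have eq2: "form n (?l j) (\<lambda>v. l' (X (ops j v))) =
        form n (?l j) (\<lambda>v. ?l' j (X v)) + (\<Sum>i\<in>J. complex_of_real (m j i) * form n (?l j) (?l' i))" if "j \<in> J" for j
    proof -
      have "(\<lambda>v. l' (X (ops j v))) = (\<lambda>v. ?l' j (X v) + (\<Sum>i\<in>J. complex_of_real (m j i) * ?l' i v))"
        by (rule ext) (simp add: comm[OF that] l' scaleC_complex_def)
      then show ?thesis by (simp only: form_add form_sum form_scale complex_cnj_complex_of_real)
    qed
    have "(\<Sum>j\<in>J. \<Sum>i\<in>J. complex_of_real (m j i) * form n (?l i) (?l' j)) =
      (\<Sum>j\<in>J. \<Sum>i\<in>J. complex_of_real (m i j) * form n (?l j) (?l' i))" by (rule sum.swap)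
    also have "\<dots> = - (\<Sum>j\<in>J. \<Sum>i\<in>J. complex_of_real (m j i) * form n (?l j) (?l' i))"
      unfolding sum_negf[symmetric] by (intro sum.cong refl) (subst skew, simp_all)
    finally have cancel: "(\<Sum>j\<in>J. \<Sum>i\<in>J. complex_of_real (m j i) * form n (?l i) (?l' j)) =
      - (\<Sum>j\<in>J. \<Sum>i\<in>J. complex_of_real (m j i) * form n (?l j) (?l' i))" .
    have "form (Suc n) (\<lambda>v. l (X v)) l' + form (Suc n) l (\<lambda>v. l' (X v)) =
        (\<Sum>j\<in>J. form n (\<lambda>v. ?l j (X v)) (?l' j) + form n (?l j) (\<lambda>v. ?l' j (X v)))"
      using cancel by (simp add: eq1 eq2 sum.distrib)
    also have "norm \<dots> \<le> (\<Sum>j\<in>J. c * (sqrt (nrm n (?l j)) * sqrt (nrm n (?l' j))))"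
      by (intro order.trans[OF norm_sum sum_mono] Suc.IH clinear_compose[OF _ clin_ops] Suc.prems)
    also have "\<dots> = c * (\<Sum>j\<in>J. \<bar>sqrt (nrm n (?l j))\<bar> * \<bar>sqrt (nrm n (?l' j))\<bar>)"
      by (simp add: sum_distrib_left nrm_nonneg)
    also have "\<dots> \<le> c * (L2_set (\<lambda>j. sqrt (nrm n (?l j))) J * L2_set (\<lambda>j. sqrt (nrm n (?l' j))) J)"
      by (intro mult_left_mono L2_set_mult_ineq c0)
    also have "L2_set (\<lambda>j. sqrt (nrm n (?l j))) J = sqrt (nrm (Suc n) l)"
      by (simp add: L2_set_def nrm_nonneg nrm_Suc)
    also have "L2_set (\<lambda>j. sqrt (nrm n (?l' j))) J = sqrt (nrm (Suc n) l')"
      by (simp add: L2_set_def nrm_nonneg nrm_Suc)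
    finally show ?case .
  qed
  then show ?thesis using that c0 by blast
qed

text \<open>If the operator were not onto \<open>V n\<close>, a functional vanishing on its image
  would be an eigenvector of the transposed sum of squares with eigenvalue \<open>a\<close>. As each
  \<open>X x\<close> is skew-Hermitian up to \<open>c x\<close>, minus its square is bounded below
  by -(c x)^2, so \<open>a\<close> could not be that small. In finite dimension, onto implies
  injective.\<close>

lemma squares_injective:
  assumes fin: "finite S" and X: "\<And>x. x \<in> S \<Longrightarrow> clinear (X x)"
    and stable: "\<And>x n v. x \<in> S \<Longrightarrow> v \<in> V n \<Longrightarrow> X x v \<in> V n"
    and c: "\<And>x. x \<in> S \<Longrightarrow> c x \<ge> 0"
    and bound: "\<And>x n l l'. x \<in> S \<Longrightarrow> clinear l \<Longrightarrow> clinear l' \<Longrightarrow>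
      norm (form n (\<lambda>v. l (X x v)) l' + form n l (\<lambda>v. l' (X x v))) \<le> c x * (sqrt (nrm n l) * sqrt (nrm n l'))"
    and a: "Re a < - (\<Sum>x\<in>S. (c x)\<^sup>2)"
    and v: "v \<in> V n" "- (\<Sum>x\<in>S. X x (X x v)) - a *\<^sub>C v = 0"
  shows "v = 0"
proof -
  let ?R = "\<lambda>v. - (\<Sum>x\<in>S. X x (X x v)) - a *\<^sub>C v"
  have lin: "clinear ?R"
  proof -
    have "clinear (\<lambda>v. (- 1) *\<^sub>C (\<Sum>x\<in>S. X x (X x v)) - a *\<^sub>C v)"
      by (intro clinear_minus' clinear_scaleC clinear_setsum clinear_compose[OF X X] clinear_ident)
    then show ?thesis by (simp add: complex_vector.scale_minus_left scaleC_one)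
  qed
  have RV: "?R v \<in> V n" if "v \<in> V n" for v
    using that stable
    by (intro csub_simps(4)[OF subV] csub_simps(5)[OF subV] csub_simps(6)[OF subV] csub_simps(3)[OF subV]) auto
  have surj: "?R ` V n = V n"
  proof (rule ccontr)
    assume "?R ` V n \<noteq> V n"
    then obtain v0 where v0: "v0 \<in> V n" "v0 \<notin> ?R ` V n" using RV by blast
    define I where "I = ?R ` V n"
    have "csubspace I" "v0 \<notin> I"
      unfolding I_def by (rule csubspace_image[OF lin subV] v0(2))+
    from separating_functional[OF this] obtain l :: "'v \<Rightarrow> complex"
      where l: "clinear l" "l v0 = 1" "\<And>w. w \<in> I \<Longrightarrow> l w = 0" by metis
    let ?XX = "\<lambda>x v. l (X x (X x v))"
    have eig: "- (\<Sum>x\<in>S. ?XX x v) = a * l v" if "v \<in> V n" for v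
    proof -
      have "l (?R v) = 0" using l(3) that by (simp add: I_def)
      then show ?thesis by (simp add: clinear_simps[OF l(1)] scaleC_complex_def)
    qed
    have "a * form n l l = form n (\<lambda>v. (- 1) * (\<Sum>x\<in>S. ?XX x v)) l"
      unfolding form_scale(1)[symmetric] by (rule form_cong) (simp add: eig)
    then have aN: "a * form n l l = - (\<Sum>x\<in>S. form n (?XX x) l)"
      by (simp only: form_scale form_sum) simp
    define b where "b = sqrt (nrm n l)"
    have b0: "b \<ge> 0" "b * b = nrm n l" by (simp_all add: b_def nrm_nonneg)
    have ge: "- Re (form n (?XX x) l) \<ge> - (c x)\<^sup>2 * (b * b)" if x: "x \<in> S" for x
    proof -
      let ?Xl = "\<lambda>v. l (X x v)"
      define d where "d = sqrt (nrm n ?Xl)"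
      have d: "d \<ge> 0" "d * d = nrm n ?Xl" by (simp_all add: d_def nrm_nonneg)
      have "norm (form n (?XX x) l + form n ?Xl ?Xl) \<le> c x * (d * b)"
        using bound[OF x clinear_compose[OF l(1) X[OF x]] l(1), of n] by (simp add: d_def b_def)
      then have "Re (form n (?XX x) l + form n ?Xl ?Xl) \<le> c x * (d * b)"
        using complex_Re_le_cmod order.trans by blast
      then have "Re (form n (?XX x) l) \<le> c x * (d * b) - d * d"
        using d(2) by (simp add: nrm_def)
      \<comment> \<open>Completing the square.\<close>
      also have "c x * (d * b) - d * d \<le> (c x)\<^sup>2 * (b * b)"
      proof -
        have "0 \<le> (d - c x * b / 2)\<^sup>2 + (3 / 4) * (c x * b)\<^sup>2" by simp
        then show ?thesis by (simp add: power2_eq_square algebra_simps)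
      qed
      finally show ?thesis by simp
    qed
    have "Re a * (b * b) = Re (a * form n l l)" by (simp add: form_real b0(2))
    also have "\<dots> = (\<Sum>x\<in>S. - Re (form n (?XX x) l))" by (simp add: aN sum_negf)
    also have "\<dots> \<ge> (\<Sum>x\<in>S. - (c x)\<^sup>2 * (b * b))" by (intro sum_mono ge)
    also have "(\<Sum>x\<in>S. - (c x)\<^sup>2 * (b * b)) = - (\<Sum>x\<in>S. (c x)\<^sup>2) * (b * b)"
      by (simp add: sum_distrib_right sum_negf)
    finally have "Re a * (b * b) \<ge> - (\<Sum>x\<in>S. (c x)\<^sup>2) * (b * b)" .
    moreover have "b * b > 0"
    proof -
      have "nrm n l \<noteq> 0" using nrm_zero[OF l(1) _ v0(1)] l(2) by auto
      then show ?thesis using b0(2) nrm_nonneg[of n l] by simp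
    qed
    ultimately show False using mult_strict_right_mono[OF a] by (meson not_less)
  qed
  show ?thesis by (rule cfinite_dim_surj_imp_inj[of "V n" ?R, OF fdV subV lin surj v])
qed

end

section \<open>Weight gradings and a criterion for finite length\<close>

section \<open>Graded decompositions\<close>

lemma span_union_sum:
  assumes H: "\<And>n :: nat. csubspace (H n)" and t: "t \<in> cspan (\<Union>n. H n)"
  obtains N h where "\<And>n. h n \<in> H n" "t = (\<Sum>n\<le>N. h n)"
proof -
  let ?S = "{t. \<exists>N h. (\<forall>n. h n \<in> H n) \<and> (\<forall>n>N. h n = 0) \<and> t = (\<Sum>n\<le>N. h n)}"
  have ext: "\<exists>h. (\<forall>n. h n \<in> H n) \<and> (\<forall>n>M. h n = 0) \<and> t = (\<Sum>n\<le>M. h n)"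
    if "N \<le> M" "\<forall>n. h n \<in> H n" "\<forall>n>N. h n = 0" "t = (\<Sum>n\<le>N. h n)" for N M h t
  proof -
    have "(\<Sum>n\<le>N. h n) = (\<Sum>n\<le>M. h n)"
      using that by (intro sum.mono_neutral_left) auto
    then show ?thesis using that by (intro exI[of _ h]) auto
  qed
  have "csubspace ?S"
  proof (rule csubspaceI)
    show "0 \<in> ?S" using csub_simps(1)[OF H] by (auto intro!: exI[of _ 0] exI[of _ "\<lambda>n. 0"])
  next
    fix s t assume "s \<in> ?S" "t \<in> ?S"
    then obtain N h N' h' where *: "\<forall>n. h n \<in> H n" "\<forall>n>N. h n = 0" "s = (\<Sum>n\<le>N. h n)"
      "\<forall>n. h' n \<in> H n" "\<forall>n>N'. h' n = 0" "t = (\<Sum>n\<le>N'. h' n)" by blast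
    let ?M = "max N N'"
    obtain g where g: "\<forall>n. g n \<in> H n" "\<forall>n>?M. g n = 0" "s = (\<Sum>n\<le>?M. g n)"
      using ext[OF _ *(1-3), of ?M] by auto
    obtain g' where g': "\<forall>n. g' n \<in> H n" "\<forall>n>?M. g' n = 0" "t = (\<Sum>n\<le>?M. g' n)"
      using ext[OF _ *(4-6), of ?M] by auto
    have "s + t = (\<Sum>n\<le>?M. g n + g' n)" unfolding g(3) g'(3) by (simp add: sum.distrib)
    moreover have "\<forall>n. g n + g' n \<in> H n" "\<forall>n>?M. g n + g' n = 0"
      using g g' csub_simps(2)[OF H] by auto
    ultimately show "s + t \<in> ?S" by (intro CollectI exI[of _ ?M] exI[of _ "\<lambda>n. g n + g' n"] conjI)
  next
    fix a t assume "t \<in> ?S"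
    then obtain N h where *: "\<forall>n. h n \<in> H n" "\<forall>n>N. h n = 0" "t = (\<Sum>n\<le>N. h n)" by blast
    have "a *\<^sub>C t = (\<Sum>n\<le>N. a *\<^sub>C h n)" unfolding *(3) by (simp add: complex_vector.scale_sum_right)
    moreover have "\<forall>n. a *\<^sub>C h n \<in> H n" "\<forall>n>N. a *\<^sub>C h n = 0"
      using * csub_simps(3)[OF H] by (auto simp: complex_vector.scale_zero_right)
    ultimately show "a *\<^sub>C t \<in> ?S" by (intro CollectI exI[of _ N] exI[of _ "\<lambda>n. a *\<^sub>C h n"] conjI)
  qed
  moreover have "(\<Union>n. H n) \<subseteq> ?S"
  proof
    fix s assume "s \<in> (\<Union>n. H n)"
    then obtain n where n: "s \<in> H n" by blast
    have "s = (\<Sum>i\<le>n. if i = n then s else 0)" by simp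
    moreover have "\<forall>i. (if i = n then s else 0) \<in> H i" using n csub_simps(1)[OF H] by auto
    ultimately show "s \<in> ?S" by (intro CollectI exI[of _ n] exI[of _ "\<lambda>i. if i = n then s else 0"]) auto
  qed
  ultimately have "t \<in> ?S" using complex_vector.span_minimal t by blast
  then show ?thesis using that by blast
qed

context equivariant_rep
begin

text \<open>Applying \<pi> z minus the last eigenvalue removes the last component and multiplies the
  others by non-zero numbers.\<close>

lemma weight_components:
  fixes h :: "nat \<Rightarrow> 'v"
  assumes Y: "csubspace Y" "\<And>v. v \<in> Y \<Longrightarrow> \<pi> z v \<in> Y" and b: "inj b"
    and h: "\<And>n. h n \<in> weight z (b n)"
  shows "(\<Sum>n\<le>N. h n) \<in> Y \<Longrightarrow> n \<le> N \<Longrightarrow> h n \<in> Y"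
  using h
proof (induction N arbitrary: h n rule: nat.induct)
  case zero
  then show ?case by simp
next
  case (Suc N)
  let ?s = "\<Sum>n\<le>Suc N. h n"
  let ?g = "\<lambda>n. (b n - b (Suc N)) *\<^sub>C h n"
  have wt: "\<pi> z (h n) = b n *\<^sub>C h n" for n using Suc.prems(3) by (simp add: weight_def)
  have "\<pi> z ?s - b (Suc N) *\<^sub>C ?s \<in> Y"
    using Y Suc.prems(1) by (intro csub_simps(4,3)) auto
  also have "\<pi> z ?s - b (Suc N) *\<^sub>C ?s = (\<Sum>n\<le>N. ?g n)"
    by (simp add: \<pi>_simps wt complex_vector.scale_sum_right complex_vector.scale_left_diff_distrib
        sum_subtractf scaleC_add_right)
  finally have g: "(\<Sum>n\<le>N. ?g n) \<in> Y" .
  have low: "h n \<in> Y" if "n \<le> N" for n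
  proof -
    have "?g n \<in> Y"
      using Suc.IH[of ?g n, OF g that] csub_simps(3)[OF csub_weight] Suc.prems(3) by blast
    then have "inverse (b n - b (Suc N)) *\<^sub>C ?g n \<in> Y" by (rule csub_simps(3)[OF Y(1)])
    moreover have "b n - b (Suc N) \<noteq> 0" using b that by (auto simp: inj_eq)
    ultimately show ?thesis by (simp add: scaleC_scaleC scaleC_one)
  qed
  show ?case
  proof (cases "n = Suc N")
    case True
    have "?s - (\<Sum>n\<le>N. h n) \<in> Y"
      by (rule csub_simps(4)[OF Y(1) Suc.prems(1) csub_simps(6)[OF Y(1)]]) (use low in auto)
    then show ?thesis using True by simp
  next
    case False then show ?thesis using low Suc.prems(2) by simp
  qed
qed

lemma weight_eq_of_span:
  assumes H: "\<And>n :: nat. csubspace (H n)" "\<And>n. H n \<subseteq> weight z (b n)" and span: "cspan (\<Union>n. H n) = UNIV" and b: "inj b"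
  shows "weight z (b n) = H n"
proof
  show "weight z (b n) \<subseteq> H n"
  proof
    fix t assume t: "t \<in> weight z (b n)"
    have "t \<in> cspan (\<Union>n. H n)" using span by simp
    from span_union_sum[OF H(1) this]
    obtain N h where h: "\<And>n. h n \<in> H n" "t = (\<Sum>n\<le>N. h n)" by metis
    let ?g = "\<lambda>m. (if m \<le> N then h m else 0) - (if m = n then t else 0)"
    have z: "csubspace {0 :: 'v}" "\<pi> z v \<in> {0}" if "v \<in> {0}" for v
      by (auto intro!: csubspaceI simp: complex_vector.scale_zero_right) (use that in \<open>simp add: \<pi>_simps\<close>)
    have gw: "?g m \<in> weight z (b m)" for m
      using h(1)[of m] H(2)[of m] t csub_simps(1,4,5)[OF csub_weight] by auto
    have "(\<Sum>m\<le>max N n. if m \<le> N then h m else 0) = (\<Sum>m\<le>N. h m)"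
      by (intro sum.mono_neutral_cong_right) auto
    then have "(\<Sum>m\<le>max N n. ?g m) \<in> {0}" by (simp add: sum_subtractf h(2)[symmetric])
    from weight_components[OF _ _ b gw this, of n] have "?g n \<in> {0}"
      using z(2) by (auto intro!: csubspaceI simp: complex_vector.scale_zero_right \<pi>_simps)
    then have "t = (if n \<le> N then h n else 0)" by simp
    then show "t \<in> H n" using h(1) csub_simps(1)[OF H(1)] by auto
  qed
qed (rule H(2))

text \<open>Intersection with \<open>D\<close> is strictly monotone on the submodules of
  \<open>Y\<close>, so the dimension of \<open>D\<close> bounds the length of chains, and a longest
  chain from \<open>{0}\<close> to \<open>Y\<close> admits no insertion.\<close>

lemma finite_lengthI:
  assumes fd: "cfinite_dim D" "csubspace D" and Y: "submodule Y"
    and strict: "\<And>Z Z'. submodule Z \<Longrightarrow> submodule Z' \<Longrightarrow> Z \<subset> Z' \<Longrightarrow> Z' \<subseteq> Y \<Longrightarrow> \<not> Z' \<inter> D \<subseteq> Z"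
  shows "gK_finite_length K \<pi> \<rho> Y"
proof -
  define chain where "chain n Z \<longleftrightarrow> Z 0 = {0} \<and> Z n = Y \<and> (\<forall>i\<le>n. submodule (Z i)) \<and> (\<forall>i<n. Z i \<subset> Z (Suc i))" for n and Z :: "nat \<Rightarrow> 'v set"
  obtain d where d: "\<And>n. \<exists>Z :: nat \<Rightarrow> 'v set. (\<forall>i\<le>n. csubspace (Z i) \<and> Z i \<subseteq> D) \<and> (\<forall>i<n. Z i \<subset> Z (Suc i)) \<Longrightarrow> n \<le> d"
    using cfinite_dim_strict_chain_bound[OF fd(1)] by metis
  have chain_mono: "Z i \<subseteq> Y" if "chain n Z" "i \<le> n" for n Z i
  proof -
    have "Z (n - j) \<subseteq> Y" if "j \<le> n" for j
      using that
    proof (induction j)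
      case 0 then show ?case using \<open>chain n Z\<close> by (simp add: chain_def)
    next
      case (Suc j)
      then have "Z (n - Suc j) \<subset> Z (Suc (n - Suc j))" using \<open>chain n Z\<close> by (simp add: chain_def)
      moreover have "Suc (n - Suc j) = n - j" using Suc.prems by simp
      ultimately show ?case using Suc.IH Suc.prems by auto
    qed
    from this[of "n - i"] show ?thesis using that(2) by simp
  qed
  have bound: "n \<le> d" if c: "chain n Z" for n Z
  proof (rule d, intro exI[of _ "\<lambda>i. Z i \<inter> D"] conjI allI impI)
    fix i assume "i \<le> n"
    then have "csubspace (Z i)" using c submoduleD(1) by (simp add: chain_def)
    then show "csubspace (Z i \<inter> D)" "Z i \<inter> D \<subseteq> D"
      using fd(2) complex_vector.subspace_inter by auto
  next
    fix i assume i: "i < n"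
    then have "\<not> Z (Suc i) \<inter> D \<subseteq> Z i"
      using strict[of "Z i" "Z (Suc i)"] c chain_mono[OF c, of "Suc i"] by (auto simp: chain_def)
    moreover have "Z i \<subseteq> Z (Suc i)" using c i by (auto simp: chain_def)
    ultimately show "Z i \<inter> D \<subset> Z (Suc i) \<inter> D" by blast
  qed
  have "\<exists>n Z. chain n Z"
  proof (cases "Y = {0}")
    case True
    then have "chain 0 (\<lambda>i. {0})" using submodule_zero by (simp add: chain_def)
    then show ?thesis by blast
  next
    case False
    then have "{0} \<subset> Y" using csub_simps(1)[OF submoduleD(1)[OF Y]] by blast
    then have "chain 1 (\<lambda>i. if i = 0 then {0} else Y)"
      using submodule_zero Y by (auto simp: chain_def)
    then show ?thesis by blast
  qed
  then obtain n0 where "\<exists>Z. chain n0 Z" by blast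
  then obtain n where n: "\<exists>Z. chain n Z" "\<And>m. \<exists>Z. chain m Z \<Longrightarrow> m \<le> n"
    using ex_has_greatest_nat[of "\<lambda>n. \<exists>Z. chain n Z" n0 "\<lambda>n. n" "Suc d"] bound by (metis le_imp_less_Suc)
  then obtain Z where Z: "chain n Z" by blast
  have "\<nexists>W. submodule W \<and> Z i \<subset> W \<and> W \<subset> Z (Suc i)" if i: "i < n" for i
  proof
    assume "\<exists>W. submodule W \<and> Z i \<subset> W \<and> W \<subset> Z (Suc i)"
    then obtain W where W: "submodule W" "Z i \<subset> W" "W \<subset> Z (Suc i)" by blast
    define Z' where "Z' j = (if j \<le> i then Z j else if j = Suc i then W else Z (j - 1))" for j
    have sm: "submodule (Z j)" if "j \<le> n" for j using Z that by (simp add: chain_def)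
    have "chain (Suc n) Z'"
      unfolding chain_def
    proof (intro conjI allI impI)
      show "Z' 0 = {0}" "Z' (Suc n) = Y" using Z i by (auto simp: Z'_def chain_def)
      show "submodule (Z' j)" if "j \<le> Suc n" for j unfolding Z'_def using that i by (auto intro: sm W(1))
      fix j assume j: "j < Suc n"
      consider "j < i" | "j = i" | "j = Suc i" | "Suc i < j" by linarith
      then show "Z' j \<subset> Z' (Suc j)"
      proof cases
        case 4
        then obtain m where "j = Suc m" by (cases j) auto
        then show ?thesis using 4 Z j by (auto simp: Z'_def chain_def)
      qed (use Z W(2,3) i in \<open>auto simp: Z'_def chain_def\<close>)
    qed
    then show False using n(2)[of "Suc n"] by auto
  qed
  note maximal = this
  show ?thesis
    unfolding gK_finite_length_def
  proof (intro exI[of _ n] exI[of _ Z] conjI allI impI)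
    show "Z 0 = {0}" "Z n = Y" using Z by (simp_all add: chain_def)
    show "submodule (Z i)" if "i \<le> n" for i using Z that by (simp add: chain_def)
    show "Z i \<subset> Z (Suc i)" if "i < n" for i using Z that by (simp add: chain_def)
  qed (rule maximal)
qed

end

section \<open>Generation of an irreducible module from its null vectors\<close>

context cartan
begin

lemma pz_kC:
  assumes z: "complex_structure z" and w: "w \<in> kC" and u: "u \<in> pz z"
  shows "complexify_bracket br w u \<in> pz z"
proof -
  obtain x where x: "x \<in> p" "u = Complexify x (- br z x)" using u by (auto simp: pz_def)
  have wk: "real_part w \<in> k" "imag_part w \<in> k" using w by (auto simp: kC_def complexify_set_def)
  have zc: "z \<in> center_k" and zz: "br z (br z x) = - x" using z x(1) by (auto simp: complex_structure_def)
  let ?x = "br (real_part w) x + br (imag_part w) (br z x)"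
  have "?x \<in> p"
    using br_kp[OF wk(1) x(1)] br_kp[OF wk(2) br_kp[OF center_kD(1)[OF zc] x(1)]] sub_p by (rule subspace_add[rotated])
  moreover have "complexify_bracket br w u = Complexify ?x (- br z ?x)"
    by (simp add: complexify_bracket_def x(2) br_simps center_kD(3)[OF wk(1) zc] center_kD(3)[OF wk(2) zc] zz)
  ultimately show ?thesis by (auto simp: pz_def)
qed

lemma pz_pC: "complex_structure z \<Longrightarrow> u \<in> pz z \<Longrightarrow> u \<in> pC"
  using br_kp[OF center_kD(1)] subspace_neg[OF sub_p]
  by (auto simp: pz_def pC_def complexify_set_def complex_structure_def)

lemma brC_pC: "u \<in> pC \<Longrightarrow> v \<in> pC \<Longrightarrow> complexify_bracket br u v \<in> kC"
  using br_pp subspace_add[OF sub_k] subspace_diff[OF sub_k]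
  by (simp add: kC_def pC_def complexify_set_def complexify_bracket_def)

end

context gK_irr
begin

lemma Adj_p: "g \<in> K \<Longrightarrow> x \<in> p \<Longrightarrow> Adj g x \<in> p"
proof -
  assume g: "g \<in> K" and x: "x \<in> p"
  obtain a b where ab: "a \<in> k" "b \<in> p" "Adj g x = a + b" by (rule kp_decomp)
  have "B a y = 0" if y: "y \<in> k" for y
  proof -
    have "B (Adj g x) y = B x (Adj (- g) y)"
      using B_Adj[OF g, of x "Adj (- g) y"] by (simp add: Adj_inverse[OF g])
    also have "\<dots> = 0" by (rule B_kp(2)[OF Adj_k[OF K_minus[OF g] y] x])
    finally show ?thesis using B_kp(2)[OF y ab(2)] by (simp add: ab(3) B_simps)
  qed
  then have "a = 0" by (rule B_nondeg_k[OF ab(1)])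
  then show ?thesis using ab by simp
qed

definition AdjC :: "'g \<Rightarrow> 'l complexification \<Rightarrow> 'l complexification"
  where "AdjC g u = Complexify (Adj g (real_part u)) (Adj g (imag_part u))"

lemma AdjC_pz: "complex_structure z \<Longrightarrow> g \<in> K \<Longrightarrow> u \<in> pz z \<Longrightarrow> AdjC g u \<in> pz z"
proof -
  assume z: "complex_structure z" and g: "g \<in> K" and "u \<in> pz z"
  then obtain x where x: "x \<in> p" "u = Complexify x (- br z x)" by (auto simp: pz_def)
  have "Adj g (- br z x) = - br z (Adj g x)"
    by (simp add: linear_neg[OF linear_Adj[OF g]] Adj_br[OF g] Adj_center[OF z g])
  then show ?thesis using Adj_p[OF g x(1)] x by (auto simp: AdjC_def pz_def)
qed

lemma \<rho>_act: "g \<in> K \<Longrightarrow> \<rho> g (act u v) = act (AdjC g u) (\<rho> g v)"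
  by (simp add: complexify_rep_def AdjC_def clinear_simps[OF clin_\<rho>] equiv)

lemma AdjC_inverse: "g \<in> K \<Longrightarrow> AdjC g (AdjC (- g) u) = u"
  by (simp add: AdjC_def Adj_inverse)

text \<open>By the Poincare-Birkhoff-Witt argument for \<open>p\<^sub>- + k + p\<^sub>+\<close>, an irreducible module is generated
  from its vectors annihilated by \<open>p\<^sub>+\<close> by applying \<open>p\<^sub>-\<close>.\<close>

lemma null_vector_span:
  assumes z: "complex_structure z" and v: "v0 \<noteq> 0" "\<And>u. u \<in> pz z \<Longrightarrow> act u v0 = 0"
  obtains W a where "csubspace W" "cfinite_dim W" "\<And>g w. g \<in> K \<Longrightarrow> w \<in> W \<Longrightarrow> \<rho> g w \<in> W"
    "cspan (\<Union>n. weight z (a - \<i> * of_nat n) \<inter> filtered_module.F act W n) = UNIV"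
proof -
  have zk: "z \<in> k" using z by (simp add: complex_structure_def center_k_def)
  define N where "N = {v. \<forall>u\<in>pz z. act u v = 0}"
  have subN: "csubspace N"
    unfolding N_def by (rule csubspaceI) (auto simp: clinear_simps[OF clinear_act] complex_vector.scale_zero_right)
  have N\<rho>: "\<rho> g v \<in> N" if g: "g \<in> K" and v: "v \<in> N" for g v
  proof -
    have "act u (\<rho> g v) = 0" if u: "u \<in> pz z" for u
    proof -
      have "act u (\<rho> g v) = \<rho> g (act (AdjC (- g) u) v)" by (simp add: \<rho>_act[OF g] AdjC_inverse[OF g])
      also have "act (AdjC (- g) u) v = 0" using v AdjC_pz[OF z K_minus[OF g] u] by (simp add: N_def)
      finally show ?thesis by (simp add: clinear_simps[OF clin_\<rho>[OF g]])
    qed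
    then show ?thesis by (simp add: N_def)
  qed
  obtain W0 where W0: "csubspace W0" "cfinite_dim W0" "v0 \<in> W0" "\<And>g w. g \<in> K \<Longrightarrow> w \<in> W0 \<Longrightarrow> \<rho> g w \<in> W0"
    using locally_finite[of v0] by blast
  let ?W1 = "W0 \<inter> N"
  have W1: "csubspace ?W1" "cfinite_dim ?W1" "\<And>g w. g \<in> K \<Longrightarrow> w \<in> ?W1 \<Longrightarrow> \<rho> g w \<in> ?W1" "?W1 \<noteq> {0}"
  proof -
    show 1: "csubspace ?W1" by (rule complex_vector.subspace_inter[OF W0(1) subN])
    show "cfinite_dim ?W1" by (rule cfinite_dim_subset[OF W0(2) 1]) blast
    show "\<rho> g w \<in> ?W1" if "g \<in> K" "w \<in> ?W1" for g w using that W0(4) N\<rho> by blast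
    show "?W1 \<noteq> {0}" using v W0(3) by (auto simp: N_def)
  qed
  have "\<pi> z ` ?W1 \<subseteq> ?W1" using k_stable[OF W1(1,3) zk] by blast
  from eigenvector_exists[OF clin_\<pi> W1(1,4) this W1(2)]
  obtain a w0 where w0: "w0 \<in> ?W1" "w0 \<noteq> 0" "\<pi> z w0 = a *\<^sub>C w0" .
  define W where "W = ?W1 \<inter> weight z a"
  have W: "csubspace W" "cfinite_dim W" "\<And>g w. g \<in> K \<Longrightarrow> w \<in> W \<Longrightarrow> \<rho> g w \<in> W" "w0 \<in> W" "W \<subseteq> weight z a" "W \<subseteq> N"
  proof -
    show 1: "csubspace W" unfolding W_def by (rule complex_vector.subspace_inter[OF W1(1) csub_weight])
    show "cfinite_dim W" by (rule cfinite_dim_subset[OF W1(2) 1]) (auto simp: W_def)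
    show "\<rho> g w \<in> W" if "g \<in> K" "w \<in> W" for g w
      using that W1(3) weight_\<rho>[OF z] unfolding W_def by blast
    show "w0 \<in> W" "W \<subseteq> weight z a" "W \<subseteq> N" using w0 by (auto simp: W_def weight_def)
  qed
  have ks: "\<pi> x w \<in> W" if "x \<in> k" "w \<in> W" for x w using k_stable[OF W(1,3) that] .
  interpret fm: filtered_module brC kC act W by (rule filtered_moduleI[OF W(1,2) ks])
  \<comment> \<open>\<open>L n\<close> is the result of applying p_- exactly n times to
    \<open>W\<close>; it has weight a - \<i> n and lies in \<open>F n\<close>.\<close>
  define L where "L = rec_nat W (\<lambda>n S. cspan {act u v | u v. u \<in> pz (- z) \<and> v \<in> S})"
  have L0: "L 0 = W" and LS: "L (Suc n) = cspan {act u v | u v. u \<in> pz (- z) \<and> v \<in> L n}" for n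
    by (simp_all add: L_def)
  have subL: "csubspace (L n)" for n using W(1) by (cases n) (auto simp: L0 LS)
  have LI: "act u v \<in> L (Suc n)" if "u \<in> pz (- z)" "v \<in> L n" for u v n
    unfolding LS using that by (intro complex_vector.span_base) blast
  have ind: "f v \<in> S" if "clinear f" "csubspace S" "\<And>u v. u \<in> pz (- z) \<Longrightarrow> v \<in> L n \<Longrightarrow> f (act u v) \<in> S"
    "v \<in> L (Suc n)" for f :: "'v \<Rightarrow> 'v" and S n v
  proof -
    have "f ` L (Suc n) \<subseteq> S" unfolding LS by (rule clinear_span_subset[OF that(1,2)]) (use that(3) in blast)
    then show ?thesis using that(4) by blast
  qed
  note z' = complex_structure_minus[OF z]
  have Lweight: "L n \<subseteq> weight z (a - \<i> * of_nat n)" for n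
  proof (induction n)
    case 0 then show ?case using W(5) by (simp add: L0)
  next
    case (Suc n)
    have "act u v \<in> weight z (a - \<i> * of_nat (Suc n))" if u: "u \<in> pz (- z)" and v: "v \<in> L n" for u v
    proof -
      have "brC (Complexify (- z) 0) u = \<i> *\<^sub>C u" by (rule pz_bracket[OF z' u])
      then have "brC (Complexify z 0) u = (- \<i>) *\<^sub>C u"
        by (simp add: complexify_bracket_def complexification_simps br_simps minus_equation_iff)
      from weight_act[OF this subsetD[OF Suc v]] show ?thesis by (simp add: algebra_simps)
    qed
    from ind[OF clinear_ident csub_weight this] show ?case by blast
  qed
  have LF: "L n \<subseteq> fm.F n" for n
  proof (induction n)
    case 0 then show ?case by (simp add: L0)
  next
    case (Suc n)
    then have "act u v \<in> fm.F (Suc n)" if "v \<in> L n" for u v using fm.act_F that by blast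
    from ind[OF clinear_ident fm.subF this] show ?case by blast
  qed
  have Lk: "act w v \<in> L n" if w: "w \<in> kC" and v: "v \<in> L n" for w v n
    using v
  proof (induction n arbitrary: v)
    case 0 then show ?case using fm.ksW[OF w] by (simp add: L0)
  next
    case (Suc n)
    have "act w (act u v) \<in> L (Suc n)" if u: "u \<in> pz (- z)" and v: "v \<in> L n" for u v
    proof -
      have "act u (act w v) + act (brC w u) v \<in> L (Suc n)"
        by (rule csub_simps(2)[OF subL LI[OF u Suc.IH[OF v]] LI[OF pz_kC[OF z' w u] v]])
      then show ?thesis by (simp add: act_brC)
    qed
    from ind[OF clinear_act subL this Suc.prems] show ?case by blast
  qed
  have L\<rho>: "\<rho> g v \<in> L n" if g: "g \<in> K" and v: "v \<in> L n" for g v n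
    using v
  proof (induction n arbitrary: v)
    case 0 then show ?case using W(3)[OF g] by (simp add: L0)
  next
    case (Suc n)
    have "\<rho> g (act u v) \<in> L (Suc n)" if u: "u \<in> pz (- z)" and v: "v \<in> L n" for u v
      unfolding \<rho>_act[OF g] by (rule LI[OF AdjC_pz[OF z' g u] Suc.IH[OF v]])
    from ind[OF clin_\<rho>[OF g] subL this Suc.prems] show ?case by blast
  qed
  define U where "U = cspan (\<Union>n. L n)"
  have subU: "csubspace U" by (simp add: U_def)
  have LU: "v \<in> U" if "v \<in> L n" for v n
    unfolding U_def using that by (intro complex_vector.span_base) blast
  have Uind: "f v \<in> U" if "clinear f" "\<And>n v. v \<in> L n \<Longrightarrow> f v \<in> U" "v \<in> U" for f :: "'v \<Rightarrow> 'v" and v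
  proof -
    have "f ` U \<subseteq> U" unfolding U_def by (rule clinear_span_subset[OF that(1) subU[unfolded U_def]]) (use that(2) in \<open>auto simp: U_def\<close>)
    then show ?thesis using that(3) by blast
  qed
  have Um: "act u v \<in> U" if u: "u \<in> pz (- z)" and v: "v \<in> U" for u v
    by (rule Uind[OF clinear_act _ v]) (rule LU[OF LI[OF u]])
  \<comment> \<open>Commuting an element of p_+ past one of p_- leaves an element of the
    complexified \<open>k\<close>, which preserves every \<open>L n\<close>; on \<open>W\<close>
    itself p_+ acts by zero.\<close>
  have Lp: "act u v \<in> U" if u: "u \<in> pz z" and v: "v \<in> L n" for u v n
    using v
  proof (induction n arbitrary: v)
    case 0
    then have "act u v = 0" using W(6) u by (auto simp: L0 N_def)
    then show ?case using csub_simps(1)[OF subU] by simp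
  next
    case (Suc n)
    have "act u (act u' v) \<in> U" if u': "u' \<in> pz (- z)" and v: "v \<in> L n" for u' v
    proof -
      have "brC u u' \<in> kC" by (rule brC_pC[OF pz_pC[OF z u] pz_pC[OF z' u']])
      then have "act u' (act u v) + act (brC u u') v \<in> U"
        by (intro csub_simps(2)[OF subU] Um[OF u' Suc.IH[OF v]] LU[OF Lk[OF _ v]])
      then show ?thesis by (simp add: act_brC)
    qed
    from ind[OF clinear_act subU this Suc.prems] show ?case by blast
  qed
  have "submodule U"
  proof (rule submoduleI[OF subU])
    fix x v assume v: "v \<in> U"
    obtain w u u' where d: "w \<in> kC" "u \<in> pz z" "u' \<in> pz (- z)" "Complexify x 0 = w + u + u'"
      by (rule weight_decomposition[OF z])
    have "act w v \<in> U" by (rule Uind[OF clinear_act _ v]) (rule LU[OF Lk[OF d(1)]])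
    moreover have "act u v \<in> U" by (rule Uind[OF clinear_act _ v]) (rule Lp[OF d(2)])
    moreover have "act u' v \<in> U" by (rule Um[OF d(3) v])
    ultimately have "act w v + act u v + act u' v \<in> U" using csub_simps(2)[OF subU] by blast
    then have "act (Complexify x 0) v \<in> U" by (simp add: d(4) clinear_simps[OF act_linear])
    then show "\<pi> x v \<in> U" by (simp only: act_real)
  next
    fix g v assume "g \<in> K" "v \<in> U"
    then show "\<rho> g v \<in> U" using Uind[OF clin_\<rho>] LU L\<rho> by blast
  qed
  moreover have "U \<noteq> {0}" using LU[of w0 0] W(4) w0(2) by (auto simp: L0)
  ultimately have "U = UNIV" by (rule irr_submodule)
  moreover have "U \<subseteq> cspan (\<Union>n. weight z (a - \<i> * of_nat n) \<inter> fm.F n)"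
    unfolding U_def by (rule complex_vector.span_mono) (use Lweight LF in blast)
  ultimately show ?thesis using that[OF W(1-3)] by blast
qed

end

section \<open>A spectral gap on the tensor product, uniform in the degree\<close>

context cartan
begin

lemma onb_k: "onb k E \<Longrightarrow> e \<in> E \<Longrightarrow> B e e = - 1"
proof -
  assume E: "onb k E" "e \<in> E"
  then have "e \<noteq> 0" using onbD(3)[OF E] by (auto simp: B_simps)
  then show ?thesis using onbD(3)[OF E] B_k_neg[OF onbD(6)[OF E]] by linarith
qed

lemma onb_p: "onb p E \<Longrightarrow> e \<in> E \<Longrightarrow> B e e = 1"
  using onbD(3)[of p E e] B_p_nonneg onbD(6)[of p E e] by force

end

context gK_pair
begin

text \<open>\<open>None\<close> is the identity, so that words of length n include the shorter ones;
  the flag selects the tensor factor acted upon.\<close>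

primrec letter :: "('l \<times> bool) option \<Rightarrow> ('v, 'w) tensor \<Rightarrow> ('v, 'w) tensor" where
  "letter None = (\<lambda>t. t)"
| "letter (Some j) = (if snd j then tensor_map (\<pi>\<^sub>1 (fst j)) (\<lambda>w. w) else tensor_map (\<lambda>v. v) (\<pi>\<^sub>2 (fst j)))"

lemma clinear_letter: "clinear (letter j)"
  by (cases j) (auto intro!: clinear_tensor_map X1.clin_\<pi> X2.clin_\<pi> clinear_ident)

lemma letter_pure: "letter (Some (b, True)) (v \<otimes> w) = \<pi>\<^sub>1 b v \<otimes> w" "letter (Some (b, False)) (v \<otimes> w) = v \<otimes> \<pi>\<^sub>2 b w"
  by (simp_all add: tensor_map_pure X1.clin_\<pi> X2.clin_\<pi> clinear_ident)

lemma letter_commute: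
  assumes E: "onb UNIV E"
  shows "\<pi>T x (letter (Some (b, s)) t) =
    letter (Some (b, s)) (\<pi>T x t) + (\<Sum>c\<in>E. complex_of_real (B c c * B (br x b) c) *\<^sub>C letter (Some (c, s)) t)"
proof (rule tensor_ext[of "\<lambda>t. \<pi>T x (letter (Some (b, s)) t)"])
  show "clinear (\<lambda>t. \<pi>T x (letter (Some (b, s)) t))" by (rule clinear_compose[OF clin_\<pi>T clinear_letter])
  show "clinear (\<lambda>t. letter (Some (b, s)) (\<pi>T x t) +
      (\<Sum>c\<in>E. complex_of_real (B c c * B (br x b) c) *\<^sub>C letter (Some (c, s)) t))"
    by (intro clinear_plus clinear_compose[OF clinear_letter clin_\<pi>T] clinear_setsum clinear_scaleC clinear_letter)
  fix v w
  note expand = onbD(5)[OF E, of "br x b", OF UNIV_I]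
  have 1: "\<pi>\<^sub>1 x (\<pi>\<^sub>1 b v) = \<pi>\<^sub>1 b (\<pi>\<^sub>1 x v) + (\<Sum>c\<in>E. complex_of_real (B c c * B (br x b) c) *\<^sub>C \<pi>\<^sub>1 c v)"
  proof -
    have "\<pi>\<^sub>1 (br x b) v = (\<Sum>c\<in>E. complex_of_real (B c c * B (br x b) c) *\<^sub>C \<pi>\<^sub>1 c v)"
      by (subst expand) (simp only: X1.\<pi>_sum X1.\<pi>_scale)
    then show ?thesis using X1.\<pi>_br[of x b v] by (simp add: algebra_simps)
  qed
  have 2: "\<pi>\<^sub>2 x (\<pi>\<^sub>2 b w) = \<pi>\<^sub>2 b (\<pi>\<^sub>2 x w) + (\<Sum>c\<in>E. complex_of_real (B c c * B (br x b) c) *\<^sub>C \<pi>\<^sub>2 c w)"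
  proof -
    have "\<pi>\<^sub>2 (br x b) w = (\<Sum>c\<in>E. complex_of_real (B c c * B (br x b) c) *\<^sub>C \<pi>\<^sub>2 c w)"
      by (subst expand) (simp only: X2.\<pi>_sum X2.\<pi>_scale)
    then show ?thesis using X2.\<pi>_br[of x b w] by (simp add: algebra_simps)
  qed
  note [simp del] = letter.simps(2)
  show "\<pi>T x (letter (Some (b, s)) (v \<otimes> w)) = letter (Some (b, s)) (\<pi>T x (v \<otimes> w)) +
      (\<Sum>c\<in>E. complex_of_real (B c c * B (br x b) c) *\<^sub>C letter (Some (c, s)) (v \<otimes> w))"
  proof (cases s)
    case True
    then show ?thesis
      by (simp add: letter_pure \<pi>T_pure clinear_simps[OF clinear_letter] 1 pure_simps add.assoc add.commute)
  next
    case False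
    then show ?thesis
      by (simp add: letter_pure \<pi>T_pure clinear_simps[OF clinear_letter] 2 pure_simps add.assoc)
  qed
qed

text \<open>\<open>ad x\<close> preserves \<open>k\<close> and \<open>p\<close> and is skew for
  \<open>B\<close>, whose sign is constant on each of the two. So its matrix in the basis is
  skew-symmetric although \<open>B\<close> is indefinite.\<close>

lemma structure_constants_skew:
  assumes E: "onb k Ek" "onb p Ep" and x: "x \<in> k" and bc: "b \<in> Ek \<union> Ep" "c \<in> Ek \<union> Ep"
  shows "B b b * B (br x c) b = - (B c c * B (br x b) c)"
proof -
  have skew: "B (br x c) b = - B (br x b) c" using B_skew[of x c b] B_sym[of c "br x b"] by simp
  have "(b \<in> Ek \<and> c \<in> Ek) \<or> (b \<in> Ep \<and> c \<in> Ep) \<or> B (br x b) c = 0"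
    using bc onbD(6)[OF E(1)] onbD(6)[OF E(2)] B_kp br_kk[OF x] br_kp[OF x] by blast
  then show ?thesis using skew by (auto simp: onb_k[OF E(1)] onb_p[OF E(2)])
qed

text \<open>The point is that \<kappa> does not depend on n. Words of length 2n in the letters,
  applied to \<open>tens W1 W2\<close>, span a space containing F n tensor F n, and the commutators
  of \<open>S\<close> with the letters form the skew matrices of the adjoint representation, so the
  bounds of \<open>words\<close> apply.\<close>

lemma spectral_gap:
  assumes W1: "csubspace W1" "cfinite_dim W1" "\<And>x w. x \<in> k \<Longrightarrow> w \<in> W1 \<Longrightarrow> \<pi>\<^sub>1 x w \<in> W1"
    and W2: "csubspace W2" "cfinite_dim W2" "\<And>x w. x \<in> k \<Longrightarrow> w \<in> W2 \<Longrightarrow> \<pi>\<^sub>2 x w \<in> W2"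
    and E: "onb k Ek" "onb p Ep" and S: "S \<subseteq> Ek"
  obtains \<kappa> where "\<And>n a t. Re a < \<kappa> \<Longrightarrow>
    t \<in> tens (filtered_module.F X1.act W1 n) (filtered_module.F X2.act W2 n) \<Longrightarrow>
    - (\<Sum>x\<in>S. \<pi>T x (\<pi>T x t)) - a *\<^sub>C t = 0 \<Longrightarrow> t = 0"
proof -
  interpret f1: filtered_module X1.brC kC X1.act W1 by (rule X1.filtered_moduleI[OF W1])
  interpret f2: filtered_module X2.brC kC X2.act W2 by (rule X2.filtered_moduleI[OF W2])
  define E where "E = Ek \<union> Ep"
  have E': "onb UNIV E" unfolding E_def by (rule onb_union(1)[OF E])
  have finE: "finite E" by (rule onbD(1)[OF E'])
  have finS: "finite S" using S onbD(1)[OF E(1)] finite_subset by blast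
  have Sk: "x \<in> k" if "x \<in> S" for x using that S onbD(2)[OF E(1)] by blast
  obtain B0 where B0: "finite B0" "B0 \<subseteq> tens W1 W2" "tens W1 W2 = cspan B0"
    using cfinite_dim_span[OF cfinite_dim_tens[OF W1(2) W2(2)] csub_tens] by metis
  define J where "J = insert None (Some ` (E \<times> (UNIV :: bool set)))"
  have finJ: "finite J" using finE by (simp add: J_def)
  interpret wd: words B0 J letter
    by (rule words.intro[OF B0(1) finJ clinear_letter])
  have letter_V: "letter j t \<in> wd.V (Suc n)" if "j \<in> J" "t \<in> wd.V n" for j t n
    using that by (auto intro!: complex_vector.span_base)
  have V_Suc: "t \<in> wd.V (Suc n)" if "t \<in> wd.V n" for t n
    using letter_V[of None, OF _ that] by (simp add: J_def del: wd.V.simps)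
  define m :: "'l \<Rightarrow> ('l \<times> bool) option \<Rightarrow> ('l \<times> bool) option \<Rightarrow> real" where
    "m x j i = (case (j, i) of (Some (b, s), Some (c, s')) \<Rightarrow> if s = s' then B c c * B (br x b) c else 0 | _ \<Rightarrow> 0)" for x j i
  have sum_J: "(\<Sum>i\<in>J. f i) = f None + (\<Sum>c\<in>E. f (Some (c, True)) + f (Some (c, False)))"
    for f :: "('l \<times> bool) option \<Rightarrow> ('v, 'w) tensor"
  proof -
    have "(\<Sum>i\<in>J. f i) = f None + (\<Sum>i\<in>Some ` (E \<times> (UNIV :: bool set)). f i)"
      unfolding J_def using finE by (subst sum.insert) auto
    also have "(\<Sum>i\<in>Some ` (E \<times> (UNIV :: bool set)). f i) = (\<Sum>(c, s)\<in>E \<times> UNIV. f (Some (c, s)))"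
      by (subst sum.reindex) (auto intro!: sum.cong)
    also have "\<dots> = (\<Sum>c\<in>E. \<Sum>s\<in>UNIV. f (Some (c, s)))" by (rule sum.cartesian_product[symmetric])
    finally show ?thesis by (simp add: UNIV_bool add.commute)
  qed
  have comm: "\<pi>T x (letter j t) = letter j (\<pi>T x t) + (\<Sum>i\<in>J. complex_of_real (m x j i) *\<^sub>C letter i t)"
    if "j \<in> J" for x j t
  proof (cases j)
    case None
    then show ?thesis by (simp add: m_def complex_vector.scale_zero_left)
  next
    case (Some bs)
    obtain b s where bs: "bs = (b, s)" by (cases bs)
    show ?thesis
      unfolding Some bs letter_commute[OF E'] sum_J
      by (cases s) (simp_all add: m_def complex_vector.scale_zero_left del: letter.simps)
  qed
  have skew: "m x i j = - m x j i" if "x \<in> S" "i \<in> J" "j \<in> J" for x i j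
    using that(2,3) structure_constants_skew[OF E Sk[OF that(1)]]
    by (auto simp: m_def J_def E_def split: option.splits)
  have X0: "\<pi>T x t \<in> tens W1 W2" if "x \<in> S" "t \<in> tens W1 W2" for x t
  proof (rule tens_image[OF clin_\<pi>T csub_tens _ that(2)])
    fix v w assume "v \<in> W1" "w \<in> W2"
    then show "\<pi>T x (v \<otimes> w) \<in> tens W1 W2"
      unfolding \<pi>T_pure using W1(3) W2(3) Sk[OF that(1)]
      by (intro csub_simps(2)[OF csub_tens] pure_tens) auto
  qed
  have "\<exists>c. c \<ge> 0 \<and> (\<forall>n l l'. clinear l \<longrightarrow> clinear l' \<longrightarrow>
      norm (wd.form n (\<lambda>t. l (\<pi>T x t)) l' + wd.form n l (\<lambda>t. l' (\<pi>T x t))) \<le> c * (sqrt (wd.nrm n l) * sqrt (wd.nrm n l')))"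
    if x: "x \<in> S" for x
  proof -
    have "\<pi>T x b \<in> cspan B0" if "b \<in> B0" for b
      using X0[OF x] B0(2,3) that by blast
    from wd.hermitian_part_bounded[OF clin_\<pi>T this comm skew[OF x]]
    obtain c where "c \<ge> 0" "\<And>n l l'. clinear l \<Longrightarrow> clinear l' \<Longrightarrow>
      norm (wd.form n (\<lambda>t. l (\<pi>T x t)) l' + wd.form n l (\<lambda>t. l' (\<pi>T x t))) \<le> c * (sqrt (wd.nrm n l) * sqrt (wd.nrm n l'))"
      by metis
    then show ?thesis by blast
  qed
  then obtain c where c: "\<And>x. x \<in> S \<Longrightarrow> c x \<ge> 0" "\<And>x n l l'. x \<in> S \<Longrightarrow> clinear l \<Longrightarrow> clinear l' \<Longrightarrow>
      norm (wd.form n (\<lambda>t. l (\<pi>T x t)) l' + wd.form n l (\<lambda>t. l' (\<pi>T x t))) \<le> c x * (sqrt (wd.nrm n l) * sqrt (wd.nrm n l'))"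
    by metis
  have stable: "\<pi>T x t \<in> wd.V n" if x: "x \<in> S" and t: "t \<in> wd.V n" for x t n
    using t
  proof (induction n arbitrary: t)
    case 0 then show ?case using X0[OF x] B0(3) by simp
  next
    case (Suc n)
    have "\<pi>T x (letter j t) \<in> wd.V (Suc n)" if j: "j \<in> J" and t: "t \<in> wd.V n" for j t
      unfolding comm[OF j]
      by (rule csub_simps(2)[OF wd.subV letter_V[OF j Suc.IH[OF t]] csub_simps(6)[OF wd.subV]])
        (rule csub_simps(3)[OF wd.subV letter_V[OF _ t]])
    then have "\<pi>T x ` cspan (\<Union>j\<in>J. letter j ` wd.V n) \<subseteq> wd.V (Suc n)"
      by (intro clinear_span_subset[OF clin_\<pi>T wd.subV]) blast
    then show ?case using Suc.prems by auto
  qed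
  have act1: "X1.act y v \<otimes> w \<in> wd.V (Suc n)" if vw: "v \<otimes> w \<in> wd.V n" for y v w n
  proof -
    have b: "\<pi>\<^sub>1 x v \<otimes> w \<in> wd.V (Suc n)" for x
    proof -
      have "\<pi>\<^sub>1 x v = (\<Sum>c\<in>E. complex_of_real (B c c * B x c) *\<^sub>C \<pi>\<^sub>1 c v)"
        using arg_cong[OF onbD(5)[OF E' UNIV_I, of x], of "\<lambda>x. \<pi>\<^sub>1 x v"] unfolding X1.\<pi>_sum X1.\<pi>_scale .
      then have "\<pi>\<^sub>1 x v \<otimes> w = (\<Sum>c\<in>E. complex_of_real (B c c * B x c) *\<^sub>C letter (Some (c, True)) (v \<otimes> w))"
        by (simp add: letter_pure pure_simps del: letter.simps)
      also have "\<dots> \<in> wd.V (Suc n)"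
        by (rule csub_simps(6)[OF wd.subV], rule csub_simps(3)[OF wd.subV], rule letter_V[OF _ vw]) (simp add: J_def)
      finally show ?thesis .
    qed
    show ?thesis
      unfolding complexify_rep_def pure_simps
      by (rule csub_simps(2)[OF wd.subV b csub_simps(3)[OF wd.subV b]])
  qed
  have act2: "v \<otimes> X2.act y w \<in> wd.V (Suc n)" if vw: "v \<otimes> w \<in> wd.V n" for y v w n
  proof -
    have b: "v \<otimes> \<pi>\<^sub>2 x w \<in> wd.V (Suc n)" for x
    proof -
      have "\<pi>\<^sub>2 x w = (\<Sum>c\<in>E. complex_of_real (B c c * B x c) *\<^sub>C \<pi>\<^sub>2 c w)"
        using arg_cong[OF onbD(5)[OF E' UNIV_I, of x], of "\<lambda>x. \<pi>\<^sub>2 x w"] unfolding X2.\<pi>_sum X2.\<pi>_scale .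
      then have "v \<otimes> \<pi>\<^sub>2 x w = (\<Sum>c\<in>E. complex_of_real (B c c * B x c) *\<^sub>C letter (Some (c, False)) (v \<otimes> w))"
        by (simp add: letter_pure pure_simps del: letter.simps)
      also have "\<dots> \<in> wd.V (Suc n)"
        by (rule csub_simps(6)[OF wd.subV], rule csub_simps(3)[OF wd.subV], rule letter_V[OF _ vw]) (simp add: J_def)
      finally show ?thesis .
    qed
    show ?thesis
      unfolding complexify_rep_def pure_simps
      by (rule csub_simps(2)[OF wd.subV b csub_simps(3)[OF wd.subV b]])
  qed
  have F1: "v \<otimes> w \<in> wd.V i" if "v \<in> f1.F i" "w \<in> W2" for v w i
    using that(1)
  proof (induction i arbitrary: v)
    case 0 then show ?case using pure_tens[OF _ that(2), of v W1] B0(3) by simp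
  next
    case (Suc i)
    have "f1.F (Suc i) \<subseteq> {v. v \<otimes> w \<in> wd.V (Suc i)}"
    proof (rule f1.F_Suc_subset)
      show "csubspace {v. v \<otimes> w \<in> wd.V (Suc i)}"
        by (rule csubspaceI) (simp_all add: pure_simps csub_simps[OF wd.subV] del: wd.V.simps)
    qed (use Suc.IH V_Suc act1 in blast)+
    then show ?case using Suc.prems by blast
  qed
  have F2: "v \<otimes> w \<in> wd.V (i + j)" if "v \<in> f1.F i" "w \<in> f2.F j" for v w i j
    using that(2)
  proof (induction j arbitrary: w)
    case 0 then show ?case using F1[OF that(1)] by simp
  next
    case (Suc j)
    have "f2.F (Suc j) \<subseteq> {w. v \<otimes> w \<in> wd.V (Suc (i + j))}"
    proof (rule f2.F_Suc_subset)
      show "csubspace {w. v \<otimes> w \<in> wd.V (Suc (i + j))}"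
        by (rule csubspaceI) (simp_all add: pure_simps csub_simps[OF wd.subV] del: wd.V.simps)
    qed (use Suc.IH V_Suc act2 in blast)+
    then show ?case using Suc.prems by auto
  qed
  have FV: "tens (f1.F n) (f2.F n) \<subseteq> wd.V (n + n)" for n
    by (rule tens_subset[OF wd.subV F2])
  show ?thesis
  proof (rule that)
    fix n a t
    assume a: "Re a < - (\<Sum>x\<in>S. (c x)\<^sup>2)" and t: "t \<in> tens (f1.F n) (f2.F n)"
      "- (\<Sum>x\<in>S. \<pi>T x (\<pi>T x t)) - a *\<^sub>C t = 0"
    show "t = 0"
      by (rule wd.squares_injective[OF finS clin_\<pi>T stable c a subsetD[OF FV t(1)] t(2)])
  qed
qed

end

section \<open>The Casimir operator on weight vectors, modulo a submodule\<close>

context cartan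
begin

text \<open>The sum is a contraction over \<open>p\<close> of an expression equivariant under
  \<open>k\<close>, so it is central in \<open>k\<close>.\<close>

lemma center_casimir:
  assumes nz: "p \<noteq> {0}" and z: "complex_structure z" and E: "onb p E"
  obtains c where "(\<Sum>e\<in>E. br e (br z e)) = c *\<^sub>R z"
proof -
  let ?c = "\<Sum>e\<in>E. br e (br z e)"
  have zc: "z \<in> center_k" using z by (simp add: complex_structure_def)
  note zk = center_kD(1)[OF zc]
  have ck: "?c \<in> k"
    by (rule subspace_sum[OF sub_k]) (rule br_pp[OF onbD(6)[OF E] br_kp[OF zk onbD(6)[OF E]]])
  have "br x ?c = 0" if x: "x \<in> k" for x
  proof -
    \<comment> \<open>\<open>cas\<close> contracts maps with values in complex vector spaces, so
      real vectors are regarded as elements of the complexification.\<close>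
    let ?T = "\<lambda>a b. Complexify (br a (br z b)) 0"
    have T: "rbilinear ?T"
      by (simp add: rbilinear_def complexification_simps br_simps)
    have "cas E (\<lambda>a b. ?T (br x a) b + ?T a (br x b)) = 0"
      by (rule cas_skew[OF E T]) (auto simp: B_skew intro: br_kp[OF x])
    moreover have "cas E (\<lambda>a b. ?T (br x a) b + ?T a (br x b)) =
      (\<Sum>e\<in>E. Complexify (br (br x e) (br z e) + br e (br z (br x e))) 0)"
      by (simp add: cas_def onb_p[OF E] zero_complexification_def plus_complexification_def scaleC_one)
    ultimately have "real_part (\<Sum>e\<in>E. Complexify (br (br x e) (br z e) + br e (br z (br x e))) 0) = 0"
      by (simp add: zero_complexification_def)
    then have "(\<Sum>e\<in>E. br (br x e) (br z e) + br e (br z (br x e))) = 0" by (simp add: real_part_sum)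
    moreover have "br x ?c = (\<Sum>e\<in>E. br (br x e) (br z e) + br e (br z (br x e)))"
      unfolding br_sum_right
    proof (rule sum.cong[OF refl])
      show "br x (br e (br z e)) = br (br x e) (br z e) + br e (br z (br x e))" for e
        unfolding center_kD(3)[OF x zc, of e] by (rule jacobi)
    qed
    ultimately show ?thesis by simp
  qed
  then have "br ?c x = 0" if "x \<in> k" for x using that br_anti[of ?c x] by simp
  then have "?c \<in> center_k" using ck by (simp add: center_k_def)
  then show ?thesis using that unfolding center_span[OF nz z] by (auto simp: span_singleton)
qed

end

context equivariant_rep
begin

text \<open>Along \<open>b = \<mu> - \<i> n\<close> the real part of the scalar tends to infinity, while the remaining operator,
  minus a sum of squares of elements of \<open>k\<close>, has spectrum bounded from below.\<close>

lemma casimir_weight: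
  assumes z: "complex_structure z" and E: "onb k Ek" "onb p Ep" and \<zeta>: "s *\<^sub>R z \<in> Ek"
    and c: "(\<Sum>e\<in>Ep. br e (br z e)) = c *\<^sub>R z"
    and Y: "submodule Y" and v: "v \<in> weight z b" "\<And>u. u \<in> pz z \<Longrightarrow> act u v \<in> Y"
  shows "casimir (Ek \<union> Ep) v -
    (- (\<Sum>x\<in>Ek - {s *\<^sub>R z}. \<pi> x (\<pi> x v)) + (\<i> / 2 * of_real c * b - of_real (s\<^sup>2) * b\<^sup>2) *\<^sub>C v) \<in> Y"
proof -
  note subY = submoduleD(1)[OF Y]
  have zv: "\<pi> z v = b *\<^sub>C v" using v(1) by (simp add: weight_def)
  have zk: "z \<in> k" using z by (simp add: complex_structure_def center_k_def)
  let ?S = "\<Sum>e\<in>Ep. \<pi> e (\<pi> e v)" and ?S' = "\<Sum>e\<in>Ep. \<pi> e (\<pi> (br z e) v)"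
  \<comment> \<open>The arguments e - \<i> [z, e] belong to \<open>pz z\<close>, which maps
    \<open>v\<close> into \<open>Y\<close>. Modulo \<open>Y\<close> this replaces \<pi> e v by \<i>
    \<pi> [z, e] v.\<close>
  have "(\<Sum>e\<in>Ep. \<pi> e (act (Complexify e (- br z e)) v)) \<in> Y"
    using onbD(6)[OF E(2)] by (intro csub_simps(6)[OF subY] submoduleD(2)[OF Y] v(2)) (auto simp: pz_def)
  also have "(\<Sum>e\<in>Ep. \<pi> e (act (Complexify e (- br z e)) v)) = ?S - \<i> *\<^sub>C ?S'"
    by (simp add: complexify_rep_def \<pi>_minus \<pi>_simps complex_vector.scale_minus_right sum_subtractf
        complex_vector.scale_sum_right)
  finally have p1: "?S - \<i> *\<^sub>C ?S' \<in> Y" .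
  \<comment> \<open>Since ad z is skew on \<open>p\<close>, exchanging the two factors of each
    product changes the sign of the total sum. Twice the sum is therefore a sum of commutators, to
    which \<open>c\<close> applies.\<close>
  have p2: "2 *\<^sub>C ?S' = (of_real c * b) *\<^sub>C v"
  proof -
    have "cas Ep (\<lambda>x y. \<pi> (br z x) (\<pi> y v) + \<pi> x (\<pi> (br z y) v)) = 0"
      by (rule cas_skew[OF E(2) rbilinear_\<pi>]) (auto simp: B_skew intro: br_kp[OF zk])
    then have "(\<Sum>e\<in>Ep. \<pi> (br z e) (\<pi> e v)) + ?S' = 0"
      by (simp add: cas_def onb_p[OF E(2)] scaleC_one sum.distrib)
    then have "?S' + ?S' = ?S' - (\<Sum>e\<in>Ep. \<pi> (br z e) (\<pi> e v))" by (simp add: add_eq_0_iff)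
    also have "\<dots> = \<pi> (\<Sum>e\<in>Ep. br e (br z e)) v" by (simp add: \<pi>_sum \<pi>_br sum_subtractf)
    also have "\<dots> = (of_real c * b) *\<^sub>C v" by (simp add: c \<pi>_scale zv scaleC_scaleC)
    finally show ?thesis using scaleC_add_left[of 1 1 ?S'] by (simp add: scaleC_one)
  qed
  have "\<i> *\<^sub>C ?S' = (\<i> / 2) *\<^sub>C (2 *\<^sub>C ?S')" by (simp add: scaleC_scaleC)
  then have p3: "\<i> *\<^sub>C ?S' = (\<i> / 2 * of_real c * b) *\<^sub>C v" by (simp add: p2 scaleC_scaleC mult.assoc)
  let ?\<zeta> = "s *\<^sub>R z" and ?R = "\<Sum>x\<in>Ek - {s *\<^sub>R z}. \<pi> x (\<pi> x v)"
  have z2: "\<pi> ?\<zeta> (\<pi> ?\<zeta> v) = (of_real (s\<^sup>2) * b\<^sup>2) *\<^sub>C v"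
    by (simp add: \<pi>_scale \<pi>_simps zv scaleC_scaleC power2_eq_square mult.assoc mult.left_commute)
  have "casimir (Ek \<union> Ep) v = (\<Sum>e\<in>Ek. - \<pi> e (\<pi> e v)) + ?S"
    unfolding casimir_def cas_def
    by (subst sum.union_disjoint[OF onbD(1)[OF E(1)] onbD(1)[OF E(2)] onb_union(2)[OF E]])
      (simp add: onb_k[OF E(1)] onb_p[OF E(2)] scaleC_one complex_vector.scale_minus_left)
  also have "(\<Sum>e\<in>Ek. - \<pi> e (\<pi> e v)) = - (of_real (s\<^sup>2) * b\<^sup>2) *\<^sub>C v - ?R"
    by (subst sum.remove[OF onbD(1)[OF E(1)] \<zeta>]) (simp only: z2 sum_negf complex_vector.scale_minus_left, simp)
  finally have "casimir (Ek \<union> Ep) v - (- ?R + (\<i> / 2 * of_real c * b - of_real (s\<^sup>2) * b\<^sup>2) *\<^sub>C v) = ?S - \<i> *\<^sub>C ?S'"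
    unfolding p3 complex_vector.scale_left_diff_distrib complex_vector.scale_minus_left by simp
  then show ?thesis using p1 by simp
qed

lemma weight_k:
  assumes z: "complex_structure z" and x: "x \<in> k" and v: "v \<in> weight z b"
  shows "\<pi> x v \<in> weight z b"
proof -
  have "br z x = 0" using z x by (simp add: complex_structure_def center_k_def)
  then have "\<pi> z (\<pi> x v) = \<pi> x (\<pi> z v)" using \<pi>_br[of z x v] by (simp add: \<pi>_zero)
  then show ?thesis using v by (simp add: weight_def \<pi>_simps)
qed

lemma weight_casimir:
  assumes "onb UNIV E" "v \<in> weight z b" shows "casimir E v \<in> weight z b"
  using assms(2) casimir_\<pi>[OF assms(1), of z v] by (simp add: weight_def clinear_simps[OF clinear_casimir])

lemma op_prod_casimir_kernel:
  assumes E: "onb UNIV E" shows "submodule {v. op_prod (casimir E) ls v = 0}"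
proof (rule submoduleI)
  have lin: "clinear (op_prod (casimir E) ls)" by (rule clinear_op_prod[OF clinear_casimir])
  show "csubspace {v. op_prod (casimir E) ls v = 0}"
    by (rule csubspaceI) (auto simp: clinear_simps[OF lin] complex_vector.scale_zero_right)
  have "op_prod (casimir E) ls (\<pi> x v) = \<pi> x (op_prod (casimir E) ls v)" for x v
    by (induction ls) (simp_all add: casimir_\<pi>[OF E] \<pi>_simps)
  then show "\<pi> x v \<in> {v. op_prod (casimir E) ls v = 0}" if "v \<in> {v. op_prod (casimir E) ls v = 0}" for x v
    using that by (simp add: \<pi>_simps)
  fix g assume g: "g \<in> K"
  have "op_prod (casimir E) ls (\<rho> g v) = \<rho> g (op_prod (casimir E) ls v)" for v
    by (induction ls) (simp_all add: casimir_\<rho>[OF E g] clinear_simps[OF clin_\<rho>[OF g]])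
  then show "\<rho> g v \<in> {v. op_prod (casimir E) ls v = 0}" if "v \<in> {v. op_prod (casimir E) ls v = 0}" for v
    using that by (simp add: clinear_simps[OF clin_\<rho>[OF g]])
qed

end

section \<open>Sufficiency: finite length controlled by finitely many weight spaces\<close>

context gK_pair
begin

lemma null_vectors_imp_decomposable:
  assumes z: "complex_structure z"
    and v1: "v1 \<noteq> 0" "\<And>u. u \<in> pz z \<Longrightarrow> X1.act u v1 = 0"
    and v2: "v2 \<noteq> 0" "\<And>u. u \<in> pz z \<Longrightarrow> X2.act u v2 = 0"
  shows "discretely_decomposable K \<pi>T \<rho>T"
proof -
  note nz = X1.p_nonzero
  have zk: "z \<in> k" using z by (simp add: complex_structure_def center_k_def)
  obtain W1 a1 where W1: "csubspace W1" "cfinite_dim W1" "\<And>g w. g \<in> K \<Longrightarrow> w \<in> W1 \<Longrightarrow> \<rho>\<^sub>1 g w \<in> W1"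
    "cspan (\<Union>n. X1.weight z (a1 - \<i> * of_nat n) \<inter> filtered_module.F X1.act W1 n) = UNIV"
    using X1.null_vector_span[OF z v1] by metis
  obtain W2 a2 where W2: "csubspace W2" "cfinite_dim W2" "\<And>g w. g \<in> K \<Longrightarrow> w \<in> W2 \<Longrightarrow> \<rho>\<^sub>2 g w \<in> W2"
    "cspan (\<Union>n. X2.weight z (a2 - \<i> * of_nat n) \<inter> filtered_module.F X2.act W2 n) = UNIV"
    using X2.null_vector_span[OF z v2] by metis
  have ks1: "\<pi>\<^sub>1 x w \<in> W1" if "x \<in> k" "w \<in> W1" for x w using X1.k_stable[OF W1(1,3) that] .
  interpret f1: filtered_module X1.brC kC X1.act W1 by (rule X1.filtered_moduleI[OF W1(1,2) ks1])
  have ks2: "\<pi>\<^sub>2 x w \<in> W2" if "x \<in> k" "w \<in> W2" for x w using X2.k_stable[OF W2(1,3) that] .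
  interpret f2: filtered_module X2.brC kC X2.act W2 by (rule X2.filtered_moduleI[OF W2(1,2) ks2])
  define b where "b n = a1 + a2 - \<i> * of_nat n" for n
  have inj_b: "inj b" by (rule injI) (simp add: b_def)
  \<comment> \<open>Intersecting with F n tensor F n gives finite dimension and brings the space
    under \<open>spectral_gap\<close>.\<close>
  define H where "H n = T.weight z (b n) \<inter> tens (f1.F n) (f2.F n)" for n
  have subH: "csubspace (H n)" for n
    unfolding H_def by (rule complex_vector.subspace_inter[OF T.csub_weight csub_tens])
  have fdH: "cfinite_dim (H n)" for n
    by (rule cfinite_dim_subset[OF cfinite_dim_tens[OF f1.fdF f2.fdF] subH]) (auto simp: H_def)
  have subU: "csubspace (cspan (\<Union>n. H n))" by simp
  have spanH: "cspan (\<Union>n. H n) = UNIV"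
  proof -
    have HI: "v \<otimes> w \<in> cspan (\<Union>n. H n)"
      if v: "v \<in> X1.weight z (a1 - \<i> * of_nat m) \<inter> f1.F m" and w: "w \<in> X2.weight z (a2 - \<i> * of_nat n) \<inter> f2.F n"
      for v w m n
    proof -
      have "\<pi>\<^sub>1 z v = (a1 - \<i> * of_nat m) *\<^sub>C v" "\<pi>\<^sub>2 z w = (a2 - \<i> * of_nat n) *\<^sub>C w"
        using v w by (auto simp: X1.weight_def X2.weight_def)
      then have "\<pi>T z (v \<otimes> w) = (a1 - \<i> * of_nat m + (a2 - \<i> * of_nat n)) *\<^sub>C (v \<otimes> w)"
        by (simp only: \<pi>T_pure pure_simps scaleC_add_left)
      also have "a1 - \<i> * of_nat m + (a2 - \<i> * of_nat n) = b (m + n)" by (simp add: b_def algebra_simps)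
      finally have "v \<otimes> w \<in> T.weight z (b (m + n))" by (simp add: T.weight_def)
      moreover have "v \<in> f1.F (m + n)" "w \<in> f2.F (m + n)"
        using v w f1.F_mono[of m "m + n"] f2.F_mono[of n "m + n"] by auto
      ultimately have "v \<otimes> w \<in> H (m + n)" by (simp add: H_def pure_tens)
      then show ?thesis by (intro complex_vector.span_base) blast
    qed
    have "v \<otimes> w \<in> cspan (\<Union>n. H n)" for v w
    proof -
      have 1: "v \<otimes> w \<in> cspan (\<Union>n. H n)" if v: "v \<in> X1.weight z (a1 - \<i> * of_nat m) \<inter> f1.F m" for v w m
      proof -
        have "(\<lambda>w. v \<otimes> w) ` cspan (\<Union>n. X2.weight z (a2 - \<i> * of_nat n) \<inter> f2.F n) \<subseteq> cspan (\<Union>n. H n)"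
          by (rule clinear_span_subset[OF clinear_pure_right subU]) (use HI[OF v] in blast)
        then show ?thesis unfolding W2(4) by blast
      qed
      have "(\<lambda>v. v \<otimes> w) ` cspan (\<Union>n. X1.weight z (a1 - \<i> * of_nat n) \<inter> f1.F n) \<subseteq> cspan (\<Union>n. H n)"
        by (rule clinear_span_subset[OF clinear_pure_left subU]) (use 1 in blast)
      then show ?thesis unfolding W1(4) by blast
    qed
    then have "tens UNIV UNIV \<subseteq> cspan (\<Union>n. H n)" by (intro tens_subset subU)
    then show ?thesis by (auto simp: tens_UNIV)
  qed
  \<comment> \<open>The spaces \<open>H n\<close> span everything and their eigenvalues are
    distinct, so the full weight spaces are no larger.\<close>
  have wt: "T.weight z (b n) = H n" for n
    by (rule T.weight_eq_of_span[OF subH _ spanH inj_b]) (simp add: H_def)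

  \<comment> \<open>Normalizes \<open>z\<close> to length -1, so that \<open>s *\<^sub>R z\<close>
    can be a member of an orthonormal basis of \<open>k\<close>.\<close>
  define s where "s = 1 / sqrt (- B z z)"
  have Bz: "B z z < 0" using B_k_neg[OF zk complex_structure_nonzero[OF nz z]] .
  have s: "s\<^sup>2 * B z z = - 1" "s\<^sup>2 > 0" using Bz by (simp_all add: s_def power_divide)
  have \<zeta>k: "s *\<^sub>R z \<in> k" using sub_k zk by (rule subspace_scale)
  have "B (s *\<^sub>R z) (s *\<^sub>R z) = - 1" using s(1) by (simp add: B_simps power2_eq_square mult.assoc)
  then have one: "\<bar>B e e\<bar> = 1" if "e \<in> {s *\<^sub>R z}" for e using that by simp
  have orth: "B e f = 0" if "e \<in> {s *\<^sub>R z}" "f \<in> {s *\<^sub>R z}" "e \<noteq> f" for e f using that by blast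
  have def_k: "B x x \<noteq> 0" if "x \<in> k" "x \<noteq> 0" for x using B_k_neg[OF that] by simp
  have "finite {s *\<^sub>R z}" "{s *\<^sub>R z} \<subseteq> k" using \<zeta>k by auto
  from onb_extend[OF sub_k def_k this one orth]
  obtain Ek where Ek: "{s *\<^sub>R z} \<subseteq> Ek" "onb k Ek" .
  obtain Ep where Ep: "onb p Ep" by (metis onb_exists)
  have \<zeta>: "s *\<^sub>R z \<in> Ek" using Ek(1) by simp
  have E: "onb UNIV (Ek \<union> Ep)" by (rule onb_union(1)[OF Ek(2) Ep])
  let ?C = "T.casimir (Ek \<union> Ep)" and ?S = "Ek - {s *\<^sub>R z}"
  let ?R = "\<lambda>t. - (\<Sum>x\<in>?S. \<pi>T x (\<pi>T x t))"
  obtain c0 where c0: "(\<Sum>e\<in>Ep. br e (br z e)) = c0 *\<^sub>R z" by (rule center_casimir[OF nz z Ep])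
  define c where "c n = \<i> / 2 * of_real c0 * b n - of_real (s\<^sup>2) * (b n)\<^sup>2" for n
  obtain \<kappa> where \<kappa>: "\<And>n a t. Re a < \<kappa> \<Longrightarrow> t \<in> tens (f1.F n) (f2.F n) \<Longrightarrow> ?R t - a *\<^sub>C t = 0 \<Longrightarrow> t = 0"
    using spectral_gap[OF W1(1,2) ks1 W2(1,2) ks2 Ek(2) Ep, of ?S] by blast
  have Sk: "x \<in> k" if "x \<in> ?S" for x using that onbD(6)[OF Ek(2)] by blast
  note C = clinear_simps[OF T.clinear_casimir]

  \<comment> \<open>Modulo \<open>Y\<close>, the Casimir operator minus \<open>l\<close> acts on Y'
    \<inter> H n as \<open>?R\<close> minus (l - c n), which is onto by the spectral gap. So a
    product of such factors is onto modulo \<open>Y\<close>; but it vanishes on Y', hence Y'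
    \<inter> H n lies in \<open>Y\<close>.\<close>
  have lift: "Y' \<inter> H n \<subseteq> Y"
    if Y: "T.submodule Y" "T.submodule Y'" and ls: "\<And>t. t \<in> Y' \<Longrightarrow> op_prod ?C ls t = 0"
      and gap: "\<And>l. l \<in> set ls \<Longrightarrow> Re (l - c n) < \<kappa>"
      and raise: "\<And>u t. u \<in> pz z \<Longrightarrow> t \<in> Y' \<inter> H n \<Longrightarrow> T.act u t \<in> Y" for Y Y' n ls
  proof
    let ?V = "Y' \<inter> H n"
    note subY = T.submoduleD(1)[OF Y(1)]
    have subV: "csubspace ?V" by (rule complex_vector.subspace_inter[OF T.submoduleD(1)[OF Y(2)] subH])
    have fdV: "cfinite_dim ?V" by (rule cfinite_dim_subset[OF fdH subV]) blast
    have XV: "\<pi>T x t \<in> ?V" if "x \<in> ?S" "t \<in> ?V" for x t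
      using that T.weight_k[OF z Sk[OF that(1)], of t "b n"] T.submoduleD(2)[OF Y(2)] by (simp add: wt)
    have cong: "?C t - (?R t + c n *\<^sub>C t) \<in> Y" if t: "t \<in> ?V" for t
      unfolding c_def
      by (rule T.casimir_weight[OF z Ek(2) Ep \<zeta> c0 Y(1) _ raise[OF _ t]]) (use t wt in auto)
    have onto: "\<exists>t'\<in>?V. ?R t' - a *\<^sub>C t' = t" if a: "Re a < \<kappa>" and t: "t \<in> ?V" for a t
    proof -
      let ?f = "\<lambda>t. (- 1) *\<^sub>C (\<Sum>x\<in>?S. \<pi>T x (\<pi>T x t)) - a *\<^sub>C t"
      have f: "?f t = ?R t - a *\<^sub>C t" for t
        by (simp add: complex_vector.scale_minus_left scaleC_one)
      have "?f ` ?V = ?V"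
      proof (rule cfinite_dim_inj_imp_surj[OF fdV subV])
        show "clinear ?f"
          by (intro clinear_minus' clinear_scaleC clinear_setsum clinear_compose[OF clin_\<pi>T clin_\<pi>T] clinear_ident)
        show "?f ` ?V \<subseteq> ?V"
        proof
          fix w assume "w \<in> ?f ` ?V"
          then obtain t where t: "t \<in> ?V" "w = ?f t" by (rule imageE)
          show "w \<in> ?V"
            unfolding t(2)
            by (rule csub_simps(4)[OF subV csub_simps(3)[OF subV csub_simps(6)[OF subV]] csub_simps(3)[OF subV t(1)]])
              (rule XV[OF _ XV[OF _ t(1)]])
        qed
        show "t = 0" if "t \<in> ?V" "?f t = 0" for t
          using \<kappa>[OF a, of t n] that unfolding f by (simp add: H_def)
      qed
      then have "t \<in> ?f ` ?V" using t by simp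
      then show ?thesis unfolding f by blast
    qed
    have approx: "\<exists>t'\<in>?V. op_prod ?C ls' t' - t \<in> Y" if "set ls' \<subseteq> set ls" "t \<in> ?V" for ls' t
      using that
    proof (induction ls' arbitrary: t)
      case Nil then show ?case using csub_simps(1)[OF subY] by (auto intro!: bexI[of _ t])
    next
      case (Cons l ls')
      have "Re (l - c n) < \<kappa>" using Cons.prems(1) by (intro gap) simp
      from onto[OF this Cons.prems(2)] obtain w where w: "w \<in> ?V" "?R w - (l - c n) *\<^sub>C w = t" by blast
      obtain t' where t': "t' \<in> ?V" "op_prod ?C ls' t' - w \<in> Y" using Cons.IH[OF _ w(1)] Cons.prems(1) by auto
      let ?d = "op_prod ?C ls' t' - w"
      have "?C ?d - l *\<^sub>C ?d + (?C w - (?R w + c n *\<^sub>C w)) \<in> Y"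
        by (rule csub_simps(2)[OF subY csub_simps(4)[OF subY T.casimir_submodule[OF E Y(1) t'(2)]
              csub_simps(3)[OF subY t'(2)]] cong[OF w(1)]])
      also have "?C ?d - l *\<^sub>C ?d + (?C w - (?R w + c n *\<^sub>C w)) = op_prod ?C (l # ls') t' - t"
        unfolding w(2)[symmetric]
        by (simp add: C complex_vector.scale_right_diff_distrib complex_vector.scale_left_diff_distrib)
      finally show ?case using t'(1) by blast
    qed
    fix t assume t: "t \<in> ?V"
    then obtain t' where t': "t' \<in> ?V" "op_prod ?C ls t' - t \<in> Y" using approx[of ls t] by blast
    then have "- t \<in> Y" using ls[of t'] by simp
    then show "t \<in> Y" using csub_simps(5)[OF subY, of "- t"] by simp
  qed

  have growth: "\<forall>\<^sub>F n in sequentially. \<forall>l\<in>set ls. Re (l - c n) < \<kappa>" for ls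
  proof (rule eventually_ball_finite[OF finite_set], rule ballI)
    fix l
    \<comment> \<open>\<open>q n\<close> is minus the imaginary part of \<open>b n\<close>. The real
      part of \<open>c n\<close> is a quadratic polynomial in it with leading coefficient s^2 >
      0.\<close>
    define q where "q n = - Im (a1 + a2) + real n" for n
    have "filterlim (\<lambda>n. - Im (a1 + a2) + real n) at_top sequentially"
      by (rule filterlim_tendsto_add_at_top[OF tendsto_const filterlim_real_sequentially])
    then have q: "filterlim q at_top sequentially" unfolding q_def[abs_def] .
    have "filterlim (\<lambda>n. c0 / 2 + s\<^sup>2 * q n) at_top sequentially"
      by (rule filterlim_tendsto_add_at_top[OF tendsto_const
            filterlim_tendsto_pos_mult_at_top[OF tendsto_const s(2) q]])
    then have "filterlim (\<lambda>n. q n * (c0 / 2 + s\<^sup>2 * q n)) at_top sequentially"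
      by (rule filterlim_at_top_mult_at_top[OF q])
    then have "\<forall>\<^sub>F n in sequentially. Re l - \<kappa> + s\<^sup>2 * (Re (a1 + a2))\<^sup>2 < q n * (c0 / 2 + s\<^sup>2 * q n)"
      by (simp add: filterlim_at_top_dense)
    then show "\<forall>\<^sub>F n in sequentially. Re (l - c n) < \<kappa>"
    proof (rule eventually_mono)
      fix n assume *: "Re l - \<kappa> + s\<^sup>2 * (Re (a1 + a2))\<^sup>2 < q n * (c0 / 2 + s\<^sup>2 * q n)"
      have b: "b n = Complex (Re (a1 + a2)) (- q n)" by (simp add: b_def q_def complex_eq_iff)
      have "Re (c n) = q n * (c0 / 2 + s\<^sup>2 * q n) - s\<^sup>2 * (Re (a1 + a2))\<^sup>2"
        unfolding c_def b by (simp add: power2_eq_square algebra_simps)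
      then show "Re (l - c n) < \<kappa>" using * by simp
    qed
  qed

  define D where "D i = cspan (\<Union>n\<in>{..i}. H n)" for i
  have subD: "csubspace (D i)" for i by (simp add: D_def)
  have fdD: "cfinite_dim (D i)" for i
    unfolding D_def by (rule cfinite_dim_finite_sum[OF finite_atMost fdH])
  have HD: "H n \<subseteq> D i" if "n \<le> i" for n i
    unfolding D_def by (rule order.trans[OF _ complex_vector.span_superset]) (use that in auto)
  define Y where "Y i = \<Inter>{Z. T.submodule Z \<and> D i \<subseteq> Z}" for i
  have DY: "D i \<subseteq> Y i" for i by (auto simp: Y_def)
  have subY: "T.submodule (Y i)" for i
  proof (rule T.submoduleI)
    show "csubspace (Y i)"
      unfolding Y_def by (rule complex_vector.subspace_Inter) (use T.submoduleD(1) in blast)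
  next
    fix x t assume t: "t \<in> Y i"
    have "\<pi>T x t \<in> Z" if Z: "T.submodule Z" "D i \<subseteq> Z" for Z
    proof -
      have "t \<in> Z" using t Z unfolding Y_def by blast
      then show ?thesis by (rule T.submoduleD(2)[OF Z(1)])
    qed
    then show "\<pi>T x t \<in> Y i" by (simp add: Y_def)
  next
    fix g t assume g: "g \<in> K" and t: "t \<in> Y i"
    have "\<rho>T g t \<in> Z" if Z: "T.submodule Z" "D i \<subseteq> Z" for Z
    proof -
      have "t \<in> Z" using t Z unfolding Y_def by blast
      then show ?thesis by (rule T.submoduleD(3)[OF Z(1) g])
    qed
    then show "\<rho>T g t \<in> Y i" by (simp add: Y_def)
  qed
  have fin: "gK_finite_length K \<pi>T \<rho>T (Y i)" for i
  proof -
    have "?C ` D i \<subseteq> D i"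
      unfolding D_def
    proof (rule clinear_span_subset[OF T.clinear_casimir], simp)
      show "?C ` (\<Union>n\<in>{..i}. H n) \<subseteq> cspan (\<Union>n\<in>{..i}. H n)"
        using T.weight_casimir[OF E, where z = z] unfolding wt[symmetric]
        by (auto intro!: complex_vector.span_base)
    qed
    from op_prod_annihilates[OF T.clinear_casimir subD this fdD]
    obtain ls where ls: "\<And>t. t \<in> D i \<Longrightarrow> op_prod ?C ls t = 0" by metis
    \<comment> \<open>The kernel of a polynomial in the Casimir operator is a submodule, so it
      contains the submodule generated by \<open>D i\<close> once it contains
      \<open>D i\<close>.\<close>
    have lsY: "op_prod ?C ls t = 0" if "t \<in> Y i" for t
    proof -
      have "Y i \<subseteq> {t. op_prod ?C ls t = 0}"
        unfolding Y_def by (rule Inter_lower) (use T.op_prod_casimir_kernel[OF E] ls in blast)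
      then show ?thesis using that by blast
    qed
    obtain n0 where n0: "\<And>n l. n \<ge> n0 \<Longrightarrow> l \<in> set ls \<Longrightarrow> Re (l - c n) < \<kappa>"
      using growth[of ls] unfolding eventually_sequentially by blast
    show ?thesis
    proof (rule T.finite_lengthI[OF fdD[of n0] subD subY])
      fix Z Z' assume Z: "T.submodule Z" "T.submodule Z'" "Z \<subset> Z'" "Z' \<subseteq> Y i"
      show "\<not> Z' \<inter> D n0 \<subseteq> Z"
      proof
        assume D: "Z' \<inter> D n0 \<subseteq> Z"
        \<comment> \<open>Agreement spreads from low weights to all weights: elements of
          \<open>pz z\<close> map H (n + 1) to \<open>H n\<close>, where \<open>Z\<close> already
          contains the vectors of Z', and beyond \<open>n0\<close> this is the situation of
          \<open>lift\<close>.\<close>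
        have HZ: "Z' \<inter> H n \<subseteq> Z" for n
        proof (induction n)
          case 0 show ?case using D HD[of 0 n0] by blast
        next
          case (Suc n)
          show ?case
          proof (cases "Suc n \<le> n0")
            case True then show ?thesis using D HD by blast
          next
            case False
            show ?thesis
            proof (rule lift[OF Z(1,2)])
              show "op_prod ?C ls t = 0" if "t \<in> Z'" for t using that Z(4) lsY by blast
              show "Re (l - c (Suc n)) < \<kappa>" if "l \<in> set ls" for l using that False by (intro n0) auto
              fix u t assume u: "u \<in> pz z" and t: "t \<in> Z' \<inter> H (Suc n)"
              have "t \<in> T.weight z (b (Suc n))" using t wt by blast
              from T.weight_act[OF pz_bracket[OF z u] this] have "T.act u t \<in> H n"
                by (simp add: b_def wt[symmetric] algebra_simps)
              moreover have "T.act u t \<in> Z'"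
                using t T.submoduleD[OF Z(2)] unfolding complexify_rep_def
                by (auto intro!: csub_simps(2)[OF T.submoduleD(1)[OF Z(2)]] csub_simps(3)[OF T.submoduleD(1)[OF Z(2)]])
              ultimately show "T.act u t \<in> Z" using Suc by blast
            qed
          qed
        qed
        have "Z' \<subseteq> Z"
        proof
          fix t assume t: "t \<in> Z'"
          have "t \<in> cspan (\<Union>n. H n)" using spanH by simp
          from span_union_sum[OF subH this]
          obtain N h where h: "\<And>n. h n \<in> H n" "t = (\<Sum>n\<le>N. h n)" by metis
          have "h n \<in> Z" if "n \<le> N" for n
          proof -
            have "h n \<in> Z'"
              by (rule T.weight_components[OF T.submoduleD(1,2)[OF Z(2)] inj_b _ _ that])
                (use h t wt in auto)
            then show ?thesis using HZ h(1) by blast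
          qed
          then show "t \<in> Z" unfolding h(2) by (intro csub_simps(6)[OF T.submoduleD(1)[OF Z(1)]]) auto
        qed
        then show False using Z(3) by blast
      qed
    qed
  qed
  have mono: "Y i \<subseteq> Y (Suc i)" for i
  proof -
    have "D i \<subseteq> D (Suc i)" unfolding D_def by (intro complex_vector.span_mono UN_mono) auto
    then show ?thesis unfolding Y_def by blast
  qed
  have "(\<Union>i. Y i) = UNIV"
  proof -
    have "t \<in> (\<Union>i. Y i)" for t
    proof -
      have "t \<in> cspan (\<Union>n. H n)" using spanH by simp
      from span_union_sum[OF subH this]
      obtain N h where h: "\<And>n. h n \<in> H n" "t = (\<Sum>n\<le>N. h n)" by metis
      have "t \<in> D N" unfolding h(2) by (rule csub_simps(6)[OF subD]) (use h(1) HD in auto)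
      then show ?thesis using DY by blast
    qed
    then show ?thesis by blast
  qed
  then show ?thesis
    unfolding discretely_decomposable_def using subY fin mono by blast
qed

end

theorem theorem6p1:
  fixes A :: "('g::{topological_group_add, t2_space, second_countable_topology},
      'e::euclidean_space) chart set"
    and br :: "'l::euclidean_space \<Rightarrow> 'l \<Rightarrow> 'l"
    and vf :: "'l \<Rightarrow> ('g \<Rightarrow> real) \<Rightarrow> ('g \<Rightarrow> real)"
    and k p :: "'l set" and K :: "'g set"
    and p_plus p_minus :: "'l complexification set"
    and \<pi>\<^sub>1 :: "'l \<Rightarrow> 'v::complex_vector \<Rightarrow> 'v" and \<rho>\<^sub>1 :: "'g \<Rightarrow> 'v \<Rightarrow> 'v"
    and \<pi>\<^sub>2 :: "'l \<Rightarrow> 'w::complex_vector \<Rightarrow> 'w" and \<rho>\<^sub>2 :: "'g \<Rightarrow> 'w \<Rightarrow> 'w"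
  assumes "lie_group A" and "connected (UNIV :: 'g set)" and "\<not> compact (UNIV :: 'g set)"
    and "lie_algebra_of A br vf" and "simple_lie_algebra br"
    and "cartan_decomposition br k p" and "connected_lie_subgroup A vf k K"
    and "hermitian_type br k \<Longrightarrow> hermitian_splitting br k p p_plus p_minus"
    and "gK_module A br vf k K \<pi>\<^sub>1 \<rho>\<^sub>1" and "gK_irreducible K \<pi>\<^sub>1 \<rho>\<^sub>1"
    and "\<not> cfinite_dim (UNIV :: 'v set)"
    and "gK_module A br vf k K \<pi>\<^sub>2 \<rho>\<^sub>2" and "gK_irreducible K \<pi>\<^sub>2 \<rho>\<^sub>2"
    and "\<not> cfinite_dim (UNIV :: 'w set)"
  shows "discretely_decomposable K (tensor_lie_action \<pi>\<^sub>1 \<pi>\<^sub>2) (tensor_group_action \<rho>\<^sub>1 \<rho>\<^sub>2) \<longleftrightarrow>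
    hermitian_type br k \<and>
    ((highest_weight_module p_plus K \<pi>\<^sub>1 \<rho>\<^sub>1 \<and> highest_weight_module p_plus K \<pi>\<^sub>2 \<rho>\<^sub>2) \<or>
     (lowest_weight_module p_minus K \<pi>\<^sub>1 \<rho>\<^sub>1 \<and> lowest_weight_module p_minus K \<pi>\<^sub>2 \<rho>\<^sub>2))"
    (is "?dd \<longleftrightarrow> ?herm \<and> (?high \<or> ?low)")
proof -
  obtain \<theta> where \<theta>: "cartan_involution br \<theta>" "k = {x. \<theta> x = x}" "p = {x. \<theta> x = - x}"
    using assms(6) unfolding cartan_decomposition_def by blast
  interpret c: cartan br \<theta> by (rule cartan.intro[OF assms(5) \<theta>(1)])
  have kp: "c.k = k" "c.p = p" by (simp_all add: c.k_def c.p_def \<theta>)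
  interpret M: gK_pair br \<theta> A vf K \<pi>\<^sub>1 \<rho>\<^sub>1 \<pi>\<^sub>2 \<rho>\<^sub>2
    by (intro gK_pair.intro gK_irr.intro gK_irr_axioms.intro c.cartan_axioms lie_grp.intro; (unfold kp)?; rule assms)
  have herm: "?herm \<longleftrightarrow> (\<exists>z. c.complex_structure z)"
    using c.hermitian_iff[OF M.X1.p_nonzero] by (simp add: kp)
  have split: "\<exists>z. c.complex_structure z \<and> p_plus = c.pz z \<and> p_minus = c.pz (- z)" if ?herm
    using c.hermitian_splitting_structure[of p_plus p_minus] assms(8)[OF that] unfolding kp by metis
  show ?thesis
  proof
    assume ?dd
    from M.decomposable_imp_null_vectors[OF this]
    obtain z v1 v2 where z: "c.complex_structure z"
      and v: "v1 \<noteq> 0" "\<forall>u\<in>c.pz z. complexify_rep \<pi>\<^sub>1 u v1 = 0" "v2 \<noteq> 0" "\<forall>u\<in>c.pz z. complexify_rep \<pi>\<^sub>2 u v2 = 0"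
      by metis
    then have ?herm using herm by blast
    from split[OF this] obtain z0 where z0: "c.complex_structure z0" "p_plus = c.pz z0" "p_minus = c.pz (- z0)" by blast
    \<comment> \<open>The complex structure found is determined only up to sign; relative to the
      given labelling, the two signs are the highest and the lowest weight case.\<close>
    have "z = z0 \<or> z = - z0" by (rule c.complex_structure_unique[OF M.X1.p_nonzero z0(1) z])
    then have "?high \<or> ?low"
      using v assms(10,13) unfolding highest_weight_module_def lowest_weight_module_def z0(2,3) by blast
    then show "?herm \<and> (?high \<or> ?low)" using \<open>?herm\<close> by blast
  next
    assume *: "?herm \<and> (?high \<or> ?low)"
    from split[OF conjunct1[OF this]]
    obtain z0 where z0: "c.complex_structure z0" "p_plus = c.pz z0" "p_minus = c.pz (- z0)" by blast
    from * obtain z v1 v2 where "z = z0 \<or> z = - z0"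
      and v: "v1 \<noteq> 0" "\<forall>u\<in>c.pz z. complexify_rep \<pi>\<^sub>1 u v1 = 0" "v2 \<noteq> 0" "\<forall>u\<in>c.pz z. complexify_rep \<pi>\<^sub>2 u v2 = 0"
      unfolding highest_weight_module_def lowest_weight_module_def z0(2,3) by blast
    then have "c.complex_structure z" using z0(1) c.complex_structure_minus by blast
    from M.null_vectors_imp_decomposable[OF this v(1) _ v(3)] v(2,4) show ?dd by blast
  qed
qed

end
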